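(* Let $n\ge1$ and $0\le k\le n$. In the CW structure on $G_k$ with open cells $\mathfrak B_{\tilde w}$, all incidence numbers between cells of adjacent dimensions lie in $\{0,1,-1\}$: for all signed permutation matrices $\tilde v,\tilde w$ with $\tilde v^2=\tilde w^2=1$, $\operatorname{Tr}\tilde v=\operatorname{Tr}\tilde w=n-2k$ and $\dim\mathfrak B_{\tilde v}=\dim\mathfrak B_{\tilde w}-1$, the coefficient of the cell $\mathfrak B_{\tilde v}$ in the cellular boundary of the cell $\mathfrak B_{\tilde w}$ (with respect to any choice of orientations of the cells) is $0$, $1$ or $-1$.
   Context: The Grassmannian of $k$-dimensional subspaces of $\mathbb R^n$ is identified with $G_k=\{g\in O(n): g^2=1,\ \operatorname{Tr} g=n-2k\}$. $B^+$ is the group of real invertible upper triangular $n\times n$ matrices with positive diagonal entries. A signed permutation matrix is a product of a diagonal matrix with entries $\pm1$ and a permutation matrix. For such $\tilde w$ with $\tilde w^2=1$, $\operatorname{Tr}\tilde w=n-2k$ put $\mathfrak B_{\tilde w}=G_k\cap B^+\tilde wB^+$; these sets are the open cells of a CW structure on $G_k$. The dimension of $\mathfrak B_{\tilde w}$ is the number of equivalence classes of inversions $(i,j)$ ($i<j$, $w(i)>w(j)$) of the underlying permutation $w$ under $(i,j)\sim(w(j),w(i))$. *)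

theory Defs
  imports "HOL-Analysis.Analysis" "HOL-Homology.Homology"
begin

section \<open>Cellular boundary and incidence numbers\<close>

text \<open>
  In this section a finite cell structure on a space \<open>X\<close> is presented by a finite index set \<open>I\<close>, the open
  cells \<open>e i\<close> and their dimensions \<open>d i\<close>. Skeleta are indexed by integers, so that the skeleton of
  dimension \<open>-1\<close> is empty. Homology is integral singular homology; its groups are written
  multiplicatively.
\<close>

definition skeleton :: "'i set \<Rightarrow> ('i \<Rightarrow> 'a set) \<Rightarrow> ('i \<Rightarrow> nat) \<Rightarrow> int \<Rightarrow> 'a set"
  where "skeleton I e d p = (\<Union>i\<in>{i \<in> I. int (d i) \<le> p}. e i)"

definition unit_ball :: "nat \<Rightarrow> (nat \<Rightarrow> real) topology"
  where "unit_ball p = subtopology (Euclidean_space p) {x. (\<Sum>i<p. x i ^ 2) \<le> 1}"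

definition unit_ball_interior :: "nat \<Rightarrow> (nat \<Rightarrow> real) set"
  where "unit_ball_interior p = {x \<in> topspace (Euclidean_space p). (\<Sum>i<p. x i ^ 2) < 1}"

definition unit_ball_boundary :: "nat \<Rightarrow> (nat \<Rightarrow> real) set"
  where "unit_ball_boundary p = {x \<in> topspace (Euclidean_space p). (\<Sum>i<p. x i ^ 2) = 1}"

definition characteristic_map ::
    "'a topology \<Rightarrow> 'i set \<Rightarrow> ('i \<Rightarrow> 'a set) \<Rightarrow> ('i \<Rightarrow> nat) \<Rightarrow> 'i \<Rightarrow> ((nat \<Rightarrow> real) \<Rightarrow> 'a) \<Rightarrow> bool"
  where "characteristic_map X I e d i \<Phi> \<longleftrightarrow>
    continuous_map (unit_ball (d i)) X \<Phi> \<and>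
    homeomorphic_map (subtopology (unit_ball (d i)) (unit_ball_interior (d i)))
      (subtopology X (e i)) \<Phi> \<and>
    \<Phi> ` unit_ball_boundary (d i) \<subseteq> skeleton I e d (int (d i) - 1)"

definition cellular_chain_group ::
    "'a topology \<Rightarrow> 'i set \<Rightarrow> ('i \<Rightarrow> 'a set) \<Rightarrow> ('i \<Rightarrow> nat) \<Rightarrow> int \<Rightarrow> 'a chain set monoid"
  where "cellular_chain_group X I e d p =
    relative_homology_group p (subtopology X (skeleton I e d p)) (skeleton I e d (p - 1))"

text \<open>
  The connecting map of the triple formed by the skeleta of dimensions \<open>p\<close>, \<open>p - 1\<close>, \<open>p - 2\<close>.
\<close>

definition cellular_boundary ::
    "'a topology \<Rightarrow> 'i set \<Rightarrow> ('i \<Rightarrow> 'a set) \<Rightarrow> ('i \<Rightarrow> nat) \<Rightarrow> int \<Rightarrow> 'a chain set \<Rightarrow> 'a chain set"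
  where "cellular_boundary X I e d p =
    hom_relboundary p (subtopology X (skeleton I e d p))
      (skeleton I e d (p - 1)) (skeleton I e d (p - 2))"

text \<open>
  An orientation of a cell of dimension \<open>p\<close> is recorded by the basis element of the cellular chain
  group that it determines: the image under a characteristic map of a generator of the relative
  homology of the ball modulo its boundary sphere in degree \<open>p\<close> (an infinite cyclic group).
\<close>

definition cell_orientation ::
    "'a topology \<Rightarrow> 'i set \<Rightarrow> ('i \<Rightarrow> 'a set) \<Rightarrow> ('i \<Rightarrow> nat) \<Rightarrow> 'i \<Rightarrow> 'a chain set \<Rightarrow> bool"
  where "cell_orientation X I e d i a \<longleftrightarrow>
    (\<exists>\<Phi> g. characteristic_map X I e d i \<Phi> \<and>
       g \<in> carrier (relative_homology_group (int (d i)) (unit_ball (d i)) (unit_ball_boundary (d i))) \<and>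
       generate (relative_homology_group (int (d i)) (unit_ball (d i)) (unit_ball_boundary (d i))) {g} =
         carrier (relative_homology_group (int (d i)) (unit_ball (d i)) (unit_ball_boundary (d i))) \<and>
       a = hom_induced (int (d i)) (unit_ball (d i)) (unit_ball_boundary (d i))
             (subtopology X (skeleton I e d (int (d i)))) (skeleton I e d (int (d i) - 1)) \<Phi> g)"

text \<open>
  Given orientations \<open>\<omega>\<close> of all cells, \<open>c\<close> is the family of coefficients of the boundary of the cell
  \<open>i\<close> in the basis of oriented cells of one dimension less; the sum is written as a product, integer
  multiples as powers.
\<close>

definition boundary_coefficients ::
    "'a topology \<Rightarrow> 'i set \<Rightarrow> ('i \<Rightarrow> 'a set) \<Rightarrow> ('i \<Rightarrow> nat) \<Rightarrow> ('i \<Rightarrow> 'a chain set) \<Rightarrow> 'i \<Rightarrow>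
      ('i \<Rightarrow> int) \<Rightarrow> bool"
  where "boundary_coefficients X I e d \<omega> i c \<longleftrightarrow>
    cellular_boundary X I e d (int (d i)) (\<omega> i) =
      finprod (cellular_chain_group X I e d (int (d i) - 1))
        (\<lambda>j. \<omega> j [^]\<^bsub>cellular_chain_group X I e d (int (d i) - 1)\<^esub> c j)
        {j \<in> I. int (d j) = int (d i) - 1}"

definition incidence_number ::
    "'a topology \<Rightarrow> 'i set \<Rightarrow> ('i \<Rightarrow> 'a set) \<Rightarrow> ('i \<Rightarrow> nat) \<Rightarrow> ('i \<Rightarrow> 'a chain set) \<Rightarrow> 'i \<Rightarrow> 'i \<Rightarrow> int"
  where "incidence_number X I e d \<omega> i j =
    (THE m. \<exists>c. boundary_coefficients X I e d \<omega> i c \<and> c j = m)"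

section \<open>The Grassmannian and its Bruhat cells\<close>

text \<open>
  The index type of the matrices is an arbitrary finite linear order, standing for \<open>{1..n}\<close> with
  \<open>n = CARD('n)\<close>; on finite types the class \<open>wellorder\<close> means no more than a linear order.
\<close>

definition grassmannian :: "nat \<Rightarrow> (real ^ 'n ^ 'n) set"
  where "grassmannian k =
    {g. orthogonal_matrix g \<and> g ** g = mat 1 \<and> trace g = real CARD('n) - 2 * real k}"

definition pos_upper_triangular :: "(real ^ 'n::{finite,wellorder} ^ 'n::{finite,wellorder}) set"
  where "pos_upper_triangular =
    {b. invertible b \<and> (\<forall>i j. j < i \<longrightarrow> b $ i $ j = 0) \<and> (\<forall>i. 0 < b $ i $ i)}"

definition diagonal_matrix :: "('n \<Rightarrow> real) \<Rightarrow> real ^ 'n ^ 'n"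
  where "diagonal_matrix s = (\<chi> i j. if i = j then s i else 0)"

definition permutation_matrix :: "('n \<Rightarrow> 'n) \<Rightarrow> real ^ 'n ^ 'n"
  where "permutation_matrix w = (\<chi> i j. if i = w j then 1 else 0)"

definition signed_permutation_over :: "('n \<Rightarrow> 'n) \<Rightarrow> real ^ 'n ^ 'n \<Rightarrow> bool"
  where "signed_permutation_over w A \<longleftrightarrow> w permutes UNIV \<and>
    (\<exists>s. (\<forall>i. s i \<in> {1, -1}) \<and> A = diagonal_matrix s ** permutation_matrix w)"

definition signed_permutation_matrix :: "real ^ 'n ^ 'n \<Rightarrow> bool"
  where "signed_permutation_matrix A \<longleftrightarrow> (\<exists>w. signed_permutation_over w A)"

definition underlying_permutation :: "real ^ 'n ^ 'n \<Rightarrow> 'n \<Rightarrow> 'n"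
  where "underlying_permutation A = (THE w. signed_permutation_over w A)"

definition cell_index :: "nat \<Rightarrow> (real ^ 'n ^ 'n) set"
  where "cell_index k =
    {A. signed_permutation_matrix A \<and> A ** A = mat 1 \<and> trace A = real CARD('n) - 2 * real k}"

definition bruhat_cell ::
    "nat \<Rightarrow> real ^ 'n::{finite,wellorder} ^ 'n::{finite,wellorder} \<Rightarrow> (real ^ 'n::{finite,wellorder} ^ 'n::{finite,wellorder}) set"
  where "bruhat_cell k A =
    grassmannian k \<inter> {b ** A ** b' | b b'. b \<in> pos_upper_triangular \<and> b' \<in> pos_upper_triangular}"

definition inversions :: "('n::linorder \<Rightarrow> 'n) \<Rightarrow> ('n \<times> 'n) set"
  where "inversions w = {(i, j). i < j \<and> w j < w i}"

text \<open>
  For an involution \<open>w\<close> the map \<open>(i, j) \<mapsto> (w j, w i)\<close> is an involution of the set of inversions, so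
  this is an equivalence relation on that set.
\<close>

definition inversion_rel :: "('n::linorder \<Rightarrow> 'n) \<Rightarrow> (('n \<times> 'n) \<times> ('n \<times> 'n)) set"
  where "inversion_rel w =
    {((i, j), q). (i, j) \<in> inversions w \<and> q \<in> inversions w \<and> (q = (i, j) \<or> q = (w j, w i))}"

definition cell_dim :: "real ^ 'n::{finite,wellorder} ^ 'n::{finite,wellorder} \<Rightarrow> nat"
  where "cell_dim A =
    card (inversions (underlying_permutation A) // inversion_rel (underlying_permutation A))"

end

(* Let d(v) + 1 = d(w). The coefficient of the cell v in the boundary of the cell w can be computed
   locally at a point x of the cell v: it is 0 if x is not in the closure of the cell w, and it is 1 or -1
   if the union of the two cells looks near x like a closed half-space, with boundary the cell v.

   Such half-space charts are found by induction on d(w). Let i < j be adjacent indices with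
   w(j) < w(i), and let the rotations of the plane of e_i and e_j act on the Grassmannian by conjugation.
   The orbits meet a cell with w(j) < w(i) in arcs which join two cells of one dimension less, those of
   w' and of a companion w''; every other cell either is such a lower end or is preserved. If i, j
   is not a descent of v, then v is one of the two ends and the rotations push a chart of the cell v into
   the cell w. If it is a descent of v, then v lies above v' and v'' in the same way, and rotating
   through an angle interval turns a half-space chart for (v', w') or (v'', w') into one for (v, w).
   At most one of these two pairs occurs: the crossing number dim (K_i / (K_i \<inter> g K_i)), K_i the span of
   e_1, ..., e_i, is the sum of two lower semicontinuous functions of g, one for each eigenvalue, which
   are constant on cells. If v' and v'' were both in the closure of w', it would be larger for w'
   than for v'; then s v' would be below w' in the rank order and of the same dimension, hence equal
   to it, but i, j is a descent of s v' and not of w'. *)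

theory Submission
  imports Defs
begin

section \<open>Upper triangular matrices and rotations\<close>

text \<open>A coefficient other than 0, 1 and -1 could only arise from several sheets of the cell w
  meeting along the cell v. Each sheet comes from a lower end of the arcs through v at which w' is
  adherent, so these ends have to be counted. Two mechanisms keep the count at one. If v' fixes both
  i and j, with opposite signs, then v' and v'' have the same underlying permutation and no rank
  condition tells them apart; the separation has to come from the eigenvalues, between which e_i
  changes sides. Otherwise a rotation that starts in v'' and turns by less than pi ends in the other
  cell over v', so v'' is not a source of v at all. In the first case conjugation through \<theta>
  is multiplication by the rotation through twice the angle, and an orbit passes all its
  neighbouring cells before it has turned through pi. The cells are never parametrized explicitly.
  Membership in a cell is tested by moving rotations across triangular factors, which reparametrizes
  the angle continuously, and local statements follow from limits of angles in a compact
  interval.\<close>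

definition adjacent :: "'n::linorder \<Rightarrow> 'n \<Rightarrow> bool"
  where "adjacent i j \<longleftrightarrow> i < j \<and> (\<forall>a. a \<le> i \<or> j \<le> a)"

definition rot :: "'n::finite \<Rightarrow> 'n \<Rightarrow> real \<Rightarrow> real ^ 'n ^ 'n"
  where "rot i j \<theta> = (\<chi> a c. if a = i then (if c = i then cos \<theta> else if c = j then - sin \<theta> else 0)
      else if a = j then (if c = i then sin \<theta> else if c = j then cos \<theta> else 0)
      else if a = c then 1 else 0)"

text \<open>A signed permutation matrix with its signs indexed by columns instead of rows; for an
  involution with \<open>s (w c) = s c\<close> the two conventions agree.\<close>

definition smat :: "('n \<Rightarrow> 'n) \<Rightarrow> ('n \<Rightarrow> real) \<Rightarrow> real ^ 'n ^ 'n::finite"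
  where "smat w s = (\<chi> a c. if a = w c then s c else 0)"

definition double_coset :: "real ^ 'n::{finite,wellorder} ^ 'n::{finite,wellorder} \<Rightarrow> (real ^ 'n::{finite,wellorder} ^ 'n::{finite,wellorder}) set"
  where "double_coset A = {b ** A ** b' | b b'. b \<in> pos_upper_triangular \<and> b' \<in> pos_upper_triangular}"

definition elem_mat :: "'n::finite \<Rightarrow> 'n \<Rightarrow> real \<Rightarrow> real ^ 'n ^ 'n"
  where "elem_mat i j t = (\<chi> a c. (if a = c then 1 else 0) + (if a = i \<and> c = j then t else 0))"

lemma sum_eq_single:
  fixes f :: "'n::finite \<Rightarrow> real"
  assumes "\<And>k. k \<noteq> i \<Longrightarrow> f k = 0"
  shows "sum f UNIV = f i"
proof -
  have "sum f UNIV = sum f {i}"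
    by (rule sum.mono_neutral_right) (use assms in auto)
  then show ?thesis by simp
qed

lemma sum_eq_pair:
  fixes f :: "'n::finite \<Rightarrow> real"
  assumes "i \<noteq> j" "\<And>k. k \<noteq> i \<Longrightarrow> k \<noteq> j \<Longrightarrow> f k = 0"
  shows "sum f UNIV = f i + f j"
proof -
  have "sum f UNIV = sum f {i, j}"
    by (rule sum.mono_neutral_right) (use assms in auto)
  then show ?thesis using assms by simp
qed

lemma pos_upper_triangular_iff:
  "b \<in> pos_upper_triangular \<longleftrightarrow> (\<forall>i j. j < i \<longrightarrow> b $ i $ j = 0) \<and> (\<forall>i. 0 < b $ i $ i)"
proof -
  have "invertible b" if "\<forall>i j. j < i \<longrightarrow> b $ i $ j = 0" "\<forall>i. 0 < b $ i $ i"
  proof -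
    have "det b = (\<Prod>i\<in>UNIV. b $ i $ i)"
      by (rule det_upperdiagonal) (use that in auto)
    also have "\<dots> \<noteq> 0"
      using that by (auto simp: less_imp_neq[symmetric])
    finally show ?thesis by (simp add: invertible_det_nz)
  qed
  then show ?thesis by (auto simp: pos_upper_triangular_def)
qed

lemma pos_upper_mult:
  assumes "b \<in> pos_upper_triangular" "c \<in> pos_upper_triangular"
  shows "b ** c \<in> pos_upper_triangular"
proof -
  have "(b ** c) $ i $ j = 0" if "j < i" for i j
    unfolding matrix_matrix_mult_def
    using assms that by (auto simp: pos_upper_triangular_iff intro!: sum.neutral) (metis le_less_trans not_le)
  moreover have "(b ** c) $ i $ i = b $ i $ i * c $ i $ i" for i
    unfolding matrix_matrix_mult_def vec_lambda_beta
  proof (rule sum_eq_single)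
    fix k assume "k \<noteq> i"
    then show "b $ i $ k * c $ k $ i = 0"
      using assms by (metis antisym_conv3 mult_eq_0_iff pos_upper_triangular_iff)
  qed
  ultimately show ?thesis using assms by (auto simp: pos_upper_triangular_iff)
qed

text \<open>No index lies between adjacent \<open>i\<close> and \<open>j\<close>, so the diagonal
  blocks at these two indices multiply like 2 by 2 upper triangular matrices.\<close>

lemma pos_upper_mult_adjacent:
  assumes "b \<in> pos_upper_triangular" "c \<in> pos_upper_triangular" "adjacent i j"
  shows "(b ** c) $ i $ j = b $ i $ i * c $ i $ j + b $ i $ j * c $ j $ j"
  unfolding matrix_matrix_mult_def vec_lambda_beta
proof (rule sum_eq_pair)
  show "i \<noteq> j" using assms(3) by (auto simp: adjacent_def)
  fix k assume "k \<noteq> i" "k \<noteq> j"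
  then have "k < i \<or> j < k" using assms(3) by (auto simp: adjacent_def not_less le_less)
  then show "b $ i $ k * c $ k $ j = 0"
    using assms by (auto simp: pos_upper_triangular_iff)
qed

lemma pos_upper_inverse:
  assumes b: "b \<in> pos_upper_triangular"
  obtains c where "c \<in> pos_upper_triangular" "b ** c = mat 1" "c ** b = mat 1"
proof -
  obtain c where c: "b ** c = mat 1" "c ** b = mat 1"
    using b by (auto simp: pos_upper_triangular_def invertible_def)
  \<comment> \<open>In row \<open>i\<close> the columns left of \<open>j\<close> already vanish by
    induction, and the entries of \<open>b\<close> below its diagonal remove the columns right of
    \<open>j\<close>.\<close>
  have low: "c $ i $ j = 0" if "j < i" for i j
    using that
  proof (induction j rule: less_induct)
    case (less j)
    have "(c ** b) $ i $ j = c $ i $ j * b $ j $ j"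
      unfolding matrix_matrix_mult_def vec_lambda_beta
    proof (rule sum_eq_single)
      fix k assume "k \<noteq> j"
      then show "c $ i $ k * b $ k $ j = 0"
        using less b by (metis less_trans mult_eq_0_iff neqE pos_upper_triangular_iff)
    qed
    moreover have "(c ** b) $ i $ j = 0" using less.prems c by (simp add: mat_def)
    moreover have "b $ j $ j \<noteq> 0" using b by (metis less_irrefl pos_upper_triangular_iff)
    ultimately show ?case by simp
  qed
  have "c $ i $ i > 0" for i
  proof -
    have "(c ** b) $ i $ i = c $ i $ i * b $ i $ i"
      unfolding matrix_matrix_mult_def vec_lambda_beta
    proof (rule sum_eq_single)
      fix k assume "k \<noteq> i"
      then show "c $ i $ k * b $ k $ i = 0"
        using low b by (metis mult_eq_0_iff neqE pos_upper_triangular_iff)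
    qed
    then have "c $ i $ i * b $ i $ i = 1" using c by (simp add: mat_def)
    then show ?thesis using b
      by (metis pos_upper_triangular_iff zero_less_mult_pos2 zero_less_one)
  qed
  then show ?thesis using that c low by (auto simp: pos_upper_triangular_iff)
qed

lemma pos_upper_one: "mat 1 \<in> pos_upper_triangular"
  by (auto simp: pos_upper_triangular_iff mat_def)

lemma elem_mat_pos_upper: "i < j \<Longrightarrow> elem_mat i j t \<in> pos_upper_triangular"
  by (auto simp: pos_upper_triangular_iff elem_mat_def)

lemma double_coset_self: "A \<in> double_coset A"
  unfolding double_coset_def using pos_upper_one by (metis (mono_tags, lifting) matrix_mul_lid matrix_mul_rid mem_Collect_eq)

lemma double_cosetI: "b \<in> pos_upper_triangular \<Longrightarrow> b' \<in> pos_upper_triangular \<Longrightarrow> b ** A ** b' \<in> double_coset A"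
  by (auto simp: double_coset_def)

lemma double_coset_mult:
  assumes "X \<in> double_coset A" "b \<in> pos_upper_triangular" "b' \<in> pos_upper_triangular"
  shows "b ** X ** b' \<in> double_coset A"
proof -
  obtain c c' where "X = c ** A ** c'" "c \<in> pos_upper_triangular" "c' \<in> pos_upper_triangular"
    using assms by (auto simp: double_coset_def)
  then have "b ** X ** b' = (b ** c) ** A ** (c' ** b')" by (simp add: matrix_mul_assoc)
  then show ?thesis using assms \<open>c \<in> _\<close> \<open>c' \<in> _\<close> by (auto intro!: double_cosetI pos_upper_mult)
qed

lemma double_coset_sym:
  assumes "X \<in> double_coset A" shows "A \<in> double_coset X"
proof -
  obtain b b' where X: "X = b ** A ** b'" and b: "b \<in> pos_upper_triangular" "b' \<in> pos_upper_triangular"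
    using assms by (auto simp: double_coset_def)
  obtain c c' where c: "c \<in> pos_upper_triangular" "c ** b = mat 1" "c' \<in> pos_upper_triangular" "b' ** c' = mat 1"
    using b pos_upper_inverse by metis
  have "c ** X ** c' = (c ** b) ** A ** (b' ** c')" by (simp add: X matrix_mul_assoc)
  then show ?thesis using c double_cosetI[of c c' X] by simp
qed

lemma double_coset_trans: "X \<in> double_coset A \<Longrightarrow> Y \<in> double_coset X \<Longrightarrow> Y \<in> double_coset A"
  unfolding double_coset_def[of X] using double_coset_mult by auto

lemma rot_mult_left:
  assumes "i \<noteq> j"
  shows "(rot i j \<theta> ** M) $ a $ c = (if a = i then cos \<theta> * M $ i $ c - sin \<theta> * M $ j $ c
      else if a = j then sin \<theta> * M $ i $ c + cos \<theta> * M $ j $ c else M $ a $ c)"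
proof -
  consider "a = i" | "a = j" | "a \<noteq> i" "a \<noteq> j" by blast
  then show ?thesis
  proof cases
    case 1
    have "(rot i j \<theta> ** M) $ a $ c = rot i j \<theta> $ a $ i * M $ i $ c + rot i j \<theta> $ a $ j * M $ j $ c"
      unfolding matrix_matrix_mult_def vec_lambda_beta
      by (rule sum_eq_pair) (use assms 1 in \<open>auto simp: rot_def\<close>)
    then show ?thesis using 1 assms by (simp add: rot_def)
  next
    case 2
    have "(rot i j \<theta> ** M) $ a $ c = rot i j \<theta> $ a $ i * M $ i $ c + rot i j \<theta> $ a $ j * M $ j $ c"
      unfolding matrix_matrix_mult_def vec_lambda_beta
      by (rule sum_eq_pair) (use assms 2 in \<open>auto simp: rot_def\<close>)
    then show ?thesis using 2 assms by (simp add: rot_def)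
  next
    case 3
    have "(rot i j \<theta> ** M) $ a $ c = rot i j \<theta> $ a $ a * M $ a $ c"
      unfolding matrix_matrix_mult_def vec_lambda_beta
      by (rule sum_eq_single) (use assms 3 in \<open>auto simp: rot_def\<close>)
    then show ?thesis using 3 assms by (simp add: rot_def)
  qed
qed

lemma rot_mult_right:
  assumes "i \<noteq> j"
  shows "(M ** rot i j \<theta>) $ a $ c = (if c = i then M $ a $ i * cos \<theta> + M $ a $ j * sin \<theta>
      else if c = j then M $ a $ j * cos \<theta> - M $ a $ i * sin \<theta> else M $ a $ c)"
proof -
  consider "c = i" | "c = j" | "c \<noteq> i" "c \<noteq> j" by blast
  then show ?thesis
  proof cases
    case 1
    have "(M ** rot i j \<theta>) $ a $ c = M $ a $ i * rot i j \<theta> $ i $ c + M $ a $ j * rot i j \<theta> $ j $ c"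
      unfolding matrix_matrix_mult_def vec_lambda_beta
      by (rule sum_eq_pair) (use assms 1 in \<open>auto simp: rot_def\<close>)
    then show ?thesis using 1 assms by (simp add: rot_def)
  next
    case 2
    have "(M ** rot i j \<theta>) $ a $ c = M $ a $ i * rot i j \<theta> $ i $ c + M $ a $ j * rot i j \<theta> $ j $ c"
      unfolding matrix_matrix_mult_def vec_lambda_beta
      by (rule sum_eq_pair) (use assms 2 in \<open>auto simp: rot_def\<close>)
    then show ?thesis using 2 assms by (simp add: rot_def)
  next
    case 3
    have "(M ** rot i j \<theta>) $ a $ c = M $ a $ c * rot i j \<theta> $ c $ c"
      unfolding matrix_matrix_mult_def vec_lambda_beta
      by (rule sum_eq_single) (use assms 3 in \<open>auto simp: rot_def\<close>)
    then show ?thesis using 3 assms by (simp add: rot_def)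
  qed
qed

lemma rot_add: "i \<noteq> j \<Longrightarrow> rot i j \<alpha> ** rot i j \<beta> = rot i j (\<alpha> + \<beta>)"
  by (simp add: vec_eq_iff rot_mult_left) (simp add: rot_def cos_add sin_add algebra_simps)

lemma rot_zero: "i \<noteq> j \<Longrightarrow> rot i j 0 = mat 1"
  by (simp add: vec_eq_iff rot_def mat_def)

lemma rot_inverse: "i \<noteq> j \<Longrightarrow> rot i j \<alpha> ** rot i j (- \<alpha>) = mat 1" "i \<noteq> j \<Longrightarrow> rot i j (- \<alpha>) ** rot i j \<alpha> = mat 1"
  by (simp_all add: rot_add rot_zero)

lemma transpose_rot: "transpose (rot i j \<theta>) = rot i j (- \<theta>)"
  by (auto simp: vec_eq_iff transpose_def rot_def)

text \<open>QR decomposition in the plane of e_i and e_j: row \<open>j\<close> of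
  \<open>rot i j \<theta> ** b\<close> has the entries \<open>r * sin \<phi>\<close> and
  \<open>r * cos \<phi>\<close> in columns \<open>i\<close> and \<open>j\<close>, and the rotation
  through \<open>- \<phi>\<close> on the right turns this pair into \<open>0\<close> and
  \<open>r\<close>.\<close>

lemma rot_through_pos_upper:
  assumes ij: "adjacent i j" and b: "b \<in> pos_upper_triangular" and "0 < r"
    and p: "sin \<theta> * b $ i $ i = r * sin \<phi>" and q: "sin \<theta> * b $ i $ j + cos \<theta> * b $ j $ j = r * cos \<phi>"
  shows "rot i j \<theta> ** b ** rot i j (- \<phi>) \<in> pos_upper_triangular"
proof -
  have ne: "i \<noteq> j" and lt: "i < j" using ij by (auto simp: adjacent_def)
  have b0: "\<And>a c. c < a \<Longrightarrow> b $ a $ c = 0" and bp: "\<And>a. 0 < b $ a $ a"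
    using b by (auto simp: pos_upper_triangular_iff)
  have split: "a < i \<or> a = i \<or> a = j \<or> j < a" for a using ij by (auto simp: adjacent_def le_less)
  let ?N = "rot i j \<theta> ** b ** rot i j (- \<phi>)"
  have N: "?N $ a $ c = (let M = rot i j \<theta> ** b in if c = i then M $ a $ i * cos \<phi> - M $ a $ j * sin \<phi>
      else if c = j then M $ a $ j * cos \<phi> + M $ a $ i * sin \<phi> else M $ a $ c)" for a c
    using ne by (simp add: rot_mult_right Let_def)
  have "?N $ a $ c = 0" if ca: "c < a" for a c
  proof -
    consider "a < i" | "a = i" | "a = j" "c = i" | "a = j" "c < i" | "j < a"
      using split[of a] split[of c] ca by (metis less_asym less_irrefl less_trans lt)
    then show ?thesis
    proof cases
      case 3
      have "r * ?N $ a $ c = (sin \<theta> * b $ i $ i) * (r * cos \<phi>) - (sin \<theta> * b $ i $ j + cos \<theta> * b $ j $ j) * (r * sin \<phi>)"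
        using 3 ne b0[OF lt] by (simp add: N rot_mult_left Let_def algebra_simps)
      also have "\<dots> = 0" by (simp add: p q)
      finally show ?thesis using \<open>0 < r\<close> by simp
    next
      case 1
      with ca lt have "c < i" "c < j" "a < j" by auto
      then show ?thesis using 1 ca ne by (simp add: N rot_mult_left Let_def b0 less_imp_neq)
    next
      case 2
      with ca lt have "c < i" "c < j" by auto
      then show ?thesis using 2 ne by (simp add: N rot_mult_left Let_def b0 less_imp_neq)
    next
      case 4
      with lt have "c < j" by auto
      then show ?thesis using 4 ne by (simp add: N rot_mult_left Let_def b0 less_imp_neq)
    next
      case 5
      with lt have "i < a" by auto
      then have "a \<noteq> i" "a \<noteq> j" using 5 by auto
      then show ?thesis using 5 ca \<open>i < a\<close> by (simp add: N rot_mult_left Let_def b0 ne)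
    qed
  qed
  moreover have "0 < ?N $ a $ a" for a
  proof -
    consider "a = i" | "a = j" | "a \<noteq> i" "a \<noteq> j" by blast
    then show ?thesis
    proof cases
      case 1
      have "r * ?N $ a $ a = cos \<theta> * b $ i $ i * (r * cos \<phi>) - (cos \<theta> * b $ i $ j - sin \<theta> * b $ j $ j) * (r * sin \<phi>)"
        using 1 ne b0[OF lt] by (simp add: N rot_mult_left Let_def algebra_simps)
      \<comment> \<open>The remaining diagonal entry times \<open>r\<close> is the determinant of
        the 2 by 2 block of \<open>b\<close>, which rotations do not change.\<close>
      also have "\<dots> = b $ i $ i * b $ j $ j * ((cos \<theta>)\<^sup>2 + (sin \<theta>)\<^sup>2)"
        unfolding p[symmetric] q[symmetric] by (simp only: power2_eq_square) (simp only: algebra_simps)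
      also have "\<dots> > 0" using bp by simp
      finally show ?thesis using \<open>0 < r\<close> zero_less_mult_pos by blast
    next
      case 2
      have "?N $ a $ a = (sin \<theta> * b $ i $ j + cos \<theta> * b $ j $ j) * cos \<phi> + (sin \<theta> * b $ i $ i) * sin \<phi>"
        using 2 ne b0[OF lt] by (simp add: N rot_mult_left Let_def algebra_simps)
      also have "\<dots> = r * ((cos \<phi>)\<^sup>2 + (sin \<phi>)\<^sup>2)"
        unfolding p q by (simp only: power2_eq_square) (simp only: algebra_simps)
      finally show ?thesis using \<open>0 < r\<close> by simp
    next
      case 3
      then show ?thesis using bp by (simp add: N rot_mult_left Let_def ne)
    qed
  qed
  ultimately show ?thesis by (simp add: pos_upper_triangular_iff)
qed

text \<open>The new angle is the argument of the nonzero vector with coordinates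
  \<open>q \<theta>\<close> and \<open>p \<theta>\<close>, which depends continuously on \<theta>.
  Since \<open>p \<theta>\<close> has the sign of \<open>sin \<theta>\<close>, the vector stays in
  the closed upper half plane for angles up to \<open>pi\<close>, where \<open>arccos\<close> gives
  its argument without a choice of branch.\<close>

lemma rot_angle_through_pos_upper:
  assumes ij: "adjacent i j" and b: "b \<in> pos_upper_triangular"
  obtains \<phi> where "continuous_on {0..pi} \<phi>" "\<phi> 0 = 0" "\<phi> pi = pi"
    "\<And>\<theta>. 0 < \<theta> \<Longrightarrow> \<theta> < pi \<Longrightarrow> 0 < \<phi> \<theta> \<and> \<phi> \<theta> < pi"
    "\<And>\<theta>. 0 \<le> \<theta> \<Longrightarrow> \<theta> \<le> pi \<Longrightarrow> \<exists>b'\<in>pos_upper_triangular. rot i j \<theta> ** b = b' ** rot i j (\<phi> \<theta>)"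
proof -
  have ne: "i \<noteq> j" using ij by (auto simp: adjacent_def)
  have bp: "\<And>a. 0 < b $ a $ a" using b by (auto simp: pos_upper_triangular_iff)
  define p where "p \<theta> = sin \<theta> * b $ i $ i" for \<theta>
  define q where "q \<theta> = sin \<theta> * b $ i $ j + cos \<theta> * b $ j $ j" for \<theta>
  define r where "r \<theta> = sqrt ((p \<theta>)\<^sup>2 + (q \<theta>)\<^sup>2)" for \<theta>
  have r: "r \<theta> > 0" for \<theta>
  proof -
    have "p \<theta> \<noteq> 0 \<or> q \<theta> \<noteq> 0"
    proof (cases "sin \<theta> = 0")
      case True
      then have "cos \<theta> \<noteq> 0" using sin_cos_squared_add[of \<theta>] by auto
      then show ?thesis using True bp[of j] by (simp add: q_def)
    next
      case False
      then show ?thesis using bp[of i] by (simp add: p_def)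
    qed
    then show ?thesis by (simp add: r_def sum_power2_gt_zero_iff)
  qed
  have r0: "r \<theta> \<noteq> 0" for \<theta> using r[of \<theta>] by simp
  have r2: "(r \<theta>)\<^sup>2 = (p \<theta>)\<^sup>2 + (q \<theta>)\<^sup>2" for \<theta> by (simp add: r_def)
  define \<phi> where "\<phi> \<theta> = arccos (q \<theta> / r \<theta>)" for \<theta>
  have le: "\<bar>q \<theta> / r \<theta>\<bar> \<le> 1" for \<theta>
  proof -
    have "(q \<theta>)\<^sup>2 \<le> (r \<theta>)\<^sup>2" by (simp add: r2)
    then have "\<bar>q \<theta>\<bar> \<le> r \<theta>" using r[of \<theta>] by (metis abs_le_square_iff abs_of_pos)
    then show ?thesis using r[of \<theta>] by (simp add: abs_divide)
  qed
  have le': "-1 \<le> q \<theta> / r \<theta>" "q \<theta> / r \<theta> \<le> 1" for \<theta>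
    using le[of \<theta>] unfolding abs_le_iff by linarith+
  have cos\<phi>: "r \<theta> * cos (\<phi> \<theta>) = q \<theta>" for \<theta>
    using r[of \<theta>] unfolding \<phi>_def cos_arccos_abs[OF le] by simp
  have sin\<phi>: "r \<theta> * sin (\<phi> \<theta>) = p \<theta>" if "0 \<le> \<theta>" "\<theta> \<le> pi" for \<theta>
  proof -
    have "0 \<le> sin (\<phi> \<theta>)" unfolding \<phi>_def
      using arccos_bounded[OF le'[of \<theta>]] by (intro sin_ge_zero) auto
    moreover have "0 \<le> p \<theta>" using that bp[of i] by (simp add: p_def sin_ge_zero)
    moreover have "(r \<theta> * sin (\<phi> \<theta>))\<^sup>2 = (p \<theta>)\<^sup>2"
    proof -
      have "(r \<theta> * sin (\<phi> \<theta>))\<^sup>2 = (r \<theta>)\<^sup>2 - (r \<theta> * cos (\<phi> \<theta>))\<^sup>2"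
        by (simp add: power_mult_distrib sin_squared_eq algebra_simps)
      then show ?thesis by (simp add: cos\<phi> r2)
    qed
    ultimately show ?thesis using r[of \<theta>] by (simp add: power2_eq_iff_nonneg)
  qed
  show ?thesis
  proof (rule that[of \<phi>])
    have "continuous_on {0..pi} (\<lambda>\<theta>. q \<theta> / r \<theta>)"
      unfolding p_def q_def r_def
      using r0 by (intro continuous_intros) (auto simp: r_def p_def q_def)
    then show "continuous_on {0..pi} \<phi>"
      unfolding \<phi>_def by (rule continuous_on_arccos) (use le' in auto)
    show "\<phi> 0 = 0" using bp[of j] by (simp add: \<phi>_def q_def r_def p_def)
    show "\<phi> pi = pi" using bp[of j] by (simp add: \<phi>_def q_def r_def p_def)
    show "0 < \<phi> \<theta> \<and> \<phi> \<theta> < pi" if "0 < \<theta>" "\<theta> < pi" for \<theta>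
    proof -
      have "sin (\<phi> \<theta>) > 0"
        using sin\<phi>[of \<theta>] that r[of \<theta>] bp[of i]
        by (metis less_eq_real_def mult_pos_pos p_def sin_gt_zero zero_less_mult_pos)
      moreover have "0 \<le> \<phi> \<theta>" "\<phi> \<theta> \<le> pi" unfolding \<phi>_def
        using arccos_bounded[OF le'[of \<theta>]] by auto
      ultimately show ?thesis by (metis less_eq_real_def less_irrefl sin_pi sin_zero)
    qed
    show "\<exists>b'\<in>pos_upper_triangular. rot i j \<theta> ** b = b' ** rot i j (\<phi> \<theta>)" if "0 \<le> \<theta>" "\<theta> \<le> pi" for \<theta>
    proof
      show "rot i j \<theta> ** b ** rot i j (- \<phi> \<theta>) \<in> pos_upper_triangular"
        using ij b r[of \<theta>] sin\<phi>[OF that] cos\<phi>[of \<theta>] unfolding p_def q_def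
        by (intro rot_through_pos_upper[where r="r \<theta>"]) auto
      show "rot i j \<theta> ** b = rot i j \<theta> ** b ** rot i j (- \<phi> \<theta>) ** rot i j (\<phi> \<theta>)"
        using ne by (simp add: rot_inverse flip: matrix_mul_assoc)
    qed
  qed
qed

section \<open>Signed permutation matrices and double cosets\<close>

lemma smat_mult_right: "(M ** smat w s) $ a $ c = M $ a $ (w c) * s c"
proof -
  have "(M ** smat w s) $ a $ c = M $ a $ (w c) * smat w s $ (w c) $ c"
    unfolding matrix_matrix_mult_def vec_lambda_beta by (rule sum_eq_single) (auto simp: smat_def)
  then show ?thesis by (simp add: smat_def)
qed

lemma smat_mult_left:
  assumes "\<And>c. w (w c) = c"
  shows "(smat w s ** M) $ a $ c = s (w a) * M $ (w a) $ c"
proof -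
  have "(smat w s ** M) $ a $ c = smat w s $ a $ (w a) * M $ (w a) $ c"
    unfolding matrix_matrix_mult_def vec_lambda_beta
    by (rule sum_eq_single) (use assms in \<open>auto simp: smat_def\<close>)
  then show ?thesis by (simp add: smat_def assms)
qed

lemma smat_smat: "smat w s ** smat w' s' = smat (w \<circ> w') (\<lambda>c. s (w' c) * s' c)"
  by (simp add: vec_eq_iff smat_mult_right) (simp add: smat_def)

lemma mat1_smat: "mat 1 = smat id (\<lambda>_. 1)"
  by (simp add: vec_eq_iff smat_def mat_def)

lemma smat_eqD:
  assumes "smat w s = smat w' s'" "\<And>c. s c \<noteq> 0"
  shows "w = w' \<and> s = s'"
proof -
  have *: "smat w s $ (w c) $ c = smat w' s' $ (w c) $ c" for c using assms by simp
  have "w c = w' c \<and> s c = s' c" for c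
    using *[of c] assms(2)[of c] by (auto simp: smat_def split: if_splits)
  then show ?thesis by auto
qed

lemma signed_permutation_over_iff:
  "signed_permutation_over w A \<longleftrightarrow> bij w \<and> (\<exists>s. (\<forall>c. s c \<in> {1, -1}) \<and> A = smat w s)"
proof -
  have *: "diagonal_matrix t ** permutation_matrix w = smat w (\<lambda>c. t (w c))" for t :: "_ \<Rightarrow> real"
  proof -
    have "permutation_matrix w = smat w (\<lambda>_. 1)" "diagonal_matrix t = smat id t"
      by (simp_all add: vec_eq_iff permutation_matrix_def diagonal_matrix_def smat_def)
    then show ?thesis by (simp add: smat_smat)
  qed
  show ?thesis
  proof
    assume "signed_permutation_over w A"
    then obtain t where t: "w permutes UNIV" "\<forall>i. t i \<in> {1, -1}" "A = smat w (\<lambda>c. t (w c))"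
      unfolding signed_permutation_over_def * by blast
    then show "bij w \<and> (\<exists>s. (\<forall>c. s c \<in> {1, -1}) \<and> A = smat w s)"
      by (intro conjI exI[of _ "\<lambda>c. t (w c)"]) (auto intro: permutes_bij)
  next
    assume r: "bij w \<and> (\<exists>s. (\<forall>c. s c \<in> {1, -1}) \<and> A = smat w s)"
    then obtain s where s: "\<forall>c. s c \<in> {1, -1}" "A = smat w s" by blast
    have "A = diagonal_matrix (\<lambda>a. s (inv_into UNIV w a)) ** permutation_matrix w"
      using r s by (simp add: * bij_is_inj)
    moreover have "w permutes UNIV" using r by (intro bij_imp_permutes) auto
    ultimately show "signed_permutation_over w A"
      using s unfolding signed_permutation_over_def by (intro conjI exI[of _ "\<lambda>a. s (inv_into UNIV w a)"]) auto
  qed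
qed

definition signed_involution :: "('n \<Rightarrow> 'n) \<Rightarrow> ('n \<Rightarrow> real) \<Rightarrow> bool"
  where "signed_involution w s \<longleftrightarrow> (\<forall>c. w (w c) = c) \<and> (\<forall>c. s c \<in> {1, -1}) \<and> (\<forall>c. s (w c) = s c)"

lemma signed_involutionD:
  assumes "signed_involution w s"
  shows "w (w c) = c" "s c = 1 \<or> s c = -1" "s c * s c = 1" "s c \<noteq> 0" "s (w c) = s c" "bij w"
proof -
  show "w (w c) = c" and s: "s c = 1 \<or> s c = -1" and "s (w c) = s c"
    using assms by (auto simp: signed_involution_def)
  then show "s c * s c = 1" "s c \<noteq> 0" by auto
  show "bij w" using assms by (intro o_bij[of w w]) (auto simp: signed_involution_def)
qed

lemma smat_square_iff:
  assumes "\<And>c. s c \<in> {1, -1}"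
  shows "smat w s ** smat w s = mat 1 \<longleftrightarrow> signed_involution w s"
proof
  assume "smat w s ** smat w s = mat 1"
  then have *: "smat id (\<lambda>_. 1) = smat (w \<circ> w) (\<lambda>c. s (w c) * s c)" by (simp add: smat_smat mat1_smat)
  have "(id :: _ \<Rightarrow> _) = w \<circ> w" "(\<lambda>_. 1) = (\<lambda>c. s (w c) * s c)" using smat_eqD[OF *] by auto
  then have "w (w c) = c" "s (w c) * s c = 1" for c by (auto simp: fun_eq_iff)
  moreover have "s (w c) = s c" if "s (w c) * s c = 1" for c
    using that assms[of c] assms[of "w c"] by auto
  ultimately show "signed_involution w s" using assms by (auto simp: signed_involution_def)
next
  assume "signed_involution w s"
  note d = signed_involutionD[OF this]
  show "smat w s ** smat w s = mat 1"
    by (simp add: vec_eq_iff smat_mult_right) (auto simp: smat_def mat_def d(1,5) d(3))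
qed

lemma cell_index_iff:
  "A \<in> cell_index k \<longleftrightarrow> (\<exists>w s. signed_involution w s \<and> A = smat w s \<and>
    trace A = real CARD('n) - 2 * real k)" for A :: "real ^ 'n ^ 'n"
  using smat_square_iff signed_involutionD(6)
  unfolding cell_index_def signed_permutation_matrix_def signed_permutation_over_iff signed_involution_def
  by (smt (verit) mem_Collect_eq)

lemma underlying_permutation_smat:
  assumes "signed_involution w s" shows "underlying_permutation (smat w s) = w"
  unfolding underlying_permutation_def
proof (rule the_equality)
  note d = signed_involutionD[OF assms]
  show "signed_permutation_over w (smat w s)"
    using d(2,6) unfolding signed_permutation_over_iff by auto
  show "w' = w" if "signed_permutation_over w' (smat w s)" for w'
    using that smat_eqD[of w s w'] d(4) unfolding signed_permutation_over_iff by blast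
qed

lemma finite_cell_index: "finite (cell_index k :: (real ^ 'n::{finite,wellorder} ^ 'n::{finite,wellorder}) set)"
proof (rule finite_subset)
  show "(cell_index k :: (real ^ 'n::{finite,wellorder} ^ 'n::{finite,wellorder}) set) \<subseteq> (\<lambda>(w, s). smat w s) ` (UNIV \<times> {s. \<forall>c. s c \<in> {1, -1}})"
  proof
    fix A :: "real ^ 'n::{finite,wellorder} ^ 'n::{finite,wellorder}" assume "A \<in> cell_index k"
    then obtain w s where "signed_involution w s" "A = smat w s" unfolding cell_index_iff by blast
    then show "A \<in> (\<lambda>(w, s). smat w s) ` (UNIV \<times> {s. \<forall>c. s c \<in> {1, -1}})"
      by (intro image_eqI[of _ _ "(w, s)"]) (auto simp: signed_involution_def)
  qed
  have "finite {s :: 'n \<Rightarrow> real. \<forall>c. s c \<in> {1, -1}}"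
    using finite_PiE[of "UNIV :: 'n set" "\<lambda>_. {1, -1 :: real}"] by (simp add: PiE_def Pi_def)
  then show "finite ((\<lambda>(w, s). smat w s) ` ((UNIV :: ('n \<Rightarrow> 'n) set) \<times> {s. \<forall>c. s c \<in> {1, -1}}))"
    by (simp add: finite_cartesian_product_iff)
qed

lemma bij_le_self_imp_id:
  fixes f :: "'n::{finite,wellorder} \<Rightarrow> 'n"
  assumes "inj f" "\<And>c. f c \<le> c"
  shows "f c = c"
proof (induction c rule: less_induct)
  case (less c)
  show ?case
  proof (rule ccontr)
    assume "f c \<noteq> c"
    then have "f c < c" using assms(2)[of c] by auto
    then have "f (f c) = f c" by (rule less)
    then show False using assms(1) \<open>f c < c\<close> by (metis inj_eq less_irrefl)
  qed
qed

text \<open>Uniqueness in the Bruhat decomposition. Comparing entries of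
  \<open>c ** smat w s = smat w' s' ** b'\<close> shows that \<open>f\<close>, the composite of
  \<open>w\<close> with the inverse of \<open>w'\<close>, never increases an index; an injective map
  with this property is the identity, and the positive diagonals then determine the signs.\<close>

lemma double_coset_unique:
  assumes w: "bij w" "\<And>c. s c \<in> {1, -1}" and w': "bij w'" "\<And>c. s' c \<in> {1, -1}"
    and mem: "smat w s \<in> double_coset (smat w' s')"
  shows "w = w' \<and> s = s'"
proof -
  obtain b b' where b: "b \<in> pos_upper_triangular" "b' \<in> pos_upper_triangular"
    and eq: "smat w s = b ** smat w' s' ** b'"
    using mem by (auto simp: double_coset_def)
  obtain c where c: "c \<in> pos_upper_triangular" "c ** b = mat 1" using pos_upper_inverse b by metis
  have eq2: "c ** smat w s = smat w' s' ** b'"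
    using c by (simp add: eq matrix_mul_assoc)
  have r: "(smat w' s' ** b') $ (w' x) $ y = s' x * b' $ x $ y" for x y
  proof -
    have "(smat w' s' ** b') $ (w' x) $ y = smat w' s' $ (w' x) $ x * b' $ x $ y"
      unfolding matrix_matrix_mult_def vec_lambda_beta
      by (rule sum_eq_single) (use w' in \<open>auto simp: smat_def bij_is_inj inj_eq\<close>)
    then show ?thesis by (simp add: smat_def)
  qed
  have key: "c $ (w' x) $ (w y) * s y = s' x * b' $ x $ y" for x y
    using r[of x y] by (simp flip: eq2 add: smat_mult_right)
  have pos: "\<And>x. c $ x $ x > 0" "\<And>x. b' $ x $ x > 0" using b c by (auto simp: pos_upper_triangular_iff)
  have ne: "s y \<noteq> 0" "s' y \<noteq> 0" for y using w(2)[of y] w'(2)[of y] by auto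
  define f where "f y = inv_into UNIV w' (w y)" for y
  have wf: "w' (f y) = w y" for y using w' by (simp add: f_def bij_is_surj surj_f_inv_f)
  have "f y \<le> y" for y
  proof (rule ccontr)
    assume "\<not> f y \<le> y"
    then have "b' $ f y $ y = 0" using b by (auto simp: pos_upper_triangular_iff)
    then show False using key[of "f y" y] pos(1)[of "w y"] ne[of y] by (simp add: wf)
  qed
  moreover have "inj f" unfolding f_def using w w' by (intro injI) (metis bij_inv_eq_iff bij_is_inj inj_eq)
  ultimately have "f y = y" for y by (intro bij_le_self_imp_id)
  then have ww: "w' y = w y" for y using wf[of y] by simp
  have "s y = s' y" for y
  proof -
    have *: "c $ w y $ w y * s y = s' y * b' $ y $ y" using key[of y y] ww by simp
    show ?thesis
      using * w(2)[of y] w'(2)[of y] pos(1)[of "w y"] pos(2)[of y] by auto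
  qed
  then show ?thesis using ww by auto
qed

lemma double_coset_disjoint:
  assumes "bij w" "\<And>c. s c \<in> {1, -1}" "bij w'" "\<And>c. s' c \<in> {1, -1}"
    and "g \<in> double_coset (smat w s)" "g \<in> double_coset (smat w' s')"
  shows "w = w' \<and> s = s'"
  using assms double_coset_unique double_coset_trans double_coset_sym by metis

text \<open>Inversion carries the double coset of \<open>smat w s\<close> to that of the inverse
  matrix. An involution \<open>g\<close> lies in both, so uniqueness makes the representative its
  own inverse.\<close>

lemma involution_double_coset:
  assumes w: "bij w" "\<And>c. s c \<in> {1, -1}" and g: "g ** g = mat 1" "g \<in> double_coset (smat w s)"
  shows "signed_involution w s"
proof -
  obtain b b' where b: "b \<in> pos_upper_triangular" "b' \<in> pos_upper_triangular"
    and eq: "g = b ** smat w s ** b'"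
    using g by (auto simp: double_coset_def)
  obtain c c' where c: "c \<in> pos_upper_triangular" "b ** c = mat 1" "c' \<in> pos_upper_triangular" "c' ** b' = mat 1"
    using pos_upper_inverse b by metis
  define A where "A = smat (inv_into UNIV w) (\<lambda>c. s (inv_into UNIV w c))"
  have AA: "smat w s ** A = mat 1"
  proof -
    have "s c * s c = 1" for c using w(2)[of c] by auto
    moreover have "w \<circ> inv_into UNIV w = id" using w bij_is_surj surj_iff by metis
    ultimately show ?thesis by (simp add: A_def smat_smat mat1_smat)
  qed
  have "g = g ** (b ** (smat w s ** A) ** c)" using AA c by simp
  also have "\<dots> = c' ** b' ** (g ** b ** smat w s ** A ** c)" using c by (simp add: matrix_mul_assoc)
  also have "\<dots> = c' ** (b' ** g ** b ** smat w s) ** A ** c" by (simp add: matrix_mul_assoc)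
  finally have g1: "g = c' ** (b' ** g ** b ** smat w s) ** A ** c" .
  have "b ** smat w s ** (b' ** g ** b ** smat w s) = g ** g ** b ** smat w s"
    by (simp add: eq matrix_mul_assoc)
  also have "\<dots> = b ** smat w s" using g by simp
  finally have "A ** c ** b ** smat w s ** (b' ** g ** b ** smat w s) = A ** c ** b ** smat w s"
    by (metis matrix_mul_assoc)
  moreover have "A ** c ** b ** smat w s = mat 1"
    using AA c matrix_left_right_inverse matrix_mul_assoc matrix_mul_rid by metis
  ultimately have "b' ** g ** b ** smat w s = mat 1" by simp
  then have "g = c' ** A ** c" using g1 by simp
  then have "g \<in> double_coset A" using c double_cosetI by blast
  moreover have "bij (inv_into UNIV w)" using w bij_imp_bij_inv by blast
  ultimately have "inv_into UNIV w = w \<and> (\<lambda>c. s (inv_into UNIV w c)) = s"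
    using double_coset_disjoint[of "inv_into UNIV w" "\<lambda>c. s (inv_into UNIV w c)" w s g] w g unfolding A_def by blast
  then have "A = smat w s" by (metis A_def)
  then have "smat w s ** smat w s = mat 1" using AA by simp
  then show ?thesis using smat_square_iff w by blast
qed

text \<open>Conjugation carries the root \<open>(i, j)\<close> to \<open>(w i, w j)\<close>. The
  image is positive because \<open>w i < w j\<close>, and under the second hypothesis it is a
  different root. Every exchange of a rotation with a signed permutation below rests on
  this.\<close>

lemma elem_conj:
  assumes inv: "signed_involution w s" and lt: "w i < w j" "i < j"
  shows "smat w s ** elem_mat i j t ** smat w s \<in> pos_upper_triangular"
    "\<not> (w i = i \<and> w j = j) \<Longrightarrow> (smat w s ** elem_mat i j t ** smat w s) $ i $ j = 0"
proof -
  note d = signed_involutionD[OF inv]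
  have e: "(smat w s ** elem_mat i j t ** smat w s) $ a $ c = s a * elem_mat i j t $ (w a) $ (w c) * s c" for a c
    using d by (simp add: smat_mult_right smat_mult_left)
  have ww: "w a = b \<longleftrightarrow> a = w b" for a b using d(1) by metis
  show "smat w s ** elem_mat i j t ** smat w s \<in> pos_upper_triangular"
    unfolding pos_upper_triangular_iff e
    using lt d(3) by (auto simp: elem_mat_def ww d(1))
  show "(smat w s ** elem_mat i j t ** smat w s) $ i $ j = 0" if "\<not> (w i = i \<and> w j = j)"
    using that lt unfolding e by (auto simp: elem_mat_def ww d(1))
qed

text \<open>Bruhat decomposition in rank one: a rotation through an angle strictly between
  \<open>0\<close> and \<open>pi\<close> lies in the double coset of the quarter turn.\<close>

lemma rot_half_decomp:
  assumes ij: "adjacent i j" and "0 < \<phi>" "\<phi> < pi"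
  obtains c c' t where "c \<in> pos_upper_triangular" "c' \<in> pos_upper_triangular"
    "rot i j \<phi> = c ** rot i j (pi/2) ** elem_mat i j t"
    "rot i j (-\<phi>) = elem_mat i j (-t) ** rot i j (- (pi/2)) ** c'"
proof -
  have ne: "i \<noteq> j" "i < j" using ij by (auto simp: adjacent_def)
  \<comment> \<open>With this value row \<open>j\<close> of
    \<open>rot i j (pi/2) ** elem_mat i j t\<close> points in the direction of the angle \<phi> and
    has length \<open>1 / sin \<phi>\<close>.\<close>
  define t where "t = cos \<phi> / sin \<phi>"
  have sp: "sin \<phi> > 0" using assms sin_gt_zero by blast
  define b where "b = rot i j (pi/2) ** elem_mat i j t ** rot i j (- \<phi>)"
  have b: "b \<in> pos_upper_triangular" unfolding b_def
    by (rule rot_through_pos_upper[where r="1 / sin \<phi>"])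
      (use ij ne sp in \<open>auto simp: elem_mat_pos_upper\<close>, auto simp: elem_mat_def t_def)
  obtain c where c: "c \<in> pos_upper_triangular" "c ** b = mat 1" "b ** c = mat 1"
    using pos_upper_inverse b by metis
  have r1: "rot i j \<phi> = c ** rot i j (pi/2) ** elem_mat i j t"
  proof -
    have "c ** rot i j (pi/2) ** elem_mat i j t = c ** b ** rot i j \<phi>"
      using ne by (simp add: b_def rot_inverse flip: matrix_mul_assoc)
    then show ?thesis using c by simp
  qed
  have ee: "elem_mat i j (-t) ** elem_mat i j t = mat 1"
  proof -
    have "(elem_mat i j (-t) ** elem_mat i j t) $ a $ c' = mat 1 $ a $ c'" for a c'
    proof -
      have "(elem_mat i j (-t) ** elem_mat i j t) $ a $ c' = elem_mat i j t $ a $ c' + (if a = i then - t * elem_mat i j t $ j $ c' else 0)"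
        unfolding matrix_matrix_mult_def vec_lambda_beta
        by (subst elem_mat_def) (simp add: distrib_right sum.distrib if_distrib[where f="\<lambda>x. x * _"] if_distribR cong: if_cong conj_cong)
      then show ?thesis using ne by (auto simp: elem_mat_def mat_def)
    qed
    then show ?thesis by (simp add: vec_eq_iff)
  qed
  have "elem_mat i j (-t) ** rot i j (- (pi/2)) ** b = elem_mat i j (-t) ** (rot i j (- (pi/2)) ** rot i j (pi/2)) ** elem_mat i j t ** rot i j (- \<phi>)"
    by (simp add: b_def matrix_mul_assoc)
  also have "\<dots> = rot i j (-\<phi>)" using ne ee by (simp add: rot_inverse)
  finally show ?thesis using that c r1 b by metis
qed

text \<open>The entry at \<open>(i, j)\<close> is the only one which conjugation by the quarter turn
  would move below the diagonal.\<close>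

lemma rot_conj_pos_upper:
  assumes "adjacent i j" "b \<in> pos_upper_triangular" "b $ i $ j = 0"
  shows "rot i j (pi/2) ** b ** rot i j (- (pi/2)) \<in> pos_upper_triangular"
  by (rule rot_through_pos_upper[where r="b $ i $ i"]) (use assms in \<open>auto simp: pos_upper_triangular_iff\<close>)


section \<open>Conjugation by rotations and its effect on double cosets\<close>

definition act :: "'n::finite \<Rightarrow> 'n \<Rightarrow> real \<Rightarrow> real ^ 'n ^ 'n \<Rightarrow> real ^ 'n ^ 'n"
  where "act i j \<theta> g = rot i j \<theta> ** g ** rot i j (- \<theta>)"

lemma act_act: "i \<noteq> j \<Longrightarrow> act i j \<alpha> (act i j \<beta> g) = act i j (\<alpha> + \<beta>) g"
proof -
  assume ne: "i \<noteq> j"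
  have "act i j \<alpha> (act i j \<beta> g) = (rot i j \<alpha> ** rot i j \<beta>) ** g ** (rot i j (- \<beta>) ** rot i j (- \<alpha>))"
    by (simp add: act_def matrix_mul_assoc)
  then show ?thesis using ne by (simp add: rot_add act_def add.commute)
qed

lemma act_zero: "i \<noteq> j \<Longrightarrow> act i j 0 g = g"
  by (simp add: act_def rot_zero)

lemma act_grassmannian:
  assumes ne: "i \<noteq> j" and g: "g \<in> grassmannian k" shows "act i j \<theta> g \<in> grassmannian k"
proof -
  have o: "orthogonal_matrix (rot i j \<alpha>)" for \<alpha>
    using rot_inverse[OF ne] by (simp add: orthogonal_matrix_def transpose_rot)
  have "orthogonal_matrix (act i j \<theta> g)"
    unfolding act_def using g o by (auto simp: grassmannian_def intro!: orthogonal_matrix_mul)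
  moreover have "act i j \<theta> g ** act i j \<theta> g = rot i j \<theta> ** (g ** (rot i j (- \<theta>) ** rot i j \<theta>) ** g) ** rot i j (- \<theta>)"
    by (simp add: act_def matrix_mul_assoc)
  then have "act i j \<theta> g ** act i j \<theta> g = mat 1"
    using g rot_inverse[OF ne] by (simp add: grassmannian_def)
  moreover have "trace (act i j \<theta> g) = trace g"
    unfolding act_def by (subst trace_mul_sym) (simp add: rot_inverse[OF ne] matrix_mul_assoc)
  ultimately show ?thesis using g by (simp add: grassmannian_def)
qed

text \<open>Conjugation puts a rotation on the left of \<open>b\<close> and its inverse on the right
  of \<open>b'\<close>. Moving both inwards gives two different angle functions, one from
  \<open>b\<close> and one from the inverse of \<open>b'\<close>. They depend on the point
  \<open>h\<close>; common to all points are the values at the ends and the range in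
  between.\<close>

lemma act_double_coset:
  assumes ij: "adjacent i j" and h: "h \<in> double_coset A"
  obtains \<phi> \<phi>' where "continuous_on {0..pi} \<phi>" "\<phi> 0 = 0" "\<phi> pi = pi"
    "\<And>\<theta>. 0 < \<theta> \<Longrightarrow> \<theta> < pi \<Longrightarrow> 0 < \<phi> \<theta> \<and> \<phi> \<theta> < pi"
    "continuous_on {0..pi} \<phi>'" "\<phi>' 0 = 0" "\<phi>' pi = pi"
    "\<And>\<theta>. 0 < \<theta> \<Longrightarrow> \<theta> < pi \<Longrightarrow> 0 < \<phi>' \<theta> \<and> \<phi>' \<theta> < pi"
    "\<And>\<theta>. 0 \<le> \<theta> \<Longrightarrow> \<theta> \<le> pi \<Longrightarrow> act i j \<theta> h \<in> double_coset (rot i j (\<phi> \<theta>) ** A ** rot i j (- \<phi>' \<theta>))"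
proof -
  have ne: "i \<noteq> j" using ij by (auto simp: adjacent_def)
  obtain b b' where b: "b \<in> pos_upper_triangular" "b' \<in> pos_upper_triangular" and eq: "h = b ** A ** b'"
    using h by (auto simp: double_coset_def)
  obtain c where c: "c \<in> pos_upper_triangular" "c ** b' = mat 1" "b' ** c = mat 1"
    using b pos_upper_inverse by metis
  from rot_angle_through_pos_upper[OF ij b(1)] obtain \<phi> where \<phi>: "continuous_on {0..pi} \<phi>" "\<phi> 0 = 0" "\<phi> pi = pi"
    "\<And>\<theta>. 0 < \<theta> \<Longrightarrow> \<theta> < pi \<Longrightarrow> 0 < \<phi> \<theta> \<and> \<phi> \<theta> < pi"
    and \<phi>1: "\<And>\<theta>. 0 \<le> \<theta> \<Longrightarrow> \<theta> \<le> pi \<Longrightarrow> \<exists>b'\<in>pos_upper_triangular. rot i j \<theta> ** b = b' ** rot i j (\<phi> \<theta>)"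
    by metis
  from rot_angle_through_pos_upper[OF ij c(1)] obtain \<phi>' where \<phi>': "continuous_on {0..pi} \<phi>'" "\<phi>' 0 = 0" "\<phi>' pi = pi"
    "\<And>\<theta>. 0 < \<theta> \<Longrightarrow> \<theta> < pi \<Longrightarrow> 0 < \<phi>' \<theta> \<and> \<phi>' \<theta> < pi"
    and \<phi>'1: "\<And>\<theta>. 0 \<le> \<theta> \<Longrightarrow> \<theta> \<le> pi \<Longrightarrow> \<exists>b'\<in>pos_upper_triangular. rot i j \<theta> ** c = b' ** rot i j (\<phi>' \<theta>)"
    by metis
  have "act i j \<theta> h \<in> double_coset (rot i j (\<phi> \<theta>) ** A ** rot i j (- \<phi>' \<theta>))" if \<theta>: "0 \<le> \<theta>" "\<theta> \<le> pi" for \<theta>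
  proof -
    obtain b1 where b1: "b1 \<in> pos_upper_triangular" "rot i j \<theta> ** b = b1 ** rot i j (\<phi> \<theta>)"
      using \<phi>1[OF \<theta>] by blast
    obtain c1 where c1: "c1 \<in> pos_upper_triangular" "rot i j \<theta> ** c = c1 ** rot i j (\<phi>' \<theta>)"
      using \<phi>'1[OF \<theta>] by blast
    obtain d where d: "d \<in> pos_upper_triangular" "c1 ** d = mat 1" "d ** c1 = mat 1"
      using c1 pos_upper_inverse by metis
    have "b' ** rot i j (- \<theta>) = rot i j (- \<phi>' \<theta>) ** (d ** c1) ** rot i j (\<phi>' \<theta>) ** (b' ** rot i j (- \<theta>))"
      using d rot_inverse[OF ne] by simp
    also have "\<dots> = rot i j (- \<phi>' \<theta>) ** d ** (c1 ** rot i j (\<phi>' \<theta>)) ** b' ** rot i j (- \<theta>)"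
      by (simp add: matrix_mul_assoc)
    also have "\<dots> = rot i j (- \<phi>' \<theta>) ** d ** rot i j \<theta> ** (c ** b') ** rot i j (- \<theta>)"
      unfolding c1(2)[symmetric] by (simp add: matrix_mul_assoc)
    also have "\<dots> = rot i j (- \<phi>' \<theta>) ** d ** (rot i j \<theta> ** rot i j (- \<theta>))"
      using c by (simp add: matrix_mul_assoc)
    finally have r: "b' ** rot i j (- \<theta>) = rot i j (- \<phi>' \<theta>) ** d"
      using rot_inverse[OF ne] by simp
    have "act i j \<theta> h = (rot i j \<theta> ** b) ** A ** (b' ** rot i j (- \<theta>))"
      by (simp add: act_def eq matrix_mul_assoc)
    also have "\<dots> = b1 ** (rot i j (\<phi> \<theta>) ** A ** rot i j (- \<phi>' \<theta>)) ** d"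
      unfolding b1(2) r by (simp add: matrix_mul_assoc)
    finally show ?thesis using b1 d double_cosetI by metis
  qed
  then show ?thesis using that \<phi> \<phi>' by blast
qed

text \<open>The rank-two part of the multiplication rule \<open>BsB \<cdot> BwB = BswB\<close> for \<open>l(sw) > l(w)\<close>.\<close>

lemma rot_mult_double_coset:
  assumes ij: "adjacent i j" and inv: "signed_involution w s" and lt: "w i < w j" and \<phi>: "0 < \<phi>" "\<phi> < pi"
  shows "rot i j \<phi> ** smat w s \<in> double_coset (rot i j (pi/2) ** smat w s)"
    "smat w s ** rot i j (- \<phi>) \<in> double_coset (smat w s ** rot i j (- (pi/2)))"
proof -
  have lt': "i < j" using ij by (auto simp: adjacent_def)
  have sq: "smat w s ** smat w s = mat 1" using inv smat_square_iff by (auto simp: signed_involution_def)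
  obtain c c' t where c: "c \<in> pos_upper_triangular" "c' \<in> pos_upper_triangular"
    "rot i j \<phi> = c ** rot i j (pi/2) ** elem_mat i j t"
    "rot i j (-\<phi>) = elem_mat i j (-t) ** rot i j (- (pi/2)) ** c'"
    using rot_half_decomp[OF ij \<phi>] by metis
  have "rot i j \<phi> ** smat w s = c ** rot i j (pi/2) ** (smat w s ** smat w s) ** elem_mat i j t ** smat w s"
    using c sq by simp
  also have "\<dots> = c ** (rot i j (pi/2) ** smat w s) ** (smat w s ** elem_mat i j t ** smat w s)"
    by (simp add: matrix_mul_assoc)
  finally show "rot i j \<phi> ** smat w s \<in> double_coset (rot i j (pi/2) ** smat w s)"
    using c elem_conj(1)[OF inv lt lt'] double_cosetI by metis
  have "smat w s ** rot i j (- \<phi>) = smat w s ** elem_mat i j (-t) ** (smat w s ** smat w s) ** rot i j (- (pi/2)) ** c'"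
    using c sq by (simp add: matrix_mul_assoc)
  also have "\<dots> = (smat w s ** elem_mat i j (-t) ** smat w s) ** (smat w s ** rot i j (- (pi/2))) ** c'"
    by (simp add: matrix_mul_assoc)
  finally show "smat w s ** rot i j (- \<phi>) \<in> double_coset (smat w s ** rot i j (- (pi/2)))"
    using c elem_conj(1)[OF inv lt lt'] double_cosetI by metis
qed

text \<open>The multiplication rule for conjugation by a quarter turn when the length grows by two.
  Splitting both rotations leaves elementary factors next to \<open>smat w s\<close>; they can pass
  the quarter turns and join the outer triangular factors once their entries at
  \<open>(i, j)\<close> vanish.\<close>

lemma rot_conj_double_coset:
  assumes ij: "adjacent i j" and inv: "signed_involution w s" and lt: "w i < w j" and nf: "\<not> (w i = i \<and> w j = j)"
    and \<phi>: "0 < \<phi>" "\<phi> < pi" and \<phi>': "0 < \<phi>'" "\<phi>' < pi"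
  shows "rot i j \<phi> ** smat w s ** rot i j (- \<phi>') \<in> double_coset (act i j (pi/2) (smat w s))"
proof -
  let ?u = "smat w s" and ?s = "rot i j (pi/2)" and ?s' = "rot i j (- (pi/2))"
  have lt': "i < j" and ne: "i \<noteq> j" using ij by (auto simp: adjacent_def)
  have sq: "?u ** ?u = mat 1" using inv smat_square_iff by (auto simp: signed_involution_def)
  have ss: "?s' ** ?s = mat 1" by (rule rot_inverse[OF ne])
  obtain c c' t where c: "c \<in> pos_upper_triangular" "c' \<in> pos_upper_triangular"
    "rot i j \<phi> = c ** ?s ** elem_mat i j t" "rot i j (-\<phi>) = elem_mat i j (-t) ** ?s' ** c'"
    using rot_half_decomp[OF ij \<phi>] by metis
  obtain d d' t' where d: "d \<in> pos_upper_triangular" "d' \<in> pos_upper_triangular"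
    "rot i j \<phi>' = d ** ?s ** elem_mat i j t'" "rot i j (-\<phi>') = elem_mat i j (-t') ** ?s' ** d'"
    using rot_half_decomp[OF ij \<phi>'] by metis
  \<comment> \<open>\<open>X\<close> stems from the left rotation and \<open>Z\<close> from the
    right one. \<open>Z\<close> is moved to the left through the signed permutation, and
    \<open>X\<close> is then replaced by its conjugate \<open>Y ** X ** Z\<close>.\<close>
  define X where "X = ?u ** elem_mat i j t ** ?u"
  define Z where "Z = elem_mat i j (- t')"
  have X: "X \<in> pos_upper_triangular" "X $ i $ j = 0" using elem_conj[OF inv lt lt'] nf by (auto simp: X_def)
  have Z: "Z \<in> pos_upper_triangular" using lt' by (simp add: Z_def elem_mat_pos_upper)
  obtain Y where Y: "Y \<in> pos_upper_triangular" "Z ** Y = mat 1" "Y ** Z = mat 1" using pos_upper_inverse[OF Z] by metis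
  have YXZ: "Y ** X ** Z \<in> pos_upper_triangular" using X Y Z by (intro pos_upper_mult)
  \<comment> \<open>\<open>X\<close> contributes nothing to this entry, and the contributions of
    \<open>Z\<close> and of its inverse \<open>Y\<close> cancel.\<close>
  have "(Y ** X ** Z) $ i $ j = 0"
  proof -
    have one: "Z $ a $ a = 1" "X $ i $ i = 1" "X $ j $ j = 1" for a
    proof -
      show "Z $ a $ a = 1" using lt' by (auto simp: Z_def elem_mat_def)
      have "X $ a $ a = 1" for a
        using signed_involutionD[OF inv] lt' unfolding X_def
        by (simp add: smat_mult_right smat_mult_left) (auto simp: elem_mat_def)
      then show "X $ i $ i = 1" "X $ j $ j = 1" by auto
    qed
    have "(Y ** (X ** Z)) $ i $ j = Y $ i $ i * (X ** Z) $ i $ j + Y $ i $ j * (X ** Z) $ j $ j"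
      using X Y Z ij by (intro pos_upper_mult_adjacent pos_upper_mult)
    moreover have "(X ** Z) $ i $ j = Z $ i $ j" using pos_upper_mult_adjacent[OF X(1) Z ij] X one by simp
    moreover have "(X ** Z) $ j $ j = 1"
    proof -
      have "(X ** Z) $ j $ j = X $ j $ j * Z $ j $ j"
        unfolding matrix_matrix_mult_def vec_lambda_beta
        by (rule sum_eq_single) (metis X(1) Z mult_eq_0_iff neqE pos_upper_triangular_iff)
      then show ?thesis using one by simp
    qed
    moreover have "(Y ** Z) $ i $ j = Y $ i $ i * Z $ i $ j + Y $ i $ j * Z $ j $ j"
      using Y Z ij by (intro pos_upper_mult_adjacent)
    ultimately show ?thesis using Y one ne by (simp add: matrix_mul_assoc mat_def)
  qed
  then have R: "?s ** (Y ** X ** Z) ** ?s' \<in> pos_upper_triangular"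
    using ij YXZ by (intro rot_conj_pos_upper)
  have L: "?s ** (?u ** Z ** ?u) ** ?s' \<in> pos_upper_triangular"
    unfolding Z_def using ij elem_conj[OF inv lt lt'] nf by (intro rot_conj_pos_upper) auto
  have "rot i j \<phi> ** ?u ** rot i j (- \<phi>') = c ** ?s ** elem_mat i j t ** ?u ** Z ** ?s' ** d'"
    using c d by (simp add: Z_def matrix_mul_assoc)
  also have "\<dots> = c ** ?s ** (?u ** ?u) ** elem_mat i j t ** ?u ** Z ** ?s' ** d'" using sq by simp
  also have "\<dots> = c ** ?s ** ?u ** (Z ** Y) ** X ** Z ** ?s' ** d'"
    using Y by (simp add: X_def matrix_mul_assoc)
  also have "\<dots> = c ** ?s ** ?u ** Z ** (?u ** ?u) ** (Y ** X ** Z) ** ?s' ** d'"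
    using sq by (simp add: matrix_mul_assoc)
  also have "\<dots> = c ** ?s ** (?u ** Z ** ?u) ** (?s' ** ?s) ** ?u ** (?s' ** ?s) ** (Y ** X ** Z) ** ?s' ** d'"
    using ss by (simp add: matrix_mul_assoc)
  also have "\<dots> = (c ** (?s ** (?u ** Z ** ?u) ** ?s')) ** (?s ** ?u ** ?s') ** ((?s ** (Y ** X ** Z) ** ?s') ** d')"
    by (simp add: matrix_mul_assoc)
  finally show ?thesis unfolding act_def
    using L R c d by (auto intro!: double_cosetI pos_upper_mult)
qed

text \<open>On the plane of e_i and e_j the matrix is plus or minus the identity if the signs agree,
  and a reflection if they differ; a reflection inverts rotations.\<close>

lemma rot_commute_smat:
  assumes "i \<noteq> j" and inv: "signed_involution w s" and "w i = i" "w j = j"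
  shows "s j = s i \<Longrightarrow> smat w s ** rot i j \<phi> = rot i j \<phi> ** smat w s"
    "s j = - s i \<Longrightarrow> smat w s ** rot i j \<phi> = rot i j (- \<phi>) ** smat w s"
proof -
  note d = signed_involutionD[OF inv]
  have ww: "w a = b \<longleftrightarrow> a = w b" for a b using d(1) by metis
  have *: "w a = i \<longleftrightarrow> a = i" "w a = j \<longleftrightarrow> a = j" for a using ww assms by metis+
  show "smat w s ** rot i j \<phi> = rot i j \<phi> ** smat w s" if "s j = s i"
    by (simp add: vec_eq_iff smat_mult_right smat_mult_left d(1)) (auto simp: rot_def * assms that d(5) ww)
  show "smat w s ** rot i j \<phi> = rot i j (-\<phi>) ** smat w s" if "s j = - s i"
    by (simp add: vec_eq_iff smat_mult_right smat_mult_left d(1)) (auto simp: rot_def * assms that d(5) ww)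
qed

section \<open>Inversions of involutions\<close>

definition sw :: "'n \<Rightarrow> 'n \<Rightarrow> 'n \<Rightarrow> 'n"
  where "sw i j c = (if c = i then j else if c = j then i else c)"

lemma sw_sw [simp]: "sw i j (sw i j c) = c"
  by (simp add: sw_def)

lemma sw_left [simp]: "sw i j i = j" and sw_right [simp]: "sw i j j = i"
  by (auto simp: sw_def)

lemma sw_eq_iff: "sw i j c = d \<longleftrightarrow> c = sw i j d"
  by (auto simp: sw_def)

lemma sw_less:
  assumes "adjacent i j" "x < y" "\<not> (x = i \<and> y = j)" shows "sw i j x < sw i j y"
proof -
  have ij: "i < j" and a: "\<And>a. a \<le> i \<or> j \<le> a" using assms by (auto simp: adjacent_def)
  have "j < y" if "i < y" "y \<noteq> j" for y using a[of y] that by auto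
  moreover have "y < i" if "y < j" "y \<noteq> i" for y using a[of y] that by auto
  ultimately show ?thesis using assms(2,3) ij
    by (auto simp: sw_def)
qed

text \<open>Twice the dimension of the cell when \<open>w\<close> is an involution: the second
  summand counts the inversions that are alone in their equivalence class, and these are the
  2-cycles of \<open>w\<close>.\<close>

definition invol_weight :: "('n::linorder \<Rightarrow> 'n) \<Rightarrow> nat"
  where "invol_weight w = card (inversions w) + card {(a, b). a < b \<and> w a = b}"

text \<open>Orbit count for a group of order two: a class consists of two elements that are
  exchanged or of one fixed element, and contributes two to the right-hand side in either
  case.\<close>

lemma card_quotient_involution:
  assumes fin: "finite A" and f: "\<And>x. x \<in> A \<Longrightarrow> f x \<in> A" "\<And>x. x \<in> A \<Longrightarrow> f (f x) = x"
    and R: "R = {(x, y). x \<in> A \<and> y \<in> A \<and> (y = x \<or> y = f x)}"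
  shows "2 * card (A // R) = card A + card {x \<in> A. f x = x}"
proof -
  have eq: "equiv A R"
    unfolding R equiv_def refl_on_def sym_def trans_def using f by auto
  have cls: "R `` {x} = {x, f x}" if "x \<in> A" for x using that f by (auto simp: R)
  have disj: "pairwise disjnt (A // R)"
    using quotient_disj[OF eq] by (auto simp: pairwise_def disjnt_def)
  have finC: "finite C" if "C \<in> A // R" for C using that fin cls by (auto elim!: quotientE)
  have finQ: "finite (A // R)" using fin eq by (simp add: equiv_type finite_quotient)
  have c1: "card A = (\<Sum>C\<in>A // R. card C)"
    using card_Union_disjoint[OF disj finC] Union_quotient[OF eq] by simp
  have "{x \<in> A. f x = x} = \<Union> ((\<lambda>C. {x \<in> C. f x = x}) ` (A // R))"
    using Union_quotient[OF eq] by auto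
  also have "card \<dots> = (\<Sum>C\<in>A // R. card {x \<in> C. f x = x})"
  proof (intro card_UN_disjoint ballI impI)
    show "finite {x \<in> C. f x = x}" if "C \<in> A // R" for C using finC[OF that] by simp
    show "{x \<in> C. f x = x} \<inter> {x \<in> C'. f x = x} = {}" if "C \<in> A // R" "C' \<in> A // R" "C \<noteq> C'" for C C'
      using disj that unfolding pairwise_def disjnt_def by blast
  qed (rule finQ)
  finally have c2: "card {x \<in> A. f x = x} = (\<Sum>C\<in>A // R. card {x \<in> C. f x = x})" .
  have "card C + card {x \<in> C. f x = x} = 2" if C: "C \<in> A // R" for C
  proof -
    obtain x where x: "x \<in> A" "C = {x, f x}" using C cls by (auto elim!: quotientE)
    show ?thesis
    proof (cases "f x = x")
      case True
      then have "C = {x}" "{y \<in> C. f y = y} = {x}" using x by auto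
      then show ?thesis by simp
    next
      case False
      then have "{y \<in> C. f y = y} = {}" using x f by auto
      then show ?thesis using False x by simp
    qed
  qed
  then have "(\<Sum>C\<in>A // R. card C + card {x \<in> C. f x = x}) = (\<Sum>C\<in>A // R. 2)" by (rule sum.cong[OF refl])
  then show ?thesis by (simp add: c1 c2 sum.distrib)
qed

lemma card_quotient_inversions:
  fixes w :: "'n::{finite,linorder} \<Rightarrow> 'n"
  assumes w: "\<And>c. w (w c) = c"
  shows "2 * card (inversions w // inversion_rel w) = invol_weight w"
proof -
  let ?f = "\<lambda>(a, b). (w b, w a)"
  have "2 * card (inversions w // inversion_rel w) = card (inversions w) + card {x \<in> inversions w. ?f x = x}"
    by (rule card_quotient_involution) (auto simp: inversions_def inversion_rel_def w)
  moreover have "{x \<in> inversions w. ?f x = x} = {(a, b). a < b \<and> w a = b}"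
    using w by (auto simp: inversions_def)
  ultimately show ?thesis by (simp add: invol_weight_def)
qed

text \<open>Conjugation carries inversions to inversions, permutes the 2-cycles, and adds the
  inversion \<open>(i, j)\<close> together with its partner under the equivalence. The two are
  distinct because \<open>w i < w j\<close>, and the partner is an increasing pair because
  \<open>w\<close> does not fix both indices.\<close>

lemma invol_weight_conj:
  fixes w :: "'n::{finite,linorder} \<Rightarrow> 'n"
  assumes ij: "adjacent i j" and w: "\<And>c. w (w c) = c" and lt: "w i < w j" and nf: "\<not> (w i = i \<and> w j = j)"
  shows "invol_weight (sw i j \<circ> w \<circ> sw i j) = invol_weight w + 2"
proof -
  let ?t = "sw i j" and ?w = "sw i j \<circ> w \<circ> sw i j"
  let ?T = "\<lambda>(a, b). (?t a, ?t b)"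
  have lt': "i < j" using ij by (auto simp: adjacent_def)
  have ww: "w a = b \<longleftrightarrow> a = w b" for a b using w by metis
  have injT: "inj_on ?T X" for X by (rule inj_onI) (auto simp: sw_eq_iff)
  have nfT: "(?t (w i), ?t (w j)) \<noteq> (i, j)" using lt lt' nf by (auto simp: sw_def split: if_splits)
  have lt2: "?t (w i) < ?t (w j)" using sw_less[OF ij lt] nf by blast
  have inv_eq: "inversions ?w = ?T ` inversions w \<union> {(i, j), (?t (w i), ?t (w j))}" (is "?L = ?R")
  proof
    show "?L \<subseteq> ?R"
    proof (rule subrelI, rule ccontr)
      fix a b assume ab: "(a, b) \<in> inversions ?w" "(a, b) \<notin> ?R"
      then have 1: "a < b" "?t (w (?t b)) < ?t (w (?t a))" by (auto simp: inversions_def)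
      have ab': "(a, b) \<noteq> (i, j)" "(a, b) \<noteq> (?t (w i), ?t (w j))" using ab(2) by blast+
      have "?t a < ?t b" using sw_less[OF ij 1(1)] ab' by blast
      moreover have "w (?t b) < w (?t a)"
      proof (rule ccontr)
        assume "\<not> w (?t b) < w (?t a)"
        then have "?t (w (?t b)) = i \<and> ?t (w (?t a)) = j" using sw_less[OF ij 1(2)] by auto
        then have "?t b = w j" "?t a = w i" by (auto simp: sw_eq_iff ww w sw_def[of i j i] sw_def[of i j j])
        then show False using ab' by (auto simp: sw_eq_iff)
      qed
      ultimately have "(?t a, ?t b) \<in> inversions w" by (auto simp: inversions_def)
      then have "(a, b) \<in> ?T ` inversions w" by (intro image_eqI[of _ _ "(?t a, ?t b)"]) auto
      then show False using ab(2) by blast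
    qed
    show "?R \<subseteq> ?L"
    proof (rule subrelI)
      fix a b assume ab: "(a, b) \<in> ?R"
      consider "(a, b) \<in> ?T ` inversions w" | "(a, b) = (i, j)" | "(a, b) = (?t (w i), ?t (w j))" using ab by blast
      then show "(a, b) \<in> ?L"
      proof cases
        case 1
        then obtain x y where xy: "(x, y) \<in> inversions w" "a = ?t x" "b = ?t y" by auto
        then have 2: "x < y" "w y < w x" by (auto simp: inversions_def)
        have "\<not> (x = i \<and> y = j)" using 2 lt by auto
        then have "a < b" using sw_less[OF ij 2(1)] xy by simp
        moreover have "?t (w y) < ?t (w x)"
        proof (rule sw_less[OF ij 2(2)], rule notI)
          assume "w y = i \<and> w x = j"
          then have "y = w i" "x = w j" by (auto simp: w)
          then show False using 2 lt by auto
        qed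
        ultimately show ?thesis using xy by (auto simp: inversions_def)
      next
        case 2
        then show ?thesis using lt' sw_less[OF ij lt] nf by (auto simp: inversions_def sw_def)
      next
        case 3
        then show ?thesis using lt2 lt' by (auto simp: inversions_def w)
      qed
    qed
  qed
  have "(i, j) \<notin> ?T ` inversions w"
    using lt' by (auto simp: inversions_def sw_eq_iff[of i j _ i, symmetric] sw_def split: if_splits)
  moreover have "(?t (w i), ?t (w j)) \<notin> ?T ` inversions w"
    using lt' w by (auto simp: inversions_def sw_eq_iff)
  moreover have "card (insert a (insert b X)) = card X + 2" if "a \<notin> X" "b \<notin> X" "b \<noteq> a" for a b and X :: "('n \<times> 'n) set"
    using that by simp
  ultimately have "card (insert (i, j) (insert (?t (w i), ?t (w j)) (?T ` inversions w))) = card (?T ` inversions w) + 2"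
    using nfT by blast
  then have 1: "card (inversions ?w) = card (inversions w) + 2"
    unfolding inv_eq using card_image[OF injT, of "inversions w"] by simp
  have "{(a, b). a < b \<and> ?w a = b} = ?T ` {(a, b). a < b \<and> w a = b}" (is "?L = ?R")
  proof
    show "?L \<subseteq> ?R"
    proof clarify
      fix a assume a: "a < ?w a"
      have "\<not> (a = i \<and> ?w a = j)"
      proof
        assume "a = i \<and> ?w a = j"
        then have "w j = i" by (auto simp: sw_eq_iff)
        moreover then have "w i = j" using w[of j] by simp
        ultimately show False using lt lt' by simp
      qed
      from sw_less[OF ij a this] have "?t a < w (?t a)" by simp
      then show "(a, ?w a) \<in> ?R" by (intro image_eqI[of _ _ "(?t a, w (?t a))"]) auto
    qed
    show "?R \<subseteq> ?L"
    proof (rule subrelI)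
      fix a b assume "(a, b) \<in> ?R"
      then obtain x where x: "x < w x" "a = ?t x" "b = ?t (w x)" by auto
      have "\<not> (x = i \<and> w x = j)"
      proof
        assume "x = i \<and> w x = j"
        moreover from this have "w j = i" using w[of i] by auto
        ultimately show False using lt lt' by auto
      qed
      from sw_less[OF ij x(1) this] show "(a, b) \<in> ?L" using x by simp
    qed
  qed
  then have "card {(a, b). a < b \<and> ?w a = b} = card {(a, b). a < b \<and> w a = b}"
    using injT by (simp add: card_image)
  then show ?thesis using 1 by (simp add: invol_weight_def)
qed

text \<open>Only the inversion \<open>(i, j)\<close> is new, but it is also a new 2-cycle, so the
  weight grows by two here as well.\<close>

lemma invol_weight_mult:
  fixes w :: "'n::{finite,linorder} \<Rightarrow> 'n"
  assumes ij: "adjacent i j" and w: "\<And>c. w (w c) = c" and f: "w i = i" "w j = j"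
  shows "invol_weight (sw i j \<circ> w) = invol_weight w + 2"
proof -
  let ?t = "sw i j" and ?w = "sw i j \<circ> w"
  let ?T = "\<lambda>(a, b). (?t a, ?t b)"
  have lt': "i < j" using ij by (auto simp: adjacent_def)
  have ww: "w a = b \<longleftrightarrow> a = w b" for a b using w by metis
  have com: "?t (w a) = w (?t a)" for a using f ww by (auto simp: sw_def)
  have injT: "inj_on ?T X" for X by (rule inj_onI) (auto simp: sw_eq_iff)
  have "inversions ?w = insert (i, j) (?T ` inversions w)" (is "?L = ?R")
  proof
    show "?L \<subseteq> ?R"
    proof (rule subrelI)
      fix a b assume ab: "(a, b) \<in> inversions ?w"
      show "(a, b) \<in> ?R"
      proof (cases "(a, b) \<in> ?T ` inversions w")
        case True
        then show ?thesis by blast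
      next
      case False
      note ab = ab False
      then have 1: "a < b" "w (?t b) < w (?t a)" by (auto simp: inversions_def com)
      have "(?t a, ?t b) \<notin> inversions w" using ab(2) image_eqI[of "(a, b)" ?T "(?t a, ?t b)"] by auto
      then show ?thesis using sw_less[OF ij 1(1)] 1 by (auto simp: inversions_def)
      qed
    qed
    show "?R \<subseteq> ?L"
    proof (rule subrelI)
      fix a b assume ab: "(a, b) \<in> ?R"
      show "(a, b) \<in> ?L"
      proof (cases "(a, b) = (i, j)")
        case True
        then show ?thesis using lt' f by (auto simp: inversions_def sw_def)
      next
        case False
        then obtain x y where xy: "x < y" "w y < w x" "a = ?t x" "b = ?t y"
          using ab by (auto simp: inversions_def)
        have "?t x < ?t y" by (rule sw_less[OF ij xy(1)]) (use xy f lt' in auto)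
        then show ?thesis using xy by (auto simp: inversions_def com)
      qed
    qed
  qed
  moreover have "(i, j) \<notin> ?T ` inversions w"
    using lt' by (auto simp: inversions_def sw_def split: if_splits)
  ultimately have 1: "card (inversions ?w) = card (inversions w) + 1"
    using injT by (simp add: card_image finite_imageI)
  have "{(a, b). a < b \<and> ?w a = b} = insert (i, j) {(a, b). a < b \<and> w a = b}"
  proof -
    have k: "(a < b \<and> sw i j (w a) = b) = ((a, b) = (i, j) \<or> a < b \<and> w a = b)" for a b
    proof (cases "a = i \<or> a = j")
      case True
      then show ?thesis using lt' f by (auto simp: sw_def)
    next
      case False
      then have "w a \<noteq> i" "w a \<noteq> j" using ww[of a i] ww[of a j] f by auto
      then show ?thesis using False by (auto simp: sw_def)
    qed
    show ?thesis using k by auto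
  qed
  moreover have "(i, j) \<notin> {(a, b). a < b \<and> w a = b}" using f lt' by auto
  ultimately have "card {(a, b). a < b \<and> ?w a = b} = card {(a, b). a < b \<and> w a = b} + 1"
    by simp
  then show ?thesis using 1 by (simp add: invol_weight_def)
qed

text \<open>An inversion with the fewest indices strictly in between is adjacent, since any index in
  between would form an inversion with one of the ends.\<close>

lemma exists_adjacent_descent:
  fixes w :: "'n::{finite,linorder} \<Rightarrow> 'n"
  assumes "inversions w \<noteq> {}"
  obtains i j where "adjacent i j" "w j < w i"
proof -
  define m where "m = (LEAST m. \<exists>i j. (i, j) \<in> inversions w \<and> card {i<..<j} = m)"
  have "\<exists>m i j. (i, j) \<in> inversions w \<and> card {i<..<j} = m" using assms by auto
  then have "\<exists>i j. (i, j) \<in> inversions w \<and> card {i<..<j} = m" unfolding m_def by (rule LeastI_ex)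
  then obtain i j where ij: "(i, j) \<in> inversions w" "card {i<..<j} = m" by blast
  have min: "m \<le> card {a<..<b}" if "(a, b) \<in> inversions w" for a b
    unfolding m_def by (rule Least_le) (use that in blast)
  have "a \<le> i \<or> j \<le> a" for a
  proof (rule ccontr)
    assume a: "\<not> (a \<le> i \<or> j \<le> a)"
    then have "a \<in> {i<..<j}" "a \<notin> {i<..<a}" "a \<notin> {a<..<j}" "{i<..<a} \<subseteq> {i<..<j}" "{a<..<j} \<subseteq> {i<..<j}" by auto
    then have "{i<..<a} \<subset> {i<..<j}" "{a<..<j} \<subset> {i<..<j}" by blast+
    then have "card {i<..<a} < m" "card {a<..<j} < m" using ij(2) by (auto intro!: psubset_card_mono)
    then have "(i, a) \<notin> inversions w" "(a, j) \<notin> inversions w" using min by force+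
    then show False using a ij(1) by (auto simp: inversions_def)
  qed
  then show ?thesis using that[of i j] ij(1) by (auto simp: inversions_def adjacent_def)
qed

section \<open>The rank order on permutations and its lifting property\<close>

text \<open>The Bruhat order in its description by rank conditions. Initial segments
  \<open>D\<close> and final segments \<open>U\<close> are given as sets instead of by endpoints,
  which includes the empty ones.\<close>

definition rank_le :: "('n::linorder \<Rightarrow> 'n) \<Rightarrow> ('n \<Rightarrow> 'n) \<Rightarrow> bool"
  where "rank_le p q \<longleftrightarrow> (\<forall>D U. (\<forall>x\<in>D. \<forall>y\<le>x. y \<in> D) \<longrightarrow> (\<forall>x\<in>U. \<forall>y\<ge>x. y \<in> U) \<longrightarrow>
    card {c \<in> D. p c \<in> U} \<le> card {c \<in> D. q c \<in> U})"

lemma rank_leD: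
  assumes "rank_le p q" and D: "\<And>x y. x \<in> D \<Longrightarrow> y \<le> x \<Longrightarrow> y \<in> D" and U: "\<And>x y. x \<in> U \<Longrightarrow> x \<le> y \<Longrightarrow> y \<in> U"
  shows "card {c \<in> D. p c \<in> U} \<le> card {c \<in> D. q c \<in> U}"
proof -
  have "\<forall>x\<in>D. \<forall>y\<le>x. y \<in> D" "\<forall>x\<in>U. \<forall>y\<ge>x. y \<in> U" using D U by simp_all
  then show ?thesis using assms(1) unfolding rank_le_def by simp
qed

lemma rank_le_trans: "rank_le p q \<Longrightarrow> rank_le q r \<Longrightarrow> rank_le p r"
  unfolding rank_le_def by (meson le_trans)

lemma card_split_two:
  fixes p :: "'n::finite \<Rightarrow> 'n"
  assumes "inj p" "i \<noteq> j" "i \<notin> U" "j \<notin> U"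
  shows "card {c \<in> D. p c \<in> insert i U} = card {c \<in> D. p c \<in> U} + card {c \<in> D. p c = i}"
    "card {c \<in> D. p c \<in> insert i (insert j U)} = card {c \<in> D. p c \<in> U} + card {c \<in> D. p c = i} + card {c \<in> D. p c = j}"
    "card {c \<in> D. p c = i} \<le> 1"
proof -
  show "card {c \<in> D. p c \<in> insert i U} = card {c \<in> D. p c \<in> U} + card {c \<in> D. p c = i}"
    using assms by (subst card_Un_disjoint[symmetric]) (auto intro!: arg_cong[where f=card])
  have *: "{c \<in> D. p c \<in> insert i (insert j U)} = ({c \<in> D. p c \<in> U} \<union> {c \<in> D. p c = i}) \<union> {c \<in> D. p c = j}" by auto
  have "card (({c \<in> D. p c \<in> U} \<union> {c \<in> D. p c = i}) \<union> {c \<in> D. p c = j}) =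
      card ({c \<in> D. p c \<in> U} \<union> {c \<in> D. p c = i}) + card {c \<in> D. p c = j}"
    by (rule card_Un_disjoint) (use assms in auto)
  moreover have "card ({c \<in> D. p c \<in> U} \<union> {c \<in> D. p c = i}) = card {c \<in> D. p c \<in> U} + card {c \<in> D. p c = i}"
    by (rule card_Un_disjoint) (use assms in auto)
  ultimately show "card {c \<in> D. p c \<in> insert i (insert j U)} = card {c \<in> D. p c \<in> U} + card {c \<in> D. p c = i} + card {c \<in> D. p c = j}"
    unfolding * by simp
  show "card {c \<in> D. p c = i} \<le> 1"
    using assms(1) by (simp add: card_le_Suc0_iff_eq inj_eq) (metis injD)
qed

text \<open>Lifting property for multiplication on the left. The assumption on \<open>q\<close> says
  that the value \<open>j\<close> occurs before the value \<open>i\<close>, so an initial segment of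
  positions which contains the latter contains the former. Only final segments that separate
  \<open>i\<close> from \<open>j\<close> need an argument.\<close>

lemma rank_le_lift_left:
  fixes p q :: "'n::{finite,linorder} \<Rightarrow> 'n"
  assumes ij: "adjacent i j" and pq: "rank_le p q" and inj: "inj p" "inj q"
    and q: "\<And>c. q c = i \<Longrightarrow> \<exists>d<c. q d = j"
  shows "(\<And>c. p c = i \<Longrightarrow> \<exists>d<c. p d = j) \<Longrightarrow> rank_le (sw i j \<circ> p) (sw i j \<circ> q)"
    "(\<And>c. p c = j \<Longrightarrow> \<exists>d<c. p d = i) \<Longrightarrow> rank_le p (sw i j \<circ> q)"
proof -
  have lt: "i < j" and aj: "\<And>a. a \<le> i \<or> j \<le> a" using ij by (auto simp: adjacent_def)
  have *: "((\<forall>c. p c = i \<longrightarrow> (\<exists>d<c. p d = j)) \<longrightarrow> card {c \<in> D. sw i j (p c) \<in> U} \<le> card {c \<in> D. sw i j (q c) \<in> U}) \<and>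
      ((\<forall>c. p c = j \<longrightarrow> (\<exists>d<c. p d = i)) \<longrightarrow> card {c \<in> D. p c \<in> U} \<le> card {c \<in> D. sw i j (q c) \<in> U})"
    if D: "\<And>x y. x \<in> D \<Longrightarrow> y \<le> x \<Longrightarrow> y \<in> D" and U: "\<And>x y. x \<in> U \<Longrightarrow> x \<le> y \<Longrightarrow> y \<in> U" for D U
  proof (cases "i \<in> U \<longleftrightarrow> j \<in> U")
    case True
    then have "sw i j x \<in> U \<longleftrightarrow> x \<in> U" for x by (auto simp: sw_def)
    then show ?thesis using rank_leD[OF pq D U] by auto
  next
    case False
    then have ji: "j \<in> U" "i \<notin> U" using U lt by auto
    \<comment> \<open>\<open>V\<close>, \<open>U\<close> and \<open>insert i U\<close> are
      consecutive final segments; the rank conditions for these three bound the count for the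
      exchanged set \<open>insert i V\<close>.\<close>
    define V where "V = U - {j}"
    have V: "U = insert j V" "i \<notin> V" "j \<notin> V" using ji by (auto simp: V_def)
    have sV: "sw i j x \<in> U \<longleftrightarrow> x \<in> insert i V" for x using ji by (auto simp: sw_def V_def)
    have "y \<in> V" if "x \<in> V" "x \<le> y" for x y
    proof -
      have "j < x" using that aj[of x] U[of x i] ji by (auto simp: V_def le_less)
      then show ?thesis using that U by (auto simp: V_def)
    qed
    note 1 = rank_leD[OF pq D this]
    note 2 = rank_leD[OF pq D U]
    have "y \<in> insert i U" if "x \<in> insert i U" "x \<le> y" for x y
      using that aj[of y] U[of x y] U[of j y] ji by (auto simp: le_less)
    note 3 = rank_leD[OF pq D this]
    have iU: "insert i U = insert i (insert j V)" using V by auto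
    define Sp Ip Jp Sq Iq Jq where d: "Sp = card {c \<in> D. p c \<in> V}" "Ip = card {c \<in> D. p c = i}" "Jp = card {c \<in> D. p c = j}"
      "Sq = card {c \<in> D. q c \<in> V}" "Iq = card {c \<in> D. q c = i}" "Jq = card {c \<in> D. q c = j}"
    have ne: "i \<noteq> j" using lt by auto
    note cp = card_split_two[OF inj(1) ne V(2,3), of D] card_split_two[OF inj(1) ne[symmetric] V(3,2), of D]
    note cq = card_split_two[OF inj(2) ne V(2,3), of D] card_split_two[OF inj(2) ne[symmetric] V(3,2), of D]
    have A: "Sp \<le> Sq" "Sp + Jp \<le> Sq + Jq" "Sp + Ip + Jp \<le> Sq + Iq + Jq"
      using 1 2 3 cp cq unfolding d V(1) by auto
    have B: "Ip \<le> 1" "Jp \<le> 1" "Iq \<le> 1" "Jq \<le> 1" using cp cq by (auto simp: d)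
    have mono: "card {c \<in> D. r c = x} \<le> card {c \<in> D. r c = y}"
      if r: "\<And>c. r c = x \<Longrightarrow> \<exists>d<c. r d = y" "inj r" for r :: "'n \<Rightarrow> 'n" and x y
    proof (cases "\<exists>c\<in>D. r c = x")
      case True
      then obtain c where c: "c \<in> D" "r c = x" by blast
      then obtain d where "d < c" "r d = y" using r(1)[of c] by blast
      then have "d \<in> {c \<in> D. r c = y}" using D c by (auto intro: less_imp_le)
      then have "1 \<le> card {c \<in> D. r c = y}" by (metis Suc_leI card_gt_0_iff empty_iff finite One_nat_def)
      moreover have "{c \<in> D. r c = x} = {c}" using c r by (auto dest: injD)
      ultimately show ?thesis by simp
    next
      case False
      then have "{c \<in> D. r c = x} = {}" by auto
      then show ?thesis by (metis card.empty le0)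
    qed
    have Q: "Iq \<le> Jq" unfolding d using mono[of q i j] q inj by blast
    have L: "card {c \<in> D. sw i j (p c) \<in> U} = Sp + Ip" "card {c \<in> D. sw i j (q c) \<in> U} = Sq + Iq"
      unfolding sV d using cp cq by (simp_all del: insert_iff)
    have L': "card {c \<in> D. p c \<in> U} = Sp + Jp"
      unfolding V(1) d using cp by (simp del: insert_iff)
    show ?thesis
    proof (intro conjI impI)
      assume "\<forall>c. p c = i \<longrightarrow> (\<exists>d<c. p d = j)"
      then have "Ip \<le> Jp" unfolding d using mono[of p i j] inj by blast
      then show "card {c \<in> D. sw i j (p c) \<in> U} \<le> card {c \<in> D. sw i j (q c) \<in> U}"
        unfolding L L' using A B Q by linarith
    next
      assume "\<forall>c. p c = j \<longrightarrow> (\<exists>d<c. p d = i)"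
      then have "Jp \<le> Ip" unfolding d using mono[of p j i] inj by blast
      then show "card {c \<in> D. p c \<in> U} \<le> card {c \<in> D. sw i j (q c) \<in> U}"
        unfolding L L' using A B Q by linarith
    qed
  qed
  show "rank_le (sw i j \<circ> p) (sw i j \<circ> q)" if "\<And>c. p c = i \<Longrightarrow> \<exists>d<c. p d = j"
    unfolding rank_le_def using * that by (simp add: Ball_def)
  show "rank_le p (sw i j \<circ> q)" if "\<And>c. p c = j \<Longrightarrow> \<exists>d<c. p d = i"
    unfolding rank_le_def using * that by (simp add: Ball_def)
qed

text \<open>The same for positions instead of values: \<open>C\<close>, \<open>D\<close> and
  \<open>insert j D\<close> are consecutive initial segments, and the exchanged set is
  \<open>insert j C\<close>.\<close>

lemma rank_le_lift_right:
  fixes p q :: "'n::{finite,linorder} \<Rightarrow> 'n"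
  assumes ij: "adjacent i j" and pq: "rank_le p q" and q: "q j < q i"
  shows "p j < p i \<Longrightarrow> rank_le (p \<circ> sw i j) (q \<circ> sw i j)"
    "p i < p j \<Longrightarrow> rank_le p (q \<circ> sw i j)"
proof -
  have lt: "i < j" and aj: "\<And>a. a \<le> i \<or> j \<le> a" using ij by (auto simp: adjacent_def)
  have *: "(p j < p i \<longrightarrow> card {c \<in> D. p (sw i j c) \<in> U} \<le> card {c \<in> D. q (sw i j c) \<in> U}) \<and>
      (p i < p j \<longrightarrow> card {c \<in> D. p c \<in> U} \<le> card {c \<in> D. q (sw i j c) \<in> U})"
    if D: "\<And>x y. x \<in> D \<Longrightarrow> y \<le> x \<Longrightarrow> y \<in> D" and U: "\<And>x y. x \<in> U \<Longrightarrow> x \<le> y \<Longrightarrow> y \<in> U" for D U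
  proof -
    have img: "card {c \<in> D. r (sw i j c) \<in> U} = card {c \<in> sw i j ` D. r c \<in> U}" for r :: "'n \<Rightarrow> 'n"
    proof -
      have "{c \<in> sw i j ` D. r c \<in> U} = sw i j ` {c \<in> D. r (sw i j c) \<in> U}" by auto
      moreover have "inj_on (sw i j) X" for X by (rule inj_onI) (metis sw_sw)
      ultimately show ?thesis by (simp add: card_image)
    qed
    show ?thesis
    proof (cases "i \<in> D \<longleftrightarrow> j \<in> D")
      case True
      have "sw i j x \<in> D \<longleftrightarrow> x \<in> D" for x
        by (cases "x = i"; cases "x = j") (use True in \<open>simp_all add: sw_def\<close>)
      then have sD: "sw i j ` D = D"
      proof (intro equalityI subsetI)
        fix x assume "x \<in> D" "\<And>x. sw i j x \<in> D \<longleftrightarrow> x \<in> D"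
        then show "x \<in> sw i j ` D" by (intro image_eqI[of _ "sw i j" "sw i j x"]) simp_all
      qed auto
      show ?thesis unfolding img[of p] img[of q] sD using rank_leD[OF pq D U] by simp
    next
      case False
      then have ji: "i \<in> D" "j \<notin> D" using D lt by auto
      define C where "C = D - {i}"
      have C: "D = insert i C" "i \<notin> C" "j \<notin> C" using ji by (auto simp: C_def)
      have sC: "sw i j ` D = insert j C" using ji by (auto simp: C_def sw_def image_iff)
      have "y \<in> C" if "x \<in> C" "y \<le> x" for x y
      proof -
        have "x < i" using that aj[of x] D[of x j] ji by (auto simp: C_def le_less)
        then show ?thesis using that D by (auto simp: C_def)
      qed
      note 1 = rank_leD[OF pq this U]
      note 2 = rank_leD[OF pq D U]
      have "y \<in> insert j D" if "x \<in> insert j D" "y \<le> x" for x y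
        using that aj[of y] D[of x y] D[of i y] ji by (auto simp: le_less)
      note 3 = rank_leD[OF pq this U]
      have ins: "card {c \<in> insert x X. r c \<in> U} = card {c \<in> X. r c \<in> U} + (if r x \<in> U then 1 else 0)"
        if "x \<notin> X" for x X and r :: "'n \<Rightarrow> 'n"
      proof -
        have "{c \<in> insert x X. r c \<in> U} = (if r x \<in> U then insert x {c \<in> X. r c \<in> U} else {c \<in> X. r c \<in> U})" by auto
        then show ?thesis using that by simp
      qed
      have ne: "j \<notin> insert i C" using C lt by auto
      have A: "card {c \<in> C. p c \<in> U} \<le> card {c \<in> C. q c \<in> U}"
        "card {c \<in> C. p c \<in> U} + (if p i \<in> U then 1 else 0) \<le> card {c \<in> C. q c \<in> U} + (if q i \<in> U then 1 else 0)"
        "card {c \<in> C. p c \<in> U} + (if p i \<in> U then 1 else 0) + (if p j \<in> U then 1 else 0) \<le>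
          card {c \<in> C. q c \<in> U} + (if q i \<in> U then 1 else 0) + (if q j \<in> U then 1 else 0)"
        using 1 2 3 unfolding C(1) ins[OF ne] ins[OF C(2)] by auto
      have Q: "q j \<in> U \<Longrightarrow> q i \<in> U" using U q by (auto intro: less_imp_le)
      have P: "p i < p j \<Longrightarrow> p i \<in> U \<Longrightarrow> p j \<in> U" "p j < p i \<Longrightarrow> p j \<in> U \<Longrightarrow> p i \<in> U"
        using U by (auto intro: less_imp_le)
      show ?thesis unfolding img[of p] img[of q] sC unfolding C(1) ins[OF C(2)] ins[OF C(3)]
        using A Q P by (auto split: if_splits)
    qed
  qed
  show "rank_le (p \<circ> sw i j) (q \<circ> sw i j)" if "p j < p i"
    unfolding rank_le_def using * that by (simp add: Ball_def)
  show "rank_le p (q \<circ> sw i j)" if "p i < p j"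
    unfolding rank_le_def using * that by (simp add: Ball_def)
qed


text \<open>One step down within the involutions. If \<open>w\<close> exchanges \<open>i\<close> and
  \<open>j\<close>, conjugation by the transposition would not change it, and it is multiplied by
  the transposition instead.\<close>

lemma invol_weight_adjacent:
  fixes w :: "'n::{finite,linorder} \<Rightarrow> 'n"
  assumes ij: "adjacent i j" and w: "\<And>c. w (w c) = c" and d: "w j < w i"
  defines "w' \<equiv> (if w i = j then sw i j \<circ> w else sw i j \<circ> w \<circ> sw i j)"
  shows "invol_weight w = invol_weight w' + 2" "w' (w' c) = c" "w' i < w' j"
    "w i = j \<longleftrightarrow> w' i = i \<and> w' j = j" "w = (if w i = j then sw i j \<circ> w' else sw i j \<circ> w' \<circ> sw i j)"
proof -
  have lt: "i < j" using ij by (auto simp: adjacent_def)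
  have ww: "w a = b \<longleftrightarrow> a = w b" for a b using w by metis
  show iff: "w i = j \<longleftrightarrow> w' i = i \<and> w' j = j"
    unfolding w'_def using lt d ww[of i j] ww[of i i] ww[of j j] by (auto simp: sw_def split: if_splits)
  show inv: "w' (w' c) = c" for c
  proof (cases "w i = j")
    case True
    then have "sw i j (w (sw i j (w c))) = c" using ww[of _ i] ww[of _ j] w by (auto simp: sw_def)
    then show ?thesis using True by (simp add: w'_def)
  qed (simp add: w'_def w)
  show eq: "w = (if w i = j then sw i j \<circ> w' else sw i j \<circ> w' \<circ> sw i j)"
    by (auto simp: w'_def fun_eq_iff)
  show lt': "w' i < w' j"
  proof (cases "w i = j")
    case True
    then show ?thesis using iff lt by simp
  next
    case False
    then have "\<not> (w j = i \<and> w i = j)" by auto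
    then show ?thesis using sw_less[OF ij d] False by (simp add: w'_def)
  qed
  show "invol_weight w = invol_weight w' + 2"
  proof (cases "w i = j")
    case True
    then show ?thesis using invol_weight_mult[OF ij inv] iff eq by metis
  next
    case False
    then show ?thesis using invol_weight_conj[OF ij inv lt'] iff eq by metis
  qed
qed

text \<open>The lifting property along a common descent reduces the comparison to smaller involutions.\<close>

lemma rank_le_imp_invol_weight_le:
  fixes u w :: "'n::{finite,wellorder} \<Rightarrow> 'n"
  assumes "rank_le u w" "\<And>c. u (u c) = c" "\<And>c. w (w c) = c"
  shows "invol_weight u \<le> invol_weight w \<and> (invol_weight u = invol_weight w \<longrightarrow> u = w)"
  using assms
proof (induction "invol_weight w" arbitrary: u w rule: less_induct)
  case less
  note ul = less.prems(1) and u = less.prems(2) and w = less.prems(3)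
  have inju: "inj u" and injw: "inj w" using u w by (metis injI)+
  show ?case
  proof (cases "inversions w = {}")
    case True
    have wle: "w a \<le> w b" if "a \<le> b" for a b
    proof (rule ccontr)
      assume "\<not> w a \<le> w b"
      then have "(a, b) \<in> inversions w" using that by (auto simp: inversions_def le_less)
      then show False using True by simp
    qed
    have wid: "w c = c" for c
      using wle[of c "w c"] wle[of "w c" c] w[of c] linear[of c "w c"] by auto
    have "u c \<le> c" for c
    proof (rule ccontr)
      assume "\<not> u c \<le> c"
      then have "c \<in> {x \<in> {..c}. u x \<in> {c<..}}" by auto
      then have "0 < card {x \<in> {..c}. u x \<in> {c<..}}" by (metis card_gt_0_iff empty_iff finite)
      also have "\<dots> \<le> card {x \<in> {..c}. w x \<in> {c<..}}" by (rule rank_leD[OF ul]) auto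
      also have "{x \<in> {..c}. w x \<in> {c<..}} = {}" by (auto simp: wid)
      finally show False by simp
    qed
    then have "u c = c" for c using bij_le_self_imp_id[OF inju] by blast
    then have "u = w" using wid by auto
    then show ?thesis by simp
  next
    case False
    then obtain i j where ij: "adjacent i j" and d: "w j < w i" by (rule exists_adjacent_descent)
    have lt: "i < j" using ij by (auto simp: adjacent_def)
    define w' where "w' = (if w i = j then sw i j \<circ> w else sw i j \<circ> w \<circ> sw i j)"
    note w' = invol_weight_adjacent[OF ij w d, folded w'_def]
    have ldw: "\<exists>d<c. w d = j" if "w c = i" for c
      using d that w[of c] w[of j] by (intro exI[of _ "w j"]) auto
    have ww: "w a = b \<longleftrightarrow> a = w b" for a b using w by metis
    have uu: "u a = b \<longleftrightarrow> a = u b" for a b using u by metis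
    have rw: "(sw i j \<circ> w) j < (sw i j \<circ> w) i" if "w i \<noteq> j"
      using sw_less[OF ij d] that by simp
    show ?thesis
    proof (cases "u i < u j")
      case True
      have ldu: "\<exists>d<c. u d = i" if "u c = j" for c
        using True that u[of c] u[of i] by (intro exI[of _ "u i"]) auto
      \<comment> \<open>Without a descent of \<open>u\<close> at \<open>i, j\<close>, removing the
        descent of \<open>w\<close> keeps \<open>u\<close> below. The weight of \<open>w\<close> has
        then dropped strictly, which excludes equality.\<close>
      have 1: "rank_le u (sw i j \<circ> w)"
        by (rule rank_le_lift_left(2)[OF ij ul inju injw ldw ldu])
      have small: "invol_weight w' < invol_weight w" using w'(1) by simp
      have "rank_le u w'"
      proof (cases "w i = j")
        case w: True
        show ?thesis using 1 unfolding w'_def if_P[OF w] .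
      next
        case w: False
        show ?thesis using rank_le_lift_right(2)[OF ij 1 rw[OF w] True] unfolding w'_def if_not_P[OF w] .
      qed
      then have "invol_weight u \<le> invol_weight w'"
        using less.hyps[OF small _ u w'(2)] by blast
      then show ?thesis using w'(1) by simp
    next
      case False
      then have du: "u j < u i" using lt inju by (metis injD less_irrefl neqE)
      have ldu: "\<exists>d<c. u d = j" if "u c = i" for c
        using du that u[of c] u[of j] by (intro exI[of _ "u j"]) auto
      define u' where "u' = (if u i = j then sw i j \<circ> u else sw i j \<circ> u \<circ> sw i j)"
      note u' = invol_weight_adjacent[OF ij u du, folded u'_def]
      have 1: "rank_le (sw i j \<circ> u) (sw i j \<circ> w)"
        by (rule rank_le_lift_left(1)[OF ij ul inju injw ldw ldu])
      have ru: "(sw i j \<circ> u) j < (sw i j \<circ> u) i" if "u i \<noteq> j"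
        using sw_less[OF ij du] that by simp
      have "rank_le u' w'"
      proof (cases "w i = j")
        case True
        \<comment> \<open>If \<open>w\<close> exchanges \<open>i\<close> and \<open>j\<close>, it is
          reduced on one side only, while \<open>u\<close> may be reduced on both. The additional
          reduction removes a right descent and so lowers \<open>u\<close> further.\<close>
        have "rank_le (sw i j \<circ> u \<circ> sw i j) (sw i j \<circ> u)" if "u i \<noteq> j"
        proof -
          have r: "rank_le (sw i j \<circ> u \<circ> sw i j) (sw i j \<circ> u \<circ> sw i j)" by (simp add: rank_le_def)
          have m: "card {c \<in> D. (sw i j \<circ> u \<circ> sw i j) c \<in> U} \<le> card {c \<in> D. (sw i j \<circ> u) c \<in> U}"
            if D: "\<And>x y. x \<in> D \<Longrightarrow> y \<le> x \<Longrightarrow> y \<in> D" and U: "\<And>x y. x \<in> U \<Longrightarrow> x \<le> y \<Longrightarrow> y \<in> U" for D U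
          proof -
            define f where "f c = (if i \<in> D \<and> j \<notin> D then c else sw i j c)" for c
            have sub: "f ` {c \<in> D. (sw i j \<circ> u \<circ> sw i j) c \<in> U} \<subseteq> {c \<in> D. (sw i j \<circ> u) c \<in> U}"
            proof (rule image_subsetI)
              fix c assume "c \<in> {c \<in> D. (sw i j \<circ> u \<circ> sw i j) c \<in> U}"
              then have c: "c \<in> D" "(sw i j \<circ> u \<circ> sw i j) c \<in> U" by blast+
              show "f c \<in> {c \<in> D. (sw i j \<circ> u) c \<in> U}"
              proof (cases "i \<in> D \<and> j \<notin> D")
                case True
                have "sw i j (u j) < sw i j (u i)" using ru[OF \<open>u i \<noteq> j\<close>] by simp
                then have "sw i j (u c) \<in> U"
                  using c True U[of "sw i j (u j)" "sw i j (u i)"] by (auto simp: sw_def[of i j c] split: if_splits)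
                then show ?thesis using True c by (simp add: f_def)
              next
                case False
                then have "sw i j c \<in> D" using c D[of j i] less_imp_le[OF lt] by (auto simp: sw_def)
                then show ?thesis using False c by (auto simp: f_def)
              qed
            qed
            have "inj_on f X" for X by (rule inj_onI) (auto simp: f_def sw_eq_iff split: if_splits)
            then show ?thesis by (rule card_inj_on_le[OF _ sub finite])
          qed
          show ?thesis unfolding rank_le_def using m by (simp add: Ball_def)
        qed
        note m = this
        show ?thesis
        proof (cases "u i = j")
          case u: True
          show ?thesis using 1 unfolding u'_def w'_def if_P[OF u] if_P[OF True] .
        next
          case u: False
          show ?thesis using rank_le_trans[OF m[OF u] 1] unfolding u'_def w'_def if_not_P[OF u] if_P[OF True] .
        qed
      next
        case False
        show ?thesis
        proof (cases "u i = j")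
          case u: True
          have "(sw i j \<circ> u) i < (sw i j \<circ> u) j" using u lt uu[of i j] by simp
          then show ?thesis using rank_le_lift_right(2)[OF ij 1 rw[OF False]]
            unfolding u'_def w'_def if_P[OF u] if_not_P[OF False] by blast
        next
          case u: False
          show ?thesis using rank_le_lift_right(1)[OF ij 1 rw[OF False] ru[OF u]]
            unfolding u'_def w'_def if_not_P[OF u] if_not_P[OF False] .
        qed
      qed
      then have "invol_weight u' \<le> invol_weight w' \<and> (invol_weight u' = invol_weight w' \<longrightarrow> u' = w')"
        using less.hyps[OF _ _ u'(2) w'(2)] w'(1) by simp
      moreover have "u = w" if "u' = w'"
      proof -
        have "u i = j \<longleftrightarrow> w i = j" using u'(4) w'(4) that by simp
        then show ?thesis using u'(5) w'(5) that by metis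
      qed
      ultimately show ?thesis using w'(1) u'(1) by auto
    qed
  qed
qed

section \<open>Rotation orbits of Bruhat cells\<close>

lemma bruhat_cell_eq: "bruhat_cell k A = grassmannian k \<inter> double_coset A"
  by (simp add: bruhat_cell_def double_coset_def)

lemma smat_perm:
  assumes "u \<in> cell_index k"
  obtains s where "signed_involution (underlying_permutation u) s" "u = smat (underlying_permutation u) s"
proof -
  obtain w s where "signed_involution w s" "u = smat w s" using assms unfolding cell_index_iff by blast
  then show ?thesis using that[of s] by (simp add: underlying_permutation_smat)
qed

lemma smat_in_cell_index:
  assumes "\<And>c. s c \<in> {1, -1}" "bij w" "smat w s \<in> grassmannian k"
  shows "smat w s \<in> cell_index k" "underlying_permutation (smat w s) = w"
proof -
  have "signed_involution w s" using assms smat_square_iff by (auto simp: grassmannian_def)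
  then show "smat w s \<in> cell_index k" "underlying_permutation (smat w s) = w"
    using assms underlying_permutation_smat by (auto simp: cell_index_iff grassmannian_def)
qed

lemma cell_index_subset_grassmannian:
  assumes "u \<in> cell_index k" shows "u \<in> grassmannian k"
proof -
  obtain w s where ws: "signed_involution w s" "u = smat w s" "trace u = real CARD('a) - 2 * real k"
    using assms unfolding cell_index_iff by blast
  note d = signed_involutionD[OF ws(1)]
  have sq: "u ** u = mat 1" using ws smat_square_iff by (auto simp: signed_involution_def)
  have "w a = c \<longleftrightarrow> a = w c" for a c using d(1) by metis
  then have "transpose u = u" by (auto simp: ws vec_eq_iff transpose_def smat_def d)
  then show ?thesis using sq ws(3) by (simp add: grassmannian_def orthogonal_matrix_def)
qed

lemma bruhat_cell_self: "u \<in> cell_index k \<Longrightarrow> u \<in> bruhat_cell k u"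
  by (simp add: bruhat_cell_eq double_coset_self cell_index_subset_grassmannian)

lemma bruhat_cell_disjoint:
  assumes "u \<in> cell_index k" "v \<in> cell_index k" "g \<in> bruhat_cell k u" "g \<in> bruhat_cell k v"
  shows "u = v"
proof -
  obtain s where s: "signed_involution (underlying_permutation u) s" "u = smat (underlying_permutation u) s"
    by (rule smat_perm[OF assms(1)])
  obtain s' where s': "signed_involution (underlying_permutation v) s'" "v = smat (underlying_permutation v) s'"
    by (rule smat_perm[OF assms(2)])
  show ?thesis
    using double_coset_disjoint[of "underlying_permutation u" s "underlying_permutation v" s' g] assms s s'
      signed_involutionD(2,6)[OF s(1)] signed_involutionD(2,6)[OF s'(1)]
    unfolding bruhat_cell_eq by (metis IntE insertI1 insertI2)
qed

lemma two_cell_dim: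
  assumes "u \<in> cell_index k" shows "2 * cell_dim u = invol_weight (underlying_permutation u)"
proof -
  obtain s where "signed_involution (underlying_permutation u) s"
    by (rule smat_perm[OF assms])
  then show ?thesis unfolding cell_dim_def
    by (intro card_quotient_inversions) (simp add: signed_involution_def)
qed

definition fixes_both :: "'n::finite \<Rightarrow> 'n \<Rightarrow> real ^ 'n ^ 'n \<Rightarrow> bool"
  where "fixes_both i j u \<longleftrightarrow> underlying_permutation u i = i \<and> underlying_permutation u j = j"

text \<open>The lower ends of rotation arcs. The second condition removes the case in which the
  plane of e_i and e_j lies in a single eigenspace of \<open>u\<close>; there the rotations preserve
  the cell.\<close>

definition ascent :: "'n::{finite,wellorder} \<Rightarrow> 'n \<Rightarrow> real ^ 'n::{finite,wellorder} ^ 'n::{finite,wellorder} \<Rightarrow> bool"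
  where "ascent i j u \<longleftrightarrow> underlying_permutation u i < underlying_permutation u j \<and>
    \<not> (fixes_both i j u \<and> u $ i $ i = u $ j $ j)"

definition descent :: "'n::{finite,wellorder} \<Rightarrow> 'n \<Rightarrow> real ^ 'n::{finite,wellorder} ^ 'n::{finite,wellorder} \<Rightarrow> bool"
  where "descent i j u \<longleftrightarrow> underlying_permutation u j < underlying_permutation u i"

definition stable :: "'n::finite \<Rightarrow> 'n \<Rightarrow> real ^ 'n ^ 'n \<Rightarrow> bool"
  where "stable i j u \<longleftrightarrow> fixes_both i j u \<and> u $ i $ i = u $ j $ j"

text \<open>The neighbours of \<open>u\<close> along rotation orbits. If both indices are fixed with
  opposite signs, conjugation through \<theta> is left multiplication by the rotation through twice
  the angle; with left multiplication both cases have the upper neighbours at \<open>pi/2\<close>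
  and \<open>- (pi/2)\<close> and the companion at \<open>pi\<close>.\<close>

definition turn :: "'n::finite \<Rightarrow> 'n \<Rightarrow> real \<Rightarrow> real ^ 'n ^ 'n \<Rightarrow> real ^ 'n ^ 'n"
  where "turn i j \<theta> u = (if fixes_both i j u then rot i j \<theta> ** u else act i j \<theta> u)"

lemma rot_smat:
  assumes "i \<noteq> j"
  shows "rot i j (pi/2) = smat (sw i j) (\<lambda>c. if c = j then -1 else 1)"
    "rot i j (- (pi/2)) = smat (sw i j) (\<lambda>c. if c = i then -1 else 1)"
    "rot i j pi = smat id (\<lambda>c. if c = i \<or> c = j then -1 else 1)"
    "rot i j (- pi) = smat id (\<lambda>c. if c = i \<or> c = j then -1 else 1)"
  using assms by (auto simp: vec_eq_iff rot_def smat_def sw_def)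

lemma rot_periodic: "rot i j (\<theta> + 2 * pi) = rot i j \<theta>" "rot i j (\<theta> - 2 * pi) = rot i j \<theta>"
  using sin_periodic[of "\<theta> - 2 * pi"] cos_periodic[of "\<theta> - 2 * pi"] by (auto simp: vec_eq_iff rot_def)

lemma act_periodic: "act i j (\<theta> + 2 * pi) = act i j \<theta>" "act i j (\<theta> - 2 * pi) = act i j \<theta>"
  using rot_periodic[of i j \<theta>] rot_periodic[of i j "- \<theta>"] by (auto simp: act_def fun_eq_iff algebra_simps)

lemma bij_sw: "bij (sw i j)"
  by (rule o_bij[of "sw i j"]) auto

text \<open>A quarter turn is a signed permutation matrix, so the product is one. Conjugation keeps
  it in the Grassmannian; in the case of left multiplication its square is the identity because
  \<open>u\<close> is a reflection on the plane and inverts rotations.\<close>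

lemma turn_cases:
  assumes ij: "adjacent i j" and u: "u \<in> cell_index k" and asc: "ascent i j u"
    and \<theta>: "\<theta> = pi/2 \<or> \<theta> = - (pi/2)"
  shows "turn i j \<theta> u \<in> cell_index k" "descent i j (turn i j \<theta> u)"
    "cell_dim (turn i j \<theta> u) = cell_dim u + 1"
    "underlying_permutation (turn i j \<theta> u) =
      (if fixes_both i j u then sw i j \<circ> underlying_permutation u else sw i j \<circ> underlying_permutation u \<circ> sw i j)"
proof -
  have ne: "i \<noteq> j" and lt: "i < j" using ij by (auto simp: adjacent_def)
  define w where "w = underlying_permutation u"
  obtain s where s: "signed_involution w s" "u = smat w s"
    unfolding w_def by (rule smat_perm[OF u])
  note d = signed_involutionD[OF s(1)]
  have lw: "w i < w j" using asc by (simp add: ascent_def w_def)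
  obtain \<sigma> \<sigma>' where \<sigma>: "rot i j \<theta> = smat (sw i j) \<sigma>" "rot i j (- \<theta>) = smat (sw i j) \<sigma>'"
    "\<And>c. \<sigma> c \<in> {1, -1}" "\<And>c. \<sigma>' c \<in> {1, -1}"
  proof (cases "\<theta> = pi/2")
    case True
    have "rot i j \<theta> = smat (sw i j) (\<lambda>c. if c = j then -1 else 1)"
      "rot i j (- \<theta>) = smat (sw i j) (\<lambda>c. if c = i then -1 else 1)"
      unfolding True using rot_smat[OF ne] by blast+
    then show ?thesis by (rule that) auto
  next
    case False
    then have "\<theta> = - (pi/2)" using \<theta> by blast
    then show ?thesis
      using that[of "\<lambda>c. if c = i then -1 else 1" "\<lambda>c. if c = j then -1 else 1"] rot_smat[OF ne] by simp
  qed
  have *: "turn i j \<theta> u \<in> cell_index k \<and> underlying_permutation (turn i j \<theta> u) =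
      (if fixes_both i j u then sw i j \<circ> w else sw i j \<circ> w \<circ> sw i j)"
  proof (cases "fixes_both i j u")
    case False
    define s' where "s' c = \<sigma> (w (sw i j c)) * (s (sw i j c) * \<sigma>' c)" for c
    have A: "turn i j \<theta> u = smat (sw i j \<circ> w \<circ> sw i j) s'"
      using False by (simp add: turn_def act_def \<sigma> s smat_smat s'_def[abs_def] mult.assoc)
    have "turn i j \<theta> u \<in> grassmannian k"
      using False cell_index_subset_grassmannian[OF u] by (simp add: turn_def act_grassmannian ne)
    moreover have "s' c \<in> {1, -1}" for c
      using \<sigma>(3)[of "w (sw i j c)"] \<sigma>(4)[of c] d(2)[of "sw i j c"] by (auto simp: s'_def)
    moreover have "bij (sw i j \<circ> w \<circ> sw i j)" using bij_sw d(6) by (intro bij_comp)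
    ultimately show ?thesis using smat_in_cell_index[of s' "sw i j \<circ> w \<circ> sw i j" k] A False by auto
  next
    case True
    then have f: "w i = i" "w j = j" by (auto simp: fixes_both_def w_def)
    have sij: "s j = - s i"
      using asc True d(2)[of i] d(2)[of j] f by (auto simp: ascent_def s smat_def)
    define s' where "s' c = \<sigma> (w c) * s c" for c
    have A: "turn i j \<theta> u = smat (sw i j \<circ> w) s'" "turn i j \<theta> u = rot i j \<theta> ** u"
      using True by (simp_all add: turn_def \<sigma> s smat_smat s'_def[abs_def])
    have s': "s' c \<in> {1, -1}" for c
      using \<sigma>(3)[of "w c"] d(2)[of c] by (auto simp: s'_def)
    have "u ** u = mat 1" using s smat_square_iff by (auto simp: signed_involution_def)
    moreover have "turn i j \<theta> u ** turn i j \<theta> u = rot i j \<theta> ** (u ** rot i j \<theta>) ** u"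
      by (simp add: A(2) matrix_mul_assoc)
    moreover have "\<dots> = (rot i j \<theta> ** rot i j (- \<theta>)) ** (u ** u)"
      using rot_commute_smat(2)[OF ne s(1) f sij] s(2) by (simp add: matrix_mul_assoc)
    ultimately have sq: "turn i j \<theta> u ** turn i j \<theta> u = mat 1" using rot_inverse[OF ne] by simp
    \<comment> \<open>Only the two diagonal entries in the plane change: they are opposite before
      the turn and zero after it.\<close>
    have "trace (rot i j \<theta> ** u) - trace u = (\<Sum>a\<in>UNIV. (rot i j \<theta> ** u) $ a $ a - u $ a $ a)"
      by (simp add: trace_def sum_subtractf)
    also have "\<dots> = ((rot i j \<theta> ** u) $ i $ i - u $ i $ i) + ((rot i j \<theta> ** u) $ j $ j - u $ j $ j)"
      by (rule sum_eq_pair[OF ne]) (simp add: rot_mult_left[OF ne])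
    also have "\<dots> = 0"
      using ne f sij by (simp add: rot_mult_left[OF ne] s smat_def)
    finally have tr: "trace (turn i j \<theta> u) = trace u" by (simp add: A(2))
    have si: "signed_involution (sw i j \<circ> w) s'" using sq s' smat_square_iff A(1) by metis
    have "trace u = real CARD('a) - 2 * real k" using u by (auto simp: cell_index_iff)
    then have "smat (sw i j \<circ> w) s' \<in> cell_index k" using si tr A(1) unfolding cell_index_iff by metis
    then show ?thesis using A(1) True underlying_permutation_smat[OF si] by simp
  qed
  then show "turn i j \<theta> u \<in> cell_index k" and
    p: "underlying_permutation (turn i j \<theta> u) =
      (if fixes_both i j u then sw i j \<circ> underlying_permutation u else sw i j \<circ> underlying_permutation u \<circ> sw i j)"
    by (simp_all add: w_def)
  have fb: "fixes_both i j u \<longleftrightarrow> w i = i \<and> w j = j" by (simp add: fixes_both_def w_def)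
  have "invol_weight (underlying_permutation (turn i j \<theta> u)) = invol_weight w + 2"
    using * invol_weight_mult[OF ij d(1)] invol_weight_conj[OF ij d(1) lw] fb by auto
  then show "cell_dim (turn i j \<theta> u) = cell_dim u + 1"
    using two_cell_dim[OF u] two_cell_dim[of "turn i j \<theta> u" k] * by (simp add: w_def)
  show "descent i j (turn i j \<theta> u)"
    using * fb lt sw_less[OF ij lw] by (auto simp: descent_def)
qed

text \<open>A half turn is diagonal with entries 1 and -1, so it changes signs and keeps the
  underlying permutation. It exchanges the two ends of an arc and, since the full turn is trivial,
  the two upper neighbours as well.\<close>

lemma turn_pi:
  assumes ij: "adjacent i j" and u: "u \<in> cell_index k" and asc: "ascent i j u"
  shows "turn i j pi u \<in> cell_index k" "ascent i j (turn i j pi u)" "cell_dim (turn i j pi u) = cell_dim u"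
    "turn i j pi u \<noteq> u" "fixes_both i j (turn i j pi u) = fixes_both i j u"
    "turn i j pi (turn i j pi u) = u"
    "turn i j (pi/2) (turn i j pi u) = turn i j (- (pi/2)) u"
    "turn i j (- (pi/2)) (turn i j pi u) = turn i j (pi/2) u"
proof -
  have ne: "i \<noteq> j" and lt: "i < j" using ij by (auto simp: adjacent_def)
  define w where "w = underlying_permutation u"
  obtain s where s: "signed_involution w s" "u = smat w s"
    unfolding w_def by (rule smat_perm[OF u])
  note d = signed_involutionD[OF s(1)]
  have lw: "w i < w j" using asc by (simp add: ascent_def w_def)
  have fb: "fixes_both i j u \<longleftrightarrow> w i = i \<and> w j = j" by (simp add: fixes_both_def w_def)
  define \<sigma> where "\<sigma> c = (if c = i \<or> c = j then -1 else 1 :: real)" for c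
  have \<sigma>: "rot i j pi = smat id \<sigma>" "rot i j (- pi) = smat id \<sigma>" using rot_smat[OF ne] by (auto simp: \<sigma>_def[abs_def])
  define s' where "s' c = (if fixes_both i j u then \<sigma> (w c) * s c else \<sigma> (w c) * s c * \<sigma> c)" for c
  have A: "turn i j pi u = smat w s'"
    by (simp add: turn_def act_def \<sigma> s smat_smat s'_def[abs_def])
  have s'1: "s' c \<in> {1, -1}" for c using d(2)[of c] by (auto simp: s'_def \<sigma>_def)
  have ww: "w a = b \<longleftrightarrow> a = w b" for a b using d(1) by metis
  have si: "signed_involution w s'"
  proof -
    have "s' (w c) = s' c" for c
    proof (cases "fixes_both i j u")
      case True
      then have "\<sigma> (w c) = \<sigma> c" using fb ww[of c i] ww[of c j] by (auto simp: \<sigma>_def)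
      then show ?thesis using True d(1,5) by (simp add: s'_def)
    next
      case False
      then show ?thesis using d(1,5) by (simp add: s'_def)
    qed
    then show ?thesis unfolding signed_involution_def using s'1 d(1) by blast
  qed
  have tr: "trace (turn i j pi u) = trace u"
  proof (cases "fixes_both i j u")
    case False
    then have "turn i j pi u \<in> grassmannian k"
      using cell_index_subset_grassmannian[OF u] by (simp add: turn_def act_grassmannian ne)
    then show ?thesis using u by (auto simp: grassmannian_def cell_index_iff)
  next
    case True
    have "trace (rot i j pi ** u) - trace u = (\<Sum>a\<in>UNIV. (rot i j pi ** u) $ a $ a - u $ a $ a)"
      by (simp add: trace_def sum_subtractf)
    also have "\<dots> = ((rot i j pi ** u) $ i $ i - u $ i $ i) + ((rot i j pi ** u) $ j $ j - u $ j $ j)"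
      by (rule sum_eq_pair[OF ne]) (simp add: rot_mult_left[OF ne])
    also have "\<dots> = 0"
      using ne True asc fb d(2)[of i] d(2)[of j] by (auto simp: rot_mult_left[OF ne] s smat_def ascent_def)
    finally show ?thesis using True by (simp add: turn_def)
  qed
  have "trace u = real CARD('a) - 2 * real k" using u by (auto simp: cell_index_iff)
  then show c: "turn i j pi u \<in> cell_index k" using si tr A unfolding cell_index_iff by metis
  have up: "underlying_permutation (turn i j pi u) = w" using A underlying_permutation_smat[OF si] by simp
  then show f: "fixes_both i j (turn i j pi u) = fixes_both i j u" by (simp add: fixes_both_def w_def)
  show "cell_dim (turn i j pi u) = cell_dim u" by (simp add: cell_dim_def up w_def)
  show "ascent i j (turn i j pi u)"
    using lw asc ne unfolding ascent_def f up
    by (auto simp: w_def turn_def rot_mult_left[OF ne])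
  \<comment> \<open>Since \<open>w i < w j\<close>, the pair \<open>i, j\<close> is mapped to itself
    only if both indices are fixed. In all other cases an index in the pair is joined by
    \<open>w\<close> to one outside, and its sign changes.\<close>
  show "turn i j pi u \<noteq> u"
  proof
    assume "turn i j pi u = u"
    then have "smat w s = smat w s'" using A s by simp
    then have "s' = s" using smat_eqD[of w s w s'] d(4) by blast
    then have *: "s' c = s c" for c by simp
    show False
      using *[of i] *[of j] d(4)[of i] d(4)[of j] fb lw lt by (auto simp: s'_def \<sigma>_def split: if_splits)
  qed
  show "turn i j pi (turn i j pi u) = u"
    using rot_add[OF ne, of pi pi] act_act[OF ne, of pi pi u] rot_periodic(1)[of i j 0] act_periodic(1)[of i j 0]
      rot_zero[OF ne] act_zero[OF ne, of u]
    unfolding turn_def[of i j pi "turn i j pi u"] f by (auto simp: turn_def matrix_mul_assoc)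
  show "turn i j (pi/2) (turn i j pi u) = turn i j (- (pi/2)) u"
    using rot_add[OF ne, of "pi/2" pi] act_act[OF ne, of "pi/2" pi u] rot_periodic(1)[of i j "-(pi/2)"] act_periodic(1)[of i j "-(pi/2)"]
    unfolding turn_def[of i j "pi/2" "turn i j pi u"] f by (auto simp: turn_def matrix_mul_assoc)
  show "turn i j (- (pi/2)) (turn i j pi u) = turn i j (pi/2) u"
    using rot_add[OF ne, of "-(pi/2)" pi] act_act[OF ne, of "-(pi/2)" pi u]
    unfolding turn_def[of i j "-(pi/2)" "turn i j pi u"] f by (auto simp: turn_def matrix_mul_assoc)
qed

text \<open>The quarter turn is undone by multiplication if the permutation exchanges
  \<open>i\<close> and \<open>j\<close>, and by conjugation otherwise.\<close>

lemma descent_is_turn: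
  assumes ij: "adjacent i j" and w: "w \<in> cell_index k" and desc: "descent i j w"
  obtains u where "u \<in> cell_index k" "ascent i j u" "turn i j (pi/2) u = w"
proof -
  have ne: "i \<noteq> j" and lt: "i < j" using ij by (auto simp: adjacent_def)
  define p where "p = underlying_permutation w"
  obtain s where s: "signed_involution p s" "w = smat p s"
    unfolding p_def by (rule smat_perm[OF w])
  note d = signed_involutionD[OF s(1)]
  have lp: "p j < p i" using desc by (simp add: descent_def p_def)
  define \<sigma> \<sigma>' where "\<sigma> c = (if c = i then -1 else 1 :: real)" and "\<sigma>' c = (if c = j then -1 else 1 :: real)" for c
  have \<sigma>: "rot i j (-(pi/2)) = smat (sw i j) \<sigma>" "rot i j (pi/2) = smat (sw i j) \<sigma>'"
    using rot_smat[OF ne] by (auto simp: \<sigma>_def[abs_def] \<sigma>'_def[abs_def])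
  note pw = invol_weight_adjacent[OF ij d(1) lp]
  show ?thesis
  proof (cases "p i = j")
    case True
    then have pji: "p j = i" using d(1)[of i] by simp
    \<comment> \<open>The signs agree along a 2-cycle. Undoing the rotation makes them opposite at
      the two fixed points, which is what the definition of \<open>ascent\<close> demands.\<close>
    have sji: "s j = s i" using d(5)[of i] True by simp
    define u where "u = rot i j (-(pi/2)) ** w"
    define s' where "s' c = \<sigma> (p c) * s c" for c
    have A: "u = smat (sw i j \<circ> p) s'" by (simp add: u_def \<sigma> s smat_smat s'_def[abs_def])
    have s': "s' c \<in> {1, -1}" for c using d(2)[of c] by (auto simp: s'_def \<sigma>_def)
    have ww: "p a = b \<longleftrightarrow> a = p b" for a b using d(1) by metis
    have "signed_involution (sw i j \<circ> p) s'"
    proof -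
      have "(sw i j \<circ> p) ((sw i j \<circ> p) c) = c" for c using pw(2)[of c] True by simp
      moreover have "s' ((sw i j \<circ> p) c) = s' c" for c
      proof -
        consider "c = i" | "c = j" | "c \<noteq> i" "c \<noteq> j" by blast
        then show ?thesis
        proof cases
          case 3
          then have "p c \<noteq> i" "p c \<noteq> j" using ww True pji by metis+
          then show ?thesis using 3 d(1,5) by (simp add: s'_def sw_def \<sigma>_def)
        qed (use True pji sji ne in \<open>auto simp: s'_def \<sigma>_def\<close>)
      qed
      ultimately show ?thesis using s' by (auto simp: signed_involution_def)
    qed
    note si = this
    have pu: "underlying_permutation u = sw i j \<circ> p" using underlying_permutation_smat[OF si] A by simp
    have fb: "fixes_both i j u" using True pji by (simp add: fixes_both_def pu)
    have di: "u $ i $ i = s i" "u $ j $ j = - s i"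
      using True pji ne sji by (auto simp: A smat_def s'_def \<sigma>_def)
    have "trace (rot i j (-(pi/2)) ** w) - trace w = (\<Sum>a\<in>UNIV. (rot i j (-(pi/2)) ** w) $ a $ a - w $ a $ a)"
      by (simp add: trace_def sum_subtractf)
    also have "\<dots> = (u $ i $ i - w $ i $ i) + (u $ j $ j - w $ j $ j)"
      unfolding u_def by (rule sum_eq_pair[OF ne]) (simp add: rot_mult_left[OF ne])
    also have "\<dots> = 0"
      using ne True pji by (simp add: di) (simp add: s smat_def)
    finally have tr: "trace u = trace w" by (simp add: u_def)
    have "trace w = real CARD('a) - 2 * real k" using w by (auto simp: cell_index_iff)
    then have "u \<in> cell_index k" using si tr A unfolding cell_index_iff by metis
    moreover have "ascent i j u" using di d(4)[of i] lt fb by (auto simp: ascent_def) (simp add: fixes_both_def)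
    moreover have "turn i j (pi/2) u = w" using fb rot_inverse[OF ne, of "pi/2"]
      by (simp add: turn_def u_def matrix_mul_assoc)
    ultimately show ?thesis using that by blast
  next
    case False
    define u where "u = act i j (-(pi/2)) w"
    define s' where "s' c = \<sigma> (p (sw i j c)) * (s (sw i j c) * \<sigma>' c)" for c
    have A: "u = smat (sw i j \<circ> p \<circ> sw i j) s'" by (simp add: u_def act_def \<sigma> s smat_smat s'_def[abs_def] mult.assoc)
    have "s' c \<in> {1, -1}" for c using d(2)[of "sw i j c"] by (auto simp: s'_def \<sigma>_def \<sigma>'_def)
    moreover have "bij (sw i j \<circ> p \<circ> sw i j)" using bij_sw d(6) by (intro bij_comp)
    moreover have "u \<in> grassmannian k" using cell_index_subset_grassmannian[OF w] by (simp add: u_def act_grassmannian ne)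
    ultimately have u: "u \<in> cell_index k" "underlying_permutation u = sw i j \<circ> p \<circ> sw i j"
      using smat_in_cell_index[of s' "sw i j \<circ> p \<circ> sw i j" k] A by auto
    have fb: "\<not> fixes_both i j u" using pw(4) False by (simp add: fixes_both_def u)
    have "ascent i j u" using pw(3) False fb by (simp add: ascent_def u)
    moreover have "turn i j (pi/2) u = w" using fb
      by (simp add: turn_def u_def act_act[OF ne] act_zero[OF ne])
    ultimately show ?thesis using that u by blast
  qed
qed


text \<open>A case rule for rotating \<open>u\<close> on both sides by different angles. Either all
  interior pairs of angles lead to the same upper coset, or only the sum of the angles matters and
  the coset changes when the sum passes \<open>pi\<close>.\<close>

lemma ascent_coset_cases:
  assumes ij: "adjacent i j" and u: "u \<in> cell_index k" and asc: "ascent i j u"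
  obtains (conj) "\<not> fixes_both i j u"
    "\<And>\<phi> \<phi>'. 0 < \<phi> \<Longrightarrow> \<phi> < pi \<Longrightarrow> 0 < \<phi>' \<Longrightarrow> \<phi>' < pi \<Longrightarrow>
      rot i j \<phi> ** u ** rot i j (- \<phi>') \<in> double_coset (turn i j (pi/2) u)"
  | (mult) "fixes_both i j u"
    "\<And>\<phi> \<phi>'. rot i j \<phi> ** u ** rot i j (- \<phi>') = rot i j (\<phi> + \<phi>') ** u"
    "\<And>\<psi>. 0 < \<psi> \<Longrightarrow> \<psi> < pi \<Longrightarrow> rot i j \<psi> ** u \<in> double_coset (turn i j (pi/2) u)"
    "rot i j pi ** u = turn i j pi u"
    "\<And>\<psi>. pi < \<psi> \<Longrightarrow> \<psi> < 2 * pi \<Longrightarrow> rot i j \<psi> ** u \<in> double_coset (turn i j (- (pi/2)) u)"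
proof -
  have ne: "i \<noteq> j" and lt: "i < j" using ij by (auto simp: adjacent_def)
  define w where "w = underlying_permutation u"
  obtain s where s: "signed_involution w s" "u = smat w s"
    unfolding w_def by (rule smat_perm[OF u])
  note d = signed_involutionD[OF s(1)]
  have lw: "w i < w j" using asc by (simp add: ascent_def w_def)
  have fb: "fixes_both i j u \<longleftrightarrow> w i = i \<and> w j = j" by (simp add: fixes_both_def w_def)
  show ?thesis
  proof (cases "fixes_both i j u")
    case False
    then have nf: "\<not> (w i = i \<and> w j = j)" using fb by simp
    show ?thesis
      by (rule conj[OF False]) (use False rot_conj_double_coset[OF ij s(1) lw nf] s(2) in \<open>simp add: turn_def\<close>)
  next
    case True
    then have f: "w i = i" "w j = j" using fb by auto
    have sij: "s j = - s i"
      using asc True d(2)[of i] d(2)[of j] f by (auto simp: ascent_def s smat_def)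
    note com = rot_commute_smat(2)[OF ne s(1) f sij, folded s(2)]
    have T: "turn i j \<theta> u = rot i j \<theta> ** u" for \<theta> using True by (simp add: turn_def)
    show ?thesis
    proof (rule mult[OF True])
      show "rot i j \<phi> ** u ** rot i j (- \<phi>') = rot i j (\<phi> + \<phi>') ** u" for \<phi> \<phi>'
        unfolding matrix_mul_assoc[symmetric] com unfolding matrix_mul_assoc rot_add[OF ne] by simp
      show 1: "rot i j \<psi> ** u \<in> double_coset (turn i j (pi/2) u)" if "0 < \<psi>" "\<psi> < pi" for \<psi>
        using rot_mult_double_coset(1)[OF ij s(1) lw that] s(2) T by simp
      show "rot i j pi ** u = turn i j pi u" by (simp add: T)
      show "rot i j \<psi> ** u \<in> double_coset (turn i j (- (pi/2)) u)" if "pi < \<psi>" "\<psi> < 2 * pi" for \<psi>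
      proof -
        have a: "ascent i j (turn i j pi u)" and c: "turn i j pi u \<in> cell_index k" using turn_pi[OF ij u asc] by auto
        define w' where "w' = underlying_permutation (turn i j pi u)"
        obtain s' where s': "signed_involution w' s'" "turn i j pi u = smat w' s'"
          unfolding w'_def by (rule smat_perm[OF c])
        have lw': "w' i < w' j" using a by (simp add: ascent_def w'_def)
        have "rot i j (\<psi> - pi) ** turn i j pi u \<in> double_coset (rot i j (pi/2) ** turn i j pi u)"
          using rot_mult_double_coset(1)[OF ij s'(1) lw', of "\<psi> - pi"] that s'(2) by simp
        moreover have "rot i j (\<psi> - pi) ** turn i j pi u = rot i j \<psi> ** u"
          using rot_add[OF ne, of "\<psi> - pi" pi] by (simp add: T matrix_mul_assoc)
        moreover have "rot i j (pi/2) ** turn i j pi u = turn i j (- (pi/2)) u"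
          using turn_pi(5,7)[OF ij u asc] True by (simp add: turn_def)
        ultimately show ?thesis by simp
      qed
    qed
  qed
qed

lemma act_double_coset_pi:
  assumes ij: "adjacent i j" and g: "g \<in> double_coset A"
  shows "act i j pi g \<in> double_coset (act i j pi A)"
proof -
  obtain \<phi> \<phi>' where "\<phi> pi = pi" "\<phi>' pi = pi"
    and A: "\<And>\<theta>. 0 \<le> \<theta> \<Longrightarrow> \<theta> \<le> pi \<Longrightarrow> act i j \<theta> g \<in> double_coset (rot i j (\<phi> \<theta>) ** A ** rot i j (- \<phi>' \<theta>))"
    by (rule act_double_coset[OF ij g]) blast
  then show ?thesis using A[of pi] unfolding act_def by simp
qed

text \<open>In the fixed case the two half turns add up to a full turn of \<open>u\<close>;
  otherwise conjugation by the half turn is the passage to the companion.\<close>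

lemma act_bruhat_cell_pi:
  assumes ij: "adjacent i j" and u: "u \<in> cell_index k" and asc: "ascent i j u" and g: "g \<in> bruhat_cell k u"
  shows "act i j pi g \<in> bruhat_cell k (if fixes_both i j u then u else turn i j pi u)"
proof -
  have ne: "i \<noteq> j" using ij by (auto simp: adjacent_def)
  have "act i j pi g \<in> double_coset (act i j pi u)"
    using act_double_coset_pi[OF ij] g by (simp add: bruhat_cell_eq)
  moreover have "act i j pi u = (if fixes_both i j u then u else turn i j pi u)"
  proof (cases "fixes_both i j u")
    case True
    show ?thesis using ij u asc
    proof (cases rule: ascent_coset_cases)
      case mult
      have "act i j pi u = rot i j (2 * pi) ** u" using mult(2)[of pi pi] by (simp add: act_def)
      then show ?thesis using True rot_periodic(1)[of i j 0] rot_zero[OF ne] by simp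
    qed (use True in simp)
  qed (simp add: turn_def)
  ultimately show ?thesis using g act_grassmannian[OF ne] by (auto simp: bruhat_cell_eq)
qed

text \<open>If \<open>fixes_both i j u\<close>, the rotated point runs through the three cells in the order in which
  they are listed; otherwise it stays in the first one until the angle \<open>pi\<close> is reached.\<close>

lemma act_bruhat_cell_ascent:
  assumes ij: "adjacent i j" and u: "u \<in> cell_index k" and asc: "ascent i j u" and g: "g \<in> bruhat_cell k u"
    and \<theta>: "0 < \<theta>" "\<theta> < pi"
  shows "act i j \<theta> g \<in> bruhat_cell k (turn i j (pi/2) u) \<union> bruhat_cell k (turn i j pi u) \<union> bruhat_cell k (turn i j (- (pi/2)) u)"
    "\<not> fixes_both i j u \<Longrightarrow> act i j \<theta> g \<in> bruhat_cell k (turn i j (pi/2) u)"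
proof -
  have ne: "i \<noteq> j" using ij by (auto simp: adjacent_def)
  have gr: "act i j \<theta> g \<in> grassmannian k" using g act_grassmannian[OF ne] by (auto simp: bruhat_cell_eq)
  obtain \<phi> \<phi>' where \<phi>: "0 < \<phi> \<and> \<phi> < pi" "0 < \<phi>' \<and> \<phi>' < pi"
    and A: "act i j \<theta> g \<in> double_coset (rot i j \<phi> ** u ** rot i j (- \<phi>'))"
  proof -
    have gu: "g \<in> double_coset u" using g by (simp add: bruhat_cell_eq)
    obtain \<phi> \<phi>' where "\<And>\<theta>. 0 < \<theta> \<Longrightarrow> \<theta> < pi \<Longrightarrow> 0 < \<phi> \<theta> \<and> \<phi> \<theta> < pi"
      "\<And>\<theta>. 0 < \<theta> \<Longrightarrow> \<theta> < pi \<Longrightarrow> 0 < \<phi>' \<theta> \<and> \<phi>' \<theta> < pi"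
      and "\<And>\<theta>. 0 \<le> \<theta> \<Longrightarrow> \<theta> \<le> pi \<Longrightarrow> act i j \<theta> g \<in> double_coset (rot i j (\<phi> \<theta>) ** u ** rot i j (- \<phi>' \<theta>))"
      by (rule act_double_coset[OF ij gu]) blast
    then show ?thesis using that[of "\<phi> \<theta>" "\<phi>' \<theta>"] \<theta> by simp
  qed
  have "act i j \<theta> g \<in> bruhat_cell k (turn i j (pi/2) u) \<or> (fixes_both i j u \<and> act i j \<theta> g \<in> bruhat_cell k (turn i j pi u) \<union> bruhat_cell k (turn i j (- (pi/2)) u))"
    using ij u asc
  proof (cases rule: ascent_coset_cases)
    case conj
    then show ?thesis using A \<phi> double_coset_trans gr by (metis IntI bruhat_cell_eq)
  next
    case mult
    consider "\<phi> + \<phi>' < pi" | "\<phi> + \<phi>' = pi" | "pi < \<phi> + \<phi>'" by linarith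
    then show ?thesis
    proof cases
      case 1
      then have "rot i j (\<phi> + \<phi>') ** u \<in> double_coset (turn i j (pi/2) u)" using mult(3) \<phi> by simp
      then show ?thesis using A gr double_coset_trans unfolding mult(2) bruhat_cell_eq by blast
    next
      case 2
      then show ?thesis using A gr mult unfolding mult(2) bruhat_cell_eq by simp
    next
      case 3
      then have "rot i j (\<phi> + \<phi>') ** u \<in> double_coset (turn i j (- (pi/2)) u)" using mult(5) \<phi> by simp
      then show ?thesis using A gr mult(1) double_coset_trans unfolding mult(2) bruhat_cell_eq by blast
    qed
  qed
  then show "act i j \<theta> g \<in> bruhat_cell k (turn i j (pi/2) u) \<union> bruhat_cell k (turn i j pi u) \<union> bruhat_cell k (turn i j (- (pi/2)) u)"
    "\<not> fixes_both i j u \<Longrightarrow> act i j \<theta> g \<in> bruhat_cell k (turn i j (pi/2) u)"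
    by blast+
qed

text \<open>Every point of an upper cell lies on an arc between the two lower ends, of total angle
  at most \<open>pi\<close>. The ends are found by the intermediate value theorem for the angle
  functions of the coset of the rotated point.\<close>

lemma act_bruhat_cell_turn:
  assumes ij: "adjacent i j" and u: "u \<in> cell_index k" and asc: "ascent i j u"
    and g: "g \<in> bruhat_cell k (turn i j (pi/2) u)"
  shows "\<exists>\<theta> \<phi>. 0 < \<theta> \<and> 0 < \<phi> \<and> \<theta> + \<phi> \<le> pi \<and> act i j (- \<theta>) g \<in> bruhat_cell k u \<and>
    act i j \<phi> g \<in> bruhat_cell k (turn i j pi u)"
proof -
  have ne: "i \<noteq> j" using ij by (auto simp: adjacent_def)
  note tc = turn_cases[OF ij u asc]
  note tp = turn_pi[OF ij u asc]
  have lt: "i < j" using ij by (simp add: adjacent_def)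
  \<comment> \<open>The angle functions exist for angles from \<open>0\<close> to \<open>pi\<close>
    only. By periodicity, turning \<open>g\<close> back by \<open>pi - \<theta>\<close> is turning
    \<open>g'\<close> forward by \<theta>.\<close>
  define g' where "g' = act i j pi g"
  have neg: "act i j (- (pi - \<theta>)) g = act i j \<theta> g'" for \<theta>
    using act_periodic(2)[of i j "\<theta> + pi"] by (simp add: g'_def act_act[OF ne] algebra_simps)
  have gr: "act i j \<theta> g \<in> grassmannian k" "act i j \<theta> g' \<in> grassmannian k" for \<theta>
    using g act_grassmannian[OF ne] by (auto simp: bruhat_cell_eq g'_def)
  have g'1: "g' \<in> double_coset (act i j pi (turn i j (pi/2) u))"
    using act_double_coset_pi[OF ij] g by (simp add: bruhat_cell_eq g'_def)
  show ?thesis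
    using ij u asc
  proof (cases rule: ascent_coset_cases)
    case conj
    have g'2: "g' \<in> double_coset (act i j (- (pi/2)) u)"
      using g'1 conj(1) act_periodic(2)[of i j "pi/2 + pi"] by (simp add: turn_def act_act[OF ne] algebra_simps)
    obtain \<phi> \<phi>' where \<phi>: "continuous_on {0..pi} \<phi>" "\<phi> 0 = 0" "\<phi> pi = pi"
      "\<And>\<theta>. 0 < \<theta> \<Longrightarrow> \<theta> < pi \<Longrightarrow> 0 < \<phi>' \<theta> \<and> \<phi>' \<theta> < pi"
      and A: "\<And>\<theta>. 0 \<le> \<theta> \<Longrightarrow> \<theta> \<le> pi \<Longrightarrow> act i j \<theta> g' \<in> double_coset (rot i j (\<phi> \<theta>) ** act i j (- (pi/2)) u ** rot i j (- \<phi>' \<theta>))"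
      by (rule act_double_coset[OF ij g'2]) blast
    \<comment> \<open>At this angle the left rotation cancels the quarter turn in the
      representative, and only a rotation \<psi> on the right remains.\<close>
    obtain \<theta> where \<theta>: "0 \<le> \<theta>" "\<theta> \<le> pi" "\<phi> \<theta> = pi/2"
      using IVT'[of \<phi> 0 "pi/2" pi] \<phi> by auto
    then have \<theta>': "0 < \<theta>" "\<theta> < pi" using \<phi> by (auto simp: le_less)
    define \<psi> where "\<psi> = pi/2 - \<phi>' \<theta>"
    have \<psi>: "- (pi/2) < \<psi>" "\<psi> < pi/2" using \<phi>(4)[OF \<theta>'] by (auto simp: \<psi>_def)
    have "rot i j (pi/2) ** act i j (- (pi/2)) u ** rot i j (- \<phi>' \<theta>) = (rot i j (pi/2) ** rot i j (- (pi/2))) ** u ** (rot i j (pi/2) ** rot i j (- \<phi>' \<theta>))"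
      by (simp add: act_def matrix_mul_assoc)
    also have "\<dots> = u ** rot i j \<psi>" by (simp add: rot_inverse[OF ne] rot_add[OF ne] rot_zero[OF ne] \<psi>_def)
    finally have B: "act i j \<theta> g' \<in> double_coset (u ** rot i j \<psi>)" using A[OF \<theta>(1,2)] \<theta>(3) by simp
    \<comment> \<open>A nonzero \<psi> would put the involution \<open>act i j \<theta> g'\<close>
      into the double coset of a signed permutation over \<open>w \<circ> sw i j\<close>, which is
      not an involution.\<close>
    have "act i j \<theta> g' \<in> double_coset u"
    proof (cases "\<psi> = 0")
      case True
      then show ?thesis using B rot_zero[OF ne] by simp
    next
      case False
      define w where "w = underlying_permutation u"
      obtain s where s: "signed_involution w s" "u = smat w s"
        unfolding w_def by (rule smat_perm[OF u])
      note d = signed_involutionD[OF s(1)]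
      have lw: "w i < w j" using asc by (simp add: ascent_def w_def)
      have rp: "rot i j \<alpha> ** rot i j pi = rot i j (\<alpha> + pi)" for \<alpha> by (rule rot_add[OF ne])
      have "\<exists>\<sigma>. (\<forall>c. \<sigma> c \<in> {1, -1}) \<and> u ** rot i j \<psi> \<in> double_coset (u ** smat (sw i j) \<sigma>)"
      proof (cases "\<psi> < 0")
        case True
        then have "u ** rot i j \<psi> \<in> double_coset (u ** rot i j (- (pi/2)))"
          using rot_mult_double_coset(2)[OF ij s(1) lw, of "- \<psi>"] \<psi> s(2) by simp
        then show ?thesis unfolding rot_smat(2)[OF ne] by (intro exI conjI) auto
      next
        case False
        define \<sigma> where "\<sigma> c = (if c = i \<or> c = j then -1 else 1 :: real)" for c
        have D: "rot i j pi = smat id \<sigma>" using rot_smat(3)[OF ne] by (simp add: \<sigma>_def[abs_def])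
        \<comment> \<open>The half turn is a diagonal sign matrix and normalizes the triangular
          group, so a positive \<psi> can be reduced to the negative angle
          \<open>\<psi> - pi\<close>.\<close>
        have P: "rot i j pi ** b ** rot i j pi \<in> pos_upper_triangular" if "b \<in> pos_upper_triangular" for b
        proof -
          have e: "(rot i j pi ** b ** rot i j pi) $ a $ c = \<sigma> a * b $ a $ c * \<sigma> c" for a c
            unfolding D by (simp add: smat_mult_right smat_mult_left)
          show ?thesis using that unfolding pos_upper_triangular_iff e by (auto simp: \<sigma>_def)
        qed
        have "u ** rot i j (\<psi> - pi) \<in> double_coset (u ** rot i j (- (pi/2)))"
          using rot_mult_double_coset(2)[OF ij s(1) lw, of "pi - \<psi>"] \<psi> s(2) False \<open>\<psi> \<noteq> 0\<close> by simp
        then obtain b b' where b: "b \<in> pos_upper_triangular" "b' \<in> pos_upper_triangular"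
          "u ** rot i j (\<psi> - pi) = b ** (u ** rot i j (- (pi/2))) ** b'" by (auto simp: double_coset_def)
        have pp: "rot i j pi ** rot i j pi = mat 1" using rp[of pi] rot_periodic(1)[of i j 0] rot_zero[OF ne] by simp
        have "u ** rot i j \<psi> = u ** rot i j (\<psi> - pi) ** rot i j pi" using rp[of "\<psi> - pi"] by (simp flip: matrix_mul_assoc)
        also have "\<dots> = b ** (u ** rot i j (- (pi/2))) ** (rot i j pi ** rot i j pi) ** b' ** rot i j pi"
          unfolding b(3) pp by simp
        also have "\<dots> = b ** (u ** (rot i j (- (pi/2)) ** rot i j pi)) ** (rot i j pi ** b' ** rot i j pi)"
          by (simp only: matrix_mul_assoc)
        also have "rot i j (- (pi/2)) ** rot i j pi = rot i j (pi/2)" using rp[of "- (pi/2)"] by simp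
        finally have "u ** rot i j \<psi> \<in> double_coset (u ** rot i j (pi/2))" using b P double_cosetI by metis
        then show ?thesis unfolding rot_smat(1)[OF ne] by (intro exI conjI) auto
      qed
      then obtain \<sigma> where \<sigma>: "\<And>c. \<sigma> c \<in> {1, -1}" "u ** rot i j \<psi> \<in> double_coset (u ** smat (sw i j) \<sigma>)" by blast
      define s' where "s' c = s (sw i j c) * \<sigma> c" for c
      have us: "u ** smat (sw i j) \<sigma> = smat (w \<circ> sw i j) s'" by (simp add: s smat_smat s'_def[abs_def])
      have "s' c \<in> {1, -1}" for c using \<sigma>(1)[of c] d(2)[of "sw i j c"] by (auto simp: s'_def)
      moreover have "bij (w \<circ> sw i j)" using d(6) bij_sw by (intro bij_comp)
      moreover have "act i j \<theta> g' ** act i j \<theta> g' = mat 1" using gr by (simp add: grassmannian_def)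
      moreover have "act i j \<theta> g' \<in> double_coset (smat (w \<circ> sw i j) s')"
        using B \<sigma>(2) double_coset_trans us by metis
      ultimately have "signed_involution (w \<circ> sw i j) s'" by (intro involution_double_coset)
      then have *: "w (sw i j (w (sw i j c))) = c" for c by (auto simp: signed_involution_def)
      have "sw i j (w j) = w i" using *[of i] d(1) by (metis sw_left)
      then have False
      proof (cases "w j = i \<or> w j = j")
        case True
        then show ?thesis
        proof
          assume "w j = i"
          then show False using \<open>sw i j (w j) = w i\<close> lw lt d(1)[of j] by simp
        next
          assume "w j = j"
          then show False using \<open>sw i j (w j) = w i\<close> conj(1) unfolding fixes_both_def w_def[symmetric] by simp
        qed
      next
        case False
        then show ?thesis using \<open>sw i j (w j) = w i\<close> lw by (simp add: sw_def)
      qed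
      then show ?thesis ..
    qed
    then have h: "act i j (- (pi - \<theta>)) g \<in> bruhat_cell k u" using gr unfolding bruhat_cell_eq neg by blast
    have "act i j pi (act i j (- (pi - \<theta>)) g) = act i j \<theta> g" by (simp add: act_act[OF ne])
    then have "act i j \<theta> g \<in> bruhat_cell k (turn i j pi u)"
      using act_bruhat_cell_pi[OF ij u asc h] conj(1) by simp
    then show ?thesis using h \<theta>' by (intro exI[of _ "pi - \<theta>"] exI[of _ \<theta>]) simp
  next
    case mult
    have g'2: "g' \<in> double_coset (rot i j (pi/2) ** u)"
    proof -
      have "act i j pi (turn i j (pi/2) u) = rot i j pi ** rot i j (pi/2) ** u ** rot i j (- pi)"
        using mult(1) by (simp add: act_def turn_def matrix_mul_assoc)
      also have "\<dots> = rot i j (pi + pi/2 + pi) ** u" using mult(2)[of "pi + pi/2" pi] by (simp add: rot_add[OF ne])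
      also have "\<dots> = rot i j (pi/2) ** u" using rot_periodic(1)[of i j "pi/2"] by (simp add: algebra_simps)
      finally show ?thesis using g'1 by simp
    qed
    obtain \<phi> \<phi>' where \<phi>: "continuous_on {0..pi} \<phi>" "\<phi> 0 = 0" "\<phi> pi = pi"
      "continuous_on {0..pi} \<phi>'" "\<phi>' 0 = 0" "\<phi>' pi = pi"
      and A: "\<And>\<theta>. 0 \<le> \<theta> \<Longrightarrow> \<theta> \<le> pi \<Longrightarrow> act i j \<theta> g' \<in> double_coset (rot i j (\<phi> \<theta>) ** (rot i j (pi/2) ** u) ** rot i j (- \<phi>' \<theta>))"
      by (rule act_double_coset[OF ij g'2]) blast
    have "continuous_on {0..pi} (\<lambda>\<theta>. \<phi> \<theta> + \<phi>' \<theta>)" using \<phi> by (intro continuous_intros)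
    \<comment> \<open>The quarter turn of the representative and the two angles together have to
      make a full turn; hence the value \<open>3 * pi / 2\<close>.\<close>
    then obtain \<theta> where \<theta>: "0 \<le> \<theta>" "\<theta> \<le> pi" "\<phi> \<theta> + \<phi>' \<theta> = 3 * pi / 2"
      using IVT'[of "\<lambda>\<theta>. \<phi> \<theta> + \<phi>' \<theta>" 0 "3 * pi / 2" pi] \<phi> by auto
    then have \<theta>': "0 < \<theta>" "\<theta> < pi" using \<phi> by (auto simp: le_less)
    have "rot i j (\<phi> \<theta>) ** (rot i j (pi/2) ** u) ** rot i j (- \<phi>' \<theta>) = rot i j (\<phi> \<theta> + pi/2 + \<phi>' \<theta>) ** u"
      using mult(2)[of "\<phi> \<theta> + pi/2" "\<phi>' \<theta>"] by (simp add: matrix_mul_assoc rot_add[OF ne])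
    also have "\<phi> \<theta> + pi/2 + \<phi>' \<theta> = 0 + 2 * pi" using \<theta>(3) by simp
    finally have "act i j \<theta> g' \<in> double_coset u" using A[OF \<theta>(1,2)] rot_periodic(1)[of i j 0] rot_zero[OF ne] by simp
    define \<alpha> where "\<alpha> = pi - \<theta>"
    have \<alpha>: "0 < \<alpha>" "\<alpha> < pi" using \<theta>' by (auto simp: \<alpha>_def)
    define h where "h = act i j (- \<alpha>) g"
    have h: "h \<in> bruhat_cell k u" using \<open>act i j \<theta> g' \<in> double_coset u\<close> gr
      unfolding bruhat_cell_eq h_def \<alpha>_def neg by blast
    have hg: "act i j \<beta> h = act i j (\<beta> - \<alpha>) g" for \<beta> by (simp add: h_def act_act[OF ne])
    then have hg': "act i j \<alpha> h = g" using act_zero[OF ne] by simp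
    obtain \<eta> \<eta>' where \<eta>: "continuous_on {0..pi} \<eta>" "\<eta> pi = pi"
      "\<And>\<theta>. 0 < \<theta> \<Longrightarrow> \<theta> < pi \<Longrightarrow> 0 < \<eta> \<theta> \<and> \<eta> \<theta> < pi"
      "continuous_on {0..pi} \<eta>'" "\<eta>' pi = pi"
      "\<And>\<theta>. 0 < \<theta> \<Longrightarrow> \<theta> < pi \<Longrightarrow> 0 < \<eta>' \<theta> \<and> \<eta>' \<theta> < pi"
      and H: "\<And>\<theta>. 0 \<le> \<theta> \<Longrightarrow> \<theta> \<le> pi \<Longrightarrow> act i j \<theta> h \<in> double_coset (rot i j (\<eta> \<theta>) ** u ** rot i j (- \<eta>' \<theta>))"
      using h unfolding bruhat_cell_eq by (elim IntE act_double_coset[OF ij]) blast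
    have H': "act i j \<theta> h \<in> double_coset (rot i j (\<eta> \<theta> + \<eta>' \<theta>) ** u)" if "0 \<le> \<theta>" "\<theta> \<le> pi" for \<theta>
      using H[OF that] mult(2) by simp
    have "\<eta> \<alpha> + \<eta>' \<alpha> \<le> pi"
    proof (rule ccontr)
      assume "\<not> \<eta> \<alpha> + \<eta>' \<alpha> \<le> pi"
      then have "rot i j (\<eta> \<alpha> + \<eta>' \<alpha>) ** u \<in> double_coset (turn i j (- (pi/2)) u)"
        using mult(5) \<eta>(3,6)[OF \<alpha>] by simp
      then have "g \<in> bruhat_cell k (turn i j (- (pi/2)) u)"
        using H'[of \<alpha>] \<alpha> double_coset_trans g hg' unfolding bruhat_cell_eq by (metis IntE IntI less_imp_le)
      then have "turn i j (- (pi/2)) u = turn i j (pi/2) u"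
        using bruhat_cell_disjoint g tc(1) by metis
      then have "rot i j (pi/2) ** (rot i j (- (pi/2)) ** u) = rot i j (pi/2) ** (rot i j (pi/2) ** u)"
        using mult(1) by (simp add: turn_def)
      then have "u = turn i j pi u" using mult(1)
        by (simp add: turn_def matrix_mul_assoc rot_inverse[OF ne] rot_add[OF ne] rot_zero[OF ne])
      then show False using tp(4) by simp
    qed
    moreover have "continuous_on {\<alpha>..pi} (\<lambda>\<theta>. \<eta> \<theta> + \<eta>' \<theta>)"
      using \<eta> \<alpha> by (intro continuous_intros; elim continuous_on_subset) auto
    ultimately obtain \<beta> where \<beta>: "\<alpha> \<le> \<beta>" "\<beta> \<le> pi" "\<eta> \<beta> + \<eta>' \<beta> = pi"
      using IVT'[of "\<lambda>\<theta>. \<eta> \<theta> + \<eta>' \<theta>" \<alpha> pi pi] \<eta> \<alpha> by auto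
    have \<beta>m: "act i j (\<beta> - \<alpha>) g \<in> bruhat_cell k (turn i j pi u)"
      using H'[of \<beta>] \<beta> \<alpha> mult(4) gr hg by (simp add: bruhat_cell_eq)
    have "\<alpha> \<noteq> \<beta>"
    proof
      assume "\<alpha> = \<beta>"
      then have "g \<in> bruhat_cell k (turn i j pi u)" using \<beta>m act_zero[OF ne] by simp
      then have "turn i j pi u = turn i j (pi/2) u" using bruhat_cell_disjoint g tc(1) tp(1) by metis
      then show False using tc(3) tp(3) by (metis less_add_one less_irrefl)
    qed
    then show ?thesis using h \<beta> \<alpha> \<beta>m unfolding h_def
      by (intro exI[of _ \<alpha>] exI[of _ "\<beta> - \<alpha>"]) auto
  qed
qed

text \<open>\<open>u\<close> commutes with the rotations, so only the difference of the two angles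
  matters. A nonzero difference would lead to a signed permutation that exchanges \<open>i\<close>
  and \<open>j\<close> with unequal signs, and the double coset of such a matrix contains no
  involution.\<close>

lemma act_bruhat_cell_stable_half:
  assumes ij: "adjacent i j" and u: "u \<in> cell_index k" and st: "stable i j u" and g: "g \<in> bruhat_cell k u"
    and \<theta>: "0 \<le> \<theta>" "\<theta> \<le> pi"
  shows "act i j \<theta> g \<in> bruhat_cell k u"
proof -
  have ne: "i \<noteq> j" and lt: "i < j" using ij by (auto simp: adjacent_def)
  define w where "w = underlying_permutation u"
  obtain s where s: "signed_involution w s" "u = smat w s"
    unfolding w_def by (rule smat_perm[OF u])
  note d = signed_involutionD[OF s(1)]
  have f: "w i = i" "w j = j" using st by (auto simp: stable_def fixes_both_def w_def)
  have sij: "s j = s i" using st f by (simp add: stable_def s smat_def)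
  have lw: "w i < w j" using f lt by simp
  note com = rot_commute_smat(1)[OF ne s(1) f sij, folded s(2)]
  have gr: "act i j \<theta> g \<in> grassmannian k" using g act_grassmannian[OF ne] by (auto simp: bruhat_cell_eq)
  have "\<exists>\<phi> \<phi>'. (0 < \<phi> \<and> \<phi> < pi \<and> 0 < \<phi>' \<and> \<phi>' < pi \<or> \<phi> = \<phi>') \<and> act i j \<theta> g \<in> double_coset (rot i j \<phi> ** u ** rot i j (- \<phi>'))"
  proof -
    have gu: "g \<in> double_coset u" using g by (simp add: bruhat_cell_eq)
    obtain \<phi> \<phi>' where "\<phi> 0 = 0" "\<phi> pi = pi" "\<phi>' 0 = 0" "\<phi>' pi = pi"
      "\<And>\<theta>. 0 < \<theta> \<Longrightarrow> \<theta> < pi \<Longrightarrow> 0 < \<phi> \<theta> \<and> \<phi> \<theta> < pi"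
      "\<And>\<theta>. 0 < \<theta> \<Longrightarrow> \<theta> < pi \<Longrightarrow> 0 < \<phi>' \<theta> \<and> \<phi>' \<theta> < pi"
      and A: "\<And>\<theta>. 0 \<le> \<theta> \<Longrightarrow> \<theta> \<le> pi \<Longrightarrow> act i j \<theta> g \<in> double_coset (rot i j (\<phi> \<theta>) ** u ** rot i j (- \<phi>' \<theta>))"
      by (rule act_double_coset[OF ij gu]) blast
    moreover from this have "0 < \<phi> \<theta> \<and> \<phi> \<theta> < pi \<and> 0 < \<phi>' \<theta> \<and> \<phi>' \<theta> < pi \<or> \<phi> \<theta> = \<phi>' \<theta>"
      using \<theta> by (cases "\<theta> = 0 \<or> \<theta> = pi") auto
    ultimately show ?thesis using \<theta> by blast
  qed
  then obtain \<phi> \<phi>' where \<phi>: "0 < \<phi> \<and> \<phi> < pi \<and> 0 < \<phi>' \<and> \<phi>' < pi \<or> \<phi> = \<phi>'"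
    and A: "act i j \<theta> g \<in> double_coset (rot i j \<phi> ** u ** rot i j (- \<phi>'))" by blast
  have "rot i j \<phi> ** u ** rot i j (- \<phi>') = rot i j (\<phi> - \<phi>') ** u"
    unfolding matrix_mul_assoc[symmetric] com unfolding matrix_mul_assoc rot_add[OF ne] by simp
  then have A: "act i j \<theta> g \<in> double_coset (rot i j (\<phi> - \<phi>') ** u)" using A by simp
  have no: False if \<sigma>: "\<And>c. \<sigma> c \<in> {1, -1}" "\<sigma> i * \<sigma> j = -1" and m: "act i j \<theta> g \<in> double_coset (smat (sw i j) \<sigma> ** u)" for \<sigma>
  proof -
    define s' where "s' c = \<sigma> (w c) * s c" for c
    have us: "smat (sw i j) \<sigma> ** u = smat (sw i j \<circ> w) s'" by (simp add: s smat_smat s'_def[abs_def])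
    have "s' c \<in> {1, -1}" for c using \<sigma>(1)[of "w c"] d(2)[of c] by (auto simp: s'_def)
    moreover have "bij (sw i j \<circ> w)" using d(6) bij_sw by (intro bij_comp)
    moreover have "act i j \<theta> g ** act i j \<theta> g = mat 1" using gr by (simp add: grassmannian_def)
    ultimately have "signed_involution (sw i j \<circ> w) s'" using m us by (intro involution_double_coset) auto
    then have "s' ((sw i j \<circ> w) i) = s' i" unfolding signed_involution_def by blast
    then have "\<sigma> j * s j = \<sigma> i * s i" using f by (simp add: s'_def)
    then have "\<sigma> j = \<sigma> i" using sij d(4)[of i] by simp
    then show False using \<sigma>(2) \<sigma>(1)[of i] by auto
  qed
  have "\<phi> = \<phi>'"
  proof (rule ccontr)
    assume nz: "\<phi> \<noteq> \<phi>'"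
    show False
    proof (cases "\<phi>' < \<phi>")
      case True
      then have "rot i j (\<phi> - \<phi>') ** u \<in> double_coset (rot i j (pi/2) ** u)"
        using rot_mult_double_coset(1)[OF ij s(1) lw, of "\<phi> - \<phi>'"] \<phi> s(2) by simp
      then have "act i j \<theta> g \<in> double_coset (smat (sw i j) (\<lambda>c. if c = j then -1 else 1) ** u)"
        using A double_coset_trans unfolding rot_smat(1)[OF ne] by blast
      then show False by (rule no[rotated 2]) (use ne in auto)
    next
      case False
      have "u ** rot i j (- (\<phi>' - \<phi>)) \<in> double_coset (u ** rot i j (- (pi/2)))"
        using rot_mult_double_coset(2)[OF ij s(1) lw, of "\<phi>' - \<phi>"] \<phi> s(2) False nz by simp
      then have "act i j \<theta> g \<in> double_coset (smat (sw i j) (\<lambda>c. if c = i then -1 else 1) ** u)"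
        using A double_coset_trans com[of "- (pi/2)"] com[of "\<phi> - \<phi>'"] unfolding rot_smat(2)[OF ne] by simp
      then show False by (rule no[rotated 2]) (use ne in auto)
    qed
  qed
  then show ?thesis using A gr rot_zero[OF ne] by (simp add: bruhat_cell_eq)
qed

lemma act_bruhat_cell_stable:
  assumes ij: "adjacent i j" and u: "u \<in> cell_index k" and st: "stable i j u" and g: "g \<in> bruhat_cell k u"
  shows "act i j \<theta> g \<in> bruhat_cell k u"
proof -
  have ne: "i \<noteq> j" using ij by (auto simp: adjacent_def)
  note half = act_bruhat_cell_stable_half[OF ij u st]
  have nat: "act i j (real n * pi + \<theta>) g \<in> bruhat_cell k u" if "0 \<le> \<theta>" "\<theta> \<le> pi" for n \<theta>
  proof (induction n)
    case (Suc n)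
    have "act i j (real (Suc n) * pi + \<theta>) g = act i j pi (act i j (real n * pi + \<theta>) g)"
      by (simp add: act_act[OF ne] algebra_simps)
    then show ?case using half[OF Suc, of pi] by simp
  qed (use half[OF g that] in simp)
  have per: "act i j (\<theta> + real n * (2 * pi)) = act i j \<theta>" for n
  proof (induction n)
    case (Suc n)
    have "\<theta> + real (Suc n) * (2 * pi) = \<theta> + real n * (2 * pi) + 2 * pi" by (simp add: algebra_simps)
    then show ?case using Suc act_periodic(1) by metis
  qed simp
  obtain n where n: "- \<theta> < real n * (2 * pi)" using reals_Archimedean3[of "2 * pi"] pi_gt_zero by auto
  define \<alpha> where "\<alpha> = \<theta> + real n * (2 * pi)"
  define m where "m = nat \<lfloor>\<alpha> / pi\<rfloor>"
  have "0 \<le> \<alpha> / pi" using n by (simp add: \<alpha>_def)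
  then have "real m \<le> \<alpha> / pi" "\<alpha> / pi \<le> real m + 1" by (auto simp: m_def)
  then have "0 \<le> \<alpha> - real m * pi" "\<alpha> - real m * pi \<le> pi" by (auto simp: field_simps)
  then have "act i j \<alpha> g \<in> bruhat_cell k u" using nat[of "\<alpha> - real m * pi" m] by simp
  then show ?thesis using per by (simp add: \<alpha>_def)
qed

section \<open>Homology of balls\<close>

definition ball_set :: "nat \<Rightarrow> (nat \<Rightarrow> real) set"
  where "ball_set p = {x. (\<forall>i\<ge>p. x i = 0) \<and> (\<Sum>i<p. x i ^ 2) \<le> 1}"

lemma Euclidean_space_top_of_set: "Euclidean_space p = top_of_set {x. \<forall>i\<ge>p. x i = 0}"
  by (simp add: Euclidean_space_def euclidean_product_topology)

lemma unit_ball_top_of_set: "unit_ball p = top_of_set (ball_set p)"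
  unfolding unit_ball_def Euclidean_space_top_of_set subtopology_subtopology ball_set_def
  by (rule arg_cong[where f="subtopology euclidean"]) auto

lemma topspace_unit_ball [simp]: "topspace (unit_ball p) = ball_set p"
  by (simp add: unit_ball_top_of_set)

lemma unit_ball_interior_eq: "unit_ball_interior p = {x. (\<forall>i\<ge>p. x i = 0) \<and> (\<Sum>i<p. x i ^ 2) < 1}"
  by (auto simp: unit_ball_interior_def topspace_Euclidean_space)

lemma unit_ball_boundary_eq: "unit_ball_boundary p = {x. (\<forall>i\<ge>p. x i = 0) \<and> (\<Sum>i<p. x i ^ 2) = 1}"
  by (auto simp: unit_ball_boundary_def topspace_Euclidean_space)

lemma ball_set_split: "ball_set p = unit_ball_interior p \<union> unit_ball_boundary p"
  "unit_ball_interior p \<inter> unit_ball_boundary p = {}"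
  by (auto simp: ball_set_def unit_ball_interior_eq unit_ball_boundary_eq)

lemma zero_in_ball_interior: "(\<lambda>i. 0) \<in> unit_ball_interior p"
  by (auto simp: unit_ball_interior_eq)

lemma compact_box_fun: "compact {x :: nat \<Rightarrow> real. \<forall>i. x i \<in> {- 1..1}}"
proof -
  have "compactin (product_topology (\<lambda>i::nat. euclideanreal) UNIV) (PiE UNIV (\<lambda>i. {- 1..1}))"
    unfolding compactin_PiE by simp
  then have "compact (PiE UNIV (\<lambda>i::nat. {- 1..1::real}))"
    by (simp add: euclidean_product_topology)
  moreover have "PiE UNIV (\<lambda>i::nat. {- 1..1::real}) = {x. \<forall>i. x i \<in> {- 1..1}}" by (auto simp: PiE_def Pi_def)
  ultimately show ?thesis by simp
qed

lemma continuous_on_coordinate [continuous_intros]: "continuous_on S (\<lambda>x :: nat \<Rightarrow> real. x i)"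
  by (rule continuous_on_product_then_coordinatewise) (rule continuous_on_id)

lemma closed_flat: "closed {x :: nat \<Rightarrow> real. \<forall>i\<ge>p. x i = 0}"
proof -
  have "{x :: nat \<Rightarrow> real. \<forall>i\<ge>p. x i = 0} = (\<Inter>i\<in>{p..}. {x. x i = 0})" by auto
  moreover have "closed {x :: nat \<Rightarrow> real. x i = 0}" for i
    by (intro closed_Collect_eq continuous_intros)
  ultimately show ?thesis by auto
qed

lemma ball_set_coord_le: "x \<in> ball_set p \<Longrightarrow> \<bar>x i\<bar> \<le> 1"
proof (cases "i < p")
  case True
  assume "x \<in> ball_set p"
  then have "(x i)\<^sup>2 \<le> 1"
    using member_le_sum[of i "{..<p}" "\<lambda>i. (x i)\<^sup>2"] True by (auto simp: ball_set_def)
  then show ?thesis by (simp add: abs_square_le_1)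
qed (auto simp: ball_set_def)

lemma compact_ball_set: "compact (ball_set p)"
proof -
  have "closed {x :: nat \<Rightarrow> real. (\<Sum>i<p. x i ^ 2) \<le> 1}"
    by (intro closed_Collect_le continuous_intros)
  then have "closed (ball_set p)"
    unfolding ball_set_def Collect_conj_eq by (intro closed_Int closed_flat)
  moreover have "ball_set p \<subseteq> {x. \<forall>i. x i \<in> {- 1..1}}"
    using ball_set_coord_le by (auto simp: abs_le_iff)
  ultimately show ?thesis using compact_box_fun by (metis closed_Int_compact inf.absorb_iff1)
qed

lemma compact_space_unit_ball: "compact_space (unit_ball p)"
  by (simp add: unit_ball_top_of_set compact_space_subtopology compact_ball_set)

lemma openin_ball_interior: "openin (unit_ball p) (unit_ball_interior p)"
proof -
  have "open {x :: nat \<Rightarrow> real. (\<Sum>i<p. x i ^ 2) < 1}"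
    by (intro open_Collect_less continuous_intros)
  moreover have "unit_ball_interior p = ball_set p \<inter> {x. (\<Sum>i<p. x i ^ 2) < 1}"
    by (auto simp: unit_ball_interior_eq ball_set_def)
  ultimately show ?thesis by (auto simp: unit_ball_top_of_set openin_open)
qed

text \<open>At time 1 the deformation is a retraction onto \<open>A\<close>, and as a self-map of
  \<open>N\<close> it is homotopic to the identity. \<open>A\<close> may move at intermediate
  times.\<close>

lemma relative_homology_trivial_by_deformation:
  assumes h: "continuous_map (prod_topology (top_of_set {0..1::real}) N) N h"
    and h0: "\<And>x. x \<in> topspace N \<Longrightarrow> h (0, x) = x"
    and h1: "\<And>x. x \<in> topspace N \<Longrightarrow> h (1, x) \<in> A"
    and hA: "\<And>x. x \<in> topspace N \<Longrightarrow> x \<in> A \<Longrightarrow> h (1, x) = x"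
  shows "trivial_group (relative_homology_group p N A)"
proof (rule trivial_relative_homology_group_gen)
  have c: "continuous_map N N (\<lambda>x. h (1, x))"
    using continuous_map_o_Pair[OF h, of 1] by (simp add: o_def Pi_iff)
  then show "continuous_map N (subtopology N A) (\<lambda>x. h (1, x))"
    using h1 by (auto simp: continuous_map_in_subtopology)
  show "homotopic_with (\<lambda>h. True) (subtopology N A) (subtopology N A) (\<lambda>x. h (1, x)) id"
    by (rule homotopic_with_equal)
      (use hA h1 c in \<open>auto simp: continuous_map_in_subtopology continuous_map_from_subtopology\<close>)
  have "homotopic_with (\<lambda>h. True) N N id (\<lambda>x. h (1, x))"
    by (subst homotopic_with) (use h h0 in auto)
  then show "homotopic_with (\<lambda>k. True) N N (\<lambda>x. h (1, x)) id"
    by (rule homotopic_with_symD)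
qed

text \<open>The exact sequence of the triple formed by \<open>A\<close>, \<open>N\<close> and
  \<open>X\<close>.\<close>

lemma iso_relativization_trivial:
  assumes "A \<subseteq> N" "\<And>p. trivial_group (relative_homology_group p (subtopology X N) A)"
  shows "hom_induced p X A X N id \<in> iso (relative_homology_group p X A) (relative_homology_group p X N)"
proof (rule very_short_exact_sequence)
  show "exact_seq
         ([relative_homology_group(p - 1) (subtopology X N) A, relative_homology_group p X N, relative_homology_group p X A, relative_homology_group p (subtopology X N) A],
          [hom_relboundary p X N A, hom_induced p X A X N id, hom_induced p (subtopology X N) A X A id])"
    using homology_exactness_triple_1 [OF assms(1)] homology_exactness_triple_3 [OF assms(1)]
    by fastforce
qed (use assms in auto)

text \<open>Excision of the complement of \<open>W\<close>: it is closed and lies in the open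
  complement of the point \<open>x\<close>.\<close>

lemma iso_excision_point:
  assumes W: "openin X W" and x: "x \<in> W" and cl: "closedin X {x}"
  shows "hom_induced p (subtopology X W) (W - {x}) X (topspace X - {x}) id
    \<in> iso (relative_homology_group p (subtopology X W) (W - {x})) (relative_homology_group p X (topspace X - {x}))"
proof -
  have sub: "W \<subseteq> topspace X" using W openin_subset by blast
  have "X closure_of (topspace X - W) \<subseteq> X interior_of (topspace X - {x})"
    using W x cl by (simp add: closure_of_closedin interior_of_openin closedin_diff openin_diff) auto
  from homology_excision_axiom[OF this, of "topspace X" p]
  have "hom_induced p (subtopology X (topspace X - (topspace X - W))) (topspace X - {x} - (topspace X - W))
      (subtopology X (topspace X)) (topspace X - {x}) id
    \<in> iso (relative_homology_group p (subtopology X (topspace X - (topspace X - W))) (topspace X - {x} - (topspace X - W)))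
        (relative_homology_group p (subtopology X (topspace X)) (topspace X - {x}))" by auto
  moreover have "topspace X - (topspace X - W) = W" "topspace X - {x} - (topspace X - W) = W - {x}"
    using sub by auto
  ultimately show ?thesis by simp
qed

text \<open>The projection of the punctured ball onto the sphere from the point \<open>y\<close>: the sphere is reached
  from \<open>x\<close> in the direction \<open>x - y\<close> at the time which is the positive root of a quadratic equation.\<close>

lemma punctured_ball_deformation:
  assumes y: "y \<in> unit_ball_interior p"
  obtains h where "continuous_on ({0..1::real} \<times> (ball_set p - {y})) h"
    "\<And>t x. t \<in> {0..1} \<Longrightarrow> x \<in> ball_set p - {y} \<Longrightarrow> h (t, x) \<in> ball_set p - {y}"
    "\<And>x. h (0, x) = x"
    "\<And>x. x \<in> ball_set p - {y} \<Longrightarrow> h (1, x) \<in> unit_ball_boundary p"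
    "\<And>t x. x \<in> unit_ball_boundary p \<Longrightarrow> h (t, x) = x"
proof -
  define a where "a x = (\<Sum>i<p. (x i - y i)\<^sup>2)" for x :: "nat \<Rightarrow> real"
  define b where "b x = (\<Sum>i<p. x i * (x i - y i))" for x :: "nat \<Rightarrow> real"
  define n where "n x = (\<Sum>i<p. (x i)\<^sup>2)" for x :: "nat \<Rightarrow> real"
  define r where "r x = (- b x + sqrt ((b x)\<^sup>2 + a x * (1 - n x))) / a x" for x
  define h where "h = (\<lambda>(t, x). (\<lambda>i. x i + t * r x * (x i - y i)))"
  have y0: "y i = 0" if "i \<ge> p" for i using y that by (simp add: unit_ball_interior_eq)
  have ny: "n y < 1" using y by (simp add: unit_ball_interior_eq n_def)
  have a: "a x > 0" if x: "x \<in> ball_set p - {y}" for x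
  proof -
    obtain i where "x i \<noteq> y i" using x by (metis DiffD2 ext singletonI)
    then have "i < p" using x y0[of i] by (auto simp: ball_set_def)
    then have "(x i - y i)\<^sup>2 \<le> a x" unfolding a_def by (intro member_le_sum) auto
    moreover have "(x i - y i)\<^sup>2 > 0" using \<open>x i \<noteq> y i\<close> by simp
    ultimately show ?thesis by linarith
  qed
  have exp: "(\<Sum>i<p. (x i + c * (x i - y i))\<^sup>2) = n x + 2 * c * b x + c\<^sup>2 * a x" for x c
    unfolding n_def a_def b_def sum_distrib_left sum.distrib[symmetric]
    by (rule sum.cong[OF refl]) (simp add: power2_eq_square algebra_simps)
  have r0: "0 \<le> r x" if x: "x \<in> ball_set p - {y}" for x
  proof -
    have "n x \<le> 1" using x by (simp add: ball_set_def n_def)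
    then have "(b x)\<^sup>2 \<le> (b x)\<^sup>2 + a x * (1 - n x)" using a[OF x] by simp
    then have "\<bar>b x\<bar> \<le> sqrt ((b x)\<^sup>2 + a x * (1 - n x))" by (metis real_sqrt_abs real_sqrt_le_iff)
    then show ?thesis using a[OF x] by (simp add: r_def)
  qed
  have r1: "n x + 2 * r x * b x + (r x)\<^sup>2 * a x = 1" if x: "x \<in> ball_set p - {y}" for x
  proof -
    have "n x \<le> 1" using x by (simp add: ball_set_def n_def)
    then have s: "(sqrt ((b x)\<^sup>2 + a x * (1 - n x)))\<^sup>2 = (b x)\<^sup>2 + a x * (1 - n x)"
      using a[OF x] by (intro real_sqrt_pow2) auto
    have "a x * r x + b x = sqrt ((b x)\<^sup>2 + a x * (1 - n x))" using a[OF x] by (simp add: r_def)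
    then have "(a x * r x + b x)\<^sup>2 = (b x)\<^sup>2 + a x * (1 - n x)" using s by simp
    then have "a x * (n x + 2 * r x * b x + (r x)\<^sup>2 * a x) = a x * 1"
      by (simp add: power2_eq_square algebra_simps)
    then show ?thesis using a[OF x] by simp
  qed
  \<comment> \<open>On the sphere the discriminant is the square of \<open>b x\<close>, and
    \<open>b x\<close> is nonnegative because \<open>y\<close> lies inside. So the root in question
    is zero and the sphere stays fixed.\<close>
  have rS: "r x = 0" if x: "x \<in> unit_ball_boundary p" for x
  proof -
    have n1: "n x = 1" using x by (simp add: unit_ball_boundary_eq n_def)
    have "0 \<le> a x" by (simp add: a_def sum_nonneg)
    also have "a x = 2 * b x - n x + n y"
      unfolding n_def a_def b_def sum_distrib_left sum.distrib[symmetric] sum_subtractf[symmetric]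
      by (rule sum.cong[OF refl]) (simp add: power2_eq_square algebra_simps)
    finally have "0 \<le> b x" using n1 ny by simp
    then show ?thesis by (simp add: r_def n1)
  qed
  have hS: "h (t, x) = x" if "x \<in> unit_ball_boundary p" for t x using rS[OF that] by (simp add: h_def)
  have h1: "h (1, x) \<in> unit_ball_boundary p" if x: "x \<in> ball_set p - {y}" for x
    using x y0 exp[of x "r x"] r1[OF x] by (simp add: h_def unit_ball_boundary_eq ball_set_def)
  have hD: "h (t, x) \<in> ball_set p - {y}" if t: "t \<in> {0..1}" and x: "x \<in> ball_set p - {y}" for t x
  proof -
    have "h (t, x) \<noteq> y"
    proof
      assume eq: "h (t, x) = y"
      have "(1 + t * r x) * (x i - y i) = 0" for i
        using fun_cong[OF eq, of i] by (simp add: h_def algebra_simps)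
      moreover have "1 + t * r x > 0" using t r0[OF x] by (simp add: add_pos_nonneg)
      ultimately have "x i = y i" for i by (metis less_irrefl mult_eq_0_iff eq_iff_diff_eq_0)
      then show False using x by auto
    qed
    moreover have "h (t, x) \<in> ball_set p"
    proof -
      let ?v = "\<lambda>i. x i + r x * (x i - y i)"
      \<comment> \<open>Convexity of the square: at time \<open>t\<close> the point lies on the
        segment from \<open>x\<close> to its projection \<open>?v\<close>.\<close>
      have "(\<Sum>i<p. (x i + t * r x * (x i - y i))\<^sup>2) \<le> (\<Sum>i<p. (1 - t) * (x i)\<^sup>2 + t * (?v i)\<^sup>2)"
      proof (rule sum_mono)
        fix i
        have "(1 - t) * (x i)\<^sup>2 + t * (?v i)\<^sup>2 - (x i + t * r x * (x i - y i))\<^sup>2 = t * (1 - t) * (r x * (x i - y i))\<^sup>2"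
          by (simp add: power2_eq_square algebra_simps)
        moreover have "\<dots> \<ge> 0" using t by simp
        ultimately show "(x i + t * r x * (x i - y i))\<^sup>2 \<le> (1 - t) * (x i)\<^sup>2 + t * (?v i)\<^sup>2" by linarith
      qed
      also have "\<dots> = (1 - t) * n x + t * 1"
        using exp[of x "r x"] r1[OF x] by (simp add: sum.distrib n_def flip: sum_distrib_left)
      also have "\<dots> \<le> (1 - t) * 1 + t * 1"
        using x t by (intro add_right_mono mult_left_mono) (auto simp: ball_set_def n_def)
      finally show ?thesis using x y0 by (simp add: h_def ball_set_def)
    qed
    ultimately show ?thesis by simp
  qed
  have ca: "continuous_on ({0..1::real} \<times> (ball_set p - {y})) (\<lambda>z. snd z i)" for i
    by (rule continuous_on_product_then_coordinatewise) (intro continuous_on_snd continuous_on_id)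
  have cr: "continuous_on ({0..1::real} \<times> (ball_set p - {y})) (\<lambda>z. r (snd z))"
  proof -
    have "a (snd z) \<noteq> 0" if "z \<in> {0..1} \<times> (ball_set p - {y})" for z
      using a[of "snd z"] that by auto
    then show ?thesis unfolding r_def a_def b_def n_def
      by (intro continuous_intros ca) blast
  qed
  have "continuous_on ({0..1::real} \<times> (ball_set p - {y})) h"
    unfolding h_def case_prod_unfold
    by (intro continuous_on_coordinatewise_then_product continuous_intros ca cr)
  then show ?thesis using that hD h1 hS by (auto simp: h_def)
qed

text \<open>The deformation of the punctured ball is carried over by \<open>f\<close> and extended
  by the identity on \<open>A\<close>. For continuity, \<open>f\<close> is proper as a map from a
  compact space to a Hausdorff space; properness survives the restriction to the punctured ball and
  the product with the interval, so the product map is closed and hence a quotient map onto its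
  image.\<close>

lemma punctured_cell_trivial:
  assumes Y: "Hausdorff_space Y" and A: "closedin Y A"
    and f: "continuous_map (unit_ball p) Y f" and surj: "topspace Y = A \<union> f ` ball_set p"
    and fS: "f ` unit_ball_boundary p \<subseteq> A" and inj: "inj_on f (unit_ball_interior p)"
    and fi: "f ` unit_ball_interior p \<inter> A = {}" and y: "y \<in> unit_ball_interior p"
  shows "trivial_group (relative_homology_group q (subtopology Y (topspace Y - {f y})) A)"
proof -
  obtain k where k: "continuous_on ({0..1::real} \<times> (ball_set p - {y})) k"
    "\<And>t x. t \<in> {0..1} \<Longrightarrow> x \<in> ball_set p - {y} \<Longrightarrow> k (t, x) \<in> ball_set p - {y}"
    "\<And>x. k (0, x) = x"
    "\<And>x. x \<in> ball_set p - {y} \<Longrightarrow> k (1, x) \<in> unit_ball_boundary p"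
    "\<And>t x. x \<in> unit_ball_boundary p \<Longrightarrow> k (t, x) = x"
    using punctured_ball_deformation[OF y] by blast
  let ?N = "subtopology Y (topspace Y - {f y})"
  let ?D = "subtopology (unit_ball p) (ball_set p - {y})"
  let ?I = "top_of_set {0..1::real}"
  let ?q = "\<lambda>(t::real, x). (t, f x)"
  have AY: "A \<subseteq> topspace Y" using A closedin_subset by blast
  have fyA: "f y \<notin> A" using fi y by blast
  have split: "x \<in> unit_ball_interior p \<or> x \<in> unit_ball_boundary p" if "x \<in> ball_set p" for x
    using that ball_set_split by blast
  have pre: "{x \<in> topspace (unit_ball p). f x \<in> topspace Y - {f y}} = ball_set p - {y}"
  proof -
    have "x = y" if "x \<in> ball_set p" "f x = f y" for x
      using split[OF that(1)] that inj fS fyA y by (auto dest: inj_onD)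
    moreover have "f x \<in> topspace Y" if "x \<in> ball_set p" for x using surj that by blast
    ultimately show ?thesis by auto
  qed
  have "proper_map (unit_ball p) Y f"
    by (intro continuous_imp_proper_map compact_space_unit_ball Hausdorff_imp_kc_space Y f)
  then have pf: "proper_map ?D ?N f" using proper_map_restriction[OF _ pre] by blast
  have "proper_map (prod_topology ?I ?D) (prod_topology ?I ?N) ?q"
    unfolding proper_map_prod using pf by (simp add: proper_map_id[unfolded id_def])
  define B where "B = f ` (ball_set p - {y})"
  have topN: "topspace ?N = A \<union> B"
    using AY fyA surj y pre by (auto simp: B_def topspace_subtopology)
  have D_top: "?D = top_of_set (ball_set p - {y})"
    by (simp add: unit_ball_top_of_set subtopology_subtopology Int_absorb1)
  have topD: "topspace ?D = ball_set p - {y}" by auto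
  have BN: "closedin ?N B"
    using proper_imp_closed_map[OF pf] unfolding closed_map_def B_def by (metis topD closedin_topspace)
  have AN: "closedin ?N A" using A fyA AY by (metis closedin_subset_topspace Diff_empty subset_Diff_insert)
  have cf: "continuous_map ?D ?N f"
    using f pre by (auto simp: continuous_map_in_subtopology continuous_map_from_subtopology)
  define g where "g = inv_into (unit_ball_interior p) f"
  define H where "H = (\<lambda>(t :: real, x). if x \<in> A then x else f (k (t, g x)))"
  have gf: "g (f x) = x" if "x \<in> unit_ball_interior p" for x using that inj by (simp add: g_def)
  \<comment> \<open>On the sphere both branches of \<open>H\<close> agree, because \<open>k\<close>
    fixes the sphere and \<open>f\<close> sends it into \<open>A\<close>.\<close>
  have Hq: "H (t, f x) = f (k (t, x))" if "x \<in> ball_set p - {y}" for t x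
    using split[of x] that fS fi k(5)[of x t] gf[of x] by (auto simp: H_def)
  have cq: "continuous_map (prod_topology ?I ?D) (prod_topology ?I ?N) ?q"
    unfolding continuous_map_prod_top using cf by auto
  have "continuous_map (prod_topology ?I ?N) ?N H"
  proof (rule pasting_lemma_closed[where I="{True, False}" and T="\<lambda>b. {0..1} \<times> (if b then A else B)" and f="\<lambda>_. H"])
    show "closedin (prod_topology ?I ?N) ({0..1} \<times> (if b then A else B))" for b
      using AN BN by (auto simp: closedin_prod_Times_iff)
    show "continuous_map (subtopology (prod_topology ?I ?N) ({0..1} \<times> (if b then A else B))) ?N H" for b
    proof (cases b)
      case True
      have "continuous_map (subtopology (prod_topology ?I ?N) ({0..1} \<times> A)) ?N snd"
        by (intro continuous_map_from_subtopology continuous_map_snd)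
      then show ?thesis using True by (rule_tac continuous_map_eq[where f=snd]) (auto simp: H_def)
    next
      case False
      let ?QT = "subtopology (prod_topology ?I ?N) ({0..1} \<times> B)"
      have qi: "?q ` topspace (prod_topology ?I ?D) = {0..1} \<times> B" by (auto simp: B_def image_iff)
      have "closed_map (prod_topology ?I ?D) ?QT ?q"
        using proper_imp_closed_map[OF \<open>proper_map (prod_topology ?I ?D) (prod_topology ?I ?N) ?q\<close>]
        by (rule closed_map_into_subtopology) (use qi in auto)
      moreover have "continuous_map (prod_topology ?I ?D) ?QT ?q"
        using cq qi by (auto simp: continuous_map_in_subtopology)
      moreover have "?q ` topspace (prod_topology ?I ?D) = topspace ?QT"
        unfolding qi using closedin_subset[OF BN] by auto
      ultimately have Q: "quotient_map (prod_topology ?I ?D) ?QT ?q"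
        by (intro continuous_closed_imp_quotient_map)
      have "prod_topology ?I ?D = top_of_set ({0..1} \<times> (ball_set p - {y}))"
        by (simp add: D_top)
      moreover have "k \<in> {0..1} \<times> (ball_set p - {y}) \<rightarrow> ball_set p - {y}"
      proof
        fix z :: "real \<times> (nat \<Rightarrow> real)" assume "z \<in> {0..1} \<times> (ball_set p - {y})"
        then obtain t x where "z = (t, x)" "t \<in> {0..1}" "x \<in> ball_set p - {y}" by blast
        then show "k z \<in> ball_set p - {y}" using k(2) by blast
      qed
      ultimately have "continuous_map (prod_topology ?I ?D) ?D k"
        using k(1) unfolding D_top by (simp add: Pi_iff)
      then have "continuous_map (prod_topology ?I ?D) ?N (f \<circ> k)" using cf continuous_map_compose by blast
      then have "continuous_map (prod_topology ?I ?D) ?N (H \<circ> ?q)"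
      proof (rule continuous_map_eq)
        fix z assume "z \<in> topspace (prod_topology ?I ?D)"
        then obtain t x where "z = (t, x)" "x \<in> ball_set p - {y}" by auto
        then show "(f \<circ> k) z = (H \<circ> ?q) z" using Hq by simp
      qed
      then show ?thesis using False continuous_compose_quotient_map[OF Q] by simp
    qed
  qed (use topN in auto)
  then show ?thesis
  proof (rule relative_homology_trivial_by_deformation)
    fix x assume x: "x \<in> topspace ?N"
    show "H (0, x) = x" "H (1, x) \<in> A" "x \<in> A \<Longrightarrow> H (1, x) = x"
    proof -
      show "x \<in> A \<Longrightarrow> H (1, x) = x" by (simp add: H_def)
      have "x \<in> A \<or> (\<exists>z\<in>ball_set p - {y}. x = f z)" using x topN by (auto simp: B_def)
      then have "H (0, x) = x \<and> H (1, x) \<in> A"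
      proof
        assume "x \<in> A"
        then show ?thesis by (simp add: H_def)
      next
        assume "\<exists>z\<in>ball_set p - {y}. x = f z"
        then obtain z where z: "z \<in> ball_set p - {y}" "x = f z" by blast
        have "f (k (1, z)) \<in> A" using k(4)[OF z(1)] fS by blast
        then show ?thesis using Hq[OF z(1)] k(3) z(2) by simp
      qed
      then show "H (0, x) = x" "H (1, x) \<in> A" by auto
    qed
  qed
qed

section \<open>Cancellation of isomorphisms and generators of infinite cyclic groups\<close>

lemma iso_cancel_right:
  assumes h: "h \<in> hom H K" and a: "a \<in> iso G H" and ha: "\<And>x. x \<in> carrier G \<Longrightarrow> h (a x) = c x" and c: "c \<in> iso G K"
  shows "h \<in> iso H K"
proof -
  have "bij_betw (h \<circ> a) (carrier G) (carrier K)"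
    using c ha by (auto simp: iso_def intro: bij_betw_cong[THEN iffD1])
  moreover have "bij_betw a (carrier G) (carrier H)" using a by (simp add: iso_def)
  ultimately have "bij_betw h (carrier H) (carrier K)" using bij_betw_comp_iff by blast
  then show ?thesis using h by (simp add: iso_def)
qed

lemma iso_cancel_left:
  assumes f: "f \<in> hom G H" and a: "a \<in> iso H K" and af: "\<And>x. x \<in> carrier G \<Longrightarrow> a (f x) = c x" and c: "c \<in> iso G K"
  shows "f \<in> iso G H"
proof -
  have A: "bij_betw a (carrier H) (carrier K)" using a by (simp add: iso_def)
  have "f ` carrier G \<subseteq> carrier H" using f by (auto simp: hom_def)
  moreover have "bij_betw (a \<circ> f) (carrier G) (carrier K)"
    using c af by (auto simp: iso_def intro: bij_betw_cong[THEN iffD1])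
  ultimately have "bij_betw f (carrier G) (carrier H)" using bij_betw_comp_iff2[OF A] by blast
  then show ?thesis using f by (simp add: iso_def)
qed

lemma iso_comp: "f \<in> iso G H \<Longrightarrow> g \<in> iso H K \<Longrightarrow> (\<lambda>x. g (f x)) \<in> iso G K"
  using iso_set_trans[of f G H g K] by (simp add: compose_def o_def iso_def hom_def bij_betw_def inj_on_def image_iff)

lemma generate_iso_image:
  assumes "group G" "group H" "f \<in> iso G H" "g \<in> carrier G" "generate G {g} = carrier G"
  shows "f g \<in> carrier H" "generate H {f g} = carrier H"
proof -
  interpret group_hom G H f using assms by (simp add: group_hom_def group_hom_axioms_def iso_def)
  show "f g \<in> carrier H" using assms by simp
  have "generate H (f ` {g}) = f ` generate G {g}" by (rule generate_img) (use assms in auto)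
  then show "generate H {f g} = carrier H" using assms by (simp add: iso_def bij_betw_def)
qed

lemma infinite_cyclic_pow_inject:
  assumes G: "group G" "G \<cong> integer_group" and g: "g \<in> carrier G" "generate G {g} = carrier G"
    and eq: "g [^]\<^bsub>G\<^esub> (m::int) = g [^]\<^bsub>G\<^esub> (n::int)"
  shows "m = n"
proof -
  interpret G: group G by (rule G)
  have inf: "infinite (carrier G)"
  proof
    assume "finite (carrier G)"
    moreover obtain f where "f \<in> iso G integer_group" using G(2) by (auto simp: is_iso_def)
    then have "bij_betw f (carrier G) (UNIV :: int set)" by (auto simp: iso_def integer_group_def)
    ultimately have "finite (UNIV :: int set)" using bij_betw_finite by blast
    then show False using infinite_UNIV_int by blast
  qed
  show ?thesis
  proof (rule ccontr)
    assume "m \<noteq> n"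
    have "G.ord g \<noteq> 0"
    proof
      assume "G.ord g = 0"
      then show False using \<open>m \<noteq> n\<close> eq G.int_pow_eq[OF g(1)] by simp
    qed
    then have "finite (generate G {g})" using G.generate_pow_card[OF g(1)] g(1)
      by (metis card_eq_0_iff not_gr_zero)
    then show False using inf g(2) by simp
  qed
qed

lemma infinite_cyclic_generator_pow:
  assumes G: "group G" "G \<cong> integer_group" and g: "g \<in> carrier G" "generate G {g} = carrier G"
    and h: "generate G {g [^]\<^bsub>G\<^esub> (c::int)} = carrier G"
  shows "c = 1 \<or> c = -1"
proof -
  interpret G: group G by (rule G)
  have "g \<in> generate G {g [^]\<^bsub>G\<^esub> c}" using g h by simp
  then obtain m :: int where "g = (g [^]\<^bsub>G\<^esub> c) [^]\<^bsub>G\<^esub> m"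
    using G.generate_pow[of "g [^]\<^bsub>G\<^esub> c"] g(1) by auto
  then have "g [^]\<^bsub>G\<^esub> (1::int) = g [^]\<^bsub>G\<^esub> (c * m)"
    using g(1) by (simp add: G.int_pow_pow)
  then have "1 = c * m" by (rule infinite_cyclic_pow_inject[OF G g])
  then show ?thesis by (metis zmult_eq_1_iff)
qed

lemma cell_relativization_iso:
  assumes Y: "Hausdorff_space Y" and A: "closedin Y A"
    and f: "continuous_map (unit_ball p) Y f" and surj: "topspace Y = A \<union> f ` ball_set p"
    and fS: "f ` unit_ball_boundary p \<subseteq> A" and inj: "inj_on f (unit_ball_interior p)"
    and fi: "f ` unit_ball_interior p \<inter> A = {}" and y: "y \<in> unit_ball_interior p"
  shows "hom_induced q Y A Y (topspace Y - {f y}) id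
    \<in> iso (relative_homology_group q Y A) (relative_homology_group q Y (topspace Y - {f y}))"
proof (rule iso_relativization_trivial)
  show "A \<subseteq> topspace Y - {f y}" using closedin_subset[OF A] fi y by auto
qed (rule punctured_cell_trivial[OF assms])

lemma closedin_ball_boundary: "closedin (unit_ball p) (unit_ball_boundary p)"
proof -
  have "unit_ball_boundary p = topspace (unit_ball p) - unit_ball_interior p"
    using ball_set_split by auto
  then show ?thesis by (metis closedin_diff closedin_topspace openin_ball_interior)
qed

lemma Hausdorff_unit_ball: "Hausdorff_space (unit_ball p)"
  by (simp add: unit_ball_top_of_set Hausdorff_space_subtopology)

lemma ball_relativization_iso:
  assumes "y \<in> unit_ball_interior p"
  shows "hom_induced q (unit_ball p) (unit_ball_boundary p) (unit_ball p) (ball_set p - {y}) id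
    \<in> iso (relative_homology_group q (unit_ball p) (unit_ball_boundary p)) (relative_homology_group q (unit_ball p) (ball_set p - {y}))"
proof -
  have "ball_set p = unit_ball_boundary p \<union> id ` ball_set p" using ball_set_split(1) by auto
  then show ?thesis
    using cell_relativization_iso[OF Hausdorff_unit_ball closedin_ball_boundary, of p p id y q]
      assms ball_set_split(2)[of p] by simp
qed

text \<open>On both sides excision leaves the open ball and its homeomorphic image. That
  \<open>f y\<close> has only one preimage in the closed ball makes \<open>f\<close> a map of the
  pairs.\<close>

lemma ball_local_iso:
  assumes f: "continuous_map (unit_ball p) Y f" and op: "openin Y (f ` unit_ball_interior p)"
    and hm: "homeomorphic_map (subtopology (unit_ball p) (unit_ball_interior p)) (subtopology Y (f ` unit_ball_interior p)) f"
    and y: "y \<in> unit_ball_interior p" and uniq: "\<And>x. x \<in> ball_set p \<Longrightarrow> f x = f y \<Longrightarrow> x = y"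
    and cl: "closedin Y {f y}"
  shows "hom_induced q (unit_ball p) (ball_set p - {y}) Y (topspace Y - {f y}) f
    \<in> iso (relative_homology_group q (unit_ball p) (ball_set p - {y})) (relative_homology_group q Y (topspace Y - {f y}))"
proof -
  let ?i = "unit_ball_interior p" let ?W = "f ` unit_ball_interior p"
  have fY: "f x \<in> topspace Y" if "x \<in> ball_set p" for x using f that by (auto simp: continuous_map_def)
  have isub: "?i \<subseteq> ball_set p" using ball_set_split by auto
  have Wsub: "?W \<subseteq> topspace Y" using op openin_subset by blast
  have "closedin (unit_ball p) {y}" using y isub Hausdorff_unit_ball
    by (metis closedin_Hausdorff_sing_eq subsetD topspace_unit_ball)
  then have a: "hom_induced q (subtopology (unit_ball p) ?i) (?i - {y}) (unit_ball p) (ball_set p - {y}) id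
    \<in> iso (relative_homology_group q (subtopology (unit_ball p) ?i) (?i - {y})) (relative_homology_group q (unit_ball p) (ball_set p - {y}))"
    using iso_excision_point[OF openin_ball_interior y] by simp
  have b: "hom_induced q (subtopology Y ?W) (?W - {f y}) Y (topspace Y - {f y}) id
    \<in> iso (relative_homology_group q (subtopology Y ?W) (?W - {f y})) (relative_homology_group q Y (topspace Y - {f y}))"
    using iso_excision_point[OF op _ cl] y by blast
  have img: "f ` (?i - {y}) = ?W - {f y}" using uniq isub y by auto
  have c: "hom_induced q (subtopology (unit_ball p) ?i) (?i - {y}) (subtopology Y ?W) (?W - {f y}) f
    \<in> iso (relative_homology_group q (subtopology (unit_ball p) ?i) (?i - {y})) (relative_homology_group q (subtopology Y ?W) (?W - {f y}))"
    by (rule homeomorphic_map_relative_homology_iso[OF hm _ img]) (use isub in auto)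
  have cf: "continuous_map (subtopology (unit_ball p) ?i) (subtopology Y ?W) f"
    using hm homeomorphic_imp_continuous_map by blast
  show ?thesis
  proof (rule iso_cancel_right[OF hom_induced_hom a _ iso_comp[OF c b]])
    fix x
    have "hom_induced q (unit_ball p) (ball_set p - {y}) Y (topspace Y - {f y}) f
       (hom_induced q (subtopology (unit_ball p) ?i) (?i - {y}) (unit_ball p) (ball_set p - {y}) id x)
       = hom_induced q (subtopology (unit_ball p) ?i) (?i - {y}) Y (topspace Y - {f y}) (f \<circ> id) x"
      by (rule hom_induced_compose') (use f fY uniq isub y in \<open>auto simp: continuous_map_from_subtopology\<close>)
    moreover have "hom_induced q (subtopology Y ?W) (?W - {f y}) Y (topspace Y - {f y}) id
       (hom_induced q (subtopology (unit_ball p) ?i) (?i - {y}) (subtopology Y ?W) (?W - {f y}) f x)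
       = hom_induced q (subtopology (unit_ball p) ?i) (?i - {y}) Y (topspace Y - {f y}) (id \<circ> f) x"
      by (rule hom_induced_compose') (use cf img Wsub in \<open>auto simp: continuous_map_from_subtopology\<close>)
    ultimately show "hom_induced q (unit_ball p) (ball_set p - {y}) Y (topspace Y - {f y}) f
       (hom_induced q (subtopology (unit_ball p) ?i) (?i - {y}) (unit_ball p) (ball_set p - {y}) id x)
      = hom_induced q (subtopology Y ?W) (?W - {f y}) Y (topspace Y - {f y}) id
       (hom_induced q (subtopology (unit_ball p) ?i) (?i - {y}) (subtopology Y ?W) (?W - {f y}) f x)" by simp
  qed
qed

lemma ball_sphere_local_iso:
  assumes f: "continuous_map (unit_ball p) Y f" and op: "openin Y (f ` unit_ball_interior p)"
    and hm: "homeomorphic_map (subtopology (unit_ball p) (unit_ball_interior p)) (subtopology Y (f ` unit_ball_interior p)) f"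
    and y: "y \<in> unit_ball_interior p" and uniq: "\<And>x. x \<in> ball_set p \<Longrightarrow> f x = f y \<Longrightarrow> x = y"
    and cl: "closedin Y {f y}"
  shows "hom_induced q (unit_ball p) (unit_ball_boundary p) Y (topspace Y - {f y}) f
    \<in> iso (relative_homology_group q (unit_ball p) (unit_ball_boundary p)) (relative_homology_group q Y (topspace Y - {f y}))"
proof -
  have fY: "f x \<in> topspace Y" if "x \<in> ball_set p" for x using f that by (auto simp: continuous_map_def)
  have "hom_induced q (unit_ball p) (ball_set p - {y}) Y (topspace Y - {f y}) f
     (hom_induced q (unit_ball p) (unit_ball_boundary p) (unit_ball p) (ball_set p - {y}) id x)
     = hom_induced q (unit_ball p) (unit_ball_boundary p) Y (topspace Y - {f y}) (f \<circ> id) x" for x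
    by (rule hom_induced_compose') (use f fY uniq ball_set_split[of p] y in auto)
  then have e: "(\<lambda>x. hom_induced q (unit_ball p) (ball_set p - {y}) Y (topspace Y - {f y}) f
     (hom_induced q (unit_ball p) (unit_ball_boundary p) (unit_ball p) (ball_set p - {y}) id x))
     = hom_induced q (unit_ball p) (unit_ball_boundary p) Y (topspace Y - {f y}) f"
    by (intro ext) (simp only: comp_id)
  show ?thesis
    using iso_comp[OF ball_relativization_iso[OF y, of q] ball_local_iso[OF assms, of q]] unfolding e .
qed

text \<open>Both groups are compared with the local group at the image of one interior point: the
  group of the pair \<open>Y\<close>, \<open>A\<close> by retracting the punctured space to
  \<open>A\<close>, the group of the ball by the local isomorphism.\<close>

lemma cell_attach_iso:
  assumes Y: "Hausdorff_space Y" and A: "closedin Y A"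
    and f: "continuous_map (unit_ball p) Y f" and surj: "topspace Y = A \<union> f ` ball_set p"
    and fS: "f ` unit_ball_boundary p \<subseteq> A"
    and hm: "homeomorphic_map (subtopology (unit_ball p) (unit_ball_interior p)) (subtopology Y (f ` unit_ball_interior p)) f"
    and fi: "f ` unit_ball_interior p \<inter> A = {}"
  shows "hom_induced q (unit_ball p) (unit_ball_boundary p) Y A f
    \<in> iso (relative_homology_group q (unit_ball p) (unit_ball_boundary p)) (relative_homology_group q Y A)"
proof -
  obtain y where y: "y \<in> unit_ball_interior p" using zero_in_ball_interior by blast
  have isub: "unit_ball_interior p \<subseteq> ball_set p" using ball_set_split by auto
  have inj: "inj_on f (unit_ball_interior p)"
    using homeomorphic_imp_injective_map[OF hm] isub by (simp add: Int_absorb1)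
  have eq: "f ` unit_ball_interior p = topspace Y - A" using surj ball_set_split fS fi by blast
  have op: "openin Y (f ` unit_ball_interior p)" unfolding eq using A by blast
  have uniq: "x = y" if "x \<in> ball_set p" "f x = f y" for x
  proof -
    have "f y \<notin> A" using y fi by blast
    then have "x \<notin> unit_ball_boundary p" using that fS image_subset_iff[of f] by auto
    then have "x \<in> unit_ball_interior p" using that ball_set_split(1) by blast
    from inj_on_eq_iff[OF inj this y] show ?thesis using that(2) by simp
  qed
  have fyY: "f y \<in> topspace Y" using eq y by blast
  then have cl: "closedin Y {f y}" using closedin_Hausdorff_sing_eq[OF Y] by simp
  show ?thesis
  proof (rule iso_cancel_left[OF hom_induced_hom cell_relativization_iso[OF Y A f surj fS inj fi y]
        _ ball_sphere_local_iso[OF f op hm y uniq cl]])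
    show "hom_induced q Y A Y (topspace Y - {f y}) id (hom_induced q (unit_ball p) (unit_ball_boundary p) Y A f x)
       = hom_induced q (unit_ball p) (unit_ball_boundary p) Y (topspace Y - {f y}) f x" for x
    proof -
      have "f \<in> unit_ball_boundary p \<rightarrow> A" "id \<in> A \<rightarrow> topspace Y - {f y}"
        using fS closedin_subset[OF A] fi y by auto
      then show ?thesis
        using hom_induced_compose'[of "unit_ball p" Y f "unit_ball_boundary p" A Y id "topspace Y - {f y}" q x] f
        by simp
    qed
  qed
qed

section \<open>The relative homology of the ball modulo its boundary sphere\<close>

lemma homotopic_with_top_of_setI:
  assumes "continuous_on ({0..1::real} \<times> S) h" "\<And>t x. t \<in> {0..1} \<Longrightarrow> x \<in> S \<Longrightarrow> h (t, x) \<in> S"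
    "\<And>x. x \<in> S \<Longrightarrow> h (0, x) = x" "\<And>x. x \<in> S \<Longrightarrow> h (1, x) = a"
  shows "contractible_space (top_of_set S)"
  unfolding contractible_space_def
proof (rule exI[of _ a])
  show "homotopic_with (\<lambda>x. True) (top_of_set S) (top_of_set S) id (\<lambda>x. a)"
    by (subst homotopic_with) (use assms in \<open>auto intro!: exI[of _ h] simp: Pi_iff\<close>)
qed

lemma contractible_unit_ball: "contractible_space (unit_ball p)"
  unfolding unit_ball_top_of_set
proof (rule homotopic_with_top_of_setI[where h="\<lambda>(t, x) i. (1 - t) * x i" and a="\<lambda>i. 0"])
  have ca: "continuous_on ({0..1::real} \<times> ball_set p) (\<lambda>z. snd z i)" for i
    by (rule continuous_on_product_then_coordinatewise) (intro continuous_on_snd continuous_on_id)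
  show "continuous_on ({0..1::real} \<times> ball_set p) (\<lambda>(t, x) i. (1 - t) * x i)"
    unfolding case_prod_unfold by (intro continuous_on_coordinatewise_then_product continuous_intros ca)
  show "(case (t, x) of (t, x) \<Rightarrow> \<lambda>i. (1 - t) * x i) \<in> ball_set p" if t: "t \<in> {0..1}" and x: "x \<in> ball_set p" for t :: real and x
  proof -
    have "(\<Sum>i<p. ((1 - t) * x i)\<^sup>2) = (1 - t)\<^sup>2 * (\<Sum>i<p. (x i)\<^sup>2)"
      by (simp add: power_mult_distrib sum_distrib_left)
    also have "\<dots> \<le> 1 * 1" using t x by (intro mult_mono) (auto simp: ball_set_def sum_nonneg power_le_one)
    finally show ?thesis using x by (simp add: ball_set_def)
  qed
qed auto

text \<open>Every point is joined to the antipode of \<open>y\<close> by the normalized segment. The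
  segment meets the origin, or its normalization meets \<open>y\<close>, only if it starts at
  \<open>y\<close>.\<close>

lemma contractible_punctured_sphere:
  assumes y: "y \<in> unit_ball_boundary p"
  shows "contractible_space (subtopology (unit_ball p) (unit_ball_boundary p - {y}))"
proof -
  define S where "S = unit_ball_boundary p - {y}"
  define n where "n = (\<lambda>(t::real, x). sqrt (\<Sum>i<p. ((1 - t) * x i - t * y i)\<^sup>2))"
  define h where "h = (\<lambda>(t, x) i. ((1 - t) * x i - t * y i) / n (t, x))"
  have y1: "(\<Sum>i<p. (y i)\<^sup>2) = 1" "\<And>i. i \<ge> p \<Longrightarrow> y i = 0" using y by (auto simp: unit_ball_boundary_eq)
  have x1: "(\<Sum>i<p. (x i)\<^sup>2) = 1" "\<And>i. i \<ge> p \<Longrightarrow> x i = 0" "x \<noteq> y" if "x \<in> S" for x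
    using that by (auto simp: unit_ball_boundary_eq S_def)
  \<comment> \<open>The case \<open>c = t\<close> means that the segment meets the origin, the case
    \<open>c = t + n (t, x)\<close> that its normalization is \<open>y\<close>. Comparing norms
    gives \<open>1 - t = c\<close>, hence \<open>x = y\<close>.\<close>
  have key: False if x: "x \<in> S" and eq: "\<And>i. i < p \<Longrightarrow> (1 - t) * x i = c * y i" and t: "0 \<le> t" "t \<le> 1" and c: "t \<le> c" for x t c
  proof -
    have "(1 - t)\<^sup>2 * (\<Sum>i<p. (x i)\<^sup>2) = (\<Sum>i<p. ((1 - t) * x i)\<^sup>2)"
      by (simp add: power_mult_distrib sum_distrib_left)
    also have "\<dots> = (\<Sum>i<p. (c * y i)\<^sup>2)" using eq by simp
    also have "\<dots> = c\<^sup>2 * (\<Sum>i<p. (y i)\<^sup>2)" by (simp add: power_mult_distrib sum_distrib_left)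
    finally have "(1 - t)\<^sup>2 = c\<^sup>2" using x1(1)[OF x] y1 by simp
    then have ct: "1 - t = c" using t c by (simp add: power2_eq_iff_nonneg)
    then have "c > 0" using t c by linarith
    then have "x i = y i" for i using eq[of i] ct x1(2)[OF x, of i] y1(2)[of i] by (cases "i < p") auto
    then show False using x1(3)[OF x] by blast
  qed
  have n0: "n (t, x) > 0" if t: "t \<in> {0..1}" and x: "x \<in> S" for t x
  proof -
    have "(\<Sum>i<p. ((1 - t) * x i - t * y i)\<^sup>2) \<noteq> 0"
    proof
      assume "(\<Sum>i<p. ((1 - t) * x i - t * y i)\<^sup>2) = 0"
      then have "(1 - t) * x i = t * y i" if "i < p" for i using that by (simp add: sum_nonneg_eq_0_iff)
      then show False using key[OF x, of t t] t by auto
    qed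
    moreover have "(\<Sum>i<p. ((1 - t) * x i - t * y i)\<^sup>2) \<ge> 0" by (simp add: sum_nonneg)
    ultimately show ?thesis by (simp add: n_def)
  qed
  have "contractible_space (top_of_set S)"
  proof (rule homotopic_with_top_of_setI[where h=h and a="\<lambda>i. - y i"])
    have ca: "continuous_on ({0..1::real} \<times> S) (\<lambda>z. snd z i)" for i
      by (rule continuous_on_product_then_coordinatewise) (intro continuous_on_snd continuous_on_id)
    have cn: "continuous_on ({0..1::real} \<times> S) (\<lambda>z. n (fst z, snd z))"
      unfolding n_def case_prod_unfold fst_conv snd_conv by (intro continuous_intros ca)
    have "n (fst z, snd z) \<noteq> 0" if "z \<in> {0..1} \<times> S" for z using n0[of "fst z" "snd z"] that by auto
    then show "continuous_on ({0..1::real} \<times> S) h"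
      unfolding h_def case_prod_unfold
      by (intro continuous_on_coordinatewise_then_product continuous_intros ca cn) blast
    show "h (t, x) \<in> S" if t: "t \<in> {0..1}" and x: "x \<in> S" for t x
    proof -
      have n2: "(n (t, x))\<^sup>2 = (\<Sum>i<p. ((1 - t) * x i - t * y i)\<^sup>2)" by (simp add: n_def sum_nonneg)
      have "(\<Sum>i<p. (h (t, x) i)\<^sup>2) = (\<Sum>i<p. ((1 - t) * x i - t * y i)\<^sup>2) / (n (t, x))\<^sup>2"
        by (simp add: h_def power_divide sum_divide_distrib)
      also have "\<dots> = 1" using n0[OF t x] unfolding n2[symmetric] by simp
      finally have 1: "(\<Sum>i<p. (h (t, x) i)\<^sup>2) = 1" .
      have "h (t, x) \<noteq> y"
      proof
        assume "h (t, x) = y"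
        then have "((1 - t) * x i - t * y i) / n (t, x) = y i" for i by (auto simp: h_def fun_eq_iff)
        then have "(1 - t) * x i = (t + n (t, x)) * y i" for i
          using n0[OF t x] by (simp add: field_simps)
        then show False using key[OF x, of t "t + n (t, x)"] t n0[OF t x] by auto
      qed
      moreover have "h (t, x) i = 0" if "i \<ge> p" for i using x1(2)[OF x that] y1(2)[OF that] by (simp add: h_def)
      ultimately show ?thesis using 1 by (simp add: S_def unit_ball_boundary_eq)
    qed
    show "h (0, x) = x" if "x \<in> S" for x using x1[OF that] by (simp add: h_def n_def)
    show "h (1, x) = (\<lambda>i. - y i)" for x using y1 by (simp add: h_def n_def)
  qed
  moreover have "subtopology (unit_ball p) (unit_ball_boundary p - {y}) = top_of_set S"
    using ball_set_split[of p] by (simp add: unit_ball_top_of_set subtopology_subtopology S_def Int_absorb1 le_infI1 subset_iff)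
  ultimately show ?thesis by simp
qed

text \<open>In dimension zero the ball is a point with empty boundary. In dimension
  \<open>Suc m\<close> contractibility of the ball reduces the claim to the reduced homology of
  \<open>nsphere m\<close> in degree \<open>m\<close>.\<close>

lemma relative_homology_ball_sphere:
  "relative_homology_group (int q) (unit_ball q) (unit_ball_boundary q) \<cong> integer_group"
proof (cases q)
  case 0
  have "ball_set 0 = {\<lambda>i. 0}" "unit_ball_boundary 0 = {}" by (auto simp: ball_set_def unit_ball_boundary_eq)
  then show ?thesis using homology_coefficients[of "unit_ball 0" "\<lambda>i. 0"] 0 by simp
next
  case (Suc m)
  have "ball_set q \<inter> unit_ball_boundary q = {x. (\<Sum>i\<le>m. x i ^ 2) = 1 \<and> (\<forall>i>m. x i = 0)}"
    by (auto simp: ball_set_def unit_ball_boundary_eq Suc lessThan_Suc_atMost Suc_le_eq)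
  then have eq: "subtopology (unit_ball q) (unit_ball_boundary q) = nsphere m"
    by (simp add: unit_ball_top_of_set nsphere euclidean_product_topology subtopology_subtopology)
  have "topspace (nsphere m) \<noteq> {}" by (metis in_topspace_nsphere empty_iff)
  then have "topspace (unit_ball q) \<inter> unit_ball_boundary q \<noteq> {}"
    unfolding eq[symmetric] by simp
  then have "relative_homology_group (int q) (unit_ball q) (unit_ball_boundary q) \<cong> reduced_homology_group (int q - 1) (nsphere m)"
    using iso_relative_homology_of_contractible[OF contractible_unit_ball, of q "unit_ball_boundary q" "int q"]
    unfolding eq is_iso_def by blast
  also have "\<dots> \<cong> integer_group" using reduced_homology_group_nsphere(1)[of m] Suc by simp
  finally show ?thesis .
qed

section \<open>Finite cell structures\<close>

text \<open>Up to the kernel of \<open>r\<close>, the element \<open>z\<close> is a power of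
  \<open>b\<close>. This peels off one cell at a time when the chain group is shown to be generated
  by cells.\<close>

lemma split_off_power:
  fixes m :: int
  assumes G: "group G" and R: "group R" and r: "r \<in> hom G R" and z: "z \<in> carrier G" and b: "b \<in> carrier G"
    and m: "r z = r b [^]\<^bsub>R\<^esub> m"
  obtains z' where "z' \<in> kernel G R r" "z = z' \<otimes>\<^bsub>G\<^esub> b [^]\<^bsub>G\<^esub> m"
proof -
  interpret group_hom G R r using G R r by (simp add: group_hom_def group_hom_axioms_def)
  let ?z = "z \<otimes>\<^bsub>G\<^esub> inv\<^bsub>G\<^esub> (b [^]\<^bsub>G\<^esub> m)"
  have "r ?z = r z \<otimes>\<^bsub>R\<^esub> inv\<^bsub>R\<^esub> (r b [^]\<^bsub>R\<^esub> m)" using z b by (simp add: hom_int_pow)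
  then have "r ?z = \<one>\<^bsub>R\<^esub>" using b by (simp add: m)
  then have "?z \<in> kernel G R r" using z b by (simp add: kernel_def)
  moreover have "z = ?z \<otimes>\<^bsub>G\<^esub> b [^]\<^bsub>G\<^esub> m" using z b by (simp add: G.m_assoc)
  ultimately show ?thesis by (rule that)
qed

lemma hom_mult_power:
  fixes m :: int
  assumes "group G" "group R" "r \<in> hom G R" "z \<in> carrier G" "b \<in> carrier G"
  shows "r (z \<otimes>\<^bsub>G\<^esub> b [^]\<^bsub>G\<^esub> m) = r z \<otimes>\<^bsub>R\<^esub> r b [^]\<^bsub>R\<^esub> m"
proof -
  interpret group_hom G R r using assms by (simp add: group_hom_def group_hom_axioms_def)
  show ?thesis using assms by (simp add: hom_int_pow)
qed

text \<open>Finitely many disjoint cells with characteristic maps in a Hausdorff space. The homology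
  below is that of the skeleta and of the stages between them.\<close>

locale cell_structure =
  fixes X :: "'a topology" and I :: "'i set" and e :: "'i \<Rightarrow> 'a set" and d :: "'i \<Rightarrow> nat"
  assumes Hausdorff: "Hausdorff_space X" and finite_cells: "finite I"
    and cell_subset: "\<And>i. i \<in> I \<Longrightarrow> e i \<subseteq> topspace X"
    and cell_disjoint: "\<And>i j x. i \<in> I \<Longrightarrow> j \<in> I \<Longrightarrow> x \<in> e i \<Longrightarrow> x \<in> e j \<Longrightarrow> i = j"
    and cell_char: "\<And>i. i \<in> I \<Longrightarrow> \<exists>\<Phi>. characteristic_map X I e d i \<Phi>"
begin

abbreviation "sk \<equiv> skeleton I e d"

definition cells :: "'i set \<Rightarrow> 'a set" where "cells J = (\<Union>i\<in>J. e i)"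

text \<open>Unions of cells over such index sets are closed; besides the skeleta they include the
  stages at which only some cells of the top dimension are attached.\<close>

definition lower :: "'i set \<Rightarrow> bool" where "lower J \<longleftrightarrow> J \<subseteq> I \<and> (\<forall>i\<in>J. \<forall>j\<in>I. d j < d i \<longrightarrow> j \<in> J)"

lemma sk_cells: "sk p = cells {i \<in> I. int (d i) \<le> p}"
  by (simp add: skeleton_def cells_def)

lemma char_map_image:
  assumes i: "i \<in> I" and \<Phi>: "characteristic_map X I e d i \<Phi>"
  shows "\<Phi> ` unit_ball_interior (d i) = e i" "\<Phi> ` ball_set (d i) \<subseteq> e i \<union> sk (int (d i) - 1)"
    "inj_on \<Phi> (unit_ball_interior (d i))"
    "homeomorphic_map (subtopology (unit_ball (d i)) (unit_ball_interior (d i))) (subtopology X (e i)) \<Phi>"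
    "continuous_map (unit_ball (d i)) X \<Phi>" "\<Phi> ` unit_ball_boundary (d i) \<subseteq> sk (int (d i) - 1)"
proof -
  have sub: "unit_ball_interior (d i) \<subseteq> ball_set (d i)" using ball_set_split by auto
  show hm: "homeomorphic_map (subtopology (unit_ball (d i)) (unit_ball_interior (d i))) (subtopology X (e i)) \<Phi>"
    and "continuous_map (unit_ball (d i)) X \<Phi>" and bd: "\<Phi> ` unit_ball_boundary (d i) \<subseteq> sk (int (d i) - 1)"
    using \<Phi> by (auto simp: characteristic_map_def)
  show im: "\<Phi> ` unit_ball_interior (d i) = e i"
    using homeomorphic_imp_surjective_map[OF hm] sub cell_subset[OF i] by (simp add: Int_absorb1)
  show "inj_on \<Phi> (unit_ball_interior (d i))"
    using homeomorphic_imp_injective_map[OF hm] sub by (simp add: Int_absorb1)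
  show "\<Phi> ` ball_set (d i) \<subseteq> e i \<union> sk (int (d i) - 1)"
    using im bd ball_set_split(1) by auto
qed

lemma closedin_closed_cell:
  assumes "i \<in> I" "characteristic_map X I e d i \<Phi>"
  shows "closedin X (\<Phi> ` ball_set (d i))"
proof (rule compactin_imp_closedin[OF Hausdorff])
  show "compactin X (\<Phi> ` ball_set (d i))"
    using image_compactin[OF _ char_map_image(5)[OF assms], of "ball_set (d i)"]
      compact_space_unit_ball[of "d i"] by (simp add: compact_space_def)
qed

text \<open>The union is also the union of the finitely many closed cells, which are images of
  compact balls.\<close>

lemma closedin_cells:
  assumes "lower J" shows "closedin X (cells J)"
proof -
  have JI: "J \<subseteq> I" using assms by (simp add: lower_def)
  then obtain \<Phi> where \<Phi>: "\<And>i. i \<in> J \<Longrightarrow> characteristic_map X I e d i (\<Phi> i)" using cell_char by (metis subsetD)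
  have "cells J = (\<Union>i\<in>J. \<Phi> i ` ball_set (d i))"
  proof (intro equalityI subsetI)
    fix x assume "x \<in> cells J"
    then obtain i where "i \<in> J" "x \<in> e i" by (auto simp: cells_def)
    then show "x \<in> (\<Union>i\<in>J. \<Phi> i ` ball_set (d i))"
      using char_map_image(1)[of i "\<Phi> i"] \<Phi> JI ball_set_split(1)[of "d i"] by blast
  next
    fix x assume "x \<in> (\<Union>i\<in>J. \<Phi> i ` ball_set (d i))"
    then obtain i where i: "i \<in> J" "x \<in> \<Phi> i ` ball_set (d i)" by blast
    then have "x \<in> e i \<or> x \<in> sk (int (d i) - 1)" using char_map_image(2)[of i "\<Phi> i"] \<Phi> JI by blast
    then show "x \<in> cells J"
    proof
      assume "x \<in> sk (int (d i) - 1)"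
      then obtain j where "j \<in> I" "d j < d i" "x \<in> e j" by (auto simp: skeleton_def)
      then show ?thesis using assms i by (auto simp: lower_def cells_def)
    qed (use i in \<open>auto simp: cells_def\<close>)
  qed
  moreover have "closedin X (\<Phi> i ` ball_set (d i))" if "i \<in> J" for i
    using that \<Phi> JI closedin_closed_cell by blast
  ultimately show ?thesis using finite_subset[OF JI finite_cells] by (auto intro: closedin_Union)
qed

lemma cells_subset: "J \<subseteq> I \<Longrightarrow> cells J \<subseteq> topspace X"
  using cell_subset by (auto simp: cells_def)

lemma cells_disjoint: "J \<subseteq> I \<Longrightarrow> i \<in> I \<Longrightarrow> i \<notin> J \<Longrightarrow> e i \<inter> cells J = {}"
  using cell_disjoint by (auto simp: cells_def)

lemma sk_mono: "p \<le> q \<Longrightarrow> sk p \<subseteq> sk q"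
  by (auto simp: skeleton_def)

lemma cells_insert: "cells (insert i J) = e i \<union> cells J"
  by (simp add: cells_def)

text \<open>The hypotheses of \<open>cell_attach_iso\<close> for one further cell over a lower
  union.\<close>

lemma attach:
  assumes J: "lower J" "i \<in> I" "i \<notin> J" and low: "\<And>j. j \<in> I \<Longrightarrow> d j < d i \<Longrightarrow> j \<in> J"
    and \<Phi>: "characteristic_map X I e d i \<Phi>"
  defines "Y \<equiv> subtopology X (cells (insert i J))"
  shows "Hausdorff_space Y" "closedin Y (cells J)" "continuous_map (unit_ball (d i)) Y \<Phi>"
    "topspace Y = cells J \<union> \<Phi> ` ball_set (d i)" "\<Phi> ` unit_ball_boundary (d i) \<subseteq> cells J"
    "homeomorphic_map (subtopology (unit_ball (d i)) (unit_ball_interior (d i))) (subtopology Y (\<Phi> ` unit_ball_interior (d i))) \<Phi>"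
    "\<Phi> ` unit_ball_interior (d i) \<inter> cells J = {}"
proof -
  note c = char_map_image[OF J(2) \<Phi>]
  have JI: "J \<subseteq> I" using J by (simp add: lower_def)
  have top: "topspace Y = e i \<union> cells J"
    using cells_subset[OF JI] cell_subset[OF J(2)] by (auto simp: Y_def cells_insert)
  have skJ: "sk (int (d i) - 1) \<subseteq> cells J" using low by (auto simp: skeleton_def cells_def)
  show "Hausdorff_space Y" unfolding Y_def using Hausdorff by (rule Hausdorff_space_subtopology)
  show "closedin Y (cells J)" unfolding Y_def
    using closedin_cells[OF J(1)] by (intro closedin_subset_topspace) (auto simp: cells_insert)
  show "\<Phi> ` unit_ball_boundary (d i) \<subseteq> cells J" using c skJ by blast
  show "continuous_map (unit_ball (d i)) Y \<Phi>"
    using c(2,5) skJ by (auto simp: Y_def continuous_map_in_subtopology cells_insert)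
  show "topspace Y = cells J \<union> \<Phi> ` ball_set (d i)"
    unfolding top using c(1,2) skJ ball_set_split(1)[of "d i"] by blast
  have "subtopology Y (e i) = subtopology X (e i)"
    by (simp add: Y_def subtopology_subtopology cells_insert Int_absorb1)
  then show "homeomorphic_map (subtopology (unit_ball (d i)) (unit_ball_interior (d i))) (subtopology Y (\<Phi> ` unit_ball_interior (d i))) \<Phi>"
    using c(1,4) by simp
  show "\<Phi> ` unit_ball_interior (d i) \<inter> cells J = {}" using c(1) cells_disjoint[OF JI J(2,3)] by simp
qed

text \<open>The other cells of dimension at most \<open>d v\<close> form a lower union, so the
  complement of the cell is closed.\<close>

lemma cell_open_in_skeleton:
  assumes v: "v \<in> I" shows "openin (subtopology X (sk (int (d v)))) (e v)"
proof -
  let ?J = "{i \<in> I. int (d i) \<le> int (d v)} - {v}"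
  have low: "lower ?J" by (auto simp: lower_def)
  have eq: "sk (int (d v)) = e v \<union> cells ?J" using v by (auto simp: sk_cells cells_def)
  have "e v = topspace (subtopology X (sk (int (d v)))) - cells ?J"
    using eq cells_disjoint[of ?J v] v cell_subset[OF v] cells_subset[of ?J] by auto
  moreover have "closedin (subtopology X (sk (int (d v)))) (cells ?J)"
    using closedin_cells[OF low] eq by (intro closedin_subset_topspace) auto
  ultimately show ?thesis using openin_diff[OF openin_topspace] by metis
qed

lemma topspace_sk: "topspace (subtopology X (sk p)) = sk p"
  using cells_subset[of "{i \<in> I. int (d i) \<le> p}"] by (auto simp: sk_cells)

lemma char_map_sk:
  assumes v: "v \<in> I" and \<Phi>: "characteristic_map X I e d v \<Phi>" and q: "d v \<le> q"
  shows "continuous_map (unit_ball (d v)) (subtopology X (sk (int q))) \<Phi>" "\<Phi> \<in> unit_ball_boundary (d v) \<rightarrow> sk (int (d v) - 1)"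
proof -
  note c = char_map_image[OF v \<Phi>]
  have "e v \<subseteq> sk (int q)" using v q by (auto simp: skeleton_def)
  moreover have "sk (int (d v) - 1) \<subseteq> sk (int q)" using q by (intro sk_mono) auto
  ultimately show "continuous_map (unit_ball (d v)) (subtopology X (sk (int q))) \<Phi>"
    using c(2,5) by (auto simp: continuous_map_in_subtopology)
  show "\<Phi> \<in> unit_ball_boundary (d v) \<rightarrow> sk (int (d v) - 1)" using c(6) by auto
qed

section \<open>Boundary coefficients read off in the local homology at a point\<close>

abbreviation local_group :: "'i \<Rightarrow> 'a \<Rightarrow> 'a chain set monoid" where
  "local_group v x \<equiv> relative_homology_group (int (d v)) (subtopology X (sk (int (d v)))) (sk (int (d v)) - {x})"

abbreviation localize :: "'i \<Rightarrow> 'a \<Rightarrow> 'a chain set \<Rightarrow> 'a chain set" where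
  "localize v x \<equiv> hom_induced (int (d v)) (subtopology X (sk (int (d v)))) (sk (int (d v) - 1))
     (subtopology X (sk (int (d v)))) (sk (int (d v)) - {x}) id"

lemma cell_notin_lower_sk: "v \<in> I \<Longrightarrow> x \<in> e v \<Longrightarrow> x \<notin> sk (int (d v) - 1)"
  using cell_disjoint by (fastforce simp: skeleton_def)

lemma localize_char:
  assumes v: "v \<in> I" and u: "u \<in> I" "d u = d v" and \<Phi>: "characteristic_map X I e d u \<Phi>" and x: "x \<in> e v"
  shows "localize v x (hom_induced (int (d u)) (unit_ball (d u)) (unit_ball_boundary (d u))
      (subtopology X (sk (int (d u)))) (sk (int (d u) - 1)) \<Phi> g) =
    hom_induced (int (d u)) (unit_ball (d u)) (unit_ball_boundary (d u)) (subtopology X (sk (int (d v)))) (sk (int (d v)) - {x}) \<Phi> g"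
proof -
  have "sk (int (d v) - 1) \<subseteq> sk (int (d v)) - {x}" using sk_mono[of "int (d v) - 1" "int (d v)"] cell_notin_lower_sk[OF v x] by auto
  then have sub: "id \<in> sk (int (d u) - 1) \<rightarrow> sk (int (d v)) - {x}" using u(2) by auto
  have cm: "continuous_map (unit_ball (d u)) (subtopology X (sk (int (d v)))) \<Phi>"
    using char_map_sk(1)[OF u(1) \<Phi>] u(2) by simp
  show ?thesis
    using hom_induced_compose'[OF cm char_map_sk(2)[OF u(1) \<Phi> order_refl] continuous_map_id sub, of "int (d u)" g] u(2)
    by simp
qed

text \<open>The cell is open in the skeleton of its dimension and \<open>x\<close> has a single
  preimage in the closed ball. So the characteristic map induces an isomorphism of local groups, and
  generators go to generators.\<close>

lemma localize_own_cell:
  assumes v: "v \<in> I" and o: "cell_orientation X I e d v a" and x: "x \<in> e v"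
  shows "local_group v x \<cong> integer_group" "localize v x a \<in> carrier (local_group v x)"
    "generate (local_group v x) {localize v x a} = carrier (local_group v x)"
proof -
  let ?Y = "subtopology X (sk (int (d v)))"
  let ?B = "relative_homology_group (int (d v)) (unit_ball (d v)) (unit_ball_boundary (d v))"
  obtain \<Phi> g where \<Phi>: "characteristic_map X I e d v \<Phi>" and g: "g \<in> carrier ?B" "generate ?B {g} = carrier ?B"
    and a: "a = hom_induced (int (d v)) (unit_ball (d v)) (unit_ball_boundary (d v)) ?Y (sk (int (d v) - 1)) \<Phi> g"
    using o unfolding cell_orientation_def by blast
  note c = char_map_image[OF v \<Phi>]
  have "x \<in> \<Phi> ` unit_ball_interior (d v)" unfolding c(1) by (rule x)
  then obtain y where y: "y \<in> unit_ball_interior (d v)" "\<Phi> y = x" by auto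
  have ev: "e v \<subseteq> sk (int (d v))" using v by (auto simp: skeleton_def)
  have uniq: "z = y" if "z \<in> ball_set (d v)" "\<Phi> z = \<Phi> y" for z
  proof -
    have "z \<notin> unit_ball_boundary (d v)" using that y c(6) cell_notin_lower_sk[OF v x] by auto
    then have "z \<in> unit_ball_interior (d v)" using that ball_set_split(1) by blast
    from inj_on_eq_iff[OF c(3) this y(1)] show ?thesis using that(2) by simp
  qed
  have "subtopology ?Y (e v) = subtopology X (e v)" using ev by (simp add: subtopology_subtopology Int_absorb1)
  then have hm: "homeomorphic_map (subtopology (unit_ball (d v)) (unit_ball_interior (d v))) (subtopology ?Y (\<Phi> ` unit_ball_interior (d v))) \<Phi>"
    using c(1,4) by simp
  have op: "openin ?Y (\<Phi> ` unit_ball_interior (d v))" unfolding c(1) by (rule cell_open_in_skeleton[OF v])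
  have cl: "closedin ?Y {\<Phi> y}"
    using closedin_Hausdorff_sing_eq[OF Hausdorff_space_subtopology[OF Hausdorff], of "sk (int (d v))"] y x ev
    unfolding topspace_sk by auto
  have iso: "hom_induced (int (d v)) (unit_ball (d v)) (unit_ball_boundary (d v)) ?Y (sk (int (d v)) - {x}) \<Phi> \<in> iso ?B (local_group v x)"
    using ball_sphere_local_iso[where q="int (d v)", OF char_map_sk(1)[OF v \<Phi> order_refl] op hm y(1) uniq cl]
    unfolding topspace_sk y(2) .
  have la: "localize v x a = hom_induced (int (d v)) (unit_ball (d v)) (unit_ball_boundary (d v)) ?Y (sk (int (d v)) - {x}) \<Phi> g"
    unfolding a by (rule localize_char[OF v v refl \<Phi> x])
  show "localize v x a \<in> carrier (local_group v x)" "generate (local_group v x) {localize v x a} = carrier (local_group v x)"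
    unfolding la using generate_iso_image[OF _ _ iso g] by auto
  have "local_group v x \<cong> ?B" using iso group.iso_sym[of ?B] is_isoI by fastforce
  then show "local_group v x \<cong> integer_group" using relative_homology_ball_sphere iso_trans by blast
qed

text \<open>The induced map factors through the pair of \<open>T\<close> and \<open>T\<close>, whose
  relative homology vanishes.\<close>

lemma hom_induced_into_subspace:
  assumes f: "continuous_map D Y f" and im: "f \<in> topspace D \<rightarrow> T" and T: "T \<subseteq> topspace Y"
  shows "hom_induced p D S Y T f c = \<one>\<^bsub>relative_homology_group p Y T\<^esub>"
\<comment> \<open>Outside the carrier \<open>hom_induced\<close> takes the neutral element as its
  default value.\<close>
proof (cases "c \<in> carrier (relative_homology_group p D S)")
  case True
  let ?T = "subtopology Y T"
  have S: "hom_induced p D (topspace D \<inter> S) Y T f = hom_induced p D S Y T f"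
    using hom_induced_restrict[of p D S Y T] hom_induced_restrict[of p D "topspace D \<inter> S" Y T] by simp
  have fT: "continuous_map D ?T f" using f im by (auto simp: continuous_map_in_subtopology)
  have top: "topspace ?T = T" using T by auto
  have "hom_induced p D (topspace D \<inter> S) Y T f c = hom_induced p ?T T Y T id (hom_induced p D (topspace D \<inter> S) ?T T f c)"
    using hom_induced_compose'[OF fT, of "topspace D \<inter> S" T Y id T p c] im
    by (auto simp: continuous_map_from_subtopology)
  moreover have "hom_induced p D (topspace D \<inter> S) ?T T f c \<in> carrier (relative_homology_group p ?T T)"
    by (rule hom_induced_carrier)
  moreover have "trivial_group (relative_homology_group p ?T T)"
    using trivial_relative_homology_group_topspace[of p ?T] top by simp
  ultimately have "hom_induced p D (topspace D \<inter> S) Y T f c = hom_induced p ?T T Y T id \<one>\<^bsub>relative_homology_group p ?T T\<^esub>"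
    by (auto simp: trivial_group_def)
  then show ?thesis unfolding S using hom_one[OF hom_induced_hom] by (metis group_relative_homology_group)
qed (simp add: hom_induced_default)

text \<open>The closed cell of \<open>u\<close> misses \<open>x\<close>, because cells are disjoint
  and its boundary has smaller dimension; so its class is carried by the complement of
  \<open>x\<close>.\<close>

lemma localize_other_cell:
  assumes v: "v \<in> I" and u: "u \<in> I" "d u = d v" "u \<noteq> v" and o: "cell_orientation X I e d u a" and x: "x \<in> e v"
  shows "localize v x a = \<one>\<^bsub>local_group v x\<^esub>"
proof -
  let ?Y = "subtopology X (sk (int (d v)))"
  obtain \<Phi> g where \<Phi>: "characteristic_map X I e d u \<Phi>"
    and a: "a = hom_induced (int (d u)) (unit_ball (d u)) (unit_ball_boundary (d u)) (subtopology X (sk (int (d u)))) (sk (int (d u) - 1)) \<Phi> g"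
    using o unfolding cell_orientation_def by blast
  note c = char_map_image[OF u(1) \<Phi>]
  have "x \<notin> e u" using cell_disjoint v u x by blast
  moreover have "x \<notin> sk (int (d u) - 1)" using cell_notin_lower_sk[OF v x] u(2) by simp
  ultimately have nx: "x \<notin> \<Phi> ` ball_set (d u)" using c(2) by blast
  have cm: "continuous_map (unit_ball (d u)) ?Y \<Phi>" using char_map_sk(1)[OF u(1) \<Phi>] u(2) by simp
  then have "\<Phi> \<in> ball_set (d u) \<rightarrow> sk (int (d v))" using topspace_sk by (auto simp: continuous_map_def)
  then have "\<Phi> \<in> topspace (unit_ball (d u)) \<rightarrow> sk (int (d v)) - {x}" using nx by auto
  then show ?thesis unfolding a localize_char[OF v u(1,2) \<Phi> x]
    using hom_induced_into_subspace[OF cm] topspace_sk u(2) by (metis Diff_subset)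
qed

lemma hom_finprod_single:
  assumes h: "h \<in> hom G H" and G: "comm_group G" and H: "group H" and fin: "finite J" and v: "v \<in> J"
    and f: "\<And>j. j \<in> J \<Longrightarrow> f j \<in> carrier G" and triv: "\<And>j. j \<in> J \<Longrightarrow> j \<noteq> v \<Longrightarrow> h (f j) = \<one>\<^bsub>H\<^esub>"
  shows "h (finprod G f J) = h (f v)"
proof -
  interpret G: comm_group G by (rule G)
  interpret H: group H by (rule H)
  interpret group_hom G H h using h by unfold_locales
  have *: "h (finprod G f K) = \<one>\<^bsub>H\<^esub>" if "finite K" "K \<subseteq> J - {v}" for K
    using that
  proof (induction K rule: finite_induct)
    case (insert a K)
    then have "finprod G f (insert a K) = f a \<otimes>\<^bsub>G\<^esub> finprod G f K" using f by (intro G.finprod_insert) auto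
    moreover have "finprod G f K \<in> carrier G" using insert f by (intro G.finprod_closed) auto
    ultimately show ?case using insert f triv by auto
  qed simp
  have "finprod G f (insert v (J - {v})) = f v \<otimes>\<^bsub>G\<^esub> finprod G f (J - {v})"
    using f v fin by (intro G.finprod_insert) auto
  moreover have "finprod G f (J - {v}) \<in> carrier G" using f by (intro G.finprod_closed) auto
  ultimately show ?thesis using *[of "J - {v}"] fin v f by (auto simp: insert_absorb)
qed

text \<open>The cells of dimension \<open>q\<close> are attached one at a time to the lower
  skeleton; modulo the previous stage, each attachment adds only powers of the new oriented cell.
  This supplies the family of coefficients whose existence \<open>incidence_number\<close>
  presupposes.\<close>

lemma chain_group_generated:
  assumes o: "\<forall>u\<in>I. cell_orientation X I e d u (\<omega> u)"
    and z: "z \<in> carrier (cellular_chain_group X I e d (int q))"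
  shows "\<exists>c. z = finprod (cellular_chain_group X I e d (int q))
    (\<lambda>j. \<omega> j [^]\<^bsub>cellular_chain_group X I e d (int q)\<^esub> (c j :: int)) {j \<in> I. int (d j) = int q}"
proof -
  let ?Y = "subtopology X (sk (int q))" and ?A = "sk (int q - 1)"
  let ?L = "{i \<in> I. int (d i) \<le> int q - 1}"
  let ?C = "relative_homology_group (int q) ?Y ?A"
  have C: "cellular_chain_group X I e d (int q) = ?C" by (simp add: cellular_chain_group_def)
  interpret C: comm_group ?C by simp
  have ocar: "\<omega> j \<in> carrier ?C" if j: "j \<in> I" "d j = q" for j
  proof -
    obtain \<Phi> g where "\<omega> j = hom_induced (int q) (unit_ball q) (unit_ball_boundary q) ?Y ?A \<Phi> g"
      using bspec[OF o j(1)] unfolding cell_orientation_def j(2) by blast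
    then show ?thesis by (simp add: hom_induced_carrier)
  qed
  have main: "\<exists>c. hom_induced (int q) (subtopology X (cells (J \<union> ?L))) ?A ?Y ?A id z = finprod ?C (\<lambda>j. \<omega> j [^]\<^bsub>?C\<^esub> (c j :: int)) J"
    if "finite J" "J \<subseteq> {j \<in> I. d j = q}" "z \<in> carrier (relative_homology_group (int q) (subtopology X (cells (J \<union> ?L))) ?A)" for J z
    using that
  proof (induction J arbitrary: z rule: finite_induct)
    case empty
    have "cells ({} \<union> ?L) = ?A" by (simp add: sk_cells)
    then have "trivial_group (relative_homology_group (int q) (subtopology X (cells ({} \<union> ?L))) ?A)"
      using trivial_relative_homology_group_topspace[of "int q" "subtopology X ?A"] topspace_sk[of "int q - 1"] by simp
    then have "z = \<one>\<^bsub>relative_homology_group (int q) (subtopology X (cells ({} \<union> ?L))) ?A\<^esub>"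
      using empty by (auto simp: trivial_group_def)
    then show ?case using hom_one[OF hom_induced_hom] by (simp del: one_relative_homology_group)
  next
    case (insert i J)
    let ?J = "J \<union> ?L"
    let ?Z = "subtopology X (cells (insert i ?J))" and ?Z' = "subtopology X (cells ?J)"
    let ?G = "relative_homology_group (int q) ?Z ?A"
    interpret G: comm_group ?G by simp
    have i: "i \<in> I" "d i = q" "i \<notin> ?J" using insert by auto
    have low: "lower ?J" using insert.prems(1) by (auto simp: lower_def)
    have lowi: "j \<in> ?J" if "j \<in> I" "d j < d i" for j using that i by auto
    obtain \<Phi> g where \<Phi>: "characteristic_map X I e d i \<Phi>"
      and g: "g \<in> carrier (relative_homology_group (int q) (unit_ball q) (unit_ball_boundary q))"
      "generate (relative_homology_group (int q) (unit_ball q) (unit_ball_boundary q)) {g} = carrier (relative_homology_group (int q) (unit_ball q) (unit_ball_boundary q))"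
      and om: "\<omega> i = hom_induced (int q) (unit_ball q) (unit_ball_boundary q) ?Y ?A \<Phi> g"
      using bspec[OF o i(1)] unfolding cell_orientation_def i(2) by blast
    note at = attach[OF low i(1,3) lowi \<Phi>, unfolded i(2)]
    have iso: "hom_induced (int q) (unit_ball q) (unit_ball_boundary q) ?Z (cells ?J) \<Phi> \<in>
        iso (relative_homology_group (int q) (unit_ball q) (unit_ball_boundary q)) (relative_homology_group (int q) ?Z (cells ?J))"
      by (rule cell_attach_iso[OF at])
    define b where "b = hom_induced (int q) (unit_ball q) (unit_ball_boundary q) ?Z ?A \<Phi> g"
    have bd: "\<Phi> \<in> unit_ball_boundary q \<rightarrow> ?A" using char_map_image(6)[OF i(1) \<Phi>] i(2) by auto
    have AJ: "?A \<subseteq> cells ?J" by (auto simp: sk_cells cells_def)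
    have bG: "b \<in> carrier ?G" unfolding b_def by (rule hom_induced_carrier)
    let ?r = "hom_induced (int q) ?Z ?A ?Z (cells ?J) id"
    have rb: "?r b = hom_induced (int q) (unit_ball q) (unit_ball_boundary q) ?Z (cells ?J) \<Phi> g"
    proof -
      have "id \<in> ?A \<rightarrow> cells ?J" using AJ by auto
      from hom_induced_compose'[OF at(3) bd continuous_map_id this, of "int q" g] show ?thesis
        unfolding b_def by (simp only: id_comp)
    qed
    let ?R = "relative_homology_group (int q) ?Z (cells ?J)"
    interpret R: group ?R by simp
    have "generate ?R {?r b} = carrier ?R" and rbc: "?r b \<in> carrier ?R"
      unfolding rb using generate_iso_image[OF _ _ iso g] by auto
    moreover have "?r z \<in> carrier ?R" by (rule hom_induced_carrier)
    ultimately obtain m :: int where m: "?r z = ?r b [^]\<^bsub>?R\<^esub> m" using R.generate_pow[OF rbc] by auto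
    have zG: "z \<in> carrier ?G" using insert.prems(2) by simp
    have rhom: "?r \<in> hom ?G ?R" by (rule hom_induced_hom)
    obtain z' where zker: "z' \<in> kernel ?G ?R ?r" and zz: "z = z' \<otimes>\<^bsub>?G\<^esub> b [^]\<^bsub>?G\<^esub> m"
      using split_off_power[OF G.is_group R.is_group rhom zG bG m] by blast
    have z'G: "z' \<in> carrier ?G" using zker by (simp only: kernel_def mem_Collect_eq)
    \<comment> \<open>By exactness the kernel is the image of the previous stage, to which the
      induction hypothesis applies.\<close>
    have "kernel ?G ?R ?r = hom_induced (int q) (subtopology ?Z (cells ?J)) ?A ?Z ?A id ` carrier (relative_homology_group (int q) (subtopology ?Z (cells ?J)) ?A)"
      using homology_exactness_triple_3[OF AJ, of "int q" ?Z] by simp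
    moreover have sub: "subtopology ?Z (cells ?J) = ?Z'" by (simp add: subtopology_subtopology cells_insert Int_absorb1)
    ultimately obtain y where y: "y \<in> carrier (relative_homology_group (int q) ?Z' ?A)" "z' = hom_induced (int q) ?Z' ?A ?Z ?A id y"
      using zker by auto
    have Jsub: "J \<subseteq> {j \<in> I. d j = q}" using insert.prems(1) by blast
    obtain c where c: "hom_induced (int q) ?Z' ?A ?Y ?A id y = finprod ?C (\<lambda>j. \<omega> j [^]\<^bsub>?C\<^esub> (c j :: int)) J"
      using insert.IH[OF Jsub y(1)] by (elim exE) (rule that)
    let ?j = "hom_induced (int q) ?Z ?A ?Y ?A id"
    have "insert i ?J \<subseteq> {i \<in> I. int (d i) \<le> int q}" using insert.prems(1) by auto
    then have ZY: "cells (insert i ?J) \<subseteq> sk (int q)" unfolding sk_cells cells_def by blast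
    have cmZ: "continuous_map ?Z ?Y id"
      using ZY by (auto simp: continuous_map_in_subtopology continuous_map_from_subtopology)
    have cmZ': "continuous_map ?Z' ?Z id"
      by (auto simp: continuous_map_in_subtopology continuous_map_from_subtopology cells_insert)
    have idA: "id \<in> ?A \<rightarrow> ?A" by auto
    have jb: "?j b = \<omega> i"
      using hom_induced_compose'[OF at(3) bd cmZ idA, of "int q" g] unfolding b_def om by (simp only: id_comp)
    have jy: "?j z' = hom_induced (int q) ?Z' ?A ?Y ?A id y"
      using hom_induced_compose'[OF cmZ' idA cmZ idA, of "int q" y] unfolding y(2) by (simp only: id_comp)
    have ocJ: "\<omega> j [^]\<^bsub>?C\<^esub> (n :: int) \<in> carrier ?C" if "j \<in> insert i J" for j n
      by (rule C.int_pow_closed[OF ocar]) (use that insert.prems(1) in auto)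
    have jhom: "?j \<in> hom ?G ?C" by (rule hom_induced_hom)
    have "?j z = ?j z' \<otimes>\<^bsub>?C\<^esub> \<omega> i [^]\<^bsub>?C\<^esub> m"
      unfolding zz hom_mult_power[OF G.is_group C.is_group jhom z'G bG] jb ..
    also have "\<dots> = \<omega> i [^]\<^bsub>?C\<^esub> m \<otimes>\<^bsub>?C\<^esub> finprod ?C (\<lambda>j. \<omega> j [^]\<^bsub>?C\<^esub> (c j :: int)) J"
      unfolding jy c by (rule C.m_comm[OF C.finprod_closed[OF Pi_I[OF ocJ]] ocJ]) auto
    also have "\<dots> = finprod ?C (\<lambda>j. \<omega> j [^]\<^bsub>?C\<^esub> ((c(i := m)) j :: int)) (insert i J)"
    proof -
      have "finprod ?C (\<lambda>j. \<omega> j [^]\<^bsub>?C\<^esub> ((c(i := m)) j :: int)) (insert i J) =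
          \<omega> i [^]\<^bsub>?C\<^esub> m \<otimes>\<^bsub>?C\<^esub> finprod ?C (\<lambda>j. \<omega> j [^]\<^bsub>?C\<^esub> ((c(i := m)) j :: int)) J"
      proof -
        have 1: "(\<lambda>j. \<omega> j [^]\<^bsub>?C\<^esub> ((c(i := m)) j :: int)) \<in> J \<rightarrow> carrier ?C" by (intro Pi_I ocJ) simp
        have 2: "\<omega> i [^]\<^bsub>?C\<^esub> ((c(i := m)) i :: int) \<in> carrier ?C" by (intro ocJ) simp
        from C.finprod_insert[OF insert.hyps 1 2] show ?thesis by (simp only: fun_upd_same)
      qed
      moreover have "finprod ?C (\<lambda>j. \<omega> j [^]\<^bsub>?C\<^esub> ((c(i := m)) j :: int)) J = finprod ?C (\<lambda>j. \<omega> j [^]\<^bsub>?C\<^esub> (c j :: int)) J"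
        by (rule C.finprod_cong'[OF refl Pi_I[OF ocJ]]) (use insert.hyps in auto)
      ultimately show ?thesis by simp
    qed
    finally have F: "?j z = finprod ?C (\<lambda>j. \<omega> j [^]\<^bsub>?C\<^esub> ((c(i := m)) j :: int)) (insert i J)" .
    show ?case unfolding Un_insert_left by (rule exI, rule F)
  qed
  let ?J = "{j \<in> I. d j = q}"
  have "?J \<union> ?L = {i \<in> I. int (d i) \<le> int q}" by auto
  then have cu: "cells (?J \<union> ?L) = sk (int q)" by (simp only: sk_cells)
  have fin: "finite ?J" using finite_cells by simp
  have zc: "z \<in> carrier (relative_homology_group (int q) (subtopology X (cells (?J \<union> ?L))) ?A)"
    using z unfolding C cu .
  obtain c where c: "hom_induced (int q) ?Y ?A ?Y ?A id z = finprod ?C (\<lambda>j. \<omega> j [^]\<^bsub>?C\<^esub> (c j :: int)) ?J"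
    using main[OF fin subset_refl zc] unfolding cu by (elim exE) (rule that)
  have Jeq: "{j \<in> I. int (d j) = int q} = ?J" by auto
  show ?thesis unfolding C Jeq
    by (rule exI[of _ c]) (use c hom_induced_id[OF z[unfolded C]] in \<open>simp only:\<close>)
qed

text \<open>At a point of the cell \<open>v\<close> all summands of the boundary except that of
  \<open>v\<close> become trivial.\<close>

lemma localize_boundary_coefficient:
  assumes o: "\<forall>u\<in>I. cell_orientation X I e d u (\<omega> u)" and v: "v \<in> I" and w: "w \<in> I" "d w = Suc (d v)"
    and x: "x \<in> e v" and c: "boundary_coefficients X I e d \<omega> w c"
  shows "localize v x (cellular_boundary X I e d (int (d w)) (\<omega> w)) = localize v x (\<omega> v) [^]\<^bsub>local_group v x\<^esub> c v"
proof -
  let ?C = "cellular_chain_group X I e d (int (d v))"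
  have iw: "int (d w) - 1 = int (d v)" using w by simp
  have Cg: "comm_group ?C" by (simp add: cellular_chain_group_def)
  have Lg: "group (local_group v x)" by simp
  have hom: "localize v x \<in> hom ?C (local_group v x)" unfolding cellular_chain_group_def by (rule hom_induced_hom)
  have ocar: "\<omega> j \<in> carrier ?C" if j: "j \<in> I" "d j = d v" for j
  proof -
    obtain \<Phi> g where "\<omega> j = hom_induced (int (d v)) (unit_ball (d v)) (unit_ball_boundary (d v))
        (subtopology X (sk (int (d v)))) (sk (int (d v) - 1)) \<Phi> g"
      using bspec[OF o j(1)] unfolding cell_orientation_def j(2) by blast
    then show ?thesis by (simp add: hom_induced_carrier cellular_chain_group_def)
  qed
  have pw: "localize v x (\<omega> j [^]\<^bsub>?C\<^esub> c j) = localize v x (\<omega> j) [^]\<^bsub>local_group v x\<^esub> c j" if "j \<in> I" "d j = d v" for j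
    by (rule Group.hom_int_pow[OF hom ocar[OF that] comm_group.axioms(2)[OF Cg] Lg])
  have "cellular_boundary X I e d (int (d w)) (\<omega> w) = finprod ?C (\<lambda>j. \<omega> j [^]\<^bsub>?C\<^esub> c j) {j \<in> I. int (d j) = int (d v)}"
    using c unfolding boundary_coefficients_def iw .
  then have "localize v x (cellular_boundary X I e d (int (d w)) (\<omega> w)) = localize v x (\<omega> v [^]\<^bsub>?C\<^esub> c v)"
  proof (rule ssubst, intro hom_finprod_single[OF hom Cg Lg])
    show "finite {j \<in> I. int (d j) = int (d v)}" using finite_cells by simp
    show "\<omega> j [^]\<^bsub>?C\<^esub> c j \<in> carrier ?C" if "j \<in> {j \<in> I. int (d j) = int (d v)}" for j
      using group.int_pow_closed[OF comm_group.axioms(2)[OF Cg] ocar] that by auto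
    show "localize v x (\<omega> j [^]\<^bsub>?C\<^esub> c j) = \<one>\<^bsub>local_group v x\<^esub>"
      if "j \<in> {j \<in> I. int (d j) = int (d v)}" "j \<noteq> v" for j
    proof -
      have j: "j \<in> I" "d j = d v" using that by auto
      show ?thesis unfolding pw[OF j] localize_other_cell[OF v j that(2) bspec[OF o j(1)] x] by (rule group.int_pow_one[OF Lg])
    qed
  qed (use v in auto)
  then show ?thesis using pw[OF v refl] by (simp only:)
qed

text \<open>The local group is infinite cyclic and generated by the localized orientation of
  \<open>v\<close>, so exponents are unique; this justifies the definite description in
  \<open>incidence_number\<close>. A power of a generator which generates again has exponent 1 or
  -1.\<close>

lemma incidence_number_from_local:
  assumes o: "\<forall>u\<in>I. cell_orientation X I e d u (\<omega> u)" and v: "v \<in> I" and w: "w \<in> I" "d w = Suc (d v)"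
    and x: "x \<in> e v"
    and loc: "localize v x (cellular_boundary X I e d (int (d w)) (\<omega> w)) = \<one>\<^bsub>local_group v x\<^esub> \<or>
      generate (local_group v x) {localize v x (cellular_boundary X I e d (int (d w)) (\<omega> w))} = carrier (local_group v x)"
  shows "incidence_number X I e d \<omega> w v \<in> {0, 1, -1}"
proof -
  let ?G = "local_group v x" and ?a = "localize v x (\<omega> v)"
  note gen = localize_own_cell[OF v bspec[OF o v] x]
  have G: "group ?G" by simp
  note coeff = localize_boundary_coefficient[OF o v w x]
  have iw: "int (d w) - 1 = int (d v)" using w by simp
  have "cellular_boundary X I e d (int (d w)) (\<omega> w) \<in> carrier (cellular_chain_group X I e d (int (d v)))"
  proof -
    have "sk (int (d w) - 1) \<subseteq> sk (int (d w))" by (rule sk_mono) simp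
    then have "subtopology (subtopology X (sk (int (d w)))) (sk (int (d w) - 1)) = subtopology X (sk (int (d v)))"
      unfolding subtopology_subtopology iw by (simp add: Int_absorb1)
    moreover have "int (d w) - 2 = int (d v) - 1" using w by simp
    ultimately show ?thesis
      using hom_relboundary[of "int (d w)" "subtopology X (sk (int (d w)))" "sk (int (d w) - 1)" "sk (int (d w) - 2)" "\<omega> w"]
      unfolding cellular_boundary_def cellular_chain_group_def by (simp only: iw)
  qed
  from chain_group_generated[OF o this] obtain c where
    "cellular_boundary X I e d (int (d w)) (\<omega> w) = finprod (cellular_chain_group X I e d (int (d v)))
      (\<lambda>j. \<omega> j [^]\<^bsub>cellular_chain_group X I e d (int (d v))\<^esub> (c j :: int)) {j \<in> I. int (d j) = int (d v)}" by blast
  then have c: "boundary_coefficients X I e d \<omega> w c" unfolding boundary_coefficients_def iw .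
  have "incidence_number X I e d \<omega> w v = c v"
    unfolding incidence_number_def
  proof (rule the_equality)
    show "\<exists>c'. boundary_coefficients X I e d \<omega> w c' \<and> c' v = c v" using c by blast
    fix m assume "\<exists>c. boundary_coefficients X I e d \<omega> w c \<and> c v = m"
    then obtain c' where c': "boundary_coefficients X I e d \<omega> w c'" "c' v = m" by blast
    have "?a [^]\<^bsub>?G\<^esub> c' v = ?a [^]\<^bsub>?G\<^esub> c v" using coeff[OF c] coeff[OF c'(1)] by (simp only:)
    then show "m = c v" using infinite_cyclic_pow_inject[OF G gen] c'(2) by blast
  qed
  moreover have "c v \<in> {0, 1, -1}"
    using loc
  proof
    assume "localize v x (cellular_boundary X I e d (int (d w)) (\<omega> w)) = \<one>\<^bsub>?G\<^esub>"
    then have "?a [^]\<^bsub>?G\<^esub> c v = ?a [^]\<^bsub>?G\<^esub> (0 :: int)" unfolding coeff[OF c] by (simp only: int_pow_0)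
    then show ?thesis using infinite_cyclic_pow_inject[OF G gen] by blast
  next
    assume "generate ?G {localize v x (cellular_boundary X I e d (int (d w)) (\<omega> w))} = carrier ?G"
    then have "generate ?G {?a [^]\<^bsub>?G\<^esub> c v} = carrier ?G" unfolding coeff[OF c] .
    then show ?thesis using infinite_cyclic_generator_pow[OF G gen] by blast
  qed
  ultimately show ?thesis by simp
qed

text \<open>By naturality of the connecting map, localizing the boundary amounts to replacing the
  smallest space of the triple by the complement of \<open>x\<close> in the skeleton of dimension
  \<open>d v\<close>.\<close>

lemma localize_boundary:
  assumes v: "v \<in> I" and w: "w \<in> I" "d w = Suc (d v)" and x: "x \<in> e v"
    and a: "a \<in> carrier (relative_homology_group (int (d w)) (subtopology X (sk (int (d w)))) (sk (int (d v))))"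
  shows "localize v x (cellular_boundary X I e d (int (d w)) a) =
    hom_relboundary (int (d w)) (subtopology X (sk (int (d w)))) (sk (int (d v))) (sk (int (d v)) - {x}) a"
proof -
  let ?Y = "subtopology X (sk (int (d w)))"
  have iw: "int (d w) - 1 = int (d v)" "int (d w) - 2 = int (d v) - 1" using w by simp_all
  have "sk (int (d v)) \<subseteq> sk (int (d w))" by (rule sk_mono) (use w in simp)
  then have sub: "subtopology ?Y (sk (int (d v))) = subtopology X (sk (int (d v)))"
    unfolding subtopology_subtopology by (simp add: Int_absorb1)
  have "sk (int (d v) - 1) \<subseteq> sk (int (d v)) - {x}" using sk_mono[of "int (d v) - 1" "int (d v)"] cell_notin_lower_sk[OF v x] by auto
  then have m: "id \<in> sk (int (d v) - 1) \<rightarrow> sk (int (d v)) - {x}" by auto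
  have m2: "id \<in> sk (int (d v)) \<rightarrow> sk (int (d v))" by auto
  from fun_cong[OF naturality_hom_induced_relboundary[OF continuous_map_id m2 m, of "int (d w)"], of ?Y a]
  have "hom_relboundary (int (d w)) ?Y (sk (int (d v))) (sk (int (d v)) - {x}) (hom_induced (int (d w)) ?Y (sk (int (d v))) ?Y (sk (int (d v))) id a) =
     localize v x (hom_relboundary (int (d w)) ?Y (sk (int (d v))) (sk (int (d v) - 1)) a)"
    unfolding iw sub comp_apply .
  then show ?thesis unfolding hom_induced_id[OF a] cellular_boundary_def iw ..
qed

lemma ball_interior_dense:
  assumes x: "x \<in> ball_set p" and U: "openin (unit_ball p) U" "x \<in> U"
  shows "\<exists>y\<in>U. y \<in> unit_ball_interior p"
proof -
  let ?h = "\<lambda>t::real. \<lambda>i. (1 - t) * x i"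
  have cont: "continuous_on {0..1} ?h"
    by (intro continuous_on_coordinatewise_then_product continuous_intros)
  have h0: "?h 0 = x" by simp
  have int: "?h t \<in> unit_ball_interior p" if "0 < t" "t \<le> 1" for t
  proof -
    have "(\<Sum>i<p. ((1 - t) * x i)\<^sup>2) = (1 - t)\<^sup>2 * (\<Sum>i<p. (x i)\<^sup>2)"
      by (simp add: power_mult_distrib sum_distrib_left)
    also have "\<dots> \<le> (1 - t)\<^sup>2 * 1" using x by (intro mult_left_mono) (auto simp: ball_set_def)
    also have "\<dots> < 1" using that by (simp add: abs_square_less_1)
    finally show ?thesis using x by (simp add: unit_ball_interior_eq ball_set_def)
  qed
  obtain T where T: "open T" "U = ball_set p \<inter> T" using U(1) by (auto simp: unit_ball_top_of_set openin_open)
  have "x \<in> T" using U T by blast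
  have "\<exists>A. open A \<and> A \<inter> {0..1} = ?h -` T \<inter> {0..1}"
    using cont T(1) unfolding continuous_on_open_invariant by blast
  then obtain A where A: "open A" "A \<inter> {0..1} = ?h -` T \<inter> {0..1}" by blast
  have "0 \<in> ?h -` T \<inter> {0..1}" using h0 \<open>x \<in> T\<close> by simp
  then have "0 \<in> A" using A(2) by blast
  then obtain \<epsilon> where \<epsilon>: "\<epsilon> > 0" "ball 0 \<epsilon> \<subseteq> A" using A(1) open_contains_ball by metis
  define t where "t = min (\<epsilon>/2) 1"
  have t: "0 < t" "t \<le> 1" "t < \<epsilon>" using \<epsilon> by (auto simp: t_def)
  then have "t \<in> A \<inter> {0..1}" using \<epsilon>(2) by (auto simp: dist_real_def)
  then have "?h t \<in> T" using A(2) by blast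
  moreover have "?h t \<in> unit_ball_interior p" using int t by blast
  ultimately show ?thesis using T(2) ball_set_split(1) by blast
qed

lemma closed_cell_subset_closure:
  assumes w: "w \<in> I" and \<Phi>: "characteristic_map X I e d w \<Phi>"
  shows "\<Phi> ` ball_set (d w) \<subseteq> X closure_of e w"
proof
  fix z assume "z \<in> \<Phi> ` ball_set (d w)"
  then obtain y where y: "y \<in> ball_set (d w)" "z = \<Phi> y" by blast
  note c = char_map_image[OF w \<Phi>]
  have zX: "z \<in> topspace X" using c(5) y by (auto simp: continuous_map_def)
  show "z \<in> X closure_of e w"
    unfolding in_closure_of
  proof (intro conjI allI impI)
    fix T assume T: "z \<in> T \<and> openin X T"
    have "openin (unit_ball (d w)) {x \<in> topspace (unit_ball (d w)). \<Phi> x \<in> T}"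
      using c(5) T openin_continuous_map_preimage by blast
    from ball_interior_dense[OF y(1) this] obtain u where "u \<in> unit_ball_interior (d w)" "\<Phi> u \<in> T"
      using y T by auto
    then show "\<exists>y. y \<in> e w \<and> y \<in> T" using c(1) by blast
  qed (rule zX)
qed

text \<open>The boundary of the class is carried by the image of the sphere under the characteristic
  map, and this image misses \<open>x\<close>.\<close>

lemma localize_boundary_away:
  assumes v: "v \<in> I" and w: "w \<in> I" "d w = Suc (d v)" and x: "x \<in> e v"
    and o: "cell_orientation X I e d w a" and away: "x \<notin> X closure_of e w"
  shows "localize v x (cellular_boundary X I e d (int (d w)) a) = \<one>\<^bsub>local_group v x\<^esub>"
proof -
  let ?Y = "subtopology X (sk (int (d w)))" and ?K = "sk (int (d v))" and ?p = "int (d w)"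
  have iw: "int (d w) - 1 = int (d v)" using w by simp
  obtain \<Phi> g where \<Phi>: "characteristic_map X I e d w \<Phi>"
    and a: "a = hom_induced ?p (unit_ball (d w)) (unit_ball_boundary (d w)) ?Y ?K \<Phi> g"
    using o unfolding cell_orientation_def iw by blast
  have aC: "a \<in> carrier (relative_homology_group ?p ?Y ?K)" unfolding a by (rule hom_induced_carrier)
  have nx: "x \<notin> \<Phi> ` ball_set (d w)" using closed_cell_subset_closure[OF w(1) \<Phi>] away by blast
  note cm = char_map_sk[OF w(1) \<Phi> order_refl, unfolded iw]
  have "?K \<subseteq> sk (int (d w))" by (rule sk_mono) (use w in simp)
  then have sub: "subtopology ?Y ?K = subtopology X ?K"
    unfolding subtopology_subtopology by (simp add: Int_absorb1)
  from fun_cong[OF naturality_hom_induced_relboundary[OF cm, of "{}" "?K - {x}" ?p], of g]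
  have "hom_relboundary ?p ?Y ?K (?K - {x}) a =
     hom_induced (int (d v)) (subtopology (unit_ball (d w)) (unit_ball_boundary (d w))) {} (subtopology X ?K) (?K - {x}) \<Phi>
       (hom_relboundary ?p (unit_ball (d w)) (unit_ball_boundary (d w)) {} g)"
    unfolding a iw sub comp_apply by simp
  also have "\<dots> = \<one>\<^bsub>local_group v x\<^esub>"
  proof (rule hom_induced_into_subspace)
    have bs: "unit_ball_boundary (d w) \<subseteq> ball_set (d w)" using ball_set_split by blast
    show "continuous_map (subtopology (unit_ball (d w)) (unit_ball_boundary (d w))) (subtopology X ?K) \<Phi>"
      using cm char_map_image(5)[OF w(1) \<Phi>] by (auto simp: continuous_map_in_subtopology continuous_map_from_subtopology)
    show "\<Phi> \<in> topspace (subtopology (unit_ball (d w)) (unit_ball_boundary (d w))) \<rightarrow> ?K - {x}"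
      using cm(2) nx bs by auto
    show "?K - {x} \<subseteq> topspace (subtopology X ?K)" using topspace_sk by blast
  qed
  finally show ?thesis using localize_boundary[OF v w x aC] by simp
qed

end

section \<open>Half-ball charts and the local coefficient\<close>

lemma generate_surj_image:
  assumes "group G" "group H" "f \<in> hom G H" "f ` carrier G = carrier H" "g \<in> carrier G" "generate G {g} = carrier G"
  shows "generate H {f g} = carrier H"
proof -
  interpret group_hom G H f using assms by (simp add: group_hom_def group_hom_axioms_def)
  have "generate H (f ` {g}) = f ` generate G {g}" by (rule generate_img) (use assms in auto)
  then show ?thesis using assms by simp
qed

lemma generate_iso_reflect:
  assumes "group G" "group H" "f \<in> iso G H" "g \<in> carrier G" "generate H {f g} = carrier H"
  shows "generate G {g} = carrier G"
proof -
  interpret group_hom G H f using assms by (simp add: group_hom_def group_hom_axioms_def iso_def)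
  have inj: "inj_on f (carrier G)" "f ` carrier G = carrier H" using assms(3) by (auto simp: iso_def bij_betw_def)
  have "f ` generate G {g} = f ` carrier G"
    using generate_img[of "{g}"] assms inj by simp
  moreover have "generate G {g} \<subseteq> carrier G" using assms G.generate_incl by auto
  ultimately show ?thesis using inj_on_image_eq_iff[OF inj(1)] by blast
qed

text \<open>The point which a half-ball chart sends to the base point. The hemisphere around it is
  given by \<open>y 0 < 0\<close>.\<close>

definition south_pole :: "nat \<Rightarrow> real" where "south_pole = (\<lambda>i. if i = 0 then -1 else 0)"

lemma south_pole_boundary: "0 < p \<Longrightarrow> south_pole \<in> unit_ball_boundary p"
proof -
  assume p: "0 < p"
  have "(\<Sum>i<p. (south_pole i)\<^sup>2) = (\<Sum>i<p. if i = 0 then 1 else 0)"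
    by (rule sum.cong) (auto simp: south_pole_def)
  then show ?thesis using p by (auto simp: unit_ball_boundary_eq south_pole_def)
qed

context cell_structure begin

text \<open>A half-space chart modelled on the whole closed ball, so that the pair of ball and
  sphere can be compared directly with a characteristic map. Only the open southern hemisphere must
  go to the cell \<open>v\<close>; the rest of the sphere may go anywhere in the union of the two
  cells.\<close>

definition half_chart :: "'i \<Rightarrow> 'i \<Rightarrow> 'a \<Rightarrow> ((nat \<Rightarrow> real) \<Rightarrow> 'a) \<Rightarrow> bool" where
  "half_chart v w x f \<longleftrightarrow> continuous_map (unit_ball (d w)) X f \<and> inj_on f (ball_set (d w)) \<and>
    f ` unit_ball_interior (d w) \<subseteq> e w \<and> f ` ball_set (d w) \<subseteq> e v \<union> e w \<and>
    (\<forall>y\<in>unit_ball_boundary (d w). y 0 < 0 \<longrightarrow> f y \<in> e v) \<and> f south_pole = x \<and>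
    (\<exists>U. openin X U \<and> x \<in> U \<and> U \<inter> (e v \<union> e w) \<subseteq> f ` ball_set (d w))"

text \<open>Invariance of domain in the coordinates of a characteristic map.\<close>

lemma open_in_cell:
  assumes w: "w \<in> I" and f: "continuous_map (unit_ball (d w)) X f" "inj_on f (ball_set (d w))" "f ` unit_ball_interior (d w) \<subseteq> e w"
  shows "openin (subtopology X (e w)) (f ` unit_ball_interior (d w))"
proof -
  let ?p = "d w" let ?i = "unit_ball_interior ?p"
  obtain \<Phi> where \<Phi>: "characteristic_map X I e d w \<Phi>" using cell_char[OF w] by blast
  note c = char_map_image[OF w \<Phi>]
  have sub: "?i \<subseteq> ball_set ?p" using ball_set_split by blast
  obtain \<psi> where hm: "homeomorphic_maps (subtopology (unit_ball ?p) ?i) (subtopology X (e w)) \<Phi> \<psi>"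
    using c(4) homeomorphic_map_maps by blast
  have top: "topspace (subtopology X (e w)) = e w" using cell_subset[OF w] by auto
  have Etop: "subtopology (unit_ball ?p) ?i = subtopology (Euclidean_space ?p) ?i"
    unfolding unit_ball_def subtopology_subtopology
    by (rule arg_cong[where f="subtopology (Euclidean_space ?p)"]) (auto simp: unit_ball_interior_eq)
  have iE: "openin (Euclidean_space ?p) ?i"
  proof -
    have "open {x :: nat \<Rightarrow> real. (\<Sum>i<?p. x i ^ 2) < 1}"
      by (intro open_Collect_less continuous_intros)
    moreover have "?i = {x. \<forall>i\<ge>?p. x i = 0} \<inter> {x. (\<Sum>i<?p. x i ^ 2) < 1}"
      by (auto simp: unit_ball_interior_eq)
    ultimately show ?thesis by (auto simp: Euclidean_space_top_of_set openin_open)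
  qed
  have cf: "continuous_map (subtopology (unit_ball ?p) ?i) (subtopology X (e w)) f"
    using f by (auto simp: continuous_map_in_subtopology continuous_map_from_subtopology)
  moreover have cpsi: "continuous_map (subtopology X (e w)) (subtopology (unit_ball ?p) ?i) \<psi>"
    using hm by (simp add: homeomorphic_maps_def)
  ultimately have cg: "continuous_map (subtopology (Euclidean_space ?p) ?i) (subtopology (Euclidean_space ?p) ?i) (\<psi> \<circ> f)"
    using continuous_map_compose unfolding Etop by blast
  then have cg': "continuous_map (subtopology (Euclidean_space ?p) ?i) (Euclidean_space ?p) (\<psi> \<circ> f)"
    by (simp add: continuous_map_in_subtopology)
  have \<psi>: "\<Phi> (\<psi> y) = y" if "y \<in> e w" for y using hm that top by (auto simp: homeomorphic_maps_def)
  have "inj_on (\<psi> \<circ> f) ?i"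
  proof (rule inj_onI)
    fix a b assume ab: "a \<in> ?i" "b \<in> ?i" "(\<psi> \<circ> f) a = (\<psi> \<circ> f) b"
    then have "f a \<in> e w" "f b \<in> e w" using f(3) by auto
    then have "f a = f b" using \<psi> ab(3) by (metis comp_apply)
    then show "a = b" using inj_onD[OF f(2)] ab sub by blast
  qed
  then have "openin (Euclidean_space ?p) ((\<psi> \<circ> f) ` ?i)"
    using invariance_of_domain_Euclidean_space[OF iE cg'] by blast
  moreover have gi: "(\<psi> \<circ> f) ` ?i \<subseteq> ?i" using continuous_map_image_subset_topspace[OF cg] iE by (auto simp: openin_subset Int_absorb1)
  ultimately have "openin (subtopology (unit_ball ?p) ?i) ((\<psi> \<circ> f) ` ?i)"
    unfolding Etop by (rule subset_openin_subtopology)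
  then have "openin (subtopology X (e w)) (\<Phi> ` ((\<psi> \<circ> f) ` ?i))"
    using homeomorphic_imp_open_map[OF c(4)] by (simp add: open_map_def)
  moreover have "\<Phi> ` ((\<psi> \<circ> f) ` ?i) = f ` ?i"
    unfolding image_image using f(3) \<psi> by (intro image_cong) auto
  ultimately show ?thesis by simp
qed

text \<open>The lower skeleton \<open>?K\<close> is replaced by \<open>A\<close>, the complement of
  the image of the open ball under the chart. In degree \<open>d w\<close> both give the same
  relative homology, as each is compared with the complement of one point \<open>z\<close>, and near
  \<open>x\<close> the two sets coincide. Relative to \<open>A\<close> the connecting map is
  computed in the chart, from the ball, its sphere and the sphere without the south pole.\<close>

lemma localize_boundary_chart:
  assumes v: "v \<in> I" and w: "w \<in> I" "d w = Suc (d v)" and x: "x \<in> e v"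
    and o: "cell_orientation X I e d w a" and chart: "half_chart v w x f"
  shows "generate (local_group v x) {localize v x (cellular_boundary X I e d (int (d w)) a)} = carrier (local_group v x)"
proof -
  let ?K = "sk (int (d v))" and ?D = "unit_ball (d w)" and ?i = "unit_ball_interior (d w)" and ?S = "unit_ball_boundary (d w)"
  let ?p = "int (d w)" and ?q = "int (d v)"
  define L where "L = {i \<in> I. int (d i) \<le> int (d v)}"
  have K: "?K = cells L" by (simp only: sk_cells L_def)
  have low: "lower L" "w \<notin> L" "\<And>j. j \<in> I \<Longrightarrow> d j < d w \<Longrightarrow> j \<in> L"
    unfolding L_def using w by (auto simp: lower_def)
  have iw: "?p - 1 = ?q" using w by simp
  have wv: "w \<noteq> v" using w by auto
  obtain \<Phi> g where \<Phi>: "characteristic_map X I e d w \<Phi>"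
    and g: "g \<in> carrier (relative_homology_group ?p ?D ?S)"
      "generate (relative_homology_group ?p ?D ?S) {g} = carrier (relative_homology_group ?p ?D ?S)"
    and a: "a = hom_induced ?p ?D ?S (subtopology X (sk ?p)) ?K \<Phi> g"
    using o unfolding cell_orientation_def iw by blast
  have f: "continuous_map ?D X f" "inj_on f (ball_set (d w))" "f ` ?i \<subseteq> e w" "f ` ball_set (d w) \<subseteq> e v \<union> e w"
    "\<And>y. y \<in> ?S \<Longrightarrow> y 0 < 0 \<Longrightarrow> f y \<in> e v" "f south_pole = x"
    using chart by (auto simp: half_chart_def)
  obtain U where U: "openin X U" "x \<in> U" "U \<inter> (e v \<union> e w) \<subseteq> f ` ball_set (d w)"
    using chart by (auto simp: half_chart_def)
  define Y where "Y = subtopology X (cells (insert w L))"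
  note at = attach[OF low(1) w(1) low(2,3) \<Phi>, folded Y_def, folded K]
  have iB: "?i \<subseteq> ball_set (d w)" and SB: "?S \<subseteq> ball_set (d w)" using ball_set_split by blast+
  have topY: "topspace Y = e w \<union> ?K"
    using cells_subset[of "insert w L"] w(1) by (auto simp: Y_def K cells_insert L_def)
  have evK: "e v \<subseteq> ?K" using v by (auto simp: skeleton_def)
  have ewK: "e w \<inter> ?K = {}" unfolding K using cells_disjoint[of L w] w(1) low(2) by (auto simp: L_def)
  have fY: "continuous_map ?D Y f"
    using f(1,4) evK by (auto simp: Y_def continuous_map_in_subtopology cells_insert K[symmetric])
  have subYe: "subtopology Y (e w) = subtopology X (e w)"
    by (simp add: Y_def subtopology_subtopology cells_insert Int_absorb1)
  have "openin Y (e w)"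
  proof -
    have "e w = topspace Y - ?K" using topY ewK by blast
    then show ?thesis using openin_diff[OF openin_topspace at(2)] by simp
  qed
  then have opf: "openin Y (f ` ?i)"
    using open_in_cell[OF w(1) f(1-3)] openin_trans_full subYe by metis
  define A where "A = topspace Y - f ` ?i"
  have clA: "closedin Y A" unfolding A_def using opf by blast
  have KA: "?K \<subseteq> A" using topY f(3) ewK by (auto simp: A_def)
  have fSA: "f ` ?S \<subseteq> A"
  proof -
    have "f y \<notin> f ` ?i" if "y \<in> ?S" for y
      using that inj_onD[OF f(2)] iB SB ball_set_split(2)[of "d w"] by blast
    moreover have "f y \<in> topspace Y" if "y \<in> ?S" for y using f(4) SB that topY evK by blast
    ultimately show ?thesis by (auto simp: A_def)
  qed
  have surjA: "topspace Y = A \<union> f ` ball_set (d w)" using f(4) topY evK iB by (auto simp: A_def)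
  have fiA: "f ` ?i \<inter> A = {}" by (auto simp: A_def)
  obtain y0 where y0: "y0 \<in> ?i" using zero_in_ball_interior by blast
  define z where "z = f y0"
  have zw: "z \<in> e w" using f(3) y0 by (auto simp: z_def)
  then have "z \<in> \<Phi> ` ?i" using char_map_image(1)[OF w(1) \<Phi>] by simp
  then obtain y1 where y1: "y1 \<in> ?i" "\<Phi> y1 = z" by auto
  have isoA: "hom_induced ?p Y A Y (topspace Y - {z}) id \<in> iso (relative_homology_group ?p Y A) (relative_homology_group ?p Y (topspace Y - {z}))"
    unfolding z_def by (rule cell_relativization_iso[OF at(1) clA fY surjA fSA inj_on_subset[OF f(2) iB] fiA y0])
  have isoK: "hom_induced ?p Y ?K Y (topspace Y - {z}) id \<in> iso (relative_homology_group ?p Y ?K) (relative_homology_group ?p Y (topspace Y - {z}))"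
    using cell_relativization_iso[OF at(1,2,3,4,5) char_map_image(3)[OF w(1) \<Phi>] at(7) y1(1), of ?p] unfolding y1(2) .
  let ?\<alpha> = "hom_induced ?p Y ?K Y A id"
  have zA: "A \<subseteq> topspace Y - {z}" using y0 by (auto simp: A_def z_def)
  have \<alpha>: "?\<alpha> \<in> iso (relative_homology_group ?p Y ?K) (relative_homology_group ?p Y A)"
  proof (rule iso_cancel_left[OF hom_induced_hom isoA _ isoK])
    have m: "id \<in> ?K \<rightarrow> A" "id \<in> A \<rightarrow> topspace Y - {z}" using KA zA by auto
    show "hom_induced ?p Y A Y (topspace Y - {z}) id (?\<alpha> t) = hom_induced ?p Y ?K Y (topspace Y - {z}) id t" for t
      using hom_induced_compose'[where X=Y and Y=Y and Z=Y and p="?p" and x=t, OF continuous_map_id m(1) continuous_map_id m(2)] by (simp only: id_comp)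
  qed
  define b where "b = hom_induced ?p ?D ?S Y ?K \<Phi> g"
  have bgen: "b \<in> carrier (relative_homology_group ?p Y ?K)" "generate (relative_homology_group ?p Y ?K) {b} = carrier (relative_homology_group ?p Y ?K)"
    unfolding b_def using generate_iso_image[OF _ _ cell_attach_iso[OF at, of ?p] g] by auto
  have \<alpha>gen: "?\<alpha> b \<in> carrier (relative_homology_group ?p Y A)" "generate (relative_homology_group ?p Y A) {?\<alpha> b} = carrier (relative_homology_group ?p Y A)"
    using generate_iso_image[OF _ _ \<alpha> bgen] by auto
  obtain G where G: "openin X G" "e v = ?K \<inter> G"
    using cell_open_in_skeleton[OF v] unfolding openin_subtopology by (auto simp: Int_commute)
  \<comment> \<open>The upper half of the ball has a compact image, which does not contain
    \<open>x\<close>. Removing this image leaves a neighbourhood of \<open>x\<close> that meets the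
    image of the sphere in southern points only.\<close>
  define C where "C = {y \<in> ball_set (d w). 0 \<le> y 0}"
  have clC: "closedin X (f ` C)"
  proof (rule compactin_imp_closedin[OF Hausdorff])
    have "closed {y :: nat \<Rightarrow> real. 0 \<le> y 0}" by (intro closed_Collect_le continuous_intros)
    from compact_Int_closed[OF compact_ball_set this] have "compact (ball_set (d w) \<inter> {y. 0 \<le> y 0})" .
    moreover have "C = ball_set (d w) \<inter> {y. 0 \<le> y 0}" by (auto simp: C_def)
    ultimately have "compact C" by simp
    then have "compactin ?D C" by (auto simp: unit_ball_top_of_set compactin_subtopology C_def)
    then show "compactin X (f ` C)" using image_compactin[OF _ f(1)] by blast
  qed
  have pole: "south_pole \<in> ?S" using south_pole_boundary[of "d w"] w(2) by simp
  have xC: "x \<notin> f ` C"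
  proof
    assume "x \<in> f ` C"
    then obtain y where y: "y \<in> C" "f y = f south_pole" using f(6) by auto
    then have "y = south_pole" using inj_onD[OF f(2), of y south_pole] pole SB by (auto simp: C_def)
    then show False using y(1) by (simp add: C_def south_pole_def)
  qed
  define Q where "Q = U \<inter> G \<inter> (topspace X - f ` C)"
  have Q: "openin X Q" unfolding Q_def using U(1) G(1) clC by (intro openin_Int openin_diff) auto
  have xQ: "x \<in> Q" using U(2) G(2) x xC cell_subset[OF v] by (auto simp: Q_def)
  define N where "N = {y \<in> ?S. f y \<in> Q}"
  have NK: "Q \<inter> ?K \<subseteq> f ` N"
  proof
    fix t assume t: "t \<in> Q \<inter> ?K"
    then have "t \<in> e v" using G(2) by (auto simp: Q_def)
    then have "t \<in> f ` ball_set (d w)" using U(3) t by (auto simp: Q_def)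
    then obtain y where y: "y \<in> ball_set (d w)" "t = f y" by auto
    have "y \<notin> ?i" using y t f(3) ewK by blast
    then show "t \<in> f ` N" using y t ball_set_split(1) by (auto simp: N_def)
  qed
  have NA: "Q \<inter> A \<subseteq> f ` N"
  proof
    fix t assume t: "t \<in> Q \<inter> A"
    show "t \<in> f ` N"
    proof (cases "t \<in> ?K")
      case True
      then show ?thesis using t NK by blast
    next
      case False
      then have "t \<in> e w" using t topY by (auto simp: A_def)
      then have "t \<in> f ` ball_set (d w)" using U(3) t by (auto simp: Q_def)
      then obtain y where y: "y \<in> ball_set (d w)" "t = f y" by auto
      have "y \<notin> ?i" using y t by (auto simp: A_def)
      then show "t \<in> f ` N" using y t ball_set_split(1) by (auto simp: N_def)
    qed
  qed
  have fN: "f ` N \<subseteq> e v"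
  proof
    fix t assume "t \<in> f ` N"
    then obtain y where y: "y \<in> ?S" "t = f y" "f y \<in> Q" by (auto simp: N_def)
    then have "y \<notin> C" by (auto simp: Q_def)
    then have "y 0 < 0" using y SB by (auto simp: C_def)
    then show "t \<in> e v" using f(5) y by blast
  qed
  \<comment> \<open>Inside \<open>Q\<close> both sets are the image of the same piece
    \<open>N\<close> of the sphere, so excision identifies their local groups at
    \<open>x\<close>.\<close>
  have WK: "f ` N = Q \<inter> ?K" and WA: "f ` N = Q \<inter> A" 
  proof -
    have "f ` N \<subseteq> Q" by (auto simp: N_def)
    then show "f ` N = Q \<inter> ?K" "f ` N = Q \<inter> A" using NK NA fN evK KA by blast+
  qed
  define TK where "TK = subtopology X ?K"
  define TA where "TA = subtopology Y A"
  define W where "W = f ` N"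
  have topTK: "topspace TK = ?K" by (simp only: TK_def topspace_sk)
  have topTA: "topspace TA = A" by (auto simp: TA_def A_def)
  have TAX: "TA = subtopology X A" using topY KA by (simp add: TA_def Y_def subtopology_subtopology)
     (rule arg_cong[where f="subtopology X"], use topY cells_insert K in \<open>auto simp: A_def\<close>)
  have opK: "openin TK W" unfolding TK_def W_def WK using Q openin_subtopology_Int2 by (metis inf_commute)
  have opA: "openin TA W" unfolding TAX W_def WA using Q openin_subtopology_Int2 by (metis inf_commute)
  have xW: "x \<in> W" using xQ x evK WK by (auto simp: W_def)
  have xK: "x \<in> ?K" and xA: "x \<in> A" using x evK KA by auto
  have sWK: "subtopology TK W = subtopology X W" using WK by (simp add: TK_def W_def subtopology_subtopology Int_absorb1)
  have sWA: "subtopology TA W = subtopology X W" using WA by (simp add: TAX W_def subtopology_subtopology Int_absorb1)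
  have HTK: "Hausdorff_space TK" and HTA: "Hausdorff_space TA"
    unfolding TK_def TAX using Hausdorff by (simp_all add: Hausdorff_space_subtopology)
  have clK: "closedin TK {x}" using closedin_Hausdorff_sing_eq[OF HTK] xK topTK by simp
  have clAx: "closedin TA {x}" using closedin_Hausdorff_sing_eq[OF HTA] xA topTA by simp
  let ?HW = "relative_homology_group ?q (subtopology X W) (W - {x})"
  let ?HK = "relative_homology_group ?q TK (?K - {x})"
  let ?HA = "relative_homology_group ?q TA (A - {x})"
  have iK: "hom_induced ?q (subtopology X W) (W - {x}) TK (?K - {x}) id \<in> iso ?HW ?HK"
    using iso_excision_point[OF opK xW clK, of ?q] unfolding topTK sWK .
  have iA: "hom_induced ?q (subtopology X W) (W - {x}) TA (A - {x}) id \<in> iso ?HW ?HA"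
    using iso_excision_point[OF opA xW clAx, of ?q] unfolding topTA sWA .
  let ?\<kappa> = "hom_induced ?q TK (?K - {x}) TA (A - {x}) id"
  have idWK: "continuous_map (subtopology X W) TK id" "id \<in> W - {x} \<rightarrow> ?K - {x}"
    using WK by (auto simp: TK_def W_def continuous_map_in_subtopology continuous_map_from_subtopology)
  have idWA: "continuous_map (subtopology X W) TA id" "id \<in> W - {x} \<rightarrow> A - {x}"
    using WA by (auto simp: TAX W_def continuous_map_in_subtopology continuous_map_from_subtopology)
  have idKA: "continuous_map TK TA id" "id \<in> ?K - {x} \<rightarrow> A - {x}"
    using KA by (auto simp: TK_def TAX continuous_map_in_subtopology continuous_map_from_subtopology)
  have \<kappa>: "?\<kappa> \<in> iso ?HK ?HA"
  proof (rule iso_cancel_right[OF hom_induced_hom iK _ iA])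
    show "?\<kappa> (hom_induced ?q (subtopology X W) (W - {x}) TK (?K - {x}) id t) = hom_induced ?q (subtopology X W) (W - {x}) TA (A - {x}) id t" for t
      using hom_induced_compose'[OF idWK idKA, of ?q t] by (simp only: id_comp)
  qed
  define TS where "TS = subtopology ?D ?S"
  have topTS: "topspace TS = ?S" using SB by (auto simp: TS_def)
  let ?HS = "relative_homology_group ?q TS (?S - {south_pole})"
  let ?fS = "hom_induced ?q TS (?S - {south_pole}) TA (A - {x}) f"
  have fTA: "continuous_map TS TA f"
    using fY fSA by (auto simp: TS_def TA_def continuous_map_in_subtopology continuous_map_from_subtopology)
  have fpole: "f \<in> ?S - {south_pole} \<rightarrow> A - {x}"
    using fSA f(6) inj_onD[OF f(2)] SB pole by auto
  \<comment> \<open>Surjectivity suffices for transporting a generator, and it follows from excision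
    in the target together with the homeomorphism on \<open>N\<close>.\<close>
  have fSsurj: "?fS ` carrier ?HS = carrier ?HA"
  proof -
    let ?HN = "relative_homology_group ?q (subtopology TS N) (N - {south_pole})"
    have NS: "N \<subseteq> ?S" by (auto simp: N_def)
    have poleN: "south_pole \<in> N" using pole xQ f(6) by (auto simp: N_def)
    have emb: "embedding_map ?D X f"
      by (intro injective_closed_imp_embedding_map continuous_imp_closed_map compact_space_unit_ball Hausdorff f(1)) (use f(2) in simp)
    have subN: "subtopology TS N = subtopology ?D N" using NS by (simp add: TS_def subtopology_subtopology Int_absorb1)
    have hmN: "homeomorphic_map (subtopology TS N) (subtopology X W) f"
    proof -
      have "homeomorphic_map ?D (subtopology X (f ` ball_set (d w))) f" using emb by (simp add: embedding_map_def)
      moreover have "topspace (subtopology X (f ` ball_set (d w))) \<inter> W = f ` (topspace ?D \<inter> N)"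
        using NS SB continuous_map_image_subset_topspace[OF f(1)] by (auto simp: W_def)
      ultimately have "homeomorphic_map (subtopology ?D N) (subtopology (subtopology X (f ` ball_set (d w))) W) f"
        by (intro homeomorphic_map_subtopologies) auto
      moreover have "subtopology (subtopology X (f ` ball_set (d w))) W = subtopology X W"
      proof -
        have "W \<subseteq> f ` ball_set (d w)" unfolding W_def using NS SB by (intro image_mono) blast
        then show ?thesis by (simp add: subtopology_subtopology Int_absorb1)
      qed
      ultimately show ?thesis unfolding subN by simp
    qed
    have img: "f ` (N - {south_pole}) = W - {x}"
      using inj_onD[OF f(2)] NS SB poleN f(6) by (auto simp: W_def)
    have c: "hom_induced ?q (subtopology TS N) (N - {south_pole}) (subtopology X W) (W - {x}) f \<in> iso ?HN ?HW"
      by (rule homeomorphic_map_relative_homology_iso[OF hmN _ img]) (use NS topTS in auto)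
    have cN: "continuous_map (subtopology TS N) (subtopology X W) f" using hmN homeomorphic_imp_continuous_map by blast
    have mN: "f \<in> N - {south_pole} \<rightarrow> W - {x}" using img by auto
    have idN: "continuous_map (subtopology TS N) TS id" "id \<in> N - {south_pole} \<rightarrow> ?S - {south_pole}"
      using NS by (auto simp: continuous_map_from_subtopology)
    show ?thesis
    proof (intro equalityI subsetI)
      fix t assume "t \<in> carrier ?HA"
      then obtain r where r: "r \<in> carrier ?HW" "t = hom_induced ?q (subtopology X W) (W - {x}) TA (A - {x}) id r"
        using iA unfolding iso_def bij_betw_def by blast
      then obtain n where n: "n \<in> carrier ?HN" "r = hom_induced ?q (subtopology TS N) (N - {south_pole}) (subtopology X W) (W - {x}) f n"
        using c unfolding iso_def bij_betw_def by blast
      have "t = hom_induced ?q (subtopology TS N) (N - {south_pole}) TA (A - {x}) f n"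
        unfolding r(2) n(2) using hom_induced_compose'[OF cN mN idWA, of ?q n] by (simp only: id_comp)
      also have "\<dots> = ?fS (hom_induced ?q (subtopology TS N) (N - {south_pole}) TS (?S - {south_pole}) id n)"
        using hom_induced_compose'[OF idN fTA fpole, of ?q n] by (simp only: comp_id)
      finally show "t \<in> ?fS ` carrier ?HS" using hom_induced_carrier by blast
    next
      fix t assume "t \<in> ?fS ` carrier ?HS"
      then show "t \<in> carrier ?HA" using hom_induced_carrier by blast
    qed
  qed
  let ?bnd = "hom_relboundary ?p Y A (A - {x})"
  have bnd_hom: "?bnd \<in> hom (relative_homology_group ?p Y A) ?HA"
    using group_homomorphism_hom_relboundary[of ?p Y A "A - {x}"] unfolding iw TA_def .
  have bnd_surj: "?bnd ` carrier (relative_homology_group ?p Y A) = carrier ?HA"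
  proof (intro equalityI subsetI)
    fix t assume "t \<in> carrier ?HA"
    then obtain s where s: "s \<in> carrier ?HS" "t = ?fS s" using fSsurj by blast
    have npole: "topspace ?D \<inter> (?S - {south_pole}) \<noteq> {}"
    proof -
      have "(\<lambda>i. - south_pole i) \<in> ?S" using pole by (simp add: unit_ball_boundary_eq)
      moreover have "(\<lambda>i. - south_pole i) \<noteq> south_pole" by (auto simp: south_pole_def fun_eq_iff)
      ultimately show ?thesis using SB by auto
    qed
    \<comment> \<open>The ball and the punctured sphere are both contractible, which makes this
      connecting map an isomorphism.\<close>
    have "hom_relboundary ?p ?D ?S (?S - {south_pole}) \<in> iso (relative_homology_group ?p ?D ?S) ?HS"
      using iso_hom_relboundary_contractible[OF contractible_unit_ball contractible_punctured_sphere[OF pole] Diff_subset npole, of ?p]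
      unfolding iw TS_def .
    then obtain r where r: "r \<in> carrier (relative_homology_group ?p ?D ?S)" "s = hom_relboundary ?p ?D ?S (?S - {south_pole}) r"
      using s(1) unfolding iso_def bij_betw_def by blast
    have m: "f \<in> ?S \<rightarrow> A" using fSA by auto
    have "t = ?bnd (hom_induced ?p ?D ?S Y A f r)"
      using fun_cong[OF naturality_hom_induced_relboundary[OF fY m fpole, of ?p], of r]
      unfolding s(2) r(2) iw TS_def TA_def comp_apply by (simp only:)
    then show "t \<in> ?bnd ` carrier (relative_homology_group ?p Y A)" using hom_induced_carrier by blast
  next
    fix t assume "t \<in> ?bnd ` carrier (relative_homology_group ?p Y A)"
    then show "t \<in> carrier ?HA" using bnd_hom by (auto simp: hom_def)
  qed
  have gen1: "generate ?HA {?bnd (?\<alpha> b)} = carrier ?HA"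
    by (rule generate_surj_image[OF _ _ bnd_hom bnd_surj \<alpha>gen]) auto
  have sYK: "subtopology Y ?K = TK" unfolding Y_def TK_def subtopology_subtopology cells_insert K by (simp add: Int_absorb1)
  have m: "id \<in> ?K \<rightarrow> A" using KA by auto
  let ?c = "hom_relboundary ?p Y ?K (?K - {x}) b"
  have "?bnd (?\<alpha> b) = ?\<kappa> ?c"
    using fun_cong[OF naturality_hom_induced_relboundary[where X=Y and Y=Y and p="?p", OF continuous_map_id m idKA(2)], of b]
    unfolding iw sYK comp_apply TA_def[symmetric] .
  then have "generate ?HA {?\<kappa> ?c} = carrier ?HA" using gen1 by (simp only:)
  moreover have "?c \<in> carrier ?HK" using hom_relboundary[of ?p Y ?K "?K - {x}" b] unfolding iw sYK .
  ultimately have gen2: "generate ?HK {?c} = carrier ?HK"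
    by (intro generate_iso_reflect[OF _ _ \<kappa>]) auto
  have aC: "a \<in> carrier (relative_homology_group ?p (subtopology X (sk ?p)) ?K)" unfolding a by (rule hom_induced_carrier)
  have YX: "cells (insert w L) \<subseteq> sk ?p" unfolding cells_insert using w by (auto simp: skeleton_def cells_def L_def)
  have idYX: "continuous_map Y (subtopology X (sk ?p)) id"
    using YX by (auto simp: Y_def continuous_map_in_subtopology continuous_map_from_subtopology)
  have idKK: "id \<in> ?K \<rightarrow> ?K" "id \<in> ?K - {x} \<rightarrow> ?K - {x}" by auto
  have bd: "\<Phi> \<in> ?S \<rightarrow> ?K" using at(5) by auto
  have ab: "a = hom_induced ?p Y ?K (subtopology X (sk ?p)) ?K id b"
    unfolding a b_def using hom_induced_compose'[OF at(3) bd idYX idKK(1), of ?p g] by (simp only: id_comp)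
  have "?K \<subseteq> sk ?p" by (rule sk_mono) (use w in simp)
  then have sXK: "subtopology (subtopology X (sk ?p)) ?K = TK"
    unfolding subtopology_subtopology TK_def by (simp add: Int_absorb1)
  have "hom_relboundary ?p (subtopology X (sk ?p)) ?K (?K - {x}) a = hom_induced ?q TK (?K - {x}) TK (?K - {x}) id ?c"
    unfolding ab using fun_cong[OF naturality_hom_induced_relboundary[OF idYX idKK, of ?p], of b]
    unfolding iw sYK sXK comp_apply .
  also have "\<dots> = ?c" by (rule hom_induced_id) fact
  finally show ?thesis unfolding localize_boundary[OF v w x aC] using gen2 unfolding TK_def by (simp only:)
qed

theorem incidence_number_by_chart:
  assumes o: "\<forall>u\<in>I. cell_orientation X I e d u (\<omega> u)" and v: "v \<in> I" and w: "w \<in> I" "d w = Suc (d v)"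
    and x: "x \<in> e v" and loc: "x \<notin> X closure_of e w \<or> (\<exists>f. half_chart v w x f)"
  shows "incidence_number X I e d \<omega> w v \<in> {0, 1, -1}"
  using loc localize_boundary_away[OF v w x bspec[OF o w(1)]] localize_boundary_chart[OF v w x bspec[OF o w(1)]]
  by (intro incidence_number_from_local[OF o v w x]) blast

end

section \<open>Crossing numbers and closures of cells\<close>

definition coord_space :: "'n set \<Rightarrow> (real ^ 'n) set"
  where "coord_space D = {x. \<forall>c. c \<notin> D \<longrightarrow> x $ c = 0}"

text \<open>For an involution \<open>g\<close> and the matrix \<open>restrict_rows (- D) g\<close>
  this is the dimension of the intersection of the coordinate space with its image under
  \<open>g\<close>, so \<open>card D\<close> minus it is the crossing number. For
  \<open>mat 1 - g\<close> and \<open>mat 1 + g\<close> it counts the eigenvectors in the coordinate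
  space.\<close>

definition ker_dim :: "'n set \<Rightarrow> real ^ 'n ^ 'm \<Rightarrow> nat"
  where "ker_dim D A = dim {x \<in> coord_space D. A *v x = 0}"

lemma subspace_coord: "subspace (coord_space D)"
  by (auto simp: subspace_def coord_space_def)

lemma subspace_ker: "subspace {x \<in> coord_space D. A *v x = 0}"
  by (auto simp: subspace_def coord_space_def matrix_vector_right_distrib matrix_vector_mult_scaleR)

lemma dim_coord: "dim (coord_space D) = card D"
  unfolding coord_space_def using dim_substandard_cart[of D, where 'a=real] by (simp add: dim_vec_eq)

lemma matrix_vector_norm_le:
  fixes A :: "real ^ 'n ^ 'm"
  shows "norm (A *v x) \<le> real CARD('m) * norm A * norm x"
proof -
  have "norm (A *v x) \<le> (\<Sum>i\<in>UNIV. norm ((A *v x) $ i))" using norm_le_l1_cart[of "A *v x"] by (simp only: real_norm_def)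
  also have "\<dots> \<le> (\<Sum>i\<in>(UNIV::'m set). norm A * norm x)"
  proof (rule sum_mono)
    fix i :: 'm
    have "norm ((A *v x) $ i) = norm (A $ i \<bullet> x)" by (simp add: matrix_vector_mul_component)
    also have "\<dots> \<le> norm (A $ i) * norm x" by (simp add: Cauchy_Schwarz_ineq2)
    also have "\<dots> \<le> norm A * norm x" by (intro mult_right_mono Finite_Cartesian_Product.norm_nth_le) auto
    finally show "norm ((A *v x) $ i) \<le> norm A * norm x" .
  qed
  finally show ?thesis by simp
qed

text \<open>Upper semicontinuity of kernel dimensions. On the orthogonal complement
  \<open>S'\<close> of the kernel in the coordinate space, \<open>A\<close> is bounded from below; a
  nearby matrix is still injective there, so its kernel meets \<open>S'\<close> trivially and cannot
  be larger.\<close>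

lemma closed_ker_dim: "closed {A :: real ^ 'n ^ 'm. r \<le> ker_dim D A}"
proof -
  have "open {A :: real ^ 'n ^ 'm. ker_dim D A < r}"
    unfolding open_dist
  proof safe
    fix A :: "real ^ 'n ^ 'm" assume A: "ker_dim D A < r"
    let ?S = "coord_space D" let ?K = "{x \<in> ?S. A *v x = 0}"
    define S' where "S' = {y \<in> ?S. \<forall>x\<in>?K. orthogonal x y}"
    have dS: "dim S' + dim ?K = dim ?S"
      unfolding S'_def by (rule dim_subspace_orthogonal_to_vectors[OF subspace_ker subspace_coord]) auto
    have sS: "subspace S'"
      using subspace_coord[of D] unfolding S'_def subspace_def by (auto simp: orthogonal_clauses)
    have "\<forall>x\<in>S'. A *v x = 0 \<longrightarrow> x = 0"
      unfolding S'_def by (auto simp: orthogonal_self dest: bspec)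
    then obtain e where e: "e > 0" "\<And>x. x \<in> S' \<Longrightarrow> e * norm x \<le> norm (A *v x)"
      using injective_imp_isometric[OF closed_subspace[OF sS] sS matrix_vector_mul_bounded_linear] by blast
    show "\<exists>\<epsilon>>0. \<forall>B. dist B A < \<epsilon> \<longrightarrow> B \<in> {A. ker_dim D A < r}"
    \<comment> \<open>The number of rows compensates the factor in the norm estimate
      \<open>matrix_vector_norm_le\<close>.\<close>
    proof (intro exI[of _ "e / real CARD('m)"] conjI allI impI)
      show "0 < e / real CARD('m)" using e by simp
      fix B assume B: "dist B A < e / real CARD('m)"
      let ?L = "{x \<in> ?S. B *v x = 0}"
      have "x = 0" if x: "x \<in> ?L \<inter> S'" for x
      proof (rule ccontr)
        assume "x \<noteq> 0"
        have "e * norm x \<le> norm (A *v x)" using e x by blast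
        also have "A *v x = (A - B) *v x" using x by (simp add: matrix_vector_mult_diff_rdistrib)
        also have "norm \<dots> \<le> real CARD('m) * norm (A - B) * norm x" by (rule matrix_vector_norm_le)
        also have "\<dots> < e * norm x"
          using B \<open>x \<noteq> 0\<close> by (intro mult_strict_right_mono) (auto simp: dist_norm norm_minus_commute field_simps)
        finally show False by simp
      qed
      then have "?L \<inter> S' = {0}" using subspace_0[OF sS] subspace_0[OF subspace_ker[of D B]] by blast
      then have "dim (?L \<inter> S') = 0" by simp
      then have "dim {x + y |x y. x \<in> ?L \<and> y \<in> S'} = dim ?L + dim S'"
        using dim_sums_Int[OF subspace_ker[of D B] sS] by linarith
      moreover have "dim {x + y |x y. x \<in> ?L \<and> y \<in> S'} \<le> dim ?S"
        using subspace_add[OF subspace_coord[of D]] by (intro dim_subset) (auto simp: S'_def)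
      ultimately show "B \<in> {A. ker_dim D A < r}" using A dS by (simp add: ker_dim_def)
    qed
  qed
  moreover have "{A :: real ^ 'n ^ 'm. r \<le> ker_dim D A} = - {A. ker_dim D A < r}" by auto
  ultimately show ?thesis by (simp add: closed_def)
qed

definition restrict_rows :: "'n set \<Rightarrow> real ^ 'n ^ 'n::finite \<Rightarrow> real ^ 'n ^ 'n"
  where "restrict_rows U A = (\<chi> a c. if a \<in> U then A $ a $ c else 0)"

lemma restrict_rows_eq_0: "restrict_rows U A *v x = 0 \<longleftrightarrow> (\<forall>a\<in>U. (A *v x) $ a = 0)"
proof -
  have "(restrict_rows U A *v x) $ a = (if a \<in> U then (A *v x) $ a else 0)" for a
    by (simp add: restrict_rows_def matrix_vector_mult_def)
  then show ?thesis by (auto simp: vec_eq_iff)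
qed

lemma upper_coord_space:
  assumes b: "b \<in> pos_upper_triangular" and D: "\<And>x y. x \<in> D \<Longrightarrow> y \<le> x \<Longrightarrow> y \<in> D" and x: "x \<in> coord_space D"
  shows "b *v x \<in> coord_space D"
  unfolding coord_space_def
proof (intro CollectI allI impI)
  fix a assume a: "a \<notin> D"
  have "b $ a $ c * x $ c = 0" for c
    using b x a D[of c a] by (cases "c \<in> D"; cases "c < a") (auto simp: coord_space_def pos_upper_triangular_iff)
  then show "(b *v x) $ a = 0" unfolding matrix_vector_mult_def vec_lambda_beta by (intro sum.neutral) blast
qed

lemma upper_rows_zero:
  assumes b: "b \<in> pos_upper_triangular" and U: "\<And>x y. x \<in> U \<Longrightarrow> x \<le> y \<Longrightarrow> y \<in> U"
    and x: "\<forall>a\<in>U. x $ a = 0" and a: "a \<in> U"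
  shows "(b *v x) $ a = 0"
proof -
  have "b $ a $ c * x $ c = 0" for c
    using b x a U[of a c] by (cases "c < a") (auto simp: pos_upper_triangular_iff)
  then show ?thesis unfolding matrix_vector_mult_def vec_lambda_beta by (intro sum.neutral) blast
qed

text \<open>Upper triangular matrices preserve initial coordinate spaces and the vanishing of the
  coordinates in a final segment. So the inverse of the right factor maps the kernel for
  \<open>u\<close> injectively into the kernel for \<open>g\<close>.\<close>

lemma ker_dim_double_coset_le:
  assumes D: "\<And>x y. x \<in> D \<Longrightarrow> y \<le> x \<Longrightarrow> y \<in> D" and U: "\<And>x y. x \<in> U \<Longrightarrow> x \<le> y \<Longrightarrow> y \<in> U"
    and g: "g \<in> double_coset u"
  shows "ker_dim D (restrict_rows U u) \<le> ker_dim D (restrict_rows U g)"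
proof -
  obtain b b' where b: "b \<in> pos_upper_triangular" "b' \<in> pos_upper_triangular" "g = b ** u ** b'"
    using g by (auto simp: double_coset_def)
  obtain c where c: "c \<in> pos_upper_triangular" "b' ** c = mat 1" "c ** b' = mat 1" using pos_upper_inverse b by metis
  let ?K = "{x \<in> coord_space D. restrict_rows U u *v x = 0}"
  have "((*v) c) ` ?K \<subseteq> {x \<in> coord_space D. restrict_rows U g *v x = 0}"
  proof (clarsimp simp: restrict_rows_eq_0)
    fix x a assume x: "x \<in> coord_space D" "\<forall>a\<in>U. (u *v x) $ a = 0"
    have "g *v (c *v x) = b *v (u *v x)"
      unfolding b(3) using c(2) by (simp add: matrix_vector_mul_assoc matrix_mul_assoc[symmetric])
    then show "c *v x \<in> coord_space D \<and> (\<forall>a\<in>U. (g *v (c *v x)) $ a = 0)"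
      using upper_coord_space[of c D x, OF c(1) _ x(1)] upper_rows_zero[of b U "u *v x", OF b(1) _ x(2)] D U by auto
  qed
  then have "dim (((*v) c) ` ?K) \<le> dim {x \<in> coord_space D. restrict_rows U g *v x = 0}" by (rule dim_subset)
  moreover have "dim (((*v) c) ` ?K) = dim ?K"
  proof (rule dim_image_eq)
    show "inj_on ((*v) c) (span ?K)"
    proof (rule inj_onI)
      fix x y assume "c *v x = c *v y"
      then have "b' *v (c *v x) = b' *v (c *v y)" by simp
      then show "x = y" unfolding matrix_vector_mul_assoc c(2) by simp
    qed
  qed simp
  ultimately show ?thesis unfolding ker_dim_def by linarith
qed

lemma ker_dim_double_coset:
  assumes "\<And>x y. x \<in> D \<Longrightarrow> y \<le> x \<Longrightarrow> y \<in> D" "\<And>x y. x \<in> U \<Longrightarrow> x \<le> y \<Longrightarrow> y \<in> U" "g \<in> double_coset u"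
  shows "ker_dim D (restrict_rows U g) = ker_dim D (restrict_rows U u)"
  by (intro antisym ker_dim_double_coset_le[OF assms] ker_dim_double_coset_le[OF assms(1,2) double_coset_sym[OF assms(3)]])

text \<open>The kernel is itself a coordinate space; hence the counts in \<open>rank_le\<close> are
  the codimensions of these kernels.\<close>

lemma ker_dim_smat:
  fixes w :: "'n::finite \<Rightarrow> 'n"
  assumes inv: "signed_involution w s"
  shows "ker_dim D (restrict_rows U (smat w s)) + card {c \<in> D. w c \<in> U} = card D"
proof -
  note d = signed_involutionD[OF inv]
  have e: "(smat w s *v x) $ a = s (w a) * x $ (w a)" for x a
  proof -
    have "(smat w s *v x) $ a = smat w s $ a $ (w a) * x $ (w a)"
      unfolding matrix_vector_mult_def vec_lambda_beta by (rule sum_eq_single) (auto simp: smat_def d(1))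
    then show ?thesis by (simp add: smat_def d(1))
  qed
  have "{x \<in> coord_space D. restrict_rows U (smat w s) *v x = 0} = coord_space {c \<in> D. w c \<notin> U}"
  proof -
    have "(\<forall>a\<in>U. s (w a) * x $ w a = 0) \<longleftrightarrow> (\<forall>c. w c \<in> U \<longrightarrow> x $ c = 0)" for x :: "real ^ 'n"
    proof safe
      fix c assume "\<forall>a\<in>U. s (w a) * x $ w a = 0" "w c \<in> U"
      then have "s (w (w c)) * x $ w (w c) = 0" by blast
      then show "x $ c = 0" using d(1,4) by simp
    next
      fix a assume "\<forall>c. w c \<in> U \<longrightarrow> x $ c = 0" "a \<in> U"
      then have "x $ w a = 0" using d(1)[of a] by simp
      then show "s (w a) * x $ w a = 0" by simp
    qed
    note * = this
    show ?thesis
    proof (rule Set.set_eqI)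
      fix x show "x \<in> {x \<in> coord_space D. restrict_rows U (smat w s) *v x = 0} \<longleftrightarrow> x \<in> coord_space {c \<in> D. w c \<notin> U}"
        unfolding mem_Collect_eq restrict_rows_eq_0 e coord_space_def * by blast
    qed
  qed
  then have "ker_dim D (restrict_rows U (smat w s)) = card {c \<in> D. w c \<notin> U}" by (simp add: ker_dim_def dim_coord)
  moreover have "card {c \<in> D. w c \<notin> U} + card {c \<in> D. w c \<in> U} = card D"
  proof -
    have "D = {c \<in> D. w c \<notin> U} \<union> {c \<in> D. w c \<in> U}" by blast
    then show ?thesis using card_Un_disjoint[of "{c \<in> D. w c \<notin> U}" "{c \<in> D. w c \<in> U}"] by (simp add: disjoint_iff)
  qed
  ultimately show ?thesis by simp
qed

text \<open>The vectors of a coordinate space which an involution maps into this space are the sums of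
  eigenvectors contained in it.\<close>

lemma ker_dim_eigen:
  fixes g :: "real ^ 'n ^ 'n"
  assumes g: "g ** g = mat 1"
  shows "ker_dim D (mat 1 - g) + ker_dim D (mat 1 + g) = ker_dim D (restrict_rows (- D) g)"
proof -
  let ?P = "{x \<in> coord_space D. (mat 1 - g) *v x = 0}" and ?M = "{x \<in> coord_space D. (mat 1 + g) *v x = 0}"
  have gg: "g *v (g *v x) = x" for x using g by (simp add: matrix_vector_mul_assoc)
  have P: "x \<in> ?P \<longleftrightarrow> x \<in> coord_space D \<and> g *v x = x" for x by (auto simp: matrix_vector_mult_diff_rdistrib)
  have M: "x \<in> ?M \<longleftrightarrow> x \<in> coord_space D \<and> g *v x = - x" for x
    by (auto simp: matrix_vector_mult_add_rdistrib add_eq_0_iff)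
  have "?P \<inter> ?M = {0}"
  proof -
    have "x = 0" if "x \<in> ?P \<inter> ?M" for x
    proof -
      have "x = - x" using P[of x] M[of x] that by (simp only: Int_iff) (elim conjE, simp)
      then show ?thesis by (simp add: vec_eq_iff)
    qed
    then show ?thesis using subspace_0[OF subspace_ker[of D "mat 1 - g"]] subspace_0[OF subspace_ker[of D "mat 1 + g"]] by blast
  qed
  moreover have "{x + y |x y. x \<in> ?P \<and> y \<in> ?M} = {x \<in> coord_space D. restrict_rows (- D) g *v x = 0}"
  proof (intro equalityI subsetI)
    fix z assume "z \<in> {x + y |x y. x \<in> ?P \<and> y \<in> ?M}"
    then obtain x y where xy: "z = x + y" "x \<in> ?P" "y \<in> ?M" by blast
    then have "g *v z = x - y" using P M by (simp add: matrix_vector_right_distrib)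
    then show "z \<in> {x \<in> coord_space D. restrict_rows (- D) g *v x = 0}"
      using xy P M unfolding restrict_rows_eq_0 by (auto simp: coord_space_def)
  next
    fix z assume z: "z \<in> {x \<in> coord_space D. restrict_rows (- D) g *v x = 0}"
    then have gz: "g *v z \<in> coord_space D" unfolding restrict_rows_eq_0 by (auto simp: coord_space_def)
    define x y where "x = (1/2) *\<^sub>R (z + g *v z)" and "y = (1/2) *\<^sub>R (z - g *v z)"
    have "x \<in> ?P" unfolding P x_def
      using z gz gg by (auto simp: coord_space_def matrix_vector_mult_scaleR matrix_vector_right_distrib add.commute)
    moreover have "y \<in> ?M" unfolding M y_def
      using z gz gg by (auto simp: coord_space_def matrix_vector_mult_scaleR matrix_vector_mult_diff_distrib scaleR_right_diff_distrib)
    moreover have "z = x + y" by (simp add: x_def y_def flip: scaleR_add_right)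
    ultimately show "z \<in> {x + y |x y. x \<in> ?P \<and> y \<in> ?M}" by blast
  qed
  ultimately show ?thesis
    using dim_sums_Int[OF subspace_ker[of D "mat 1 - g"] subspace_ker[of D "mat 1 + g"]] by (simp add: ker_dim_def)
qed

section \<open>Kernel dimensions at limit points of cells\<close>

lemma ker_dim_closure_le:
  fixes F :: "real ^ 'n ^ 'n \<Rightarrow> real ^ 'n ^ 'n"
  assumes F: "continuous_on UNIV F" and r: "\<And>g. g \<in> E \<Longrightarrow> r \<le> ker_dim D (F g)" and y: "y \<in> closure E"
  shows "r \<le> ker_dim D (F y)"
proof -
  have "closed (F -` {A. r \<le> ker_dim D A})"
    using continuous_closed_vimage[OF closed_ker_dim] F continuous_on_eq_continuous_at[OF open_UNIV] by blast
  then have "closure E \<subseteq> F -` {A. r \<le> ker_dim D A}" by (rule closure_minimal[rotated]) (use r in auto)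
  then show ?thesis using y by auto
qed

lemma continuous_restrict_rows: "continuous_on UNIV (restrict_rows U :: real ^ 'n ^ 'n \<Rightarrow> real ^ 'n ^ 'n)"
proof -
  have "continuous_on UNIV (\<lambda>A :: real ^ 'n ^ 'n. \<chi> a c. if a \<in> U then A $ a $ c else 0)"
  proof (intro continuous_on_vec_lambda)
    fix a c show "continuous_on UNIV (\<lambda>A :: real ^ 'n ^ 'n. if a \<in> U then A $ a $ c else 0)"
      by (cases "a \<in> U") (auto intro!: continuous_intros)
  qed
  then show ?thesis by (simp add: restrict_rows_def[abs_def])
qed

text \<open>The contributions of the two eigenvalues are upper semicontinuous and their sum is
  constant on the cell. So a bound on one of them defines a relatively closed set whose complement
  in the cell is closed too, and the cell is connected.\<close>

lemma eigen_ker_dim_constant: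
  assumes u: "u \<in> cell_index k" and con: "connected (bruhat_cell k u)"
    and g: "g \<in> bruhat_cell k u" "h \<in> bruhat_cell k u" and \<sigma>: "\<sigma> = 1 \<or> \<sigma> = -1"
  shows "ker_dim {..i} (mat 1 - \<sigma> *\<^sub>R g) = ker_dim {..i} (mat 1 - \<sigma> *\<^sub>R h)"
proof -
  let ?E = "bruhat_cell k u" and ?k = "\<lambda>\<sigma> g. ker_dim {..i} (mat 1 - \<sigma> *\<^sub>R g)"
  define N where "N = ker_dim {..i} (restrict_rows (- {..i}) u)"
  have sum: "?k \<sigma> g + ?k (- \<sigma>) g = N" if "g \<in> ?E" for g
  proof -
    have "ker_dim {..i} (mat 1 - g) + ker_dim {..i} (mat 1 + g) = ker_dim {..i} (restrict_rows (- {..i}) g)"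
      using that by (intro ker_dim_eigen) (auto simp: bruhat_cell_eq grassmannian_def)
    also have "\<dots> = N" unfolding N_def using that by (intro ker_dim_double_coset) (auto simp: bruhat_cell_eq)
    finally show ?thesis using \<sigma> by auto
  qed
  have cl: "closed {g. r \<le> ?k \<tau> g}" for r \<tau>
  proof -
    have c: "continuous_on UNIV (\<lambda>g :: real ^ 'a::{finite,wellorder} ^ 'a::{finite,wellorder}. mat 1 - \<tau> *\<^sub>R g)" by (intro continuous_intros)
    have "closed ((\<lambda>g :: real ^ 'a::{finite,wellorder} ^ 'a::{finite,wellorder}. mat 1 - \<tau> *\<^sub>R g) -` {A. r \<le> ker_dim {..i} A})"
      using continuous_closed_vimage[OF closed_ker_dim] c continuous_on_eq_continuous_at[OF open_UNIV] by blast
    then show ?thesis by (simp add: vimage_def)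
  qed
  let ?A = "{g. ?k \<sigma> h \<le> ?k \<sigma> g}" and ?B = "{g. N - ?k \<sigma> h + 1 \<le> ?k (- \<sigma>) g}"
  have "?k \<sigma> h \<le> ?k \<sigma> g" if g: "g \<in> ?E" and h: "h \<in> ?E" for g h
  proof (rule ccontr)
    assume "\<not> ?k \<sigma> h \<le> ?k \<sigma> g"
    let ?A = "{g. ?k \<sigma> h \<le> ?k \<sigma> g}" and ?B = "{g. N - ?k \<sigma> h + 1 \<le> ?k (- \<sigma>) g}"
    have iff: "x \<in> ?B \<longleftrightarrow> x \<notin> ?A" if "x \<in> ?E" for x using sum[OF that] sum[OF h] by auto
    have "?E \<subseteq> ?A \<union> ?B" "?A \<inter> ?B \<inter> ?E = {}" using iff by blast+
    moreover have "?A \<inter> ?E \<noteq> {}" using h by blast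
    moreover have "?B \<inter> ?E \<noteq> {}" using iff[OF g] g \<open>\<not> ?k \<sigma> h \<le> ?k \<sigma> g\<close> by blast
    ultimately show False using con cl unfolding connected_closed by blast
  qed
  then show ?thesis using g by (intro antisym) auto
qed

text \<open>The companion of \<open>u\<close> has the same underlying permutation, but the
  eigenvalue of e_i is the opposite one. Using each of the two limits for the eigenvalue for which
  it is more restrictive makes one rank of \<open>q\<close> strictly larger than that of
  \<open>p\<close>, namely at the only pair of segments where \<open>sw i j \<circ> p\<close> can
  exceed \<open>p\<close>.\<close>

lemma not_both_in_closure:
  fixes i j :: "'n::{finite,wellorder}"
  assumes ij: "adjacent i j" and u: "u \<in> cell_index k" "ascent i j u" "fixes_both i j u"
    and w: "w \<in> cell_index k" "ascent i j w" and dim: "cell_dim w = cell_dim u + 1"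
    and con: "\<And>u :: real ^ 'n::{finite,wellorder} ^ 'n::{finite,wellorder}. u \<in> cell_index k \<Longrightarrow> connected (bruhat_cell k u)"
    and y: "y \<in> bruhat_cell k u" "y \<in> closure (bruhat_cell k w)"
    and y': "y' \<in> bruhat_cell k (turn i j pi u)" "y' \<in> closure (bruhat_cell k w)"
  shows False
proof -
  have ne: "i \<noteq> j" and lt: "i < j" and aj: "\<And>a. a \<le> i \<or> j \<le> a" using ij by (auto simp: adjacent_def)
  note tp = turn_pi[OF ij u(1,2)]
  define p where "p = underlying_permutation u"
  obtain s where s: "signed_involution p s" "u = smat p s" unfolding p_def by (rule smat_perm[OF u(1)])
  note d = signed_involutionD[OF s(1)]
  define q where "q = underlying_permutation w"
  obtain t where t: "signed_involution q t" "w = smat q t" unfolding q_def by (rule smat_perm[OF w(1)])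
  have f: "p i = i" "p j = j" using u(3) by (auto simp: fixes_both_def p_def)
  have lq: "q i < q j" using w(2) by (simp add: ascent_def q_def)
  have count: "card {c \<in> D. p c \<in> U} \<le> card {c \<in> D. q c \<in> U}"
    if D: "\<And>x y. x \<in> D \<Longrightarrow> y \<le> x \<Longrightarrow> y \<in> D" and U: "\<And>x y. x \<in> U \<Longrightarrow> x \<le> y \<Longrightarrow> y \<in> U" for D U
  proof -
    have "ker_dim D (restrict_rows U w) \<le> ker_dim D (restrict_rows U y)"
      using ker_dim_double_coset[OF D U]
      by (intro ker_dim_closure_le[OF continuous_restrict_rows _ y(2)]) (auto simp: bruhat_cell_eq)
    also have "\<dots> = ker_dim D (restrict_rows U u)"
      using ker_dim_double_coset[OF D U] y(1) by (auto simp: bruhat_cell_eq)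
    finally show ?thesis using ker_dim_smat[OF s(1), of D U] ker_dim_smat[OF t(1), of D U] s(2) t(2) by simp
  qed
  let ?D = "{..i}" and ?U = "- {..i}"
  have strict: "card {c \<in> ?D. p c \<in> ?U} + 1 \<le> card {c \<in> ?D. q c \<in> ?U}"
  proof -
    let ?k = "\<lambda>\<sigma> g. ker_dim {..i} (mat 1 - \<sigma> *\<^sub>R g)"
    define \<sigma> where "\<sigma> = s i"
    have \<sigma>: "\<sigma> = 1 \<or> \<sigma> = -1" using d(2)[of i] by (simp add: \<sigma>_def)
    have \<sigma>': "- \<sigma> = 1 \<or> - \<sigma> = -1" using \<sigma> by auto
    define u' where "u' = turn i j pi u"
    have u'eq: "u' = rot i j pi ** u" using u(3) by (simp add: u'_def turn_def)
    have sum: "?k \<sigma> g + ?k (- \<sigma>) g = ker_dim ?D (restrict_rows ?U g)" if "g ** g = mat 1" for g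
      using ker_dim_eigen[OF that, of ?D] \<sigma> by auto
    have cF: "continuous_on UNIV (\<lambda>g :: real ^ 'n::{finite,wellorder} ^ 'n::{finite,wellorder}. mat 1 - \<tau> *\<^sub>R g)" for \<tau> by (intro continuous_intros)
    have k1: "?k \<tau> w \<le> ?k \<tau> u" and k2: "?k \<tau> w \<le> ?k \<tau> u'" if \<tau>: "\<tau> = 1 \<or> \<tau> = -1" for \<tau>
    proof -
      have c: "?k \<tau> w \<le> ?k \<tau> g" if "g \<in> bruhat_cell k w" for g
        using eigen_ker_dim_constant[OF w(1) con[OF w(1)] bruhat_cell_self[OF w(1)] that \<tau>] by simp
      have "?k \<tau> w \<le> ?k \<tau> y" by (rule ker_dim_closure_le[OF cF c y(2)])
      also have "\<dots> = ?k \<tau> u" by (rule eigen_ker_dim_constant[OF u(1) con[OF u(1)] y(1) bruhat_cell_self[OF u(1)] \<tau>])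
      finally show "?k \<tau> w \<le> ?k \<tau> u" .
      have "?k \<tau> w \<le> ?k \<tau> y'" by (rule ker_dim_closure_le[OF cF c y'(2)])
      also have "\<dots> = ?k \<tau> u'" unfolding u'_def
        by (rule eigen_ker_dim_constant[OF tp(1) con[OF tp(1)] y'(1) bruhat_cell_self[OF tp(1)] \<tau>])
      finally show "?k \<tau> w \<le> ?k \<tau> u'" .
    qed
    \<comment> \<open>In the coordinate space every eigenvector of \<open>u'\<close> for \<sigma> is
      one of \<open>u\<close>, with vanishing coordinate \<open>i\<close>, and e_i is an additional
      one for \<open>u\<close>.\<close>
    have k3: "?k \<sigma> u' < ?k \<sigma> u"
    proof -
      let ?A = "{x \<in> coord_space ?D. (mat 1 - \<sigma> *\<^sub>R u') *v x = 0}" and ?B = "{x \<in> coord_space ?D. (mat 1 - \<sigma> *\<^sub>R u) *v x = 0}"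
      have ux: "(u *v x) $ a = s (p a) * x $ (p a)" for x a
      proof -
        have "(u *v x) $ a = u $ a $ (p a) * x $ (p a)"
          unfolding matrix_vector_mult_def vec_lambda_beta by (rule sum_eq_single) (auto simp: s smat_def d(1))
        then show ?thesis by (simp add: s smat_def d(1))
      qed
      have u'x: "(u' *v x) $ a = (if a = i \<or> a = j then - 1 else 1) * (u *v x) $ a" for x a
      proof -
        have "u' $ a $ c = (if a = i \<or> a = j then - 1 else 1) * u $ a $ c" for c
          unfolding u'eq by (simp add: rot_mult_left[OF ne])
        then show ?thesis by (simp add: matrix_vector_mult_def sum_distrib_left mult.assoc)
      qed
      have sub: "x \<in> ?B \<and> x $ i = 0" if x: "x \<in> ?A" for x
      proof -
        have xj: "x $ j = 0" using x lt by (auto simp: coord_space_def)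
        have ax: "x $ a = \<sigma> * (u' *v x) $ a" for a
          using x by (simp add: matrix_vector_mult_diff_rdistrib vec_eq_iff scaleR_matrix_vector_assoc[symmetric])
        have "x $ i = - (s i * s i * x $ i)" using ax[of i] u'x[of x i] ux[of x i] f by (simp add: \<sigma>_def)
        then have xi: "x $ i = 0" using d(3)[of i] by simp
        have "(u' *v x) $ a = (u *v x) $ a" for a
          using u'x[of x a] ux[of x a] f xi xj by auto
        then have "(mat 1 - \<sigma> *\<^sub>R u) *v x = 0"
          using ax by (simp add: matrix_vector_mult_diff_rdistrib vec_eq_iff scaleR_matrix_vector_assoc[symmetric])
        then show ?thesis using x xi by simp
      qed
      have "axis i 1 \<in> ?B"
      proof -
        have "(u *v axis i 1) $ a = \<sigma> * axis i 1 $ a" for a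
        proof (cases "a = i")
          case False
          then have "p a \<noteq> i" using f d(1) by metis
          then show ?thesis using False by (simp add: ux axis_def)
        qed (simp add: ux f \<sigma>_def)
        then have "\<sigma> *\<^sub>R (u *v axis i 1) = axis i 1" using \<sigma> by (auto simp: vec_eq_iff)
        then show ?thesis by (auto simp: matrix_vector_mult_diff_rdistrib scaleR_matrix_vector_assoc[symmetric] coord_space_def axis_def)
      qed
      moreover have "axis i 1 \<notin> ?A" using sub[of "axis i 1"] by (auto simp: axis_def)
      ultimately have "?A \<subset> ?B" using sub by blast
      then show ?thesis unfolding ker_dim_def
        by (intro dim_psubset) (simp only: span_eq_iff[THEN iffD2, OF subspace_ker])
    qed
    have sq: "u ** u = mat 1" "w ** w = mat 1" using cell_index_subset_grassmannian[OF u(1)] cell_index_subset_grassmannian[OF w(1)]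
      by (auto simp: grassmannian_def)
    \<comment> \<open>For \<open>- \<sigma>\<close> the bound comes from the limit in the cell of
      \<open>u\<close>, for \<sigma> from the limit in the cell of \<open>u'\<close>, where it is
      strictly better.\<close>
    have "ker_dim ?D (restrict_rows ?U w) + 1 \<le> ker_dim ?D (restrict_rows ?U u)"
      using sum[OF sq(1)] sum[OF sq(2)] k1[OF \<sigma>'] k2[OF \<sigma>] k3 by linarith
    then show ?thesis using ker_dim_smat[OF s(1), of ?D ?U] ker_dim_smat[OF t(1), of ?D ?U] s(2) t(2) by simp
  qed
  have "rank_le (sw i j \<circ> p) q"
    unfolding rank_le_def
  proof (intro allI impI)
    fix D U :: "'n set" assume "\<forall>x\<in>D. \<forall>y\<le>x. y \<in> D" "\<forall>x\<in>U. \<forall>y\<ge>x. y \<in> U"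
    then have D: "\<And>x y. x \<in> D \<Longrightarrow> y \<le> x \<Longrightarrow> y \<in> D" and U: "\<And>x y. x \<in> U \<Longrightarrow> x \<le> y \<Longrightarrow> y \<in> U" by blast+
    have pp: "p a = b \<longleftrightarrow> a = p b" for a b using d(1) by metis
    have pij: "p c = i \<longleftrightarrow> c = i" "p c = j \<longleftrightarrow> c = j" for c using pp f by metis+
    show "card {c \<in> D. (sw i j \<circ> p) c \<in> U} \<le> card {c \<in> D. q c \<in> U}"
    \<comment> \<open>Only when the segments are cut exactly between \<open>i\<close> and
      \<open>j\<close> can the transposition raise the count, and then by at most one, which
      \<open>strict\<close> absorbs.\<close>
    proof (cases "j \<in> U \<and> i \<notin> U \<and> i \<in> D \<and> j \<notin> D")
      case True
      have "x \<in> D \<longleftrightarrow> x \<le> i" for x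
        using True D[of i x] D[of x j] aj[of x] by blast
      then have "D = ?D" by blast
      moreover have "x \<in> U \<longleftrightarrow> \<not> x \<le> i" for x
        using True U[of j x] U[of x i] aj[of x] by blast
      then have "U = ?U" by blast
      moreover have "{c \<in> ?D. (sw i j \<circ> p) c \<in> ?U} = insert i {c \<in> ?D. p c \<in> ?U}"
        using lt pij by (auto simp: sw_def f)
      then have "card {c \<in> ?D. (sw i j \<circ> p) c \<in> ?U} \<le> card {c \<in> ?D. p c \<in> ?U} + 1" by (simp add: card_insert_if)
      ultimately show ?thesis using strict by simp
    next
      case False
      have "card {c \<in> D. (sw i j \<circ> p) c \<in> U} \<le> card {c \<in> D. p c \<in> U}"
      proof (rule card_inj_on_le[of "\<lambda>c. if i \<in> D \<and> j \<in> D then sw i j c else c"])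
        show "inj_on (\<lambda>c. if i \<in> D \<and> j \<in> D then sw i j c else c) {c \<in> D. (sw i j \<circ> p) c \<in> U}"
          by (rule inj_onI) (auto simp: sw_eq_iff split: if_splits)
        have com: "sw i j (p c) = p (sw i j c)" for c using pij by (auto simp: sw_def f)
        show "(\<lambda>c. if i \<in> D \<and> j \<in> D then sw i j c else c) ` {c \<in> D. (sw i j \<circ> p) c \<in> U} \<subseteq> {c \<in> D. p c \<in> U}"
        proof (rule image_subsetI)
          fix c assume "c \<in> {c \<in> D. (sw i j \<circ> p) c \<in> U}"
          then have c: "c \<in> D" "sw i j (p c) \<in> U" by auto
          show "(if i \<in> D \<and> j \<in> D then sw i j c else c) \<in> {c \<in> D. p c \<in> U}"
          proof (cases "i \<in> D \<and> j \<in> D")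
            case True
            then have "sw i j c \<in> D" using c by (auto simp: sw_def)
            then show ?thesis using True c com by simp
          next
            case F: False
            then have jD: "j \<notin> D" using D[of j i] less_imp_le[OF lt] by blast
            then have "c \<noteq> j" using c by blast
            have "p c \<in> U"
            proof (cases "c = i")
              case True
              then have "j \<in> U" "i \<in> D" using c f by auto
              then have "i \<in> U" using False jD by blast
              then show ?thesis using True f by simp
            next
              case cF: False
              then show ?thesis using c pij[of c] \<open>c \<noteq> j\<close> by (simp add: sw_def)
            qed
            then show ?thesis using F c by auto
          qed
        qed
      qed simp
      moreover have "card {c \<in> D. p c \<in> U} \<le> card {c \<in> D. q c \<in> U}" by (rule count) (use D U in blast)+
      ultimately show ?thesis by linarith
    qed
  qed
  moreover have "(sw i j \<circ> p) ((sw i j \<circ> p) c) = c" for c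
  proof -
    have "p c = i \<longleftrightarrow> c = i" "p c = j \<longleftrightarrow> c = j" using d(1) f by metis+
    then show ?thesis using d(1)[of c] by (auto simp: sw_def f)
  qed
  moreover have "q (q c) = c" for c using t(1) by (simp add: signed_involution_def)
  moreover have "invol_weight (sw i j \<circ> p) = invol_weight q"
    using invol_weight_mult[OF ij d(1) f] two_cell_dim[OF u(1)] two_cell_dim[OF w(1)] dim by (simp add: p_def q_def)
  ultimately have "sw i j \<circ> p = q" using rank_le_imp_invol_weight_le by blast
  then have "q i = j" "q j = i" using f by auto
  then show False using lq lt by simp
qed

section \<open>Charts on cubes\<close>

text \<open>A cube, halved by \<open>0 \<le> t 0\<close> if the flag is set. On a cube a rotation
  angle can simply be added as one more coordinate.\<close>

definition unit_cube :: "nat \<Rightarrow> bool \<Rightarrow> (nat \<Rightarrow> real) set"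
  where "unit_cube p h = {t. (\<forall>i\<ge>p. t i = 0) \<and> (\<forall>i<p. \<bar>t i\<bar> \<le> 1) \<and> (h \<longrightarrow> 0 \<le> t 0)}"

lemma unit_cube_zero: "(\<lambda>_. 0) \<in> unit_cube p h"
  by (simp add: unit_cube_def)

lemma unit_cube_coord: "t \<in> unit_cube p h \<Longrightarrow> \<bar>t i\<bar> \<le> 1"
  by (cases "i < p") (auto simp: unit_cube_def)

lemma unit_cube_scale: "t \<in> unit_cube p h \<Longrightarrow> 0 \<le> \<delta> \<Longrightarrow> \<delta> \<le> 1 \<Longrightarrow> (\<lambda>i. \<delta> * t i) \<in> unit_cube p h"
  by (auto simp: unit_cube_def abs_mult intro!: mult_le_one)

lemma compact_unit_cube: "compact (unit_cube p h)"
proof -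
  have "closed {t :: nat \<Rightarrow> real. \<forall>i<p. \<bar>t i\<bar> \<le> 1}"
  proof -
    have "{t :: nat \<Rightarrow> real. \<forall>i<p. \<bar>t i\<bar> \<le> 1} = (\<Inter>i<p. {t. \<bar>t i\<bar> \<le> 1})" by auto
    moreover have "closed {t :: nat \<Rightarrow> real. \<bar>t i\<bar> \<le> 1}" for i by (intro closed_Collect_le continuous_intros)
    ultimately show ?thesis by auto
  qed
  moreover have "closed {t :: nat \<Rightarrow> real. h \<longrightarrow> 0 \<le> t 0}"
    by (cases h) (auto intro!: closed_Collect_le continuous_intros)
  ultimately have "closed (unit_cube p h)"
    unfolding unit_cube_def Collect_conj_eq by (intro closed_Int closed_flat)
  moreover have "unit_cube p h \<subseteq> {x. \<forall>i. x i \<in> {- 1..1}}"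
    using unit_cube_coord by (fastforce simp: abs_le_iff)
  ultimately show ?thesis by (metis compact_Int_closed compact_box_fun inf.absorb_iff2)
qed

lemma continuous_on_scale: "continuous_on S (\<lambda>t :: nat \<Rightarrow> real. \<lambda>i. \<delta> * t i)"
  by (intro continuous_on_coordinatewise_then_product continuous_intros)

text \<open>On the compact cubes a continuous injection is a homeomorphism onto its image, so the
  inverse is continuous automatically.\<close>

definition chart :: "(nat \<Rightarrow> real) set \<Rightarrow> 'a::metric_space set \<Rightarrow> 'a \<Rightarrow> ((nat \<Rightarrow> real) \<Rightarrow> 'a) \<Rightarrow> bool"
  where "chart D S x f \<longleftrightarrow> continuous_on D f \<and> inj_on f D \<and> f (\<lambda>_. 0) = x \<and> f ` D \<subseteq> S \<and>
    (\<exists>N. open N \<and> x \<in> N \<and> N \<inter> S \<subseteq> f ` D)"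

text \<open>The points of the cube with a coordinate of size at least \<delta> have a compact image,
  which by injectivity does not contain \<open>x\<close> and can be removed from the given
  neighbourhood.\<close>

lemma chart_core:
  assumes f: "chart (unit_cube p h) S x f" and \<delta>: "0 < \<delta>"
  obtains N where "open N" "x \<in> N" "N \<inter> S \<subseteq> f ` {t \<in> unit_cube p h. \<forall>i<p. \<bar>t i\<bar> < \<delta>}"
proof -
  let ?D = "unit_cube p h"
  obtain M where M: "open M" "x \<in> M" "M \<inter> S \<subseteq> f ` ?D" using f by (auto simp: chart_def)
  define C where "C = ?D \<inter> (\<Union>i<p. {t. \<delta> \<le> \<bar>t i\<bar>})"
  have "closed (\<Union>i<p. {t :: nat \<Rightarrow> real. \<delta> \<le> \<bar>t i\<bar>})"
    by (intro closed_UN ballI closed_Collect_le continuous_on_const continuous_on_rabs continuous_on_coordinate) simp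
  then have "compact C" unfolding C_def by (intro compact_Int_closed compact_unit_cube)
  moreover have "continuous_on C f" using f by (auto simp: chart_def C_def intro: continuous_on_subset)
  ultimately have "closed (f ` C)" by (intro compact_imp_closed compact_continuous_image)
  moreover have "x \<notin> f ` C"
  proof
    assume "x \<in> f ` C"
    then obtain t where t: "t \<in> C" "f t = f (\<lambda>_. 0)" using f by (auto simp: chart_def)
    then have "t = (\<lambda>_. 0)" using f unit_cube_zero by (intro inj_onD[of f ?D]) (auto simp: chart_def C_def)
    then show False using t \<delta> by (auto simp: C_def)
  qed
  moreover have "z \<in> f ` {t \<in> ?D. \<forall>i<p. \<bar>t i\<bar> < \<delta>}" if z: "z \<in> (M - f ` C) \<inter> S" for z
  proof -
    obtain t where t: "t \<in> ?D" "z = f t" using z M by blast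
    then have "t \<notin> C" using z by blast
    then have "\<forall>i<p. \<bar>t i\<bar> < \<delta>" using t by (auto simp: C_def not_le)
    then show ?thesis using t by blast
  qed
  ultimately show ?thesis using M by (intro that[of "M - f ` C"]) auto
qed

text \<open>If every scale \<open>inverse (real (Suc n))\<close> failed, the scaled counterexamples
  would converge along a subsequence to the centre of the cube, contradicting continuity
  there.\<close>

lemma chart_shrink:
  assumes f: "chart (unit_cube p h) S x f" and N: "open N" "x \<in> N"
  obtains \<delta> where "0 < \<delta>" "\<delta> \<le> 1" "chart (unit_cube p h) S x (\<lambda>t. f (\<lambda>i. \<delta> * t i))"
    "\<And>t. t \<in> unit_cube p h \<Longrightarrow> f (\<lambda>i. \<delta> * t i) \<in> N"
proof -
  let ?D = "unit_cube p h"
  have c: "continuous_on ?D f" "inj_on f ?D" "f (\<lambda>_. 0) = x" "f ` ?D \<subseteq> S" using f by (auto simp: chart_def)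
  have "\<exists>\<delta>. 0 < \<delta> \<and> \<delta> \<le> 1 \<and> (\<forall>t\<in>?D. f (\<lambda>i. \<delta> * t i) \<in> N)"
  proof (rule ccontr)
    assume "\<not> ?thesis"
    then have "\<forall>n :: nat. \<exists>t\<in>?D. f (\<lambda>i. inverse (real (Suc n)) * t i) \<notin> N"
      by (metis inverse_le_1_iff inverse_positive_iff_positive of_nat_0_less_iff real_of_nat_ge_one_iff zero_less_Suc One_nat_def Suc_leI)
    then obtain t where t: "\<And>n. t n \<in> ?D" "\<And>n. f (\<lambda>i. inverse (real (Suc n)) * t n i) \<notin> N" by metis
    define s where "s n = (\<lambda>i. inverse (real (Suc n)) * t n i)" for n
    have s: "s n \<in> ?D" for n unfolding s_def by (intro unit_cube_scale t) (auto simp: field_simps)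
    obtain l r where l: "l \<in> ?D" "strict_mono r" "(s \<circ> r) \<longlonglongrightarrow> l"
      using compact_imp_seq_compact[OF compact_unit_cube[of p h]] s unfolding seq_compact_def by blast
    have "l i = 0" for i
    proof -
      have "(\<lambda>n. s n i) \<longlonglongrightarrow> 0"
      proof (rule Lim_null_comparison[OF _ LIMSEQ_inverse_real_of_nat])
        have "\<bar>s n i\<bar> \<le> inverse (real (Suc n))" for n
          unfolding s_def abs_mult using unit_cube_coord[OF t(1), of n i] by (simp add: mult_left_le)
        then show "\<forall>\<^sub>F n in sequentially. norm (s n i) \<le> inverse (real (Suc n))" by simp
      qed
      then have "(\<lambda>n. (s \<circ> r) n i) \<longlonglongrightarrow> 0" using LIMSEQ_subseq_LIMSEQ[OF _ l(2)] by (force simp: o_def)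
      moreover have "(\<lambda>n. (s \<circ> r) n i) \<longlonglongrightarrow> l i"
        using continuous_on_tendsto_compose[OF continuous_on_coordinate[of UNIV i] l(3)] by simp
      ultimately show ?thesis using LIMSEQ_unique by blast
    qed
    then have "l = (\<lambda>_. 0)" by auto
    moreover have "(\<lambda>n. f ((s \<circ> r) n)) \<longlonglongrightarrow> f l"
      using continuous_on_tendsto_compose[OF c(1) l(3,1)] s by simp
    ultimately have "\<forall>\<^sub>F n in sequentially. f ((s \<circ> r) n) \<in> N" using N c(3) topological_tendstoD by blast
    then obtain n where "f (s (r n)) \<in> N" by (auto simp: eventually_sequentially)
    then show False using t(2)[of "r n"] by (simp add: s_def)
  qed
  then obtain \<delta> where \<delta>: "0 < \<delta>" "\<delta> \<le> 1" "\<And>t. t \<in> ?D \<Longrightarrow> f (\<lambda>i. \<delta> * t i) \<in> N" by blast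
  have sc: "(\<lambda>t i. \<delta> * t i) ` ?D \<subseteq> ?D" using unit_cube_scale \<delta> by (auto intro: less_imp_le)
  obtain M where M: "open M" "x \<in> M" "M \<inter> S \<subseteq> f ` {t \<in> ?D. \<forall>i<p. \<bar>t i\<bar> < \<delta>}" by (rule chart_core[OF f \<delta>(1)])
  have "{t \<in> ?D. \<forall>i<p. \<bar>t i\<bar> < \<delta>} \<subseteq> (\<lambda>t i. \<delta> * t i) ` ?D"
  proof
    fix t assume t: "t \<in> {t \<in> ?D. \<forall>i<p. \<bar>t i\<bar> < \<delta>}"
    show "t \<in> (\<lambda>t i. \<delta> * t i) ` ?D"
    proof (rule image_eqI[where x="\<lambda>i. t i / \<delta>"])
      show "(\<lambda>i. t i / \<delta>) \<in> ?D" using t \<delta> by (auto simp: unit_cube_def field_simps less_imp_le)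
      show "t = (\<lambda>i. \<delta> * (t i / \<delta>))" using \<delta> by auto
    qed
  qed
  then have im: "M \<inter> S \<subseteq> (\<lambda>t. f (\<lambda>i. \<delta> * t i)) ` ?D" using M(3) by (force simp: image_iff)
  have "chart ?D S x (\<lambda>t. f (\<lambda>i. \<delta> * t i))"
    unfolding chart_def
  proof (intro conjI exI[of _ M] M(1,2) im)
    show "continuous_on ?D (\<lambda>t. f (\<lambda>i. \<delta> * t i))"
      using continuous_on_compose2[OF c(1) continuous_on_scale sc] .
    show "inj_on (\<lambda>t. f (\<lambda>i. \<delta> * t i)) ?D"
    proof (rule inj_onI)
      fix s t assume st: "s \<in> ?D" "t \<in> ?D" "f (\<lambda>i. \<delta> * s i) = f (\<lambda>i. \<delta> * t i)"
      then have "(\<lambda>i. \<delta> * s i) = (\<lambda>i. \<delta> * t i)" using inj_onD[OF c(2)] sc by blast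
      then show "s = t" using \<delta> by (auto simp: fun_eq_iff)
    qed
    show "f (\<lambda>i. \<delta> * 0) = x" using c by simp
    show "(\<lambda>t. f (\<lambda>i. \<delta> * t i)) ` ?D \<subseteq> S" using c(4) sc by blast
  qed
  then show ?thesis using that \<delta> by blast
qed

lemma chart_sequence:
  assumes "chart D S x f" "\<And>n. z n \<in> S" "z \<longlonglongrightarrow> x"
  shows "\<forall>\<^sub>F n in sequentially. z n \<in> f ` D"
proof -
  obtain N where "open N" "x \<in> N" "N \<inter> S \<subseteq> f ` D" using assms(1) by (auto simp: chart_def)
  then show ?thesis using topological_tendstoD[OF assms(3)] assms(2) by (force elim: eventually_mono)
qed

text \<open>Otherwise points of \<open>S\<close> outside \<open>A\<close> at distance less than
  \<open>inverse (real (Suc n))\<close> form a forbidden sequence. The hypothesis asks for one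
  member only, which is what an argument along subsequences delivers.\<close>

lemma neighbourhood_from_sequences:
  fixes x :: "'a::metric_space"
  assumes "\<And>z. (\<And>n. z n \<in> S) \<Longrightarrow> z \<longlonglongrightarrow> x \<Longrightarrow> \<exists>n. z n \<in> A"
  obtains N where "open N" "x \<in> N" "N \<inter> S \<subseteq> A"
proof (rule ccontr)
  assume no: "\<not> thesis"
  have "\<exists>z. z \<in> S \<and> dist z x < inverse (real (Suc n)) \<and> z \<notin> A" for n
  proof (rule ccontr)
    assume "\<not> ?thesis"
    then have "ball x (inverse (real (Suc n))) \<inter> S \<subseteq> A" by (auto simp: dist_commute)
    then show False using that[of "ball x (inverse (real (Suc n)))"] no by simp
  qed
  then obtain z where z: "\<And>n. z n \<in> S" "\<And>n. dist (z n) x < inverse (real (Suc n))" "\<And>n. z n \<notin> A" by metis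
  have "(\<lambda>n. dist (z n) x) \<longlonglongrightarrow> 0"
    by (rule Lim_null_comparison[OF _ LIMSEQ_inverse_real_of_nat]) (use z(2) in \<open>auto intro!: always_eventually less_imp_le\<close>)
  then show False using assms[of z] z tendsto_dist_iff by blast
qed

section \<open>Continuity of the rotation action and limits of angles\<close>

lemma continuous_act: "continuous_on UNIV (\<lambda>p. act i j (fst p) (snd p))"
proof -
  have m: "continuous_on S (\<lambda>x. f x ** g x)" if "continuous_on S f" "continuous_on S g"
    for S and f g :: "'b::topological_space \<Rightarrow> real ^ 'c ^ 'c"
    unfolding matrix_matrix_mult_def by (intro continuous_intros continuous_on_vec_lambda that)
  have r: "continuous_on UNIV (\<lambda>x. rot i j (f x))" if f: "continuous_on UNIV f" for f :: "'b::t2_space \<Rightarrow> real"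
    unfolding rot_def
  proof (intro continuous_on_vec_lambda)
    fix a c show "continuous_on UNIV (\<lambda>x. if a = i then (if c = i then cos (f x) else if c = j then - sin (f x) else 0)
      else if a = j then (if c = i then sin (f x) else if c = j then cos (f x) else 0) else if a = c then 1 else 0)"
      using continuous_on_compose2[OF continuous_on_cos[OF continuous_on_id] f subset_UNIV]
        continuous_on_compose2[OF continuous_on_sin[OF continuous_on_id] f subset_UNIV]
      by (cases "a = i"; cases "a = j"; cases "c = i"; cases "c = j"; cases "a = c") (auto intro: continuous_on_minus)
  qed
  show ?thesis unfolding act_def by (intro m r continuous_intros)
qed

lemma tendsto_act:
  assumes "(\<theta> \<longlongrightarrow> \<theta>0) F" "(g \<longlongrightarrow> g0) F"
  shows "((\<lambda>n. act i j (\<theta> n) (g n)) \<longlongrightarrow> act i j \<theta>0 g0) F"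
proof -
  have "isCont (\<lambda>p. act i j (fst p) (snd p)) (\<theta>0, g0)"
    using continuous_act[of i j] by (simp add: continuous_on_eq_continuous_at)
  from isCont_tendsto_compose[OF this tendsto_Pair[OF assms]] show ?thesis by simp
qed

lemma continuous_on_act:
  assumes "continuous_on S \<theta>" "continuous_on S g"
  shows "continuous_on S (\<lambda>x. act i j (\<theta> x) (g x))"
  using continuous_on_compose2[OF continuous_act[of i j] continuous_on_Pair[OF assms]] by simp

lemma act_neighbourhood:
  fixes g :: "real ^ 'n ^ 'n"
  assumes "open M" "act i j \<theta> g \<in> M"
  obtains \<epsilon> N where "0 < \<epsilon>" "open N" "g \<in> N" "\<And>\<theta>' h. \<bar>\<theta>' - \<theta>\<bar> < \<epsilon> \<Longrightarrow> h \<in> N \<Longrightarrow> act i j \<theta>' h \<in> M"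
proof -
  have "open ((\<lambda>p. act i j (fst p) (snd p)) -` M)"
    using continuous_act[of i j] assms(1) by (intro open_vimage)
  then obtain A B where AB: "open A" "open B" "(\<theta>, g) \<in> A \<times> B" "A \<times> B \<subseteq> (\<lambda>p. act i j (fst p) (snd p)) -` M"
    using assms(2) by (auto elim!: open_prod_elim[where x="(\<theta>, g)"])
  then obtain \<epsilon> where "0 < \<epsilon>" "ball \<theta> \<epsilon> \<subseteq> A" using open_contains_ball by blast
  then show ?thesis using AB
    by (intro that[of \<epsilon> B]) (auto simp: dist_real_def abs_minus_commute subset_iff)
qed

lemma bounded_angle_subsequence:
  fixes \<theta> :: "nat \<Rightarrow> real"
  assumes "\<And>n. a \<le> \<theta> n \<and> \<theta> n \<le> b"
  obtains l r where "a \<le> l" "l \<le> b" "strict_mono r" "(\<lambda>n. \<theta> (r n)) \<longlonglongrightarrow> l"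
proof -
  have "\<forall>n. \<theta> n \<in> {a..b}" using assms by simp
  then obtain l r where "l \<in> {a..b}" "strict_mono r" "(\<theta> \<circ> r) \<longlonglongrightarrow> l"
    using compact_imp_seq_compact[OF compact_Icc[of a b]] unfolding seq_compact_def by meson
  then show ?thesis using that by (auto simp: o_def)
qed

section \<open>Charts at the edge of a cell\<close>

lemma star_connected:
  fixes A :: "(nat \<Rightarrow> real) set"
  assumes star: "\<And>z s. z \<in> A \<Longrightarrow> 0 \<le> s \<Longrightarrow> s \<le> 1 \<Longrightarrow> (\<lambda>i. b i + s * (z i - b i)) \<in> A"
  shows "connected A"
proof -
  have c: "connected_component A b z" if z: "z \<in> A" for z
    unfolding connected_component_def
  proof (intro exI[of _ "(\<lambda>s i. b i + s * (z i - b i)) ` {0..1}"] conjI)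
    show "connected ((\<lambda>s i. b i + s * (z i - b i)) ` {0..1})"
      by (intro connected_continuous_image continuous_on_coordinatewise_then_product continuous_intros) auto
    show "(\<lambda>s i. b i + s * (z i - b i)) ` {0..1} \<subseteq> A" using star z by auto
    show "b \<in> (\<lambda>s i. b i + s * (z i - b i)) ` {0..1}" by (rule image_eqI[where x=0]) auto
    show "z \<in> (\<lambda>s i. b i + s * (z i - b i)) ` {0..1}" by (rule image_eqI[where x=1]) auto
  qed
  show ?thesis unfolding connected_iff_connected_component
    using c connected_component_trans connected_component_sym by metis
qed

lemma turn_distinct:
  assumes ij: "adjacent i j" and a: "a \<in> cell_index k" "ascent i j a"
  shows "turn i j (pi/2) a \<noteq> turn i j (- (pi/2)) a"
proof
  assume eq: "turn i j (pi/2) a = turn i j (- (pi/2)) a"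
  have ne: "i \<noteq> j" using ij by (auto simp: adjacent_def)
  have "turn i j pi a = a"
  proof (cases "fixes_both i j a")
    case True
    then have "rot i j (pi/2) ** (rot i j (pi/2) ** a) = rot i j (pi/2) ** (rot i j (- (pi/2)) ** a)"
      using eq by (simp add: turn_def)
    then show ?thesis using True ne by (simp add: turn_def matrix_mul_assoc rot_add rot_zero)
  next
    case False
    then have "act i j (pi/2) (act i j (pi/2) a) = act i j (pi/2) (act i j (- (pi/2)) a)"
      using eq by (simp add: turn_def)
    then show ?thesis using False ne by (simp add: turn_def act_act act_zero)
  qed
  then show False using turn_pi(4)[OF ij a] by simp
qed

lemma act_minus_pi: "act i j (- pi) = act i j pi"
  using act_periodic(1)[of i j "- pi"] by simp

type_synonym 'n sqmat = "((real, 'n) vec, 'n) vec"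

text \<open>The orientations given in the theorem provide the characteristic maps. Closures,
  connectedness and local charts of the cells are drawn from them; the parameter \<open>T\<close>
  fixes the index type.\<close>

locale bruhat_structure =
  fixes k :: nat and T :: "'n::{finite,wellorder} itself"
  assumes char: "\<And>u :: 'n sqmat. u \<in> cell_index k \<Longrightarrow>
    \<exists>\<Phi>. characteristic_map (top_of_set (grassmannian k)) (cell_index k) (bruhat_cell k) cell_dim u \<Phi>"
begin

abbreviation I :: "'n sqmat set" where "I \<equiv> cell_index k"
abbreviation E :: "'n sqmat \<Rightarrow> 'n sqmat set" where "E \<equiv> bruhat_cell k"
abbreviation X :: "'n sqmat topology" where "X \<equiv> top_of_set (grassmannian k)"

lemma cell_structure: "cell_structure X I E cell_dim"
proof
  show "Hausdorff_space X" by (simp add: Hausdorff_space_subtopology)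
  show "finite I" by (rule finite_cell_index)
  show "E u \<subseteq> topspace X" for u by (auto simp: bruhat_cell_eq)
  show "u = v" if "u \<in> I" "v \<in> I" "g \<in> E u" "g \<in> E v" for u v g using bruhat_cell_disjoint that .
  show "\<exists>\<Phi>. characteristic_map X I E cell_dim u \<Phi>" if "u \<in> I" for u using char that .
qed

lemmas disj = bruhat_cell_disjoint

text \<open>The image of the closed ball is compact, hence contains the closure of the cell; what it
  has beyond the cell lies in the lower skeleton.\<close>

lemma closure_cell:
  assumes u: "u \<in> I" and g: "g \<in> closure (E u)"
  shows "g \<in> E u \<or> (\<exists>u'\<in>I. cell_dim u' < cell_dim u \<and> g \<in> E u')"
proof -
  interpret cell_structure X I E cell_dim by (rule cell_structure)
  obtain \<Phi> where \<Phi>: "characteristic_map X I E cell_dim u \<Phi>" using char[OF u] by blast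
  note c = char_map_image[OF u \<Phi>]
  have "continuous_on (ball_set (cell_dim u)) \<Phi>" using c(5) by (simp add: unit_ball_top_of_set)
  then have "closed (\<Phi> ` ball_set (cell_dim u))"
    by (intro compact_imp_closed compact_continuous_image compact_ball_set)
  moreover have "E u \<subseteq> \<Phi> ` ball_set (cell_dim u)"
    unfolding c(1)[symmetric] by (rule image_mono) (use ball_set_split(1) in blast)
  ultimately have "closure (E u) \<subseteq> \<Phi> ` ball_set (cell_dim u)" by (intro closure_minimal)
  then have "g \<in> E u \<union> skeleton I E cell_dim (int (cell_dim u) - 1)" by (rule subsetD[OF subset_trans[OF _ c(2)] g])
  then show ?thesis by (auto simp: skeleton_def)
qed

lemma closure_cellD:
  assumes "u \<in> I" "v \<in> I" "x \<in> E v" "x \<in> closure (E u)"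
  shows "v = u \<or> cell_dim v < cell_dim u"
  using closure_cell[OF assms(1,4)] disj assms by blast

lemma connected_cell: assumes u: "u \<in> I" shows "connected (E u)"
proof -
  interpret cell_structure X I E cell_dim by (rule cell_structure)
  obtain \<Phi> where \<Phi>: "characteristic_map X I E cell_dim u \<Phi>" using char[OF u] by blast
  note c = char_map_image[OF u \<Phi>]
  have "continuous_on (ball_set (cell_dim u)) \<Phi>" using c(5) by (simp add: unit_ball_top_of_set)
  then have "continuous_on (unit_ball_interior (cell_dim u)) \<Phi>"
    by (rule continuous_on_subset) (use ball_set_split(1) in blast)
  moreover have "connected (unit_ball_interior (cell_dim u))"
  proof (rule star_connected[where b="\<lambda>_. 0"])
    fix z :: "nat \<Rightarrow> real" and s :: real
    assume z: "z \<in> unit_ball_interior (cell_dim u)" and s: "0 \<le> s" "s \<le> 1"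
    have "(\<Sum>i<cell_dim u. (s * z i)\<^sup>2) \<le> (\<Sum>i<cell_dim u. (z i)\<^sup>2)"
      using s by (intro sum_mono) (auto simp: power_mult_distrib power_le_one mult_left_le_one_le)
    also have "\<dots> < 1" using z by (simp add: unit_ball_interior_eq)
    finally show "(\<lambda>i. 0 + s * (z i - 0)) \<in> unit_ball_interior (cell_dim u)" using z by (simp add: unit_ball_interior_eq)
  qed
  ultimately have "connected (\<Phi> ` unit_ball_interior (cell_dim u))" by (rule connected_continuous_image)
  then show ?thesis unfolding c(1) .
qed

text \<open>A small cube around the preimage of \<open>x\<close> in the open ball, mapped by the
  characteristic map.\<close>

lemma chart_cell:
  assumes u: "u \<in> I" and x: "x \<in> E u"
  obtains f where "chart (unit_cube (cell_dim u) False) (E u) x f"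
proof -
  interpret cell_structure X I E cell_dim by (rule cell_structure)
  let ?p = "cell_dim u" let ?B = "unit_ball_interior ?p" let ?D = "unit_cube ?p False"
  obtain \<Phi> where \<Phi>: "characteristic_map X I E cell_dim u \<Phi>" using char[OF u] by blast
  note c = char_map_image[OF u \<Phi>]
  have "x \<in> \<Phi> ` ?B" unfolding c(1) by (rule x)
  then obtain z where z: "z \<in> ?B" "\<Phi> z = x" by (elim imageE) simp
  define r where "r = (\<Sum>i<?p. (z i)\<^sup>2)"
  have r: "0 \<le> r" "r < 1" using z by (auto simp: r_def unit_ball_interior_eq sum_nonneg)
  \<comment> \<open>Each coordinate increases the sum of squares by at most
    \<open>3 * \<epsilon>\<close>, so the cube stays in the open ball. The summand 1 avoids a zero
    denominator in dimension zero.\<close>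
  define \<epsilon> where "\<epsilon> = (1 - r) / (3 * real ?p + 1)"
  have \<epsilon>: "0 < \<epsilon>" "\<epsilon> \<le> 1" using r by (auto simp: \<epsilon>_def field_simps)
  have \<epsilon>3: "3 * real ?p * \<epsilon> < 1 - r"
  proof -
    have "(3 * real ?p + 1) * \<epsilon> = 1 - r" by (simp add: \<epsilon>_def)
    then show ?thesis using \<epsilon>(1) by (simp add: algebra_simps)
  qed
  define m where "m t = (\<lambda>i. z i + \<epsilon> * t i)" for t :: "nat \<Rightarrow> real"
  have m: "m t \<in> ?B" if t: "t \<in> ?D" for t
  proof -
    have "(z i + \<epsilon> * t i)\<^sup>2 \<le> (z i)\<^sup>2 + 3 * \<epsilon>" for i
    proof -
      have "\<bar>z i\<bar> \<le> 1" using ball_set_coord_le z(1) ball_set_split(1) by blast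
      moreover have "\<bar>t i\<bar> \<le> 1" using unit_cube_coord t by blast
      ultimately have "\<bar>z i\<bar> * \<bar>t i\<bar> \<le> 1" "\<bar>t i\<bar> * \<bar>t i\<bar> \<le> 1" by (intro mult_le_one; simp)+
      then have "z i * t i \<le> 1" "t i * t i \<le> 1" unfolding abs_mult[symmetric] by linarith+
      then have "\<epsilon> * (2 * (z i * t i)) \<le> \<epsilon> * 2" "\<epsilon> * (\<epsilon> * (t i * t i)) \<le> \<epsilon> * 1"
        using \<epsilon> by (auto intro!: mult_left_mono mult_le_one)
      then show ?thesis by (simp add: power2_eq_square algebra_simps)
    qed
    then have "(\<Sum>i<?p. (z i + \<epsilon> * t i)\<^sup>2) \<le> (\<Sum>i<?p. (z i)\<^sup>2 + 3 * \<epsilon>)" by (intro sum_mono)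
    also have "\<dots> = r + 3 * real ?p * \<epsilon>" by (simp add: sum.distrib r_def)
    also have "\<dots> < 1" using \<epsilon>3 by simp
    finally show ?thesis using t z(1) by (simp add: unit_ball_interior_eq unit_cube_def m_def)
  qed
  have cm: "continuous_on ?D m" unfolding m_def
    by (intro continuous_on_coordinatewise_then_product continuous_intros)
  have "continuous_on (ball_set ?p) \<Phi>" using c(5) by (simp add: unit_ball_top_of_set)
  then have c\<Phi>: "continuous_on ?B \<Phi>" by (rule continuous_on_subset) (use ball_set_split(1) in blast)
  define G where "G = {y. \<forall>i<?p. \<bar>y i - z i\<bar> < \<epsilon>}"
  have "G = (\<Inter>i<?p. {y. \<bar>y i - z i\<bar> < \<epsilon>})" by (auto simp: G_def)
  moreover have "open {y :: nat \<Rightarrow> real. \<bar>y i - z i\<bar> < \<epsilon>}" for i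
    by (intro open_Collect_less continuous_intros)
  ultimately have oG: "open G" by auto
  have top: "subtopology (unit_ball ?p) ?B = top_of_set ?B"
    using ball_set_split(1)[of ?p] by (simp add: unit_ball_top_of_set subtopology_subtopology Int_absorb1)
  have topE: "subtopology X (E u) = top_of_set (E u)"
    by (simp add: subtopology_subtopology bruhat_cell_eq Int_absorb1)
  have "openin (top_of_set (E u)) (\<Phi> ` (?B \<inter> G))"
    using homeomorphic_imp_open_map[OF c(4)] openin_open_Int[OF oG, of ?B] unfolding top topE open_map_def by blast
  then obtain N where N: "open N" "\<Phi> ` (?B \<inter> G) = E u \<inter> N" by (auto simp: openin_open)
  have "chart ?D (E u) x (\<Phi> \<circ> m)"
    unfolding chart_def
  proof (intro conjI exI[of _ N])
    show "continuous_on ?D (\<Phi> \<circ> m)" using continuous_on_compose2[OF c\<Phi> cm] m by (auto simp: o_def)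
    show "inj_on (\<Phi> \<circ> m) ?D"
    proof (rule inj_onI)
      fix s t assume st: "s \<in> ?D" "t \<in> ?D" "(\<Phi> \<circ> m) s = (\<Phi> \<circ> m) t"
      then have "m s = m t" using inj_onD[OF c(3)] m by simp
      then show "s = t" using \<epsilon> by (auto simp: m_def fun_eq_iff)
    qed
    show "(\<Phi> \<circ> m) (\<lambda>_. 0) = x" using z by (simp add: m_def)
    show "(\<Phi> \<circ> m) ` ?D \<subseteq> E u" unfolding c(1)[symmetric] using m by auto
    show "open N" by (rule N)
    have "z \<in> ?B \<inter> G" using z \<epsilon> by (simp add: G_def)
    then show "x \<in> N" using N z by blast
    show "N \<inter> E u \<subseteq> (\<Phi> \<circ> m) ` ?D"
    proof
      fix g assume "g \<in> N \<inter> E u"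
      then obtain y where y: "y \<in> ?B" "y \<in> G" "g = \<Phi> y" using N by blast
      have "(\<lambda>i. (y i - z i) / \<epsilon>) \<in> ?D"
        using y z \<epsilon> by (auto simp: unit_cube_def unit_ball_interior_eq G_def field_simps abs_if less_imp_le split: if_splits)
      moreover have "m (\<lambda>i. (y i - z i) / \<epsilon>) = y" using \<epsilon> by (auto simp: m_def)
      ultimately show "g \<in> (\<Phi> \<circ> m) ` ?D" unfolding y(3) by (intro image_eqI[where x="\<lambda>i. (y i - z i) / \<epsilon>"]) auto
    qed
  qed
  then show ?thesis by (rule that)
qed

lemma act_pi_cell:
  assumes ij: "adjacent i j" and a: "a \<in> I" "ascent i j a" and g: "g \<in> E a"
  shows "act i j pi g \<in> E a \<union> E (turn i j pi a)"
  using act_bruhat_cell_pi[OF ij a g] by (auto split: if_splits)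

text \<open>A negative angle \<theta> is the positive angle \<open>pi + \<theta>\<close> after a
  half turn. The half turn leads to \<open>a\<close> or to its companion, and the companion has the
  same upper neighbours.\<close>

lemma orbit:
  assumes ij: "adjacent i j" and a: "a \<in> I" "ascent i j a" and g: "g \<in> E a" and \<theta>: "\<theta> \<noteq> 0" "\<bar>\<theta>\<bar> < pi"
  shows "act i j \<theta> g \<in> E (turn i j (pi/2) a) \<union> E (turn i j pi a) \<union> E (turn i j (- (pi/2)) a)"
proof (cases "0 < \<theta>")
  case True
  then show ?thesis using act_bruhat_cell_ascent(1)[OF ij a g] \<theta> by simp
next
  case False
  have ne: "i \<noteq> j" using ij by (auto simp: adjacent_def)
  note tp = turn_pi[OF ij a]
  have r: "0 < pi + \<theta>" "pi + \<theta> < pi" using False \<theta> by auto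
  have eq: "act i j \<theta> g = act i j (pi + \<theta>) (act i j pi g)"
    using act_minus_pi[of i j] act_act[OF ne, of "pi + \<theta>" "- pi" g] by simp
  show ?thesis
  proof (cases "fixes_both i j a")
    case True
    then have "act i j pi g \<in> E a" using act_bruhat_cell_pi[OF ij a g] by simp
    then show ?thesis unfolding eq by (rule act_bruhat_cell_ascent(1)[OF ij a _ r])
  next
    case F: False
    then have "act i j pi g \<in> E (turn i j pi a)" using act_bruhat_cell_pi[OF ij a g] by simp
    from act_bruhat_cell_ascent(2)[OF ij tp(1,2) this r] show ?thesis using F tp unfolding eq by simp
  qed
qed

lemma orbit_cell:
  assumes ij: "adjacent i j" and a: "a \<in> I" "ascent i j a" and g: "g \<in> E a" and \<theta>: "\<theta> \<noteq> 0" "\<bar>\<theta>\<bar> < pi"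
    and b: "b \<in> I" "act i j \<theta> g \<in> E b"
  shows "b = turn i j (pi/2) a \<or> b = turn i j pi a \<or> b = turn i j (- (pi/2)) a"
  using orbit[OF ij a g \<theta>] b turn_pi(1)[OF ij a] turn_cases(1)[OF ij a, of "pi/2"]
    turn_cases(1)[OF ij a, of "- (pi/2)"] disj[of b k] by blast

lemma ascent_not_descent: "ascent i j a \<Longrightarrow> \<not> descent i j a"
  by (auto simp: ascent_def descent_def)

text \<open>A nonzero rotation by less than \<open>pi\<close> leads from the cell of
  \<open>a\<close> to its companion or to cells with a descent at \<open>i, j\<close>, and
  \<open>b\<close> is none of these.\<close>

lemma move_disjoint:
  assumes ij: "adjacent i j" and a: "a \<in> I" "ascent i j a" and g: "g \<in> E a"
    and b: "b \<in> I" "ascent i j b" "b \<noteq> turn i j pi a" "act i j \<theta> g \<in> E b" and \<theta>: "\<bar>\<theta>\<bar> < pi"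
  shows "\<theta> = 0"
  using orbit_cell[OF ij a g _ \<theta> b(1,4)] b ascent_not_descent
    turn_cases(2)[OF ij a, of "pi/2"] turn_cases(2)[OF ij a, of "- (pi/2)"] by blast

lemma act_limit:
  assumes "\<And>n. act i j (- \<theta> n) (z n) \<in> A" "\<theta> \<longlonglongrightarrow> l" "z \<longlonglongrightarrow> x"
  shows "act i j (- l) x \<in> closure A"
proof (rule Lim_in_closed_set[OF closed_closure])
  show "(\<lambda>n. act i j (- \<theta> n) (z n)) \<longlonglongrightarrow> act i j (- l) x" by (intro tendsto_act tendsto_minus assms)
  show "\<forall>\<^sub>F n in sequentially. act i j (- \<theta> n) (z n) \<in> closure A" using assms(1) closure_subset by (auto intro!: always_eventually)
qed simp

lemma act_pi_closure:
  assumes ij: "adjacent i j" and a: "a \<in> I" "ascent i j a" and g: "act i j (- pi) g \<in> closure (E a)"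
  shows "g \<in> closure (E a) \<union> closure (E (turn i j pi a))"
proof -
  have ne: "i \<noteq> j" using ij by (auto simp: adjacent_def)
  obtain z where z: "\<And>n. z n \<in> E a" "z \<longlonglongrightarrow> act i j (- pi) g" using g unfolding closure_sequential by blast
  have "act i j (- (- pi)) (act i j (- pi) g) \<in> closure (E a \<union> E (turn i j pi a))"
    by (rule act_limit[OF _ tendsto_const z(2)]) (use act_pi_cell[OF ij a z(1)] in simp)
  then show ?thesis using ne by (simp add: act_act act_zero closure_Un)
qed

definition edge_chart :: "'n sqmat \<Rightarrow> 'n sqmat \<Rightarrow> 'n sqmat \<Rightarrow> ((nat \<Rightarrow> real) \<Rightarrow> 'n sqmat) \<Rightarrow> bool"
  where "edge_chart v w x f \<longleftrightarrow> chart (unit_cube (cell_dim w) True) (E v \<union> E w) x f \<and>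
    (\<forall>t\<in>unit_cube (cell_dim w) True. f t \<in> E v \<longleftrightarrow> t 0 = 0)"

text \<open>The common frame of the next two constructions. A chart \<open>f\<close> of
  \<open>S\<close> at \<open>y\<close> is rotated through angles near \<theta>0;
  \<open>c * s t\<close> is the deviation of the angle, \<open>J\<close> its range in units of
  \<open>c\<close>. \<open>move\<close> yields injectivity and \<open>seq\<close> yields that a
  neighbourhood is covered. Off the face the rotated points may at first lie in \<open>w\<close> or
  in its twin \<open>w2\<close>; connectedness decides for \<open>w\<close>.\<close>

lemma edge_chart_extend:
  fixes \<theta>0 c :: real and s :: "(nat \<Rightarrow> real) \<Rightarrow> real" and \<pi> :: "(nat \<Rightarrow> real) \<Rightarrow> nat \<Rightarrow> real"
  defines "D w \<equiv> unit_cube (cell_dim w) True"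
  assumes ne: "i \<noteq> j" and v: "v \<in> I" and w: "w \<in> I" "cell_dim w = Suc (cell_dim v)"
    and w2: "w2 \<in> I" "cell_dim w2 = cell_dim w" "w2 \<noteq> w"
    and x: "x \<in> closure (E w)" "x = act i j \<theta>0 y" and c0: "c \<noteq> 0"
    and f: "chart (unit_cube q h) S y f"
    and cont: "continuous_on (D w) \<pi>" "continuous_on (D w) s"
    and dom: "\<And>t. t \<in> D w \<Longrightarrow> \<pi> t \<in> unit_cube q h \<and> s t \<in> J"
    and onto: "\<And>t' r. t' \<in> unit_cube q h \<Longrightarrow> r \<in> J \<Longrightarrow> \<exists>t\<in>D w. \<pi> t = t' \<and> s t = r"
    and inj: "\<And>t t'. t \<in> D w \<Longrightarrow> t' \<in> D w \<Longrightarrow> \<pi> t = \<pi> t' \<Longrightarrow> s t = s t' \<Longrightarrow> t = t'"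
    and zero: "\<pi> (\<lambda>_. 0) = (\<lambda>_. 0)" "s (\<lambda>_. 0) = 0"
    and cells: "\<And>t. t \<in> D w \<Longrightarrow> act i j (\<theta>0 + c * s t) (f (\<pi> t)) \<in> (if t 0 = 0 then E v else E w \<union> E w2)"
    and move: "\<And>g g' r r'. g \<in> S \<Longrightarrow> g' \<in> S \<Longrightarrow> r \<in> J \<Longrightarrow> r' \<in> J \<Longrightarrow>
      act i j (\<theta>0 + c * r) g = act i j (\<theta>0 + c * r') g' \<Longrightarrow> r = r'"
    and seq: "\<And>z u. u = v \<or> u = w \<Longrightarrow> (\<And>n. z n \<in> E u) \<Longrightarrow> z \<longlonglongrightarrow> x \<Longrightarrow>
      \<exists>r \<theta>. strict_mono r \<and> \<theta> \<longlonglongrightarrow> \<theta>0 \<and> (\<forall>n::nat. act i j (- \<theta> n) (z (r n)) \<in> S) \<and>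
        (\<forall>\<^sub>F n in sequentially. (\<theta> n - \<theta>0) / c \<in> J)"
  shows "\<exists>F. edge_chart v w x F"
proof -
  define F where "F t = act i j (\<theta>0 + c * s t) (f (\<pi> t))" for t
  let ?D = "D w"
  have vw: "v \<noteq> w" using w by auto
  have vw2: "v \<noteq> w2" using w w2 by auto
  have F: "F t \<in> (if t 0 = 0 then E v else E w \<union> E w2)" if "t \<in> ?D" for t using cells[OF that] by (simp add: F_def)
  have f': "continuous_on (unit_cube q h) f" "inj_on f (unit_cube q h)" "f (\<lambda>_. 0) = y" "f ` unit_cube q h \<subseteq> S"
    using f by (auto simp: chart_def)
  have cF: "continuous_on ?D F"
    unfolding F_def
    by (intro continuous_on_act continuous_intros cont continuous_on_compose2[OF f'(1) cont(1)]) (use dom in auto)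
  have F0: "F (\<lambda>_. 0) = x" using zero x f' by (simp add: F_def)
  have injF: "inj_on F ?D"
  proof (rule inj_onI)
    fix t t' assume t: "t \<in> ?D" "t' \<in> ?D" "F t = F t'"
    have s: "s t = s t'" by (rule move[OF _ _ _ _ t(3)[unfolded F_def]]) (use dom t f' in auto)
    have "act i j (- (\<theta>0 + c * s t)) (F t) = act i j (- (\<theta>0 + c * s t)) (F t')" using t by simp
    then have "f (\<pi> t) = f (\<pi> t')" using s ne by (simp add: F_def act_act act_zero)
    then have "\<pi> t = \<pi> t'" using inj_onD[OF f'(2)] dom t by blast
    then show "t = t'" using inj t s by blast
  qed
  \<comment> \<open>A sequence in one of the two cells is rotated back into \<open>S\<close>, where
    it converges to \<open>y\<close> and eventually enters the image of the chart
    \<open>f\<close>.\<close>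
  have hit: "\<exists>n. z n \<in> F ` ?D" if u: "u = v \<or> u = w" and z: "\<And>n. z n \<in> E u" "z \<longlonglongrightarrow> x" for u z
  proof -
    obtain r \<theta> where r: "strict_mono r" "\<theta> \<longlonglongrightarrow> \<theta>0" "\<And>n. act i j (- \<theta> n) (z (r n)) \<in> S"
      "\<forall>\<^sub>F n in sequentially. (\<theta> n - \<theta>0) / c \<in> J" using seq[of u z] u z by blast
    have zr: "(\<lambda>n. z (r n)) \<longlonglongrightarrow> x" using LIMSEQ_subseq_LIMSEQ[OF z(2) r(1)] by (simp add: o_def)
    have "(\<lambda>n. act i j (- \<theta> n) (z (r n))) \<longlonglongrightarrow> act i j (- \<theta>0) x" by (intro tendsto_act tendsto_minus r(2) zr)
    then have "(\<lambda>n. act i j (- \<theta> n) (z (r n))) \<longlonglongrightarrow> y" using ne x by (simp add: act_act act_zero)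
    from eventually_happens'[OF _ eventually_conj[OF chart_sequence[OF f r(3) this] r(4)]]
    obtain n where n: "act i j (- \<theta> n) (z (r n)) \<in> f ` unit_cube q h" "(\<theta> n - \<theta>0) / c \<in> J"
      by auto
    then obtain t' where t': "t' \<in> unit_cube q h" "act i j (- \<theta> n) (z (r n)) = f t'" by blast
    obtain t where t: "t \<in> ?D" "\<pi> t = t'" "s t = (\<theta> n - \<theta>0) / c" using onto[OF t'(1) n(2)] by blast
    have "F t = act i j (\<theta> n) (act i j (- \<theta> n) (z (r n)))" using t t' c0 by (simp add: F_def)
    then have "F t = z (r n)" using ne by (simp add: act_act act_zero)
    then show ?thesis using t(1) by (metis image_eqI)
  qed
  \<comment> \<open>The part of the cube off the face is connected, and in its image the cells
    \<open>w\<close> and \<open>w2\<close> are separated, since cells of equal dimension do not meet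
    each other's closures. The image contains a point of \<open>w\<close> because \<open>x\<close>
    is a limit of such points.\<close>
  have side: "F t \<in> E w" if t: "t \<in> ?D" "t 0 \<noteq> 0" for t
  proof (rule ccontr)
    assume no: "F t \<notin> E w"
    let ?H = "{t \<in> ?D. 0 < t 0}"
    obtain z where z: "\<And>n. z n \<in> E w" "z \<longlonglongrightarrow> x" using x(1) unfolding closure_sequential by blast
    obtain n t' where t': "t' \<in> ?D" "z n = F t'" using hit[of w z] z by blast
    have pos: "0 < t 0" if "t \<in> ?D" "t 0 \<noteq> 0" for t using that by (auto simp: D_def unit_cube_def)
    have "t' 0 \<noteq> 0" using F[OF t'(1)] z(1)[of n] t'(2) disj[OF v w(1)] vw by auto
    have tH: "t \<in> ?H" "t' \<in> ?H" using pos t t' \<open>t' 0 \<noteq> 0\<close> by auto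
    have "connected ?H"
    proof (rule star_connected[where b="\<lambda>i. if i = 0 then 1 else 0"])
      fix u :: "nat \<Rightarrow> real" and r :: real assume u: "u \<in> ?H" and r: "0 \<le> r" "r \<le> 1"
      have "0 < 1 + r * (u 0 - 1)"
      proof (cases "r = 0")
        case False
        then have "0 < r * u 0" using u r by simp
        then show ?thesis using r by (simp add: algebra_simps)
      qed simp
      moreover have "\<bar>1 + r * (u 0 - 1)\<bar> \<le> 1"
      proof -
        have "u 0 \<le> 1" using unit_cube_coord[of u _ True 0] u by (force simp: D_def)
        then have "r * (u 0 - 1) \<le> 0" using r by (simp add: mult_le_0_iff)
        then show ?thesis using \<open>0 < 1 + r * (u 0 - 1)\<close> by simp
      qed
      moreover have "\<bar>r * u l\<bar> \<le> 1" for l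
        using unit_cube_coord[of u _ True l] u r by (auto simp: abs_mult D_def intro!: mult_le_one)
      ultimately show "(\<lambda>i. (if i = 0 then 1 else 0) + r * (u i - (if i = 0 then 1 else 0))) \<in> ?H"
        using u w(2) by (auto simp: D_def unit_cube_def)
    qed
    then have con: "connected (F ` ?H)" by (rule connected_continuous_image[rotated]) (rule continuous_on_subset[OF cF], blast)
    have sub: "F ` ?H \<subseteq> E w \<union> E w2"
    proof (rule image_subsetI)
      fix t assume "t \<in> ?H"
      then have "t \<in> ?D" "t 0 \<noteq> 0" by auto
      then show "F t \<in> E w \<union> E w2" using F[of t] by simp
    qed
    have cov: "F ` ?H \<subseteq> closure (E w) \<union> closure (E w2)" using sub closure_subset by blast
    have dj: "closure (E w) \<inter> closure (E w2) \<inter> F ` ?H = {}"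
    proof -
      have False if g: "g \<in> closure (E w)" "g \<in> closure (E w2)" "g \<in> F ` ?H" for g
      proof -
        have "g \<in> E w \<or> g \<in> E w2" using sub g(3) by blast
        then show False
          using closure_cellD[OF w(1) w2(1) _ g(1)] closure_cellD[OF w2(1) w(1) _ g(2)] w2 by auto
      qed
      then show ?thesis by blast
    qed
    have "F t' \<in> E w" using t'(2) z(1)[of n] by simp
    then have 1: "closure (E w) \<inter> F ` ?H \<noteq> {}" using tH(2) closure_subset by blast
    have "F t \<in> E w \<union> E w2" using sub tH(1) by blast
    then have "F t \<in> E w2" using no by blast
    then have 2: "closure (E w2) \<inter> F ` ?H \<noteq> {}" using tH(1) closure_subset by blast
    show False using connected_closedD[OF con dj cov closed_closure closed_closure] 1 2 by blast
  qed
  obtain N1 where N1: "open N1" "x \<in> N1" "N1 \<inter> E v \<subseteq> F ` ?D"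
    by (rule neighbourhood_from_sequences[of "E v" x "F ` ?D"]) (use hit[of v] in auto)
  obtain N2 where N2: "open N2" "x \<in> N2" "N2 \<inter> E w \<subseteq> F ` ?D"
    by (rule neighbourhood_from_sequences[of "E w" x "F ` ?D"]) (use hit[of w] in auto)
  have "edge_chart v w x F"
    unfolding edge_chart_def chart_def D_def[symmetric]
  proof (intro conjI exI[of _ "N1 \<inter> N2"] cF injF F0 ballI)
    show "F ` ?D \<subseteq> E v \<union> E w" using F side by fastforce
    show "open (N1 \<inter> N2)" using N1 N2 by auto
    show "x \<in> N1 \<inter> N2" using N1 N2 by auto
    show "N1 \<inter> N2 \<inter> (E v \<union> E w) \<subseteq> F ` ?D" using N1 N2 by blast
    fix t assume t: "t \<in> ?D"
    show "F t \<in> E v \<longleftrightarrow> t 0 = 0" using F[OF t] side[OF t] disj[OF v w(1)] vw by auto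
  qed
  then show ?thesis by blast
qed


text \<open>For \<open>\<sigma> = -1\<close> the cell is the neighbour of the companion at
  \<open>pi/2\<close>, and the two ends of the arc exchange their roles.\<close>

lemma turn_back:
  assumes ij: "adjacent i j" and a: "a \<in> I" "ascent i j a" and \<sigma>: "\<sigma> = 1 \<or> \<sigma> = -1"
    and g: "g \<in> E (turn i j (\<sigma> * (pi/2)) a)"
  obtains \<theta> \<phi> where "0 < \<theta>" "0 < \<phi>" "\<theta> + \<phi> \<le> pi" "act i j (- (\<sigma> * \<theta>)) g \<in> E a"
    "act i j (\<sigma> * \<phi>) g \<in> E (turn i j pi a)"
proof (cases "\<sigma> = 1")
  case True
  then show ?thesis using act_bruhat_cell_turn[OF ij a, of g] g that by auto
next
  case False
  then have s: "\<sigma> = -1" using \<sigma> by simp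
  note tp = turn_pi[OF ij a]
  have "g \<in> E (turn i j (pi/2) (turn i j pi a))" using g s tp(7) by simp
  from act_bruhat_cell_turn[OF ij tp(1,2) this] obtain \<theta> \<phi> where
    "0 < \<theta>" "0 < \<phi>" "\<theta> + \<phi> \<le> pi" "act i j (- \<theta>) g \<in> E (turn i j pi a)" "act i j \<phi> g \<in> E a"
    using tp(6) by auto
  then show ?thesis using s by (intro that[of \<phi> \<theta>]) auto
qed

lemma turn_back_angle:
  assumes "adjacent i j" "a \<in> I" "ascent i j a" "g \<in> E (turn i j (pi/2) a)"
  shows "\<exists>\<theta>. 0 \<le> \<theta> \<and> \<theta> \<le> pi \<and> act i j (- \<theta>) g \<in> E a"
proof -
  obtain \<theta> \<phi> where "0 < \<theta>" "0 < \<phi>" "\<theta> + \<phi> \<le> pi" "act i j (- \<theta>) g \<in> E a"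
    using act_bruhat_cell_turn[OF assms] by blast
  then show ?thesis by (intro exI[of _ \<theta>]) simp
qed

text \<open>A chart of the cell \<open>v\<close> times a short interval of angles in the direction
  \<sigma>, the angle being coordinate 0. That this direction enters \<open>w\<close> and not its
  twin is left to the connectedness argument of \<open>edge_chart_extend\<close>.\<close>

lemma edge_chart_ascent:
  assumes ij: "adjacent i j" and v: "v \<in> I" "ascent i j v" and \<sigma>: "\<sigma> = 1 \<or> \<sigma> = -1"
    and w: "w = turn i j (\<sigma> * (pi/2)) v" and x: "x \<in> E v" "x \<in> closure (E w)"
  shows "\<exists>F. edge_chart v w x F"
proof -
  have ne: "i \<noteq> j" using ij by (auto simp: adjacent_def)
  note tp = turn_pi[OF ij v]
  let ?op = "turn i j pi v"
  define w2 where "w2 = turn i j (- \<sigma> * (pi/2)) v"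
  have ang: "\<sigma> * (pi/2) = pi/2 \<or> \<sigma> * (pi/2) = - (pi/2)" "- \<sigma> * (pi/2) = pi/2 \<or> - \<sigma> * (pi/2) = - (pi/2)"
    using \<sigma> by auto
  note tw = turn_cases[OF ij v ang(1), folded w] and tw2 = turn_cases[OF ij v ang(2), folded w2_def]
  have w2w: "w2 \<noteq> w" using turn_distinct[OF ij v] \<sigma> by (auto simp: w w2_def)
  have updn: "{turn i j (pi/2) v, turn i j (- (pi/2)) v} = {w, w2}" using \<sigma> by (auto simp: w w2_def)
  \<comment> \<open>The companion has the dimension of \<open>v\<close>, so its closure misses
    \<open>x\<close> and, by continuity, all points near \<open>x\<close> turned through small
    angles.\<close>
  have xop: "x \<notin> closure (E ?op)" using closure_cellD[OF tp(1) v(1) x(1)] tp(3,4) by fastforce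
  have "act i j 0 x \<in> - closure (E ?op)" using xop ne by (simp add: act_zero)
  then obtain e N where e: "0 < e" "open N" "x \<in> N"
    and eN: "\<And>\<theta> g. \<bar>\<theta> - 0\<bar> < e \<Longrightarrow> g \<in> N \<Longrightarrow> act i j \<theta> g \<in> - closure (E ?op)"
    using act_neighbourhood[of "- closure (E ?op)" i j 0 x] by blast
  define \<epsilon> where "\<epsilon> = min (e/2) 1"
  have \<epsilon>: "0 < \<epsilon>" "\<epsilon> < e" "\<epsilon> < pi" using e pi_gt3 by (auto simp: \<epsilon>_def)
  obtain f0 where f0: "chart (unit_cube (cell_dim v) False) (E v) x f0" by (rule chart_cell[OF v(1) x(1)])
  obtain \<delta> where f: "chart (unit_cube (cell_dim v) False) (E v) x (\<lambda>t. f0 (\<lambda>i. \<delta> * t i))"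
    and fN: "\<And>t. t \<in> unit_cube (cell_dim v) False \<Longrightarrow> f0 (\<lambda>i. \<delta> * t i) \<in> N"
    using chart_shrink[OF f0 e(2,3)] by blast
  define f where "f = (\<lambda>t. f0 (\<lambda>i. \<delta> * t i))"
  note f = f[folded f_def]
  have fN: "f t \<in> N" if "t \<in> unit_cube (cell_dim v) False" for t using fN[OF that] by (simp add: f_def)
  have fE: "f t \<in> E v" if "t \<in> unit_cube (cell_dim v) False" for t using f that by (auto simp: chart_def)
  have q: "cell_dim w = Suc (cell_dim v)" using tw(3) by simp
  let ?D = "unit_cube (cell_dim w) True" and ?\<pi> = "\<lambda>t :: nat \<Rightarrow> real. \<lambda>i. t (Suc i)"
  have angle: "\<bar>\<sigma> * \<epsilon> * r\<bar> \<le> \<epsilon>" if "0 \<le> r" "r \<le> 1" for r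
    using \<sigma> \<epsilon> that by (auto simp: abs_mult mult_left_le)
  have same: "\<theta> = 0" if "\<bar>\<theta>\<bar> < pi" "g \<in> E v" "act i j \<theta> g \<in> E v" for \<theta> g
    using move_disjoint[OF ij v that(2) v _ that(3,1)] tp(4) by auto
  show ?thesis
  proof (rule edge_chart_extend[where ?\<theta>0.0=0 and c="\<sigma> * \<epsilon>" and s="\<lambda>t. t 0" and \<pi>="?\<pi>" and J="{0..1}",
        OF ne v(1) tw(1) q tw2(1) _ w2w x(2) _ _ f])
    show "cell_dim w2 = cell_dim w" using tw tw2 by simp
    show "x = act i j 0 x" using ne by (simp add: act_zero)
    show "\<sigma> * \<epsilon> \<noteq> 0" using \<sigma> \<epsilon> by auto
    show "continuous_on ?D ?\<pi>" by (intro continuous_on_coordinatewise_then_product continuous_on_coordinate)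
    show "continuous_on ?D (\<lambda>t. t 0)" by (rule continuous_on_coordinate)
    show dom: "?\<pi> t \<in> unit_cube (cell_dim v) False \<and> t 0 \<in> {0..1}" if "t \<in> ?D" for t
      using that unit_cube_coord[OF that, of 0] by (auto simp: unit_cube_def q)
    show "\<exists>t\<in>?D. ?\<pi> t = t' \<and> t 0 = r" if "t' \<in> unit_cube (cell_dim v) False" "r \<in> {0..1}" for t' r
      using that by (intro bexI[of _ "\<lambda>i. case i of 0 \<Rightarrow> r | Suc i \<Rightarrow> t' i"]) (auto simp: unit_cube_def q split: nat.split)
    show "t = t'" if "?\<pi> t = ?\<pi> t'" "t 0 = t' 0" for t t' :: "nat \<Rightarrow> real"
    proof
      fix i show "t i = t' i" using that by (cases i) (auto simp: fun_eq_iff)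
    qed
    show "act i j (0 + \<sigma> * \<epsilon> * t 0) (f (?\<pi> t)) \<in> (if t 0 = 0 then E v else E w \<union> E w2)" if t: "t \<in> ?D" for t
    proof (cases "t 0 = 0")
      case True
      then show ?thesis using fE dom[OF t] ne by (simp add: act_zero)
    next
      case False
      have a: "\<bar>\<sigma> * \<epsilon> * t 0\<bar> \<le> \<epsilon>" using dom[OF t] angle by auto
      have "act i j (\<sigma> * \<epsilon> * t 0) (f (?\<pi> t)) \<notin> E ?op"
        using eN[of "\<sigma> * \<epsilon> * t 0" "f (?\<pi> t)"] fN[of "?\<pi> t"] dom[OF t] a \<epsilon> closure_subset[of "E ?op"] by auto
      moreover have "act i j (\<sigma> * \<epsilon> * t 0) (f (?\<pi> t)) \<in> E (turn i j (pi/2) v) \<union> E ?op \<union> E (turn i j (- (pi/2)) v)"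
        by (rule orbit[OF ij v fE]) (use dom[OF t] a \<epsilon> \<sigma> False in auto)
      ultimately show ?thesis using False updn by (auto simp: doubleton_eq_iff)
    qed
    show "r = r'" if g: "g \<in> E v" "g' \<in> E v" and r: "r \<in> {0..1}" "r' \<in> {0..1}"
      and eq: "act i j (0 + \<sigma> * \<epsilon> * r) g = act i j (0 + \<sigma> * \<epsilon> * r') g'" for g g' r r'
    proof -
      have "act i j (- (\<sigma> * \<epsilon> * r')) (act i j (\<sigma> * \<epsilon> * r) g) = g'" using eq ne by (simp add: act_act act_zero)
      then have "act i j (\<sigma> * \<epsilon> * (r - r')) g = g'" using ne by (simp add: act_act algebra_simps)
      moreover have "\<bar>\<sigma> * \<epsilon> * (r - r')\<bar> < pi"
      proof -
        have "\<bar>r - r'\<bar> \<le> 1" using r by auto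
        then have "\<epsilon> * \<bar>r - r'\<bar> \<le> \<epsilon>" using \<epsilon> by (simp add: mult_left_le)
        moreover have "\<bar>\<sigma> * \<epsilon> * (r - r')\<bar> = \<epsilon> * \<bar>r - r'\<bar>" using \<sigma> \<epsilon> by (auto simp: abs_mult)
        ultimately show ?thesis using \<epsilon> by linarith
      qed
      ultimately have "\<sigma> * \<epsilon> * (r - r') = 0" using same g by blast
      then show "r = r'" using \<sigma> \<epsilon> by auto
    qed
    show "\<exists>r \<theta>. strict_mono r \<and> \<theta> \<longlonglongrightarrow> 0 \<and> (\<forall>n::nat. act i j (- \<theta> n) (z (r n)) \<in> E v) \<and>
        (\<forall>\<^sub>F n in sequentially. (\<theta> n - 0) / (\<sigma> * \<epsilon>) \<in> {0..1})"
      if u: "u = v \<or> u = w" and z: "\<And>n. z n \<in> E u" "z \<longlonglongrightarrow> x" for z u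
    proof (cases "u = v")
      case True
      then show ?thesis using z ne
        by (intro exI[of _ id] exI[of _ "\<lambda>_. 0"]) (auto simp: act_zero strict_mono_def)
    next
      case False
      then have zw: "z n \<in> E (turn i j (\<sigma> * (pi/2)) v)" for n using z u w by blast
      have "\<exists>\<theta> \<phi>. 0 < \<theta> \<and> 0 < \<phi> \<and> \<theta> + \<phi> \<le> pi \<and> act i j (- (\<sigma> * \<theta>)) (z n) \<in> E v \<and> act i j (\<sigma> * \<phi>) (z n) \<in> E ?op" for n
        using turn_back[OF ij v \<sigma> zw[of n]] by metis
      then obtain \<theta> \<phi> where t: "\<And>n. 0 < \<theta> n" "\<And>n. 0 < \<phi> n" "\<And>n. \<theta> n + \<phi> n \<le> pi"
        "\<And>n. act i j (- (\<sigma> * \<theta> n)) (z n) \<in> E v" "\<And>n. act i j (\<sigma> * \<phi> n) (z n) \<in> E ?op" by metis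
      have b: "0 \<le> \<theta> n \<and> \<theta> n \<le> pi" "0 \<le> \<phi> n \<and> \<phi> n \<le> pi" for n using t(1,2,3)[of n] by auto
      obtain l r1 where l: "0 \<le> l" "l \<le> pi" "strict_mono r1" "(\<lambda>n. \<theta> (r1 n)) \<longlonglongrightarrow> l"
        by (rule bounded_angle_subsequence[of 0 \<theta> pi, OF b(1)])
      obtain m r2 where m: "0 \<le> m" "m \<le> pi" "strict_mono r2" "(\<lambda>n. \<phi> (r1 (r2 n))) \<longlonglongrightarrow> m"
        by (rule bounded_angle_subsequence[of 0 "\<lambda>n. \<phi> (r1 n)" pi, OF b(2)])
      define r where "r = r1 \<circ> r2"
      have r: "strict_mono r" unfolding r_def by (rule strict_mono_o[OF l(3) m(3)])
      have lr: "(\<lambda>n. \<theta> (r n)) \<longlonglongrightarrow> l" using LIMSEQ_subseq_LIMSEQ[OF l(4) m(3)] by (simp add: r_def o_def)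
      have mr: "(\<lambda>n. \<phi> (r n)) \<longlonglongrightarrow> m" using m(4) by (simp add: r_def)
      have zr: "(\<lambda>n. z (r n)) \<longlonglongrightarrow> x" using LIMSEQ_subseq_LIMSEQ[OF z(2) r] by (simp add: o_def)
      have lm: "l + m \<le> pi" using LIMSEQ_le_const2[OF tendsto_add[OF lr mr]] t(3) by blast
      have cl: "act i j (- (\<sigma> * l)) x \<in> closure (E v)"
        by (rule act_limit[OF t(4) tendsto_mult_left[OF lr] zr])
      have cm: "act i j (- (- \<sigma> * m)) x \<in> closure (E ?op)"
        by (rule act_limit[OF _ tendsto_mult_left[OF mr] zr]) (use t(5) in simp)
      \<comment> \<open>At \<open>l = pi\<close> the companion would be adherent to
        \<open>x\<close>. For an angle in between, the rotated \<open>x\<close> would lie in the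
        closure of \<open>v\<close> and in a different cell of at least the same dimension.\<close>
      have "l = 0"
      proof (rule ccontr)
        assume l0: "l \<noteq> 0"
        have "l \<noteq> pi"
        proof
          assume "l = pi"
          then have "m = 0" using lm m by simp
          then show False using cm xop ne by (simp add: act_zero)
        qed
        then have "\<bar>- (\<sigma> * l)\<bar> < pi" "- (\<sigma> * l) \<noteq> 0" using \<sigma> l l0 by auto
        from orbit[OF ij v x(1) this(2,1)] obtain b where b: "b \<in> {w, w2, ?op}" "act i j (- (\<sigma> * l)) x \<in> E b"
          using updn by (auto simp: doubleton_eq_iff)
        have "b \<in> I" using b tw tw2 tp by auto
        from closure_cellD[OF v(1) this b(2) cl] show False using b(1) tw(3) tw2(3) tp(3,4) w2w
          ascent_not_descent[OF v(2)] tw(2) tw2(2) by auto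
      qed
      then have l0: "(\<lambda>n. \<theta> (r n)) \<longlonglongrightarrow> 0" using lr by simp
      have "\<forall>\<^sub>F n in sequentially. \<theta> (r n) < \<epsilon>" using order_tendstoD(2)[OF l0 \<epsilon>(1)] .
      then have "\<forall>\<^sub>F n in sequentially. (\<sigma> * \<theta> (r n) - 0) / (\<sigma> * \<epsilon>) \<in> {0..1}"
      proof (rule eventually_mono)
        fix n assume "\<theta> (r n) < \<epsilon>"
        then show "(\<sigma> * \<theta> (r n) - 0) / (\<sigma> * \<epsilon>) \<in> {0..1}" using t(1)[of "r n"] \<epsilon> \<sigma> by auto
      qed
      moreover have "(\<lambda>n. \<sigma> * \<theta> (r n)) \<longlonglongrightarrow> 0" using tendsto_mult_left[OF l0, of \<sigma>] by simp
      ultimately show ?thesis using r t(4)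
        by (intro exI[of _ r] exI[of _ "\<lambda>n. \<sigma> * \<theta> (r n)"]) auto
    qed
  qed auto
qed


text \<open>A chart of the lower pair is multiplied by an interval of angles around \<theta>0, and
  the angle becomes the last coordinate. \<theta>0 is the limit of the angles that turn points of
  \<open>w\<close> near \<open>x\<close> back into \<open>w'\<close>; what has to be shown is that
  all such sequences have the same limit angle.\<close>

lemma edge_chart_descent:
  assumes ij: "adjacent i j" and a: "v' \<in> I" "ascent i j v'" and b: "w' \<in> I" "ascent i j w'"
    and v: "v = turn i j (pi/2) v'" and w: "w = turn i j (pi/2) w'" and dim: "cell_dim w = Suc (cell_dim v)"
    and x: "x \<in> E v" "x \<in> closure (E w)"
    and IH: "\<And>u y. u \<in> I \<Longrightarrow> cell_dim w' = Suc (cell_dim u) \<Longrightarrow> y \<in> E u \<Longrightarrow> y \<in> closure (E w') \<Longrightarrow> \<exists>f. edge_chart u w' y f"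
  shows "\<exists>F. edge_chart v w x F"
proof -
  have ne: "i \<noteq> j" using ij by (auto simp: adjacent_def)
  note tpa = turn_pi[OF ij a] and tpb = turn_pi[OF ij b]
  let ?opa = "turn i j pi v'" and ?opb = "turn i j pi w'"
  define v2 where "v2 = turn i j (- (pi/2)) v'"
  define w2 where "w2 = turn i j (- (pi/2)) w'"
  note tv = turn_cases[OF ij a disjI1[OF refl], folded v] and tv2 = turn_cases[OF ij a disjI2[OF refl], folded v2_def]
  note tw = turn_cases[OF ij b disjI1[OF refl], folded w] and tw2 = turn_cases[OF ij b disjI2[OF refl], folded w2_def]
  have v2v: "v2 \<noteq> v" using turn_distinct[OF ij a] by (simp add: v v2_def)
  have w2w: "w2 \<noteq> w" using turn_distinct[OF ij b] by (simp add: w w2_def)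
  have dv: "cell_dim v = Suc (cell_dim v')" and dw': "cell_dim w' = cell_dim v" using dim tv(3) tw(3) by auto
  have vasc: "v \<noteq> w'" "v \<noteq> ?opb" using tv(2) b(2) tpb(2) ascent_not_descent by blast+
  have xw': "x \<notin> closure (E w')" using closure_cellD[OF b(1) tv(1) x(1)] vasc dw' by auto
  have xopb: "x \<notin> closure (E ?opb)" using closure_cellD[OF tpb(1) tv(1) x(1)] vasc dw' tpb(3) by auto
  have xv2: "x \<notin> closure (E v2)" using closure_cellD[OF tv2(1) tv(1) x(1)] v2v tv2(3) dv by auto
  have low: "u \<in> I" "ascent i j u" "cell_dim u = cell_dim v'" "turn i j pi u \<in> {v', ?opa}" "x \<notin> closure (E u)"
    "{turn i j (pi/2) u, turn i j (- (pi/2)) u} = {v, v2}" if "u \<in> {v', ?opa}" for u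
  proof -
    show u: "u \<in> I" "ascent i j u" "cell_dim u = cell_dim v'" "turn i j pi u \<in> {v', ?opa}"
      using that a tpa by auto
    show "x \<notin> closure (E u)" using closure_cellD[OF u(1) tv(1) x(1)] u(3) dv by auto
    show "{turn i j (pi/2) u, turn i j (- (pi/2)) u} = {v, v2}" using that tpa(7,8) by (auto simp: v v2_def)
  qed
  \<comment> \<open>One sheet of \<open>w\<close> along \<open>v\<close> at \<open>x\<close>:
    turning \<open>x\<close> back by \<open>l\<close> gives a point of the lower end
    \<open>u\<close> which is a limit of points of \<open>w'\<close>.\<close>
  define P where "P l u \<longleftrightarrow> 0 < l \<and> l < pi \<and> act i j (- l) x \<in> E u \<and> act i j (- l) x \<in> closure (E w')" for l u
  \<comment> \<open>Unless both indices are fixed, every rotation of the companion by an angle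
    strictly between \<open>0\<close> and \<open>pi\<close> ends in \<open>v2\<close>, not in
    \<open>v\<close>.\<close>
  have unfix: False if l: "0 < l" "l < pi" "act i j (- l) x \<in> E ?opa" and nf: "\<not> fixes_both i j v'" for l
  proof -
    have "act i j l (act i j (- l) x) \<in> E (turn i j (pi/2) ?opa)"
      using act_bruhat_cell_ascent(2)[OF ij tpa(1,2) l(3,1,2)] nf tpa(5) by simp
    then have "x \<in> E v2" using ne tpa(7) by (simp add: act_act act_zero v2_def)
    then show False using xv2 closure_subset by blast
  qed
  \<comment> \<open>Only one of the two lower ends can carry a sheet: by the eigenvalues in the
    fixed case, by the direction of rotation otherwise.\<close>
  have noboth: False if P: "P l1 v'" "P l2 ?opa" for l1 l2
  proof (cases "fixes_both i j v'")
    case True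
    show False
    proof (rule not_both_in_closure[OF ij a True b])
      show "cell_dim w' = cell_dim v' + 1" using dw' dv by simp
      show "connected (bruhat_cell k u)" if "u \<in> cell_index k" for u :: "'n sqmat" using connected_cell[OF that] .
      show "act i j (- l1) x \<in> E v'" "act i j (- l1) x \<in> closure (E w')"
        "act i j (- l2) x \<in> E ?opa" "act i j (- l2) x \<in> closure (E w')" using P by (auto simp: P_def)
    qed
  next
    case False
    show False by (rule unfix[of l2, OF _ _ _ False]) (use P in \<open>auto simp: P_def\<close>)
  qed
  obtain \<theta>' where \<theta>': "0 < \<theta>'" "\<theta>' < pi" "act i j (- \<theta>') x \<in> E v'"
    using act_bruhat_cell_turn[OF ij a x(1)[unfolded v]] by fastforce
  \<comment> \<open>The limit of the backward angles turns \<open>x\<close> into the closure of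
    \<open>w'\<close>. The extreme angles are impossible, and comparing dimensions leaves only the
    two lower ends as cells of the rotated point.\<close>
  have Lw: "\<exists>r \<theta> l u. strict_mono r \<and> \<theta> \<longlonglongrightarrow> l \<and> (\<forall>n::nat. act i j (- \<theta> n) (z (r n)) \<in> E w') \<and> u \<in> {v', ?opa} \<and> P l u"
    if z: "\<And>n. z n \<in> E w" "z \<longlonglongrightarrow> x" for z
  proof -
    have "\<exists>\<theta>. 0 \<le> \<theta> \<and> \<theta> \<le> pi \<and> act i j (- \<theta>) (z n) \<in> E w'" for n
      using turn_back_angle[OF ij b z(1)[of n, unfolded w]] .
    then obtain \<theta> where t: "\<And>n. 0 \<le> \<theta> n \<and> \<theta> n \<le> pi" "\<And>n. act i j (- \<theta> n) (z n) \<in> E w'" by metis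
    obtain l r where l: "0 \<le> l" "l \<le> pi" "strict_mono r" "(\<lambda>n. \<theta> (r n)) \<longlonglongrightarrow> l"
      by (rule bounded_angle_subsequence[of 0 \<theta> pi, OF t(1)])
    have zr: "(\<lambda>n. z (r n)) \<longlonglongrightarrow> x" using LIMSEQ_subseq_LIMSEQ[OF z(2) l(3)] by (simp add: o_def)
    have cl: "act i j (- l) x \<in> closure (E w')" by (rule act_limit[OF t(2) l(4) zr])
    have "l \<noteq> 0" using cl xw' ne by (auto simp: act_zero)
    moreover have "l \<noteq> pi" using act_pi_closure[OF ij b, of x] cl xw' xopb by auto
    ultimately have l0: "0 < l" "l < pi" using l by auto
    have "\<exists>u\<in>{v', ?opa}. act i j (- l) x \<in> E u"
    proof (cases "l = \<theta>'")
      case True then show ?thesis using \<theta>' by auto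
    next
      case False
      have eq: "act i j (- l) x = act i j (\<theta>' - l) (act i j (- \<theta>') x)" using ne by (simp add: act_act)
      have "act i j (- l) x \<in> E v \<union> E ?opa \<union> E v2"
        unfolding eq v v2_def by (rule orbit[OF ij a \<theta>'(3)]) (use False l0 \<theta>' in auto)
      moreover have "act i j (- l) x \<notin> E v" using closure_cellD[OF b(1) tv(1) _ cl] vasc dw' by auto
      moreover have "act i j (- l) x \<notin> E v2"
        using closure_cellD[OF b(1) tv2(1) _ cl] dw' dv tv2(2,3) ascent_not_descent[OF b(2)] by auto
      ultimately show ?thesis by blast
    qed
    then obtain u where "u \<in> {v', ?opa}" "act i j (- l) x \<in> E u" by blast
    then show ?thesis using l0 l cl t(2)
      by (intro exI[of _ r] exI[of _ "\<lambda>n. \<theta> (r n)"] exI[of _ l] exI[of _ u]) (simp add: P_def)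
  qed
  obtain z0 where z0: "\<And>n. z0 n \<in> E w" "z0 \<longlonglongrightarrow> x" using x(2) unfolding closure_sequential by blast
  obtain \<theta>0 u where u: "u \<in> {v', ?opa}" and Pu: "P \<theta>0 u" using Lw[OF z0] by blast
  define y where "y = act i j (- \<theta>0) x"
  have \<theta>0: "0 < \<theta>0" "\<theta>0 < pi" and y: "y \<in> E u" "y \<in> closure (E w')" using Pu by (auto simp: P_def y_def)
  have xy: "x = act i j \<theta>0 y" using ne by (simp add: y_def act_act act_zero)
  note lu = low[OF u]
  note tpu = turn_pi[OF ij lu(1,2)]
  have uop: "turn i j pi u \<noteq> u" by (rule tpu(4))
  have shift: "act i j (- l) x = act i j (\<theta>0 - l) y" for l using ne by (simp add: y_def act_act)
  \<comment> \<open>Both angles belong to the same end and differ by less than \<open>pi\<close>, so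
    the two points in the cell of \<open>u\<close> must coincide.\<close>
  have uniq: "l = \<theta>0" if l: "P l u1" "u1 \<in> {v', ?opa}" for l u1
  proof -
    have "u1 = u" using noboth l Pu u by auto
    then have "act i j (\<theta>0 - l) y \<in> E u" using l by (simp add: P_def shift)
    moreover have "\<bar>\<theta>0 - l\<bar> < pi" using l(1) \<theta>0 unfolding P_def by linarith
    ultimately have "\<theta>0 - l = 0" by (rule move_disjoint[OF ij lu(1,2) y(1) lu(1,2) uop[symmetric]])
    then show ?thesis by simp
  qed
  have angle_back: "\<exists>\<theta>. 0 \<le> \<theta> \<and> \<theta> \<le> pi \<and> act i j (- \<theta>) g \<in> E u" if g: "g \<in> E v" for g
  proof (cases "u = v'")
    case True
    then show ?thesis using turn_back_angle[OF ij a g[unfolded v]] by simp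
  next
    case False
    then have uo: "u = ?opa" using u by blast
    \<comment> \<open>If \<open>u\<close> is the companion, the fixed case must hold. There the half
      turn preserves the cell of the companion, which is therefore reached by turning backwards as
      well as forwards.\<close>
    have fb: "fixes_both i j v'" using unfix[OF \<theta>0] Pu uo by (auto simp: P_def)
    obtain \<phi> where p: "0 < \<phi>" "\<phi> \<le> pi" "act i j \<phi> g \<in> E ?opa"
      using act_bruhat_cell_turn[OF ij a g[unfolded v]] by fastforce
    have "act i j pi (act i j \<phi> g) \<in> E ?opa"
      using act_bruhat_cell_pi[OF ij tpa(1,2) p(3)] fb tpa(5) by simp
    moreover have "act i j pi (act i j \<phi> g) = act i j (- (pi - \<phi>)) g"
      unfolding act_minus_pi[symmetric] using ne by (simp add: act_act)
    ultimately have "act i j (- (pi - \<phi>)) g \<in> E u" using uo by simp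
    then show ?thesis using p by (intro exI[of _ "pi - \<phi>"]) auto
  qed
  have Lv: "\<exists>r \<theta>. strict_mono r \<and> \<theta> \<longlonglongrightarrow> \<theta>0 \<and> (\<forall>n::nat. act i j (- \<theta> n) (z (r n)) \<in> E u)"
    if z: "\<And>n. z n \<in> E v" "z \<longlonglongrightarrow> x" for z
  proof -
    obtain \<theta> where t: "\<And>n. 0 \<le> \<theta> n \<and> \<theta> n \<le> pi" "\<And>n. act i j (- \<theta> n) (z n) \<in> E u" using angle_back[OF z(1)] by metis
    obtain l r where l: "0 \<le> l" "l \<le> pi" "strict_mono r" "(\<lambda>n. \<theta> (r n)) \<longlonglongrightarrow> l"
      by (rule bounded_angle_subsequence[of 0 \<theta> pi, OF t(1)])
    have zr: "(\<lambda>n. z (r n)) \<longlonglongrightarrow> x" using LIMSEQ_subseq_LIMSEQ[OF z(2) l(3)] by (simp add: o_def)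
    have cl: "act i j (- l) x \<in> closure (E u)" by (rule act_limit[OF t(2) l(4) zr])
    have "l \<noteq> 0" using cl lu(5) ne by (auto simp: act_zero)
    moreover have "l \<noteq> pi" using act_pi_closure[OF ij lu(1,2), of x] cl lu(5) low(5)[OF lu(4)] by auto
    ultimately have l0: "0 < l" "l < pi" using l by auto
    have "l = \<theta>0"
    proof (rule ccontr)
      assume "l \<noteq> \<theta>0"
      then have "act i j (- l) x \<in> E (turn i j (pi/2) u) \<union> E (turn i j pi u) \<union> E (turn i j (- (pi/2)) u)"
        unfolding shift by (intro orbit[OF ij lu(1,2) y(1)]) (use l0 \<theta>0 in auto)
      then obtain c where c: "c \<in> {v, v2, turn i j pi u}" "act i j (- l) x \<in> E c"
        using lu(6) by (auto simp: doubleton_eq_iff)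
      have "c \<in> I" using c(1) tv tv2 tpu by auto
      from closure_cellD[OF lu(1) this c(2) cl] show False
        using c(1) dv tv2(3) lu(3) tpu(3) uop by auto
    qed
    then show ?thesis using l t(2) by (intro exI[of _ r] exI[of _ "\<lambda>n. \<theta> (r n)"]) simp
  qed
  \<comment> \<open>An open neighbourhood of \<open>x\<close> avoiding the unwanted cells on the
    orbits of \<open>u\<close> and \<open>w'\<close>. Points rotated into it can only lie in
    \<open>v\<close>, \<open>w\<close> or the twin \<open>w2\<close>.\<close>
  let ?M = "- closure (E ?opb) \<inter> - closure (E (turn i j pi u)) \<inter> - closure (E v2)"
  have "act i j \<theta>0 y \<in> ?M" using xy xopb xv2 low(5)[OF lu(4)] by simp
  then obtain e N where e: "0 < e" "open N" "y \<in> N"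
    and eN: "\<And>\<theta> g. \<bar>\<theta> - \<theta>0\<bar> < e \<Longrightarrow> g \<in> N \<Longrightarrow> act i j \<theta> g \<in> ?M"
    using act_neighbourhood[of ?M i j \<theta>0 y] by blast
  \<comment> \<open>The three bounds keep the angles within the range of \<open>eN\<close> and
    strictly between \<open>0\<close> and \<open>pi\<close>; they also make any two of these angles
    differ by less than \<open>pi\<close>.\<close>
  define \<epsilon> where "\<epsilon> = min (e/2) (min (\<theta>0/2) ((pi - \<theta>0)/2))"
  have \<epsilon>0: "0 < \<epsilon>" using e \<theta>0 by (simp add: \<epsilon>_def)
  have "\<epsilon> \<le> e/2" "\<epsilon> \<le> \<theta>0/2" "\<epsilon> \<le> (pi - \<theta>0)/2" unfolding \<epsilon>_def by (meson min.cobounded1 min.cobounded2 order_trans)+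
  then have "2 * \<epsilon> \<le> e" "2 * \<epsilon> \<le> \<theta>0" "2 * \<epsilon> \<le> pi - \<theta>0" by (simp_all add: field_simps)
  then have \<epsilon>: "0 < \<epsilon>" "\<epsilon> < e" "\<epsilon> < \<theta>0" "\<epsilon> < pi - \<theta>0" "2 * \<epsilon> < pi"
    using \<epsilon>0 \<theta>0(1) by simp_all
  have dw'u: "cell_dim w' = Suc (cell_dim u)" using dw' dv lu(3) by simp
  obtain f0 where f0: "edge_chart u w' y f0" using IH[OF lu(1) dw'u y] by blast
  let ?q = "cell_dim v" let ?C = "unit_cube ?q True"
  have q: "0 < ?q" using dv by simp
  have f0c: "chart ?C (E u \<union> E w') y f0" "\<And>t. t \<in> ?C \<Longrightarrow> f0 t \<in> E u \<longleftrightarrow> t 0 = 0"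
    using f0 dw' by (auto simp: edge_chart_def)
  obtain \<delta> where \<delta>: "0 < \<delta>" "\<delta> \<le> 1" and fc: "chart ?C (E u \<union> E w') y (\<lambda>t. f0 (\<lambda>i. \<delta> * t i))"
    and fN: "\<And>t. t \<in> ?C \<Longrightarrow> f0 (\<lambda>i. \<delta> * t i) \<in> N"
    using chart_shrink[OF f0c(1) e(2,3)] by blast
  define f where "f = (\<lambda>t. f0 (\<lambda>i. \<delta> * t i))"
  note fc = fc[folded f_def]
  have fN: "f t \<in> N" if "t \<in> ?C" for t using fN[OF that] by (simp add: f_def)
  have fE: "f t \<in> (if t 0 = 0 then E u else E w')" if t: "t \<in> ?C" for t
  proof -
    have "f t \<in> E u \<union> E w'" using fc t by (auto simp: chart_def)
    moreover have "f t \<in> E u \<longleftrightarrow> t 0 = 0"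
      using f0c(2)[OF unit_cube_scale[OF t, of \<delta>]] \<delta> by (simp add: f_def)
    ultimately show ?thesis by auto
  qed
  let ?D = "unit_cube (cell_dim w) True" and ?\<pi> = "\<lambda>t :: nat \<Rightarrow> real. t(?q := 0)"
  show ?thesis
  proof (rule edge_chart_extend[where ?\<theta>0.0=\<theta>0 and c="\<epsilon>" and s="\<lambda>t. t ?q" and \<pi>="?\<pi>" and J="{-1..1}",
        OF ne tv(1) tw(1) dim tw2(1) _ w2w x(2) xy _ fc])
    show "cell_dim w2 = cell_dim w" using tw tw2 by simp
    show "\<epsilon> \<noteq> 0" using \<epsilon> by simp
    show "continuous_on ?D ?\<pi>"
    proof (intro continuous_on_coordinatewise_then_product)
      fix l show "continuous_on ?D (\<lambda>t. (?\<pi> t) l)" by (cases "l = ?q") (auto intro: continuous_on_coordinate)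
    qed
    show "continuous_on ?D (\<lambda>t. t ?q)" by (rule continuous_on_coordinate)
    show dom: "?\<pi> t \<in> ?C \<and> t ?q \<in> {-1..1}" if "t \<in> ?D" for t
      using that unit_cube_coord[OF that, of ?q] by (auto simp: unit_cube_def dim abs_le_iff)
    show "\<exists>t\<in>?D. ?\<pi> t = t' \<and> t ?q = r" if "t' \<in> ?C" "r \<in> {-1..1}" for t' r
      using that q by (intro bexI[of _ "t'(?q := r)"]) (auto simp: unit_cube_def dim abs_le_iff)
    show "t = t'" if "?\<pi> t = ?\<pi> t'" "t ?q = t' ?q" for t t' :: "nat \<Rightarrow> real"
    proof
      fix l show "t l = t' l" using fun_cong[OF that(1), of l] that(2) by (cases "l = ?q") (simp_all del: fun_upd_idem_iff)
    qed
    show "act i j (\<theta>0 + \<epsilon> * t ?q) (f (?\<pi> t)) \<in> (if t 0 = 0 then E v else E w \<union> E w2)" if t: "t \<in> ?D" for t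
    proof -
      have "\<bar>t ?q\<bar> \<le> 1" by (rule unit_cube_coord[OF t])
      then have a: "\<bar>\<epsilon> * t ?q\<bar> \<le> \<epsilon>" using \<epsilon> by (simp add: abs_mult mult_left_le)
      then have ang: "\<theta>0 + \<epsilon> * t ?q \<noteq> 0" "\<bar>\<theta>0 + \<epsilon> * t ?q\<bar> < pi" using \<epsilon> by auto
      have M: "act i j (\<theta>0 + \<epsilon> * t ?q) (f (?\<pi> t)) \<in> ?M"
      proof (rule eN)
        show "\<bar>\<theta>0 + \<epsilon> * t ?q - \<theta>0\<bar> < e" using a \<epsilon> by simp
        show "f (?\<pi> t) \<in> N" using fN dom[OF t] by blast
      qed
      have t0: "(?\<pi> t) 0 = t 0" using q by simp
      show ?thesis
      proof (cases "t 0 = 0")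
        case True
        then have "f (?\<pi> t) \<in> E u" using fE[of "?\<pi> t"] dom[OF t] t0 by simp
        from orbit[OF ij lu(1,2) this ang] M show ?thesis
          using True lu(6) closure_subset[of "E v2"] closure_subset[of "E (turn i j pi u)"] by (auto simp: doubleton_eq_iff)
      next
        case False
        then have "f (?\<pi> t) \<in> E w'" using fE[of "?\<pi> t"] dom[OF t] t0 by simp
        from orbit[OF ij b this ang] M show ?thesis
          using False closure_subset[of "E ?opb"] by (auto simp: w w2_def)
      qed
    qed
    show "r = r'" if g: "g \<in> E u \<union> E w'" "g' \<in> E u \<union> E w'" and r: "r \<in> {-1..1}" "r' \<in> {-1..1}"
      and eq: "act i j (\<theta>0 + \<epsilon> * r) g = act i j (\<theta>0 + \<epsilon> * r') g'" for g g' r r'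
    proof -
      have "act i j (- (\<theta>0 + \<epsilon> * r')) (act i j (\<theta>0 + \<epsilon> * r) g) = g'" using eq ne by (simp add: act_act act_zero)
      then have g': "act i j (\<epsilon> * (r - r')) g = g'" using ne by (simp add: act_act algebra_simps)
      have "\<bar>r - r'\<bar> \<le> 2" using r by auto
      then have "\<epsilon> * \<bar>r - r'\<bar> \<le> \<epsilon> * 2" using \<epsilon> by simp
      moreover have "\<bar>\<epsilon> * (r - r')\<bar> = \<epsilon> * \<bar>r - r'\<bar>" using \<epsilon> by (simp add: abs_mult)
      ultimately have lt: "\<bar>\<epsilon> * (r - r')\<bar> < pi" using \<epsilon> by linarith
      have "\<epsilon> * (r - r') = 0"
        using g(1)
      proof
        assume "g \<in> E u"
        note m = move_disjoint[OF ij lu(1,2) this]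
        have "w' \<noteq> turn i j pi u" using tpu(3) dw'u by auto
        then show ?thesis using g(2) m[OF lu(1,2) uop[symmetric] _ lt] m[OF b _ _ lt] g' by blast
      next
        assume "g \<in> E w'"
        note m = move_disjoint[OF ij b this]
        have "u \<noteq> ?opb" using tpb(3) dw'u by auto
        then show ?thesis using g(2) m[OF lu(1,2) _ _ lt] m[OF b tpb(4)[symmetric] _ lt] g' by blast
      qed
      then show "r = r'" using \<epsilon> by auto
    qed
    show "\<exists>r \<theta>. strict_mono r \<and> \<theta> \<longlonglongrightarrow> \<theta>0 \<and> (\<forall>n::nat. act i j (- \<theta> n) (z (r n)) \<in> E u \<union> E w') \<and>
        (\<forall>\<^sub>F n in sequentially. (\<theta> n - \<theta>0) / \<epsilon> \<in> {-1..1})"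
      if c: "c = v \<or> c = w" and z: "\<And>n. z n \<in> E c" "z \<longlonglongrightarrow> x" for z c
    proof -
      have "\<exists>r \<theta>. strict_mono r \<and> \<theta> \<longlonglongrightarrow> \<theta>0 \<and> (\<forall>n::nat. act i j (- \<theta> n) (z (r n)) \<in> E u \<union> E w')"
      proof (cases "c = v")
        case True
        then show ?thesis using Lv[of z] z by blast
      next
        case False
        then have "\<And>n. z n \<in> E w" using c z by blast
        from Lw[OF this z(2)] show ?thesis using uniq by blast
      qed
      then obtain r \<theta> where r: "strict_mono r" "\<theta> \<longlonglongrightarrow> \<theta>0" "\<forall>n::nat. act i j (- \<theta> n) (z (r n)) \<in> E u \<union> E w'" by blast
      have "\<forall>\<^sub>F n in sequentially. dist (\<theta> n) \<theta>0 < \<epsilon>" using tendstoD[OF r(2) \<epsilon>(1)] .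
      then have "\<forall>\<^sub>F n in sequentially. (\<theta> n - \<theta>0) / \<epsilon> \<in> {-1..1}"
        by (rule eventually_mono) (use \<epsilon> in \<open>auto simp: dist_real_def field_simps\<close>)
      then show ?thesis using r by blast
    qed
  qed auto
qed

text \<open>If \<open>i, j\<close> is not a descent of \<open>v\<close>, a limit of the backward
  angles turns \<open>x\<close> into the closure of \<open>w'\<close>. This excludes a stable
  \<open>v\<close>, whose rotated points would stay in \<open>v\<close>, and identifies
  \<open>w'\<close> as \<open>v\<close> or its companion.\<close>

lemma edge_chart_exists:
  assumes "v \<in> I" "w \<in> I" "cell_dim w = Suc (cell_dim v)" "x \<in> E v" "x \<in> closure (E w)"
  shows "\<exists>F. edge_chart v w x F"
  using assms
proof (induction "cell_dim w" arbitrary: v w x rule: less_induct)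
  case less
  note v = less.prems(1) and w = less.prems(2) and dim = less.prems(3) and x = less.prems(4,5)
  have "inversions (underlying_permutation w) \<noteq> {}"
  proof
    assume "inversions (underlying_permutation w) = {}"
    then have "cell_dim w = 0" by (simp add: cell_dim_def)
    then show False using dim by simp
  qed
  then obtain i j where ij: "adjacent i j" and "underlying_permutation w j < underlying_permutation w i"
    by (rule exists_adjacent_descent)
  then have dw: "descent i j w" by (simp add: descent_def)
  obtain w' where b: "w' \<in> I" "ascent i j w'" and w': "turn i j (pi/2) w' = w" by (rule descent_is_turn[OF ij w dw])
  note tw = turn_cases(3)[OF ij b disjI1[OF refl], unfolded w']
  have ne: "i \<noteq> j" using ij by (auto simp: adjacent_def)
  show ?case
  proof (cases "descent i j v")
    case True
    obtain v' where a: "v' \<in> I" "ascent i j v'" and v': "turn i j (pi/2) v' = v" by (rule descent_is_turn[OF ij v True])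
    show ?thesis
    proof (rule edge_chart_descent[OF ij a b v'[symmetric] w'[symmetric] dim x])
      fix u y assume "u \<in> I" "cell_dim w' = Suc (cell_dim u)" "y \<in> E u" "y \<in> closure (E w')"
      then show "\<exists>f. edge_chart u w' y f" using less.hyps[of w' u y] b(1) tw by simp
    qed
  next
    case False
    note tpb = turn_pi[OF ij b]
    have dv: "cell_dim v = cell_dim w'" using dim tw by simp
    obtain z where z: "\<And>n. z n \<in> E w" "z \<longlonglongrightarrow> x" using x(2) unfolding closure_sequential by blast
    have "\<exists>\<theta>. 0 \<le> \<theta> \<and> \<theta> \<le> pi \<and> act i j (- \<theta>) (z n) \<in> E w'" for n
      using turn_back_angle[OF ij b z(1)[of n, folded w']] .
    then obtain \<theta> where t: "\<And>n. 0 \<le> \<theta> n \<and> \<theta> n \<le> pi" "\<And>n. act i j (- \<theta> n) (z n) \<in> E w'" by metis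
    obtain l r where l: "0 \<le> l" "l \<le> pi" "strict_mono r" "(\<lambda>n. \<theta> (r n)) \<longlonglongrightarrow> l"
      by (rule bounded_angle_subsequence[of 0 \<theta> pi, OF t(1)])
    have zr: "(\<lambda>n. z (r n)) \<longlonglongrightarrow> x" using LIMSEQ_subseq_LIMSEQ[OF z(2) l(3)] by (simp add: o_def)
    have cl: "act i j (- l) x \<in> closure (E w')" by (rule act_limit[OF t(2) l(4) zr])
    have vasc: "ascent i j v"
    proof (rule ccontr)
      assume na: "\<not> ascent i j v"
      have "stable i j v"
      proof -
        obtain s where "signed_involution (underlying_permutation v) s" by (rule smat_perm[OF v])
        then have "inj (underlying_permutation v)" using signed_involutionD(6) bij_is_inj by blast
        then have "underlying_permutation v i \<noteq> underlying_permutation v j" using ne by (auto dest: injD)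
        then show ?thesis using na False by (auto simp: ascent_def descent_def stable_def)
      qed
      then have "act i j (- l) x \<in> E v" using act_bruhat_cell_stable[OF ij v _ x(1)] by blast
      then have "v = w'" using closure_cellD[OF b(1) v _ cl] dv by auto
      then show False using na b by blast
    qed
    note tpv = turn_pi[OF ij v vasc]
    have up: "cell_dim (turn i j (pi/2) v) = Suc (cell_dim v)" "cell_dim (turn i j (- (pi/2)) v) = Suc (cell_dim v)"
      "turn i j (pi/2) v \<in> I" "turn i j (- (pi/2)) v \<in> I"
      using turn_cases(1,3)[OF ij v vasc] by auto
    have "\<exists>b\<in>{v, turn i j pi v, turn i j (pi/2) v, turn i j (- (pi/2)) v}. act i j (- l) x \<in> E b"
    proof (cases "l = 0 \<or> l = pi")
      case True
      then show ?thesis using x(1) act_pi_cell[OF ij v vasc x(1)] ne by (auto simp: act_zero act_minus_pi)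
    next
      case False
      then show ?thesis using orbit[OF ij v vasc x(1), of "- l"] l by auto
    qed
    then obtain c where c: "c \<in> {v, turn i j pi v, turn i j (pi/2) v, turn i j (- (pi/2)) v}" "act i j (- l) x \<in> E c" by blast
    have "c \<in> I" using c(1) v tpv(1) up by auto
    \<comment> \<open>The rotated point lies in the closure of \<open>w'\<close> and in a cell of at
      least the dimension of \<open>w'\<close>, so this cell is \<open>w'\<close> itself.\<close>
    from closure_cellD[OF b(1) this c(2) cl] have "c = w'" using c(1) up dv tpv(3) by auto
    then have "w' = v \<or> w' = turn i j pi v" using c(1) up dv by auto
    then have "w = turn i j (1 * (pi/2)) v \<or> w = turn i j (-1 * (pi/2)) v" using w' tpv(7) by auto
    then show ?thesis using edge_chart_ascent[OF ij v vasc _ _ x, of 1] edge_chart_ascent[OF ij v vasc _ _ x, of "-1"] by blast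
  qed
qed


text \<open>A shear of the ball which flattens its southern hemisphere turns a chart on a half cube into a
  half-ball chart.\<close>

lemma half_chart_of_edge_chart:
  assumes v: "v \<in> I" and w: "w \<in> I" "cell_dim w = Suc (cell_dim v)" and F: "edge_chart v w x F"
  shows "\<exists>f. cell_structure.half_chart X E cell_dim v w x f"
proof -
  interpret cell_structure X I E cell_dim by (rule cell_structure)
  define q where "q = cell_dim v"
  let ?p = "Suc q" let ?B = "ball_set ?p" let ?K = "unit_cube ?p True"
  have p: "cell_dim w = ?p" using w by (simp add: q_def)
  have ch: "chart ?K (E v \<union> E w) x F" and Fv: "\<And>t. t \<in> ?K \<Longrightarrow> F t \<in> E v \<longleftrightarrow> t 0 = 0"
    using F p by (auto simp: edge_chart_def)
  have cF: "continuous_on ?K F" "inj_on F ?K" "F (\<lambda>_. 0) = x" "F ` ?K \<subseteq> E v \<union> E w" using ch by (auto simp: chart_def)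
  define R where "R y = (\<Sum>i<q. (y (Suc i))\<^sup>2)" for y :: "nat \<Rightarrow> real"
  define h where "h y = sqrt (1 - R y)" for y
  \<comment> \<open>\<open>y 0 + h y\<close> is the height above the southern hemisphere over the
    same base point, so the hemisphere goes to the face \<open>t 0 = 0\<close>. Dividing by two
    keeps the image inside the cube.\<close>
  define m where "m y = (\<lambda>i. if i = 0 then (y 0 + h y) / 2 else y i / 2)" for y
  have R: "(\<Sum>i<?p. (y i)\<^sup>2) = (y 0)\<^sup>2 + R y" "0 \<le> R y" for y
    by (simp_all add: R_def sum.lessThan_Suc_shift sum_nonneg del: sum.lessThan_Suc)
  have B: "y \<in> ?B \<longleftrightarrow> (\<forall>i\<ge>?p. y i = 0) \<and> (y 0)\<^sup>2 \<le> 1 - R y" for y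
    unfolding ball_set_def mem_Collect_eq R(1) by (simp add: algebra_simps)
  have hB: "(h y)\<^sup>2 = 1 - R y" "0 \<le> h y" "h y \<le> 1" "\<bar>y 0\<bar> \<le> h y" if "y \<in> ?B" for y
  proof -
    have *: "(y 0)\<^sup>2 \<le> 1 - R y" using that B by blast
    then have "0 \<le> 1 - R y" using zero_le_power2[of "y 0"] by linarith
    then show "(h y)\<^sup>2 = 1 - R y" "0 \<le> h y" "h y \<le> 1" using R(2)[of y] by (simp_all add: h_def)
    show "\<bar>y 0\<bar> \<le> h y" unfolding h_def using real_sqrt_le_mono[OF *] by simp
  qed
  have mK: "m y \<in> ?K" if y: "y \<in> ?B" for y
    unfolding unit_cube_def mem_Collect_eq
  proof (intro conjI allI impI)
    show "m y i = 0" if "?p \<le> i" for i using that y B by (simp add: m_def)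
    show "\<bar>m y i\<bar> \<le> 1" for i
      using hB[OF y] ball_set_coord_le[OF y, of i] ball_set_coord_le[OF y, of 0] by (simp add: m_def abs_le_iff)
    show "0 \<le> m y 0" using hB(4)[OF y] by (simp add: m_def abs_le_iff)
  qed
  have cm: "continuous_on ?B m"
  proof (intro continuous_on_coordinatewise_then_product)
    fix i show "continuous_on ?B (\<lambda>y. m y i)"
      unfolding m_def h_def R_def by (cases "i = 0") (auto intro!: continuous_intros)
  qed
  have mi: "inj_on m ?B"
  proof (rule inj_onI)
    fix y z assume yz: "m y = m z"
    have s: "y (Suc i) = z (Suc i)" for i using fun_cong[OF yz, of "Suc i"] by (simp add: m_def)
    then have "h y = h z" by (simp add: h_def R_def)
    then have "y 0 = z 0" using fun_cong[OF yz, of 0] by (simp add: m_def)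
    show "y = z"
    proof
      fix i show "y i = z i" using s \<open>y 0 = z 0\<close> by (cases i) auto
    qed
  qed
  \<comment> \<open>Coordinates below \<delta> give \<open>4 * R t\<close> at most 1/4; then
    \<open>h y\<close> is at least 1/2, which exceeds the height still available, and the point
    constructed below lies in the ball.\<close>
  define \<delta> where "\<delta> = 1 / (4 * real ?p)"
  have \<delta>: "0 < \<delta>" "\<delta> \<le> 1/4" by (auto simp: \<delta>_def field_simps)
  obtain N where N: "open N" "x \<in> N" "N \<inter> (E v \<union> E w) \<subseteq> F ` {t \<in> ?K. \<forall>i<?p. \<bar>t i\<bar> < \<delta>}"
    by (rule chart_core[OF ch \<delta>(1)])
  have onto: "\<exists>y\<in>?B. m y = t" if t: "t \<in> ?K" "\<forall>i<?p. \<bar>t i\<bar> < \<delta>" for t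
  proof -
    define y where "y i = (if i = 0 then 2 * t 0 - sqrt (1 - 4 * R t) else 2 * t i)" for i
    have Ry: "R y = 4 * R t" by (simp add: R_def y_def power_mult_distrib sum_distrib_left)
    have "R t \<le> (\<Sum>i<q. \<delta>\<^sup>2)" unfolding R_def
    proof (rule sum_mono)
      fix i assume "i \<in> {..<q}"
      then have "\<bar>t (Suc i)\<bar> \<le> \<bar>\<delta>\<bar>" using t(2)[rule_format, of "Suc i"] by simp
      then show "(t (Suc i))\<^sup>2 \<le> \<delta>\<^sup>2" by (rule power2_mono)
    qed
    also have "\<dots> \<le> real ?p * \<delta> * \<delta>" using \<delta> by (simp add: power2_eq_square algebra_simps)
    also have "\<dots> = \<delta> / 4"
    proof -
      have "real ?p * \<delta> = 1/4" unfolding \<delta>_def by (simp del: of_nat_Suc)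
      then show ?thesis by simp
    qed
    finally have Rt: "4 * R t \<le> 1/4" using \<delta> by linarith
    have hy: "1/2 \<le> h y"
    proof -
      have "(1/2::real)\<^sup>2 \<le> 1 - 4 * R t" using Rt by (simp add: power2_eq_square)
      then show ?thesis unfolding h_def Ry by (rule real_le_rsqrt)
    qed
    have y0: "y 0 = 2 * t 0 - h y" by (simp add: y_def h_def Ry)
    have t0: "0 \<le> t 0" "t 0 < 1/4" using t \<delta> by (auto simp: unit_cube_def)
    have "\<bar>y 0\<bar> \<le> \<bar>h y\<bar>" using y0 hy t0 by auto
    then have "(y 0)\<^sup>2 \<le> (h y)\<^sup>2" by (rule power2_mono)
    also have "(h y)\<^sup>2 = 1 - R y" using Rt unfolding h_def Ry by simp
    finally have "y \<in> ?B" using t(1) B by (auto simp: y_def unit_cube_def)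
    moreover have "m y = t"
    proof
      fix i show "m y i = t i" using y0 by (cases i) (auto simp: m_def y_def)
    qed
    ultimately show ?thesis by blast
  qed
  have "half_chart v w x (F \<circ> m)"
    unfolding half_chart_def p
  proof (intro conjI exI[of _ "N \<inter> grassmannian k"] ballI impI)
    have sub: "(F \<circ> m) ` ?B \<subseteq> E v \<union> E w" using mK cF(4) by auto
    then show "(F \<circ> m) ` ?B \<subseteq> E v \<union> E w" .
    have "continuous_on ?B (F \<circ> m)" using continuous_on_compose2[OF cF(1) cm] mK by (auto simp: o_def)
    moreover have "(F \<circ> m) ` ?B \<subseteq> grassmannian k" using sub by (auto simp: bruhat_cell_eq)
    ultimately show "continuous_map (unit_ball ?p) X (F \<circ> m)" by (auto simp: unit_ball_top_of_set)
    show "inj_on (F \<circ> m) ?B" by (intro comp_inj_on mi inj_on_subset[OF cF(2)]) (use mK in auto)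
    show "(F \<circ> m) ` unit_ball_interior ?p \<subseteq> E w"
    proof (rule image_subsetI)
      fix y assume y: "y \<in> unit_ball_interior ?p"
      then have yB: "y \<in> ?B" using ball_set_split(1) by blast
      have "(y 0)\<^sup>2 + R y < 1" using y unfolding unit_ball_interior_eq mem_Collect_eq R(1) by blast
      then have "(y 0)\<^sup>2 < (h y)\<^sup>2" using hB(1)[OF yB] by simp
      then have "m y 0 \<noteq> 0" using hB(2)[OF yB] by (auto simp: m_def add_eq_0_iff)
      then have "F (m y) \<notin> E v" using Fv[OF mK[OF yB]] by simp
      then show "(F \<circ> m) y \<in> E w" using sub yB by auto
    qed
    show "(F \<circ> m) y \<in> E v" if y: "y \<in> unit_ball_boundary ?p" "y 0 < 0" for y
    proof -
      have yB: "y \<in> ?B" using y ball_set_split(1) by blast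
      have "(y 0)\<^sup>2 + R y = 1" using y(1) unfolding unit_ball_boundary_eq mem_Collect_eq R(1) by blast
      then have "(y 0)\<^sup>2 = (h y)\<^sup>2" using hB(1)[OF yB] by simp
      then have "m y 0 = 0" using y(2) hB(2)[OF yB] by (auto simp: m_def power2_eq_iff)
      then show ?thesis using Fv[OF mK[OF yB]] by simp
    qed
    have "m south_pole = (\<lambda>_. 0)" by (auto simp: m_def h_def R_def south_pole_def)
    then show "(F \<circ> m) south_pole = x" using cF(3) by simp
    show "openin X (N \<inter> grassmannian k)" using N(1) by (auto simp: openin_open)
    have "x \<in> E v \<union> E w" using cF(3,4) unit_cube_zero by blast
    then show "x \<in> N \<inter> grassmannian k" using N(2) by (auto simp: bruhat_cell_eq)
    show "N \<inter> grassmannian k \<inter> (E v \<union> E w) \<subseteq> (F \<circ> m) ` ?B"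
    proof
      fix g assume "g \<in> N \<inter> grassmannian k \<inter> (E v \<union> E w)"
      then obtain t where t: "t \<in> ?K" "\<forall>i<?p. \<bar>t i\<bar> < \<delta>" "g = F t" using N(3) by blast
      then obtain y where "y \<in> ?B" "m y = t" using onto by blast
      then show "g \<in> (F \<circ> m) ` ?B" using t by auto
    qed
  qed
  then show ?thesis by blast
qed

end

theorem mainTheorem2:
  fixes k :: nat
    and v w :: "real ^ 'n::{finite,wellorder} ^ 'n::{finite,wellorder}"
    and \<omega> :: "real ^ 'n::{finite,wellorder} ^ 'n::{finite,wellorder} \<Rightarrow>
      (real ^ 'n::{finite,wellorder} ^ 'n::{finite,wellorder}) chain set"
  assumes "k \<le> CARD('n)"
    and "\<forall>u \<in> cell_index k. cell_orientation (top_of_set (grassmannian k))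
           (cell_index k) (bruhat_cell k) cell_dim u (\<omega> u)"
    and "v \<in> cell_index k" and "w \<in> cell_index k"
    and "int (cell_dim v) = int (cell_dim w) - 1"
  shows "incidence_number (top_of_set (grassmannian k))
           (cell_index k) (bruhat_cell k) cell_dim \<omega> w v \<in> {0, 1, -1}"
proof -
  \<comment> \<open>An orientation of a cell contains a characteristic map, so the hypothesis on
    \<omega> provides the whole cell structure.\<close>
  interpret bruhat_structure k "TYPE('n)"
  proof
    fix u :: "'n sqmat" assume "u \<in> cell_index k"
    then show "\<exists>\<Phi>. characteristic_map (top_of_set (grassmannian k)) (cell_index k) (bruhat_cell k) cell_dim u \<Phi>"
      using assms(2) by (auto simp: cell_orientation_def)
  qed
  interpret cell_structure X I E cell_dim by (rule cell_structure)
  have dim: "cell_dim w = Suc (cell_dim v)" using assms(5) by simp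
  \<comment> \<open>The signed permutation matrix \<open>v\<close> lies in its own cell and serves
    as the point at which the coefficient is computed.\<close>
  have "v \<notin> X closure_of E w \<or> (\<exists>f. half_chart v w v f)"
  proof (cases "v \<in> closure (E w)")
    case True
    then show ?thesis
      using edge_chart_exists[OF assms(3,4) dim bruhat_cell_self[OF assms(3)]]
        half_chart_of_edge_chart[OF assms(3,4) dim] by blast
  next
    case False
    then show ?thesis using closure_of_subtopology_subset[of euclidean "grassmannian k" "E w"] by auto
  qed
  then show ?thesis
    by (rule incidence_number_by_chart[OF assms(2,3,4) dim bruhat_cell_self[OF assms(3)]])
qed

end
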